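(* Set $$X=6000000185827,\qquad \tau_0=\frac{129}{800},\qquad y_0^2=\frac{87677}{2500000}\quad(y_0>0).$$ For every $\tau$ with $\tau_0\le\tau\le\frac{89}{500}=0.178$ and every simple maximal-height nonreal zero $z=x+iy$ of $H_\tau$ satisfying $$x\ge X,\qquad |y|\le y_0,$$ one has $$\mathcal G_\tau(z)>1.60028669>\frac32.$$ Consequently, if such a maximal branch (a branch of simple maximal-height nonreal zeros, followed from time $\tau_0$) remains in the sector $\{x\ge X,\ |y|\le y_0\}$ throughout its subsequent nonreal evolution, then it reaches the real axis no later than the time $$\tau_0+\frac16\log(1+3y_0^2)=0.1779229222821547\ldots<0.178.$$
   Context: For real $\tau$ (heat time), $H_\tau(z)=\int_0^\infty e^{\tau u^2}\Phi(u)\cos(zu)\,\mathrm du$, where $\Phi(u)=\sum_{n\ge1}(2\pi^2n^4e^{9u}-3\pi n^2e^{5u})e^{-\pi n^2e^{4u}}$. $H_\tau$ is an even entire function, real on the real axis. A zero $z=x+iy$, $y>0$, of $H_\tau$ has maximal height if every zero $\rho$ of $H_\tau$ satisfies $|\operatorname{Im}\rho|\le y$; for such a zero define $$\mathcal G_\tau(z)=\sum_{\rho\ne z,\bar z}\frac{1}{(\operatorname{Re}\rho-x)^2+4y^2},$$ the sum being over all zeros $\rho$ of $H_\tau$ other than $z,\bar z$, counted with multiplicity. A branch of zeros is a continuous function $\tau\mapsto z(\tau)$ with $H_\tau(z(\tau))=0$. *)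

theory Defs
  imports "HOL-Complex_Analysis.Complex_Analysis"
begin

(* The summation index is shifted: the n-th term below is the (n+1)-st term of the
   classical series, which starts at 1. *)
definition Phi :: "real \<Rightarrow> real" where
  "Phi u = (\<Sum>n. (2 * pi\<^sup>2 * real (Suc n) ^ 4 * exp (9 * u) - 3 * pi * real (Suc n) ^ 2 * exp (5 * u))
                  * exp (- pi * real (Suc n) ^ 2 * exp (4 * u)))"

definition H :: "real \<Rightarrow> complex \<Rightarrow> complex" where
  "H \<tau> z = (LBINT u:{0..}. of_real (exp (\<tau> * u\<^sup>2) * Phi u) * cos (z * of_real u))"

definition simple_zero :: "real \<Rightarrow> complex \<Rightarrow> bool" where
  "simple_zero \<tau> z \<longleftrightarrow> H \<tau> z = 0 \<and> zorder (H \<tau>) z = 1"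

(* Zeros of maximal height are taken in the open upper half plane, so they are nonreal. *)
definition max_height_zero :: "real \<Rightarrow> complex \<Rightarrow> bool" where
  "max_height_zero \<tau> z \<longleftrightarrow>
     H \<tau> z = 0 \<and> Im z > 0 \<and> (\<forall>\<rho>. H \<tau> \<rho> = 0 \<longrightarrow> \<bar>Im \<rho>\<bar> \<le> Im z)"

(* Each zero is weighted by its multiplicity, the order of vanishing of H \<tau>.  An infsum that
   does not converge is 0, so a strictly positive lower bound for this quantity includes
   the convergence of the sum. *)
definition G :: "real \<Rightarrow> complex \<Rightarrow> real" where
  "G \<tau> z = (\<Sum>\<^sub>\<infinity>\<rho> \<in> {\<rho>. H \<tau> \<rho> = 0 \<and> \<rho> \<noteq> z \<and> \<rho> \<noteq> cnj z}.
              of_int (zorder (H \<tau>) \<rho>) / ((Re \<rho> - Re z)\<^sup>2 + 4 * (Im z)\<^sup>2))"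

(* A branch of zeros whose time domain J is an interval (of any kind, bounded or not)
   with initial time t0. *)
definition zero_branch_from :: "real \<Rightarrow> real set \<Rightarrow> (real \<Rightarrow> complex) \<Rightarrow> bool" where
  "zero_branch_from t0 J z \<longleftrightarrow>
     is_interval J \<and> t0 \<in> J \<and> J \<subseteq> {t0..} \<and> continuous_on J z \<and> (\<forall>t\<in>J. H t (z t) = 0)"

(* The branch is followed throughout its nonreal evolution: its time domain does not stop
   while the branch is still nonreal and could be continued as a branch of zeros. *)
definition followed_while_nonreal :: "real \<Rightarrow> real set \<Rightarrow> (real \<Rightarrow> complex) \<Rightarrow> bool" where
  "followed_while_nonreal t0 J z \<longleftrightarrow>
     (\<exists>t\<in>J. Im (z t) = 0) \<or>
     \<not> (\<exists>J' z'. zero_branch_from t0 J' z' \<and> J \<subset> J' \<and> (\<forall>t\<in>J. z' t = z t))"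

end

theory Submission
  imports Defs "HOL-Probability.Probability" "HOL-Real_Asymp.Real_Asymp"
begin

text \<open>
  Two facts carry the theorem: a lower bound for the vertical growth of \<open>H t\<close>, which forces
  \<open>G\<close> to be large, and the heat equation, which turns a large \<open>G\<close> into a fast descent of the zero.

  \<^bold>\<open>Growth measures \<open>G\<close>.\<close>  \<open>H t\<close> is even, real and grows more slowly than every \<open>exp (e \<bar>z\<bar>\<^sup>2)\<close>, so it is a product over its zeros
  (\<open>product_approx\<close>).  Taking logarithms, the quotient of \<open>\<bar>H t (x + 4\<i>)\<bar>\<close> by \<open>\<bar>H t (x + 2\<i>)\<bar>\<close> becomes a
  sum over zeros in which a zero other than \<open>z\<close>, \<open>cnj z\<close> contributes at most six times its term in \<open>G\<close>; the pair
  \<open>z\<close>, \<open>cnj z\<close> contributes \<open>ln ((16 - y\<^sup>2) / (4 - y\<^sup>2))\<close>, at most \<open>ln 4.04\<close> here (\<open>growth_le_G\<close>).  It remains to show that \<open>H t\<close> grows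
  by a factor of more than 90000 between the heights 2 and 4, since
  \<open>ln 90000 > 6 \<cdot> 1.60028669 + ln 4.04\<close>.

  \<^bold>\<open>Growth is visible.\<close>  For \<open>t > 0\<close>, \<open>H t\<close> is the average of \<open>H 0\<close> along a vertical line against a Gaussian
  (\<open>H_gauss_average\<close>), and \<open>H 0\<close> is Riemann's \<open>\<xi>\<close>-function (\<open>H0_eq_zeta\<close>): a Gamma factor times \<open>\<zeta>(s)\<close>.
  On the line \<open>Re = 2 T\<close> with \<open>T\<close> of size \<open>10\<^sup>1\<^sup>2\<close> the Gamma factor is, up to tiny relative errors, an exponential
  \<open>mT T \<cdot> exp (\<lambda> v)\<close> in the vertical variable, with \<open>Re \<lambda>\<close> close to \<open>ln (T / 2\<pi>) / 2\<close> and \<open>\<bar>Im \<lambda>\<bar> \<le> 1\<close>; the Gaussian average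
  of an exponential is explicit, and it damps the correction \<open>\<zeta> - 1\<close> (\<open>H_right_estimate\<close>).
  The left half of the line is reached by symmetry, which needs the modularity of \<open>\<Phi>\<close> (\<open>jacobi_theta\<close>, \<open>Phi_even\<close>).

  \<^bold>\<open>Descent.\<close>  \<open>H\<close> solves the backward heat equation, so a branch of simple zeros moves with velocity
  \<open>H'' / H'\<close> (\<open>zero_branch_derivative\<close>).  The same product gives \<open>y' \<le> - 1 / y - 2 y G\<close> for a zero of maximal height
  (\<open>zero_velocity\<close>): its conjugate attracts it, and all other zeros together pull it down with strength at least \<open>G\<close>.
  With \<open>G > 3/2\<close>, \<open>(y\<^sup>2 + 1/3) exp (6 t)\<close> does not increase (\<open>height_decay\<close>), so \<open>y\<close> cannot stay positive up to the claimed time.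

  \<^bold>\<open>The branch cannot end earlier.\<close>  At a closed end the zero is simple and the branch continues by the inverse function theorem.
  At an open end the branch has a limit, and can be continued by it, provided it does not run off to infinity.
  It does not: far out in the strip \<open>H t\<close> is close to a cosine of a \<open>phase\<close> that tends to \<open>-\<infinity>\<close> along the real direction and moves continuously
  with time, and \<open>H t\<close> has no zeros where the phase is a multiple of \<open>\<pi>\<close>; a branch cannot cross these barriers (\<open>no_escape\<close>).
\<close>

section \<open>Zeros, vertical growth and velocity for even entire functions\<close>

lemma abs_le_imp_square_le:
  fixes a b :: real
  shows "\<bar>a\<bar> \<le> b \<Longrightarrow> a\<^sup>2 \<le> b\<^sup>2"
  by (metis abs_ge_zero power2_abs power_mono)

text \<open>\<open>zor_poly\<close> is the local quotient near \<open>a\<close>; gluing it to \<open>f w / (w - a) ^ n\<close> away from \<open>a\<close> makes the quotient entire.\<close>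
lemma entire_factor_zero:
  fixes f :: "complex \<Rightarrow> complex"
  assumes f: "f holomorphic_on UNIV" and nz: "f b \<noteq> 0"
  shows "\<exists>g. g holomorphic_on UNIV \<and> g a \<noteq> 0 \<and> (\<forall>w. f w = (w - a) ^ nat (zorder f a) * g w)"
proof -
  define n where "n = nat (zorder f a)"
  obtain r where r: "r > 0" "zor_poly f a holomorphic_on cball a r"
    "\<And>w. w \<in> cball a r \<Longrightarrow> f w = zor_poly f a w * (w - a) ^ n \<and> zor_poly f a w \<noteq> 0"
    using zorder_exist_zero[of f UNIV a] f nz unfolding n_def by blast
  define g where "g = (\<lambda>w. if w = a then zor_poly f a a else f w / (w - a) ^ n)"
  have "g holomorphic_on ball a r"
  proof (rule holomorphic_transform)
    show "zor_poly f a holomorphic_on ball a r"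
      using r(2) by (rule holomorphic_on_subset) auto
    show "zor_poly f a w = g w" if "w \<in> ball a r" for w
      using r(3)[of w] that by (auto simp: g_def)
  qed
  moreover have "g holomorphic_on - {a}"
  proof (rule holomorphic_transform)
    show "(\<lambda>w. f w / (w - a) ^ n) holomorphic_on - {a}"
      by (intro holomorphic_intros holomorphic_on_subset[OF f]) auto
  qed (auto simp: g_def)
  ultimately have "g holomorphic_on ball a r \<union> - {a}"
    by (intro holomorphic_on_Un) auto
  moreover have "ball a r \<union> - {a} = UNIV"
    using r(1) by auto
  ultimately have "g holomorphic_on UNIV" by simp
  moreover have "g a \<noteq> 0"
    using r(3)[of a] r(1) by (simp add: g_def)
  moreover have "f w = (w - a) ^ n * g w" for w
    using r(3)[of a] r(1) by (auto simp: g_def)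
  ultimately show ?thesis unfolding n_def by blast
qed

lemma entire_factor_zeros:
  fixes f :: "complex \<Rightarrow> complex"
  assumes f: "f holomorphic_on UNIV" and nz: "f b \<noteq> 0" and "finite A"
  shows "\<exists>g. g holomorphic_on UNIV \<and> (\<forall>a\<in>A. g a \<noteq> 0) \<and>
           (\<forall>w. f w = (\<Prod>a\<in>A. (w - a) ^ nat (zorder f a)) * g w)"
  using \<open>finite A\<close>
proof induction
  case empty
  then show ?case using f by auto
next
  case (insert a A)
  define zprod where "zprod = (\<lambda>w. \<Prod>a\<in>A. (w - a) ^ nat (zorder f a))"
  obtain g where g: "g holomorphic_on UNIV" "\<And>a. a \<in> A \<Longrightarrow> g a \<noteq> 0" "\<And>w. f w = zprod w * g w"
    using insert unfolding zprod_def by blast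
  have "g b \<noteq> 0" using g(3)[of b] nz by auto
  then obtain g2 where g2: "g2 holomorphic_on UNIV" "g2 a \<noteq> 0"
     "\<And>w. g w = (w - a) ^ nat (zorder g a) * g2 w"
    using entire_factor_zero[OF g(1), of b a] by blast
  define k where "k = nat (zorder g a)"
  have "zorder f a = int k"
  proof (rule zorder_eqI[where S = UNIV and g = "\<lambda>w. zprod w * g2 w"])
    show "(\<lambda>w. zprod w * g2 w) holomorphic_on UNIV"
      unfolding zprod_def by (intro holomorphic_intros g2)
    show "zprod a * g2 a \<noteq> 0"
      using insert g2 by (auto simp: zprod_def)
    show "f w = zprod w * g2 w * (w - a) powi int k" for w
      using g(3)[of w] g2(3)[of w] unfolding k_def[symmetric] by (simp add: power_int_of_nat mult_ac)
  qed auto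
  then have k: "nat (zorder f a) = k" by simp
  have "f w = (\<Prod>a\<in>insert a A. (w - a) ^ nat (zorder f a)) * g2 w" for w
    using insert g(3)[of w] g2(3)[of w] k by (simp add: k_def zprod_def mult_ac)
  moreover have "g2 c \<noteq> 0" if "c \<in> insert a A" for c
    using that g(2)[of c] g2 by auto
  ultimately show ?case using g2(1) by blast
qed

text \<open>The Borel--Caratheodory inequality: the map \<open>h / (2 A - h)\<close> sends the disc into the unit disc and fixes 0,
  because \<open>Re h < A\<close> says that \<open>h\<close> is closer to 0 than to \<open>2 A\<close>; the Schwarz lemma does the rest.\<close>
lemma borel_caratheodory:
  fixes h :: "complex \<Rightarrow> complex"
  assumes h: "h holomorphic_on ball 0 R" and h0: "h 0 = 0" and A: "A > 0" 
    and Re: "\<And>w. w \<in> ball 0 R \<Longrightarrow> Re (h w) < A" and w: "norm w < R"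
  shows "norm (h w) * (R - norm w) \<le> 2 * A * norm w"
proof -
  have R: "R > 0" using w norm_ge_zero[of w] by linarith
  define \<phi> where "\<phi> = (\<lambda>u. h (of_real R * u) / (of_real (2 * A) - h (of_real R * u)))"
  have ball: "of_real R * u \<in> ball 0 R" if "norm u < 1" for u :: complex
    using that R by (simp add: norm_mult)
  have nz: "of_real (2 * A) - h v \<noteq> 0" if "v \<in> ball 0 R" for v
    using Re[OF that] A by (auto simp: complex_eq_iff)
  have hol: "\<phi> holomorphic_on ball 0 1"
    unfolding \<phi>_def
    by (intro holomorphic_intros holomorphic_on_compose_gen[OF _ h, unfolded o_def] nz)
       (use ball in auto)
  have lt: "norm (\<phi> u) < 1" if "norm u < 1" for u
  proof -
    define v where "v = h (of_real R * u)"
    have "Re v < A" unfolding v_def using Re ball that by blast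
    then have "(Re v)\<^sup>2 < (2 * A - Re v)\<^sup>2"
      using A by (intro power2_strict_mono) auto
    then have "(norm v)\<^sup>2 < (norm (of_real (2 * A) - v))\<^sup>2"
      by (simp add: cmod_power2)
    then have "norm v < norm (of_real (2 * A) - v)"
      using power_less_imp_less_base by force
    then show ?thesis
      by (auto simp: \<phi>_def v_def norm_divide divide_simps)
  qed
  define u where "u = w / of_real R"
  have "norm w / R < 1" using divide_less_eq_1_pos[OF R] w by blast
  then have u: "norm u < 1" "norm u = norm w / R" "of_real R * u = w"
    using R by (auto simp: u_def norm_divide)
  have le: "norm (\<phi> u) \<le> norm u"
    by (rule Schwarz_Lemma[OF hol _ lt]) (simp_all add: \<phi>_def h0 u(1))
  have "\<phi> u = h w / (of_real (2 * A) - h w)"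
    by (simp add: \<phi>_def u(3))
  moreover have "of_real (2 * A) - h w \<noteq> 0" using nz w by auto
  ultimately have "norm (h w) = norm (\<phi> u) * norm (of_real (2 * A) - h w)"
    by (simp add: norm_divide)
  also have "\<dots> \<le> norm w / R * (2 * A + norm (h w))"
    using le u norm_triangle_ineq4[of "of_real (2 * A)" "h w"] A
    by (intro mult_mono) (auto simp: divide_nonneg_pos R)
  finally show ?thesis
    using R by (simp add: field_simps)
qed

text \<open>The properties of \<open>H t\<close> on which the theory of its zeros rests.  Growth slower than every \<open>exp (e \<bar>z\<bar>\<^sup>2)\<close>
  together with evenness makes the canonical product over the zeros free of exponential factors.\<close>
locale real_even_entire =
  fixes f :: "complex \<Rightarrow> complex"
  assumes hol: "f holomorphic_on UNIV"
    and even: "\<And>z. f (- z) = f z"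
    and real: "\<And>z. f (cnj z) = cnj (f z)"
    and nz0: "f 0 \<noteq> 0"
    and growth: "\<And>e. e > 0 \<Longrightarrow> \<exists>C. \<forall>z. norm (f z) \<le> C * exp (e * (norm z)\<^sup>2)"
begin

definition ord :: "complex \<Rightarrow> nat" where "ord \<rho> = nat (zorder f \<rho>)"

definition zeros :: "real \<Rightarrow> complex set" where "zeros R = {\<rho>. f \<rho> = 0 \<and> norm \<rho> \<le> R}"

definition zprod :: "real \<Rightarrow> complex \<Rightarrow> complex" where
  "zprod R w = (\<Prod>\<rho>\<in>zeros R. (1 - w / \<rho>) ^ ord \<rho>)"

lemma finite_zeros: "finite (zeros R)"
proof (cases "f constant_on UNIV")
  case True
  then have "zeros R = {}" using nz0 unfolding constant_on_def zeros_def by auto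
  then show ?thesis by simp
next
  case False
  have "finite {z \<in> cball 0 R. f z = 0}"
    by (rule holomorphic_compact_finite_zeros[OF hol _ _ _ _ False]) auto
  moreover have "zeros R = {z \<in> cball 0 R. f z = 0}" by (auto simp: zeros_def)
  ultimately show ?thesis by simp
qed

lemma zero_nz: "f \<rho> = 0 \<Longrightarrow> \<rho> \<noteq> 0" using nz0 by auto

lemma zorder_nonneg: "zorder f a \<ge> 0" and zorder_pos: "f a = 0 \<Longrightarrow> zorder f a > 0"
  proof -
  have "if f a = 0 then zorder f a > 0 else zorder f a = 0"
    using zorder_exist_zero[of f UNIV a] hol nz0 connected_UNIV by blast
  then show "zorder f a \<ge> 0" "f a = 0 \<Longrightarrow> zorder f a > 0" by (auto split: if_splits)
qed

lemma of_int_zorder: "of_int (zorder f a) = of_nat (ord a)"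
  using zorder_nonneg[of a] by (simp add: ord_def)

lemma ord_pos: "f a = 0 \<Longrightarrow> ord a \<ge> 1"
  using zorder_pos[of a] by (simp add: ord_def)

lemma ord_uminus: "ord (- a) = ord a"
proof -
  obtain g where g: "g holomorphic_on UNIV" "g a \<noteq> 0" "\<And>w. f w = (w - a) ^ ord a * g w"
    using entire_factor_zero[OF hol nz0, of a] unfolding ord_def by blast
  have "zorder f (- a) = int (ord a)"
  proof (rule zorder_eqI[where S = UNIV and g = "\<lambda>w. (- 1) ^ ord a * g (- w)"])
    show "(\<lambda>w. (- 1) ^ ord a * g (- w)) holomorphic_on UNIV"
      by (intro holomorphic_intros holomorphic_on_compose_gen[OF _ g(1), unfolded o_def]) auto
    show "f w = (- 1) ^ ord a * g (- w) * (w - - a) powi int (ord a)" for w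
    proof -
      have "f w = (- w - a) ^ ord a * g (- w)" using g(3)[of "- w"] even by simp
      also have "(- w - a) ^ ord a = (- 1) ^ ord a * (w - - a) ^ ord a"
        by (simp add: power_mult_distrib[symmetric])
      finally show ?thesis by (simp add: power_int_of_nat)
    qed
  qed (use g in auto)
  then show ?thesis by (simp add: ord_def[of "-a"])
qed

lemma ord_cnj: "ord (cnj a) = ord a"
proof -
  obtain g where g: "g holomorphic_on UNIV" "g a \<noteq> 0" "\<And>w. f w = (w - a) ^ ord a * g w"
    using entire_factor_zero[OF hol nz0, of a] unfolding ord_def by blast
  have "zorder f (cnj a) = int (ord a)"
  proof (rule zorder_eqI[where S = UNIV and g = "\<lambda>w. cnj (g (cnj w))"])
    show "(\<lambda>w. cnj (g (cnj w))) holomorphic_on UNIV"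
      using holomorphic_on_compose_cnj_cnj[of g UNIV] holomorphic_on_subset[OF g(1) subset_UNIV] by (simp add: o_def)
    show "f w = cnj (g (cnj w)) * (w - cnj a) powi int (ord a)" for w
      using g(3)[of "cnj w"] real[of "cnj w"] by (simp add: power_int_of_nat)
  qed (use g in auto)
  then show ?thesis by (simp add: ord_def[of "cnj a"])
qed

lemma uminus_zeros: "bij_betw uminus (zeros R) (zeros R)"
  by (rule bij_betwI[where g = uminus]) (auto simp: zeros_def even)

lemma cnj_zeros: "bij_betw cnj (zeros R) (zeros R)"
  by (rule bij_betwI[where g = cnj]) (auto simp: zeros_def real)

lemma zprod_even: "zprod R (- w) = zprod R w"
proof -
  have "zprod R w = (\<Prod>\<rho>\<in>zeros R. (1 - w / (- \<rho>)) ^ ord (- \<rho>))"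
    unfolding zprod_def by (rule prod.reindex_bij_betw[OF uminus_zeros, symmetric])
  then show ?thesis by (simp add: zprod_def ord_uminus)
qed

lemma zprod_hol: "zprod R holomorphic_on A"
  unfolding zprod_def by (intro holomorphic_intros) (auto simp: zeros_def zero_nz)

lemma zprod_0: "zprod R 0 = 1" by (simp add: zprod_def)

text \<open>Far outside the disc each factor has modulus at least 1.  On such a circle the product may be dropped when a bound for \<open>f\<close>
  is passed on to the cofactor in \<open>zero_free_factor\<close>.\<close>
lemma zprod_ge_1:
  assumes "norm w \<ge> 2 * R"
  shows "norm (zprod R w) \<ge> 1"
proof -
  have "1 \<le> norm (1 - w / \<rho>)" if "\<rho> \<in> zeros R" for \<rho>
  proof -
    have \<rho>: "norm \<rho> > 0" "norm \<rho> \<le> R" using that zero_nz by (auto simp: zeros_def)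
    then have "2 \<le> norm (w / \<rho>)" using assms by (simp add: norm_divide field_simps)
    then show ?thesis using norm_triangle_ineq2[of "w / \<rho>" 1] by (simp add: norm_minus_commute)
  qed
  then have "1 \<le> (\<Prod>\<rho>\<in>zeros R. norm ((1 - w / \<rho>) ^ ord \<rho>))"
    by (intro prod_ge_1) (auto simp: norm_power intro: one_le_power)
  then show ?thesis by (simp add: zprod_def prod_norm)
qed

text \<open>Dividing out the zeros of modulus at most \<open>R\<close> leaves an entire function without zeros in the disc of radius \<open>R\<close>.\<close>
lemma zero_free_factor:
  "\<exists>F. F holomorphic_on UNIV \<and> F 0 = f 0 \<and> (\<forall>w. f w = F w * zprod R w) \<and> (\<forall>w. norm w \<le> R \<longrightarrow> F w \<noteq> 0)"
proof -
  obtain g where g: "g holomorphic_on UNIV" "\<And>a. a \<in> zeros R \<Longrightarrow> g a \<noteq> 0"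
     "\<And>w. f w = (\<Prod>a\<in>zeros R. (w - a) ^ ord a) * g w"
    using entire_factor_zeros[OF hol nz0 finite_zeros, of R] unfolding ord_def by blast
  define F where "F w = g w * (\<Prod>a\<in>zeros R. (- a) ^ ord a)" for w
  have F: "f w = F w * zprod R w" for w
  proof -
    have "(\<Prod>a\<in>zeros R. (w - a) ^ ord a) = (\<Prod>a\<in>zeros R. (- a) ^ ord a * (1 - w / a) ^ ord a)"
      by (rule prod.cong) (auto simp: zeros_def zero_nz power_mult_distrib[symmetric] field_simps)
    then show ?thesis using g(3)[of w] by (simp add: F_def zprod_def prod.distrib mult_ac)
  qed
  have "F holomorphic_on UNIV" unfolding F_def by (intro holomorphic_intros g)
  moreover have "F 0 = f 0" using F[of 0] by (simp add: zprod_0)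
  moreover have "F w \<noteq> 0" if "norm w \<le> R" for w
  proof (cases "f w = 0")
    case True
    then have "w \<in> zeros R" using that by (simp add: zeros_def)
    moreover have "a \<noteq> 0" if "a \<in> zeros R" for a using that zero_nz by (auto simp: zeros_def)
    ultimately show ?thesis using g(2) finite_zeros[of R] by (simp add: F_def)
  next
    case False
    then show ?thesis using F[of w] by auto
  qed
  ultimately show ?thesis using F by blast
qed

text \<open>The zero-free cofactor is \<open>f 0 * exp h\<close>, and \<open>Re h\<close> is at most of order \<open>e R\<^sup>2\<close>.  By Borel--Caratheodory and
  Cauchy, the second derivative of \<open>h\<close> is of order \<open>A / R\<^sup>2\<close> near the origin.  Both \<open>h\<close> and, by evenness, \<open>h'\<close> vanish at 0,
  so \<open>h\<close> and \<open>h'\<close> inherit this bound on a fixed disc: the quadratic growth in \<open>R\<close> is compensated exactly.\<close>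
lemma log_factor:
  assumes C: "\<And>z. norm (f z) \<le> C * exp (e * (norm z)\<^sup>2)" and e: "e > 0" 
    and R: "R > 0" and K: "4 * K \<le> R" "K \<ge> 1"
  defines "A \<equiv> ln (C / norm (f 0)) + 4 * e * R\<^sup>2 + 1"
  shows "\<exists>h. h holomorphic_on ball 0 R \<and> (\<forall>u\<in>ball 0 R. f u = f 0 * exp (h u) * zprod R u) \<and>
           (\<forall>w. norm w \<le> K \<longrightarrow> norm (h w) \<le> 64 * A * K\<^sup>2 / R\<^sup>2 \<and> norm (deriv h w) \<le> 64 * A * K\<^sup>2 / R\<^sup>2)"
proof -
  obtain F where F: "F holomorphic_on UNIV" "F 0 = f 0" "\<And>w. f w = F w * zprod R w"
      "\<And>w. norm w \<le> R \<Longrightarrow> F w \<noteq> 0"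
    using zero_free_factor[of R] by blast
  have C0: "C \<ge> norm (f 0)" using C[of 0] by simp
  then have Cp: "C > 0" using nz0 by (meson order.strict_trans2 zero_less_norm_iff)
  have lnC: "ln (C / norm (f 0)) \<ge> 0" using C0 nz0 by simp
  have Ap: "A > 0" unfolding A_def using lnC e by (intro add_nonneg_pos add_nonneg_nonneg) auto
  \<comment> \<open>on the circle of radius \<open>2 R\<close> the product has modulus at least 1, and the maximum principle moves the bound inside\<close>
  have Fb: "norm (F w) \<le> C * exp (4 * e * R\<^sup>2)" if w: "norm w < R" for w
  proof (rule maximum_modulus_frontier[where f = F and S = "cball 0 (2 * R)"])
    show "F holomorphic_on interior (cball 0 (2 * R))" "continuous_on (closure (cball 0 (2*R))) F"
      using F(1) holomorphic_on_subset holomorphic_on_imp_continuous_on by blast+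
    show "w \<in> cball 0 (2 * R)" using w R by simp
    fix z assume "z \<in> frontier (cball (0::complex) (2 * R))"
    then have z: "norm z = 2 * R" using R by (simp add: sphere_def)
    have "norm (F z) \<le> norm (F z) * norm (zprod R z)"
      using zprod_ge_1[of R z] z by (simp add: mult_le_cancel_left1)
    also have "\<dots> \<le> C * exp (e * (2 * R)\<^sup>2)" using C[of z] F(3)[of z] z by (simp add: norm_mult)
    finally show "norm (F z) \<le> C * exp (4 * e * R\<^sup>2)" by (simp add: power2_eq_square mult_ac)
  qed auto
  obtain L where L: "L holomorphic_on ball 0 R" "\<And>w. w \<in> ball 0 R \<Longrightarrow> exp (L w) = F w / f 0"
  proof (rule holomorphic_logarithm_exists[where A = "ball 0 R" and f = "\<lambda>w. F w / f 0" and ?z0.0 = 0])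
    show "(\<lambda>w. F w / f 0) holomorphic_on ball 0 R"
      by (intro holomorphic_intros holomorphic_on_subset[OF F(1)]) (auto simp: nz0)
    show "F w / f 0 \<noteq> 0" if "w \<in> ball 0 R" for w using F(4)[of w] that nz0 by simp
  qed (use R in auto)
  define h where "h w = L w - L 0" for w
  have L0: "exp (L 0) = 1" using L(2)[of 0] R F(2) nz0 by simp
  have h: "h holomorphic_on ball 0 R" unfolding h_def by (intro holomorphic_intros L)
  have eh: "F w = f 0 * exp (h w)" if "w \<in> ball 0 R" for w
    using L(2)[OF that] L0 nz0 by (simp add: h_def exp_diff)
  have Re: "Re (h w) < A" if "w \<in> ball 0 R" for w
  proof -
    have "exp (Re (h w)) = norm (F w) / norm (f 0)"
      using eh[OF that] nz0 by (simp add: norm_mult)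
    also have "\<dots> \<le> C * exp (4 * e * R\<^sup>2) / norm (f 0)"
      using Fb[of w] that by (intro divide_right_mono) auto
    also have "\<dots> = exp (ln (C / norm (f 0)) + 4 * e * R\<^sup>2)"
      using Cp nz0 by (simp add: exp_add)
    finally show ?thesis unfolding A_def by simp
  qed
  have hb: "norm (h w) \<le> 2 * A" if "norm w \<le> R / 2" for w
  proof -
    have "norm (h w) * (R / 2) \<le> norm (h w) * (R - norm w)"
      using that by (intro mult_left_mono) auto
    also have "\<dots> \<le> 2 * A * norm w"
      using that R by (intro borel_caratheodory[OF h _ Ap Re]) (auto simp: h_def)
    also have "\<dots> \<le> 2 * A * (R / 2)" using that Ap by (intro mult_left_mono) auto
    finally show ?thesis using R by simp
  qed
  have d1: "(h has_field_derivative deriv h w) (at w)" if "norm w < R" for w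
    using h that by (intro holomorphic_derivI[where S = "ball 0 R"]) auto
  have hol': "deriv h holomorphic_on ball 0 R" by (intro holomorphic_deriv h) auto
  have d2: "(deriv h has_field_derivative (deriv ^^ 2) h w) (at w)" if "norm w < R" for w
    using holomorphic_derivI[OF hol', of w] that by (simp add: numeral_2_eq_2)
  have b2: "norm ((deriv ^^ 2) h w) \<le> 64 * A / R\<^sup>2" if w: "norm w \<le> R / 4" for w
  proof -
    have sub: "cball w (R / 4) \<subseteq> ball 0 R"
    proof
      fix x assume "x \<in> cball w (R / 4)"
      then have "norm x \<le> norm w + R / 4"
        by (metis add_le_cancel_left dist_norm mem_cball norm_minus_commute norm_triangle_sub order_trans)
      then show "x \<in> ball 0 R" using w R by simp
    qed
    have "norm ((deriv ^^ 2) h w) \<le> fact 2 * (2 * A) / (R / 4) ^ 2"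
    proof (rule Cauchy_inequality)
      show "h holomorphic_on ball w (R / 4)"
        by (rule holomorphic_on_subset[OF h]) (use sub in \<open>auto simp: subset_iff\<close>)
      show "continuous_on (cball w (R / 4)) h"
        by (rule holomorphic_on_imp_continuous_on[OF holomorphic_on_subset[OF h sub]])
      fix x assume "norm (w - x) = R / 4"
      then have "norm x \<le> R / 2"
        using w norm_triangle_ineq4[of w "w - x"] by simp
      then show "norm (h x) \<le> 2 * A" by (rule hb)
    qed (use R in auto)
    then show ?thesis by (simp add: power2_eq_square field_simps)
  qed
  \<comment> \<open>evenness of \<open>f\<close> and of the product; without it \<open>h'\<close> would only be of order \<open>A / R\<close>\<close>
  have h'0: "deriv h 0 = 0"
  proof -
    have "continuous (at 0) (zprod R)"
      using zprod_hol[of R UNIV] holomorphic_on_imp_continuous_on continuous_on_eq_continuous_at open_UNIV by blast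
    then have "\<forall>\<^sub>F w in nhds 0. zprod R w \<noteq> 0"
      by (intro tendsto_imp_eventually_ne[where c = 1]) (metis zprod_0 isCont_def tendsto_at_iff_tendsto_nhds, simp)
    then have ev: "\<forall>\<^sub>F w in nhds 0. F (- w) = F w"
    proof eventually_elim
      case (elim w)
      then show ?case using F(3)[of w] F(3)[of "- w"] even[of w] zprod_even[of R w] by simp
    qed
    have dF: "(F has_field_derivative deriv F 0) (at 0)"
      by (rule holomorphic_derivI[OF F(1)]) auto
    have "((\<lambda>w. F (- w)) has_field_derivative deriv F 0 * (- 1)) (at 0)"
      by (rule DERIV_chain2[where f = F]) (use dF in \<open>auto intro!: derivative_eq_intros\<close>)
    then have "(F has_field_derivative - deriv F 0) (at 0)"
      using DERIV_cong_ev[OF refl ev refl] by simp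
    then have "deriv F 0 = - deriv F 0" using dF DERIV_unique by blast
    then have F0: "deriv F 0 = 0" by simp
    have "((\<lambda>w. f 0 * exp (h w)) has_field_derivative f 0 * (exp (h 0) * deriv h 0)) (at 0)"
      using d1[of 0] R by (auto intro!: derivative_eq_intros)
    moreover have ev2: "\<forall>\<^sub>F w in nhds 0. F w = f 0 * exp (h w)"
      using eventually_nhds_in_open[of "ball 0 R" 0] R eh by (auto elim!: eventually_mono)
    ultimately have "(F has_field_derivative f 0 * (exp (h 0) * deriv h 0)) (at 0)"
      using DERIV_cong_ev[OF refl ev2 refl] by blast
    then have "f 0 * (exp (h 0) * deriv h 0) = deriv F 0" using dF DERIV_unique by blast
    then show ?thesis using F0 nz0 by (simp add: h_def)
  qed
  have l1: "norm (deriv h w) \<le> 64 * A / R\<^sup>2 * norm w" if "norm w \<le> K" for w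
  proof -
    have "norm (deriv h w - deriv h 0) \<le> 64 * A / R\<^sup>2 * norm (w - 0)"
      by (rule field_differentiable_bound[where S = "cball 0 K" and f' = "(deriv ^^ 2) h"])
         (use that K R in \<open>auto intro!: b2 has_field_derivative_at_within d2\<close>)
    then show ?thesis by (simp add: h'0)
  qed
  have le: "64 * A / R\<^sup>2 * K \<le> 64 * A * K\<^sup>2 / R\<^sup>2"
    using K Ap by (simp add: power2_eq_square divide_right_mono)
  have l1': "norm (deriv h w) \<le> 64 * A / R\<^sup>2 * K" if "norm w \<le> K" for w
    using l1[OF that] that Ap by (meson divide_nonneg_nonneg mult_left_mono mult_nonneg_nonneg order_trans zero_le_power2 zero_le_numeral less_imp_le)
  have l2: "norm (h w) \<le> 64 * A * K\<^sup>2 / R\<^sup>2" if "norm w \<le> K" for w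
  proof -
    have "norm (h w - h 0) \<le> 64 * A / R\<^sup>2 * K * norm (w - 0)"
      by (rule field_differentiable_bound[where S = "cball 0 K" and f' = "deriv h"])
         (use that K R l1' in \<open>auto intro!: has_field_derivative_at_within d1\<close>)
    also have "\<dots> \<le> 64 * A / R\<^sup>2 * K * K"
      using that K Ap by (intro mult_left_mono) auto
    finally show ?thesis by (simp add: h_def power2_eq_square)
  qed
  have "f u = f 0 * exp (h u) * zprod R u" if "u \<in> ball 0 R" for u
    using F(3)[of u] eh[OF that] by simp
  moreover have "norm (deriv h w) \<le> 64 * A * K\<^sup>2 / R\<^sup>2" if "norm w \<le> K" for w
    using l1'[OF that] le by linarith
  ultimately show ?thesis using h l2 by blast
qed

text \<open>A quantitative form of the Hadamard product without convergence issues: on a fixed disc, the partial products over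
  the zeros of modulus at most \<open>R\<close> represent \<open>f\<close> up to a factor \<open>exp h\<close> with \<open>h\<close> and \<open>h'\<close> uniformly small.\<close>
lemma product_approx:
  assumes "e > 0"
  shows "\<exists>R0. \<forall>R\<ge>R0. R > K \<and> (\<exists>h. h holomorphic_on ball 0 R \<and> (\<forall>u\<in>ball 0 R. f u = f 0 * exp (h u) * zprod R u) \<and>
           (\<forall>w. norm w \<le> K \<longrightarrow> norm (h w) \<le> e \<and> norm (deriv h w) \<le> e))"
proof -
  define K' where "K' = max K 1"
  have K': "K' \<ge> 1" "K \<le> K'" by (auto simp: K'_def)
  \<comment> \<open>the bound of \<open>log_factor\<close> tends to \<open>256 d K'\<^sup>2\<close>, which this choice makes equal to \<open>e / 2\<close>\<close>
  define d where "d = e / (512 * K'\<^sup>2)"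
  have d: "d > 0" using assms K' by (auto simp: d_def)
  obtain C where C: "\<And>z. norm (f z) \<le> C * exp (d * (norm z)\<^sup>2)" using growth[OF d] by blast
  define l where "l = ln (C / norm (f 0)) + 1"
  have "((\<lambda>R. 64 * (l + 4 * d * R\<^sup>2) * K'\<^sup>2 / R\<^sup>2) \<longlongrightarrow> 64 * 4 * d * K'\<^sup>2) at_top"
    using d K' by real_asymp
  moreover have "64 * 4 * d * K'\<^sup>2 < e"
    using K' assms by (simp add: d_def)
  ultimately have "\<forall>\<^sub>F R in at_top. 64 * (l + 4 * d * R\<^sup>2) * K'\<^sup>2 / R\<^sup>2 < e"
    by (rule order_tendstoD)
  moreover have "\<forall>\<^sub>F R in at_top. R \<ge> 4 * K'" by (rule eventually_ge_at_top)
  ultimately have "\<forall>\<^sub>F R in at_top. R \<ge> 4 * K' \<and> 64 * (l + 4 * d * R\<^sup>2) * K'\<^sup>2 / R\<^sup>2 < e"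
    by eventually_elim auto
  then obtain R0 where R0: "\<And>R. R \<ge> R0 \<Longrightarrow> R \<ge> 4 * K' \<and> 64 * (l + 4 * d * R\<^sup>2) * K'\<^sup>2 / R\<^sup>2 < e"
    unfolding eventually_at_top_linorder by blast
  show ?thesis
  proof (intro exI[of _ R0] allI impI conjI)
    fix R assume "R0 \<le> R"
    note R = R0[OF this]
    show "R > K" using R K' by linarith
    have "R > 0" using R K' by linarith
    then obtain h where h: "h holomorphic_on ball 0 R" "\<forall>u\<in>ball 0 R. f u = f 0 * exp (h u) * zprod R u"
       "\<forall>w. norm w \<le> K' \<longrightarrow> norm (h w) \<le> 64 * (ln (C / norm (f 0)) + 4 * d * R\<^sup>2 + 1) * K'\<^sup>2 / R\<^sup>2 \<and>
         norm (deriv h w) \<le> 64 * (ln (C / norm (f 0)) + 4 * d * R\<^sup>2 + 1) * K'\<^sup>2 / R\<^sup>2"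
      using log_factor[OF C d, of R K'] R K' by blast
    have "ln (C / norm (f 0)) + 4 * d * R\<^sup>2 + 1 = l + 4 * d * R\<^sup>2" by (simp add: l_def)
    then have "\<forall>w. norm w \<le> K \<longrightarrow> norm (h w) \<le> e \<and> norm (deriv h w) \<le> e"
      using h(3) R K' by (smt (verit))
    then show "\<exists>h. h holomorphic_on ball 0 R \<and> (\<forall>u\<in>ball 0 R. f u = f 0 * exp (h u) * zprod R u) \<and>
           (\<forall>w. norm w \<le> K \<longrightarrow> norm (h w) \<le> e \<and> norm (deriv h w) \<le> e)"
      using h by blast
  qed
qed

text \<open>The zeros are symmetric under conjugation; pairing \<open>\<rho>\<close> with \<open>cnj \<rho>\<close> makes each factor monotone in the height
  and removes the odd part in \<open>Im \<rho>\<close> from all estimates below.\<close>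
lemma norm_zprod_pair: "(norm (zprod R w))\<^sup>2 = (\<Prod>\<rho>\<in>zeros R. (norm (1 - w / \<rho>) * norm (1 - w / cnj \<rho>)) ^ ord \<rho>)"
proof -
  have 1: "norm (zprod R w) = (\<Prod>\<rho>\<in>zeros R. norm (1 - w / \<rho>) ^ ord \<rho>)"
    by (simp add: zprod_def prod_norm[symmetric] norm_power)
  also have "\<dots> = (\<Prod>\<rho>\<in>zeros R. norm (1 - w / cnj \<rho>) ^ ord (cnj \<rho>))"
    by (rule prod.reindex_bij_betw[OF cnj_zeros, symmetric])
  finally have 2: "norm (zprod R w) = (\<Prod>\<rho>\<in>zeros R. norm (1 - w / cnj \<rho>) ^ ord \<rho>)"
    by (simp add: ord_cnj)
  have "(norm (zprod R w))\<^sup>2 = norm (zprod R w) * norm (zprod R w)" by (simp add: power2_eq_square)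
  also have "\<dots> = (\<Prod>\<rho>\<in>zeros R. norm (1 - w / \<rho>) ^ ord \<rho>) * (\<Prod>\<rho>\<in>zeros R. norm (1 - w / cnj \<rho>) ^ ord \<rho>)"
    using 1 2 by simp
  finally show ?thesis by (simp add: prod.distrib[symmetric] power_mult_distrib)
qed

lemma pair_factor:
  assumes "f \<rho> = 0"
  shows "norm (1 - Complex x \<eta> / \<rho>) * norm (1 - Complex x \<eta> / cnj \<rho>) =
         sqrt (((x - Re \<rho>)\<^sup>2 + (\<eta> - Im \<rho>)\<^sup>2) * ((x - Re \<rho>)\<^sup>2 + (\<eta> + Im \<rho>)\<^sup>2)) / (norm \<rho>)\<^sup>2"
proof -
  have [simp]: "\<rho> \<noteq> 0" using zero_nz assms by blast
  have "norm (1 - Complex x \<eta> / \<rho>) = norm (Complex x \<eta> - \<rho>) / norm \<rho>"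
    by (metis \<open>\<rho> \<noteq> 0\<close> diff_divide_distrib divide_self norm_divide norm_minus_commute)
  moreover have "norm (1 - Complex x \<eta> / cnj \<rho>) = norm (Complex x \<eta> - cnj \<rho>) / norm \<rho>"
    by (metis \<open>\<rho> \<noteq> 0\<close> complex_cnj_zero_iff complex_mod_cnj diff_divide_distrib divide_self norm_divide norm_minus_commute)
  ultimately show ?thesis
    by (simp add: norm_complex_def real_sqrt_mult power2_eq_square)
qed

text \<open>In a conjugate pair of factors the dependence on the height \<open>\<eta>\<close> is through
  \<open>2 d\<^sup>2 \<eta>\<^sup>2 + (\<eta>\<^sup>2 - B\<^sup>2)\<^sup>2\<close>, with \<open>B = Im \<rho>\<close>; this is largest at \<open>\<eta> = Y\<close> as soon as \<open>Y\<^sup>2 \<ge> 2 B\<^sup>2\<close>.  Hence the modulus on a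
  vertical line at moderate height is dominated by the modulus outside the strip of zeros.\<close>
lemma modulus_mono:
  assumes b: "\<And>\<rho>. f \<rho> = 0 \<Longrightarrow> \<bar>Im \<rho>\<bar> \<le> b" and Y: "2 * b\<^sup>2 \<le> Y\<^sup>2" and \<eta>: "\<bar>\<eta>\<bar> \<le> Y"
  shows "norm (f (Complex x \<eta>)) \<le> norm (f (Complex x Y))"
proof -
  have zprod: "norm (zprod R (Complex x \<eta>)) \<le> norm (zprod R (Complex x Y))" for R
  proof -
    have "(norm (zprod R (Complex x \<eta>)))\<^sup>2 \<le> (norm (zprod R (Complex x Y)))\<^sup>2"
      unfolding norm_zprod_pair
    proof (intro prod_mono conjI power_mono)
      fix \<rho> assume "\<rho> \<in> zeros R"
      then have \<rho>: "f \<rho> = 0" by (simp add: zeros_def)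
      define d B where "d = x - Re \<rho>" and "B = Im \<rho>"
      have B: "B\<^sup>2 \<le> b\<^sup>2" unfolding B_def using b[OF \<rho>] by (rule abs_le_imp_square_le)
      have \<eta>Y: "\<eta>\<^sup>2 \<le> Y\<^sup>2" using \<eta> by (rule abs_le_imp_square_le)
      have "\<bar>\<eta>\<^sup>2 - B\<^sup>2\<bar> \<le> Y\<^sup>2 - B\<^sup>2" using B \<eta>Y Y zero_le_power2[of \<eta>] by linarith
      then have "(\<eta>\<^sup>2 - B\<^sup>2)\<^sup>2 \<le> (Y\<^sup>2 - B\<^sup>2)\<^sup>2" by (rule abs_le_imp_square_le)
      moreover have "d\<^sup>2 * \<eta>\<^sup>2 \<le> d\<^sup>2 * Y\<^sup>2" using \<eta>Y by (intro mult_left_mono) auto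
      moreover have "(d\<^sup>2 + (t - B)\<^sup>2) * (d\<^sup>2 + (t + B)\<^sup>2) = d\<^sup>2 * d\<^sup>2 + 2 * (d\<^sup>2 * t\<^sup>2) + 2 * d\<^sup>2 * B\<^sup>2 + (t\<^sup>2 - B\<^sup>2)\<^sup>2" for t
        by (simp add: power2_eq_square algebra_simps)
      ultimately have "(d\<^sup>2 + (\<eta> - B)\<^sup>2) * (d\<^sup>2 + (\<eta> + B)\<^sup>2) \<le> (d\<^sup>2 + (Y - B)\<^sup>2) * (d\<^sup>2 + (Y + B)\<^sup>2)"
        by simp
      then show "norm (1 - Complex x \<eta> / \<rho>) * norm (1 - Complex x \<eta> / cnj \<rho>)
          \<le> norm (1 - Complex x Y / \<rho>) * norm (1 - Complex x Y / cnj \<rho>)"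
        unfolding pair_factor[OF \<rho>] d_def B_def by (intro divide_right_mono real_sqrt_le_mono) auto
    qed auto
    then show ?thesis by (rule power2_le_imp_le) auto
  qed
  define K where "K = norm (Complex x \<eta>) + norm (Complex x Y)"
  have le: "norm (f (Complex x \<eta>)) \<le> norm (f (Complex x Y)) * exp (2 * e)" if e: "e > 0" for e
  proof -
    obtain R h where R: "R > K" and h: "\<And>u. norm u < R \<Longrightarrow> f u = f 0 * exp (h u) * zprod R u"
       "\<And>w. norm w \<le> K \<Longrightarrow> norm (h w) \<le> e"
      using product_approx[OF e, of K] by (metis dist_0_norm mem_ball order_refl)
    have K: "norm (Complex x \<eta>) \<le> K" "norm (Complex x Y) \<le> K" by (auto simp: K_def)
    have r: "- e \<le> Re (h w)" "Re (h w) \<le> e" if "norm w \<le> K" for w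
      using h(2)[OF that] abs_Re_le_cmod[of "h w"] by linarith+
    have "norm (f (Complex x \<eta>)) = norm (f 0) * exp (Re (h (Complex x \<eta>))) * norm (zprod R (Complex x \<eta>))"
      using h(1)[of "Complex x \<eta>"] K R by (simp add: norm_mult)
    also have "\<dots> \<le> norm (f 0) * exp (Re (h (Complex x Y)) + 2 * e) * norm (zprod R (Complex x Y))"
      using r(2)[OF K(1)] r(1)[OF K(2)] zprod by (intro mult_mono) auto
    also have "\<dots> = norm (f (Complex x Y)) * exp (2 * e)"
      using h(1)[of "Complex x Y"] K R by (simp add: norm_mult exp_add)
    finally show ?thesis .
  qed
  \<comment> \<open>let the error of the product representation tend to 0\<close>
  have "((\<lambda>e. norm (f (Complex x Y)) * exp (2 * e)) \<longlongrightarrow> norm (f (Complex x Y))) (at_right 0)"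
    by (auto intro!: tendsto_eq_intros)
  moreover have "\<forall>\<^sub>F e in at_right 0. norm (f (Complex x \<eta>)) \<le> norm (f (Complex x Y)) * exp (2 * e)"
    using le by (auto simp: eventually_at_right_field intro!: exI[of _ 1])
  ultimately show ?thesis by (rule tendsto_lowerbound) simp
qed

text \<open>With \<open>others\<close> below, the sum defining \<open>G\<close>, for an arbitrary even entire function; \<open>of_int_zorder\<close> reconciles the multiplicities.\<close>
definition G_term :: "complex \<Rightarrow> complex \<Rightarrow> real" where
  "G_term z \<rho> = real (ord \<rho>) / ((Re \<rho> - Re z)\<^sup>2 + 4 * (Im z)\<^sup>2)"

definition others :: "complex \<Rightarrow> complex set" where
  "others z = {\<rho>. f \<rho> = 0 \<and> \<rho> \<noteq> z \<and> \<rho> \<noteq> cnj z}"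

lemma G_term_nonneg: "G_term z \<rho> \<ge> 0"
  by (simp add: G_term_def)

lemma ln_ratio_bounds:
  fixes a b :: real
  assumes "a > 0" "b > 0"
  shows "ln (b / a) \<le> (b - a) / a" and "ln (b / a) \<ge> (b - a) / b"
proof -
  show "ln (b / a) \<le> (b - a) / a"
    using ln_le_minus_one[of "b / a"] assms by (simp add: diff_divide_distrib)
  have "ln (a / b) \<le> a / b - 1"
    using ln_le_minus_one[of "a / b"] assms by simp
  then show "ln (b / a) \<ge> (b - a) / b"
    using assms by (simp add: ln_div diff_divide_distrib)
qed

text \<open>The logarithmic growth of the two factors of \<open>\<rho>\<close> and \<open>cnj \<rho>\<close> together between the heights 2 and 4.  Summed over all zeros it gives
  twice the logarithmic growth of \<open>f\<close>, since every pair occurs for both of its members.\<close>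
definition growth_pair :: "real \<Rightarrow> complex \<Rightarrow> real" where
  "growth_pair x \<rho> = (ln (((x - Re \<rho>)\<^sup>2 + (4 - Im \<rho>)\<^sup>2) / ((x - Re \<rho>)\<^sup>2 + (2 - Im \<rho>)\<^sup>2)) +
     ln (((x - Re \<rho>)\<^sup>2 + (4 + Im \<rho>)\<^sup>2) / ((x - Re \<rho>)\<^sup>2 + (2 + Im \<rho>)\<^sup>2))) / 2"

text \<open>By \<open>ln q \<le> q - 1\<close> a logarithm is at most \<open>(12 - 4 c) / (d\<^sup>2 + (2 - c)\<^sup>2)\<close> with \<open>c = \<plusminus> Im \<rho>\<close>, and the denominator
  is at least \<open>d\<^sup>2 + 4 y\<^sup>2\<close> because \<open>2 y \<le> 2 - c\<close>.  The terms linear in \<open>c\<close> cancel in the pair.\<close>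
lemma growth_pair_upper:
  assumes "\<bar>Im \<rho>\<bar> \<le> y" "0 < y" "y \<le> 1 / 5"
  shows "growth_pair x \<rho> \<le> 12 / ((Re \<rho> - x)\<^sup>2 + 4 * y\<^sup>2)"
proof -
  define d B where "d = x - Re \<rho>" and "B = Im \<rho>"
  have B: "\<bar>B\<bar> \<le> 1 / 5" using assms by (simp add: B_def)
  have 1: "ln ((d\<^sup>2 + (4 - c)\<^sup>2) / (d\<^sup>2 + (2 - c)\<^sup>2)) \<le> (12 - 4 * c) / (d\<^sup>2 + 4 * y\<^sup>2)" if c: "\<bar>c\<bar> \<le> 1 / 5" for c
  proof -
    have pos: "d\<^sup>2 + (2 - c)\<^sup>2 > 0" "d\<^sup>2 + (4 - c)\<^sup>2 > 0" "d\<^sup>2 + 4 * y\<^sup>2 > 0"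
      using c assms by (auto intro!: add_nonneg_pos)
    have "(2 * y)\<^sup>2 \<le> (2 - c)\<^sup>2" using assms c by (intro power_mono) auto
    then have le: "d\<^sup>2 + 4 * y\<^sup>2 \<le> d\<^sup>2 + (2 - c)\<^sup>2" by (simp add: power_mult_distrib)
    have "ln ((d\<^sup>2 + (4 - c)\<^sup>2) / (d\<^sup>2 + (2 - c)\<^sup>2)) \<le> (12 - 4 * c) / (d\<^sup>2 + (2 - c)\<^sup>2)"
      using ln_ratio_bounds(1)[OF pos(1,2)] by (simp add: power2_eq_square algebra_simps)
    also have "\<dots> \<le> (12 - 4 * c) / (d\<^sup>2 + 4 * y\<^sup>2)"
      using le pos c by (intro divide_left_mono) auto
    finally show ?thesis .
  qed
  have "growth_pair x \<rho> \<le> ((12 - 4 * B) / (d\<^sup>2 + 4 * y\<^sup>2) + (12 - 4 * (- B)) / (d\<^sup>2 + 4 * y\<^sup>2)) / 2"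
    using 1[of B] 1[of "- B"] B unfolding growth_pair_def d_def[symmetric] B_def[symmetric]
    by (intro divide_right_mono add_mono) auto
  also have "((12 - 4 * B) / D + (12 - 4 * (- B)) / D) / 2 = 12 / D" for D
    by (cases "D = 0") (auto simp: field_simps)
  finally show ?thesis by (simp add: d_def power2_commute)
qed

text \<open>A crude bound in the opposite direction.  Since the total growth is finite, it gives the convergence of the sum \<open>G\<close>.\<close>
lemma growth_pair_lower:
  assumes "\<bar>Im \<rho>\<bar> \<le> y" "0 < y" "y \<le> 1 / 5"
  shows "growth_pair x \<rho> \<ge> 1 / (1 + 5 / y\<^sup>2) * (1 / ((Re \<rho> - x)\<^sup>2 + 4 * y\<^sup>2))"
proof -
  define d B where "d = x - Re \<rho>" and "B = Im \<rho>"
  have B: "\<bar>B\<bar> \<le> 1 / 5" using assms by (simp add: B_def)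
  have 1: "ln ((d\<^sup>2 + (4 - c)\<^sup>2) / (d\<^sup>2 + (2 - c)\<^sup>2)) \<ge> 1 / (1 + 5 / y\<^sup>2) * (1 / (d\<^sup>2 + 4 * y\<^sup>2))" if c: "\<bar>c\<bar> \<le> 1 / 5" for c
  proof -
    have pos: "d\<^sup>2 + (2 - c)\<^sup>2 > 0" "d\<^sup>2 + (4 - c)\<^sup>2 > 0" "d\<^sup>2 + 4 * y\<^sup>2 > 0" "1 + 5 / y\<^sup>2 > 0"
      using c assms by (intro add_nonneg_pos add_pos_nonneg; simp)+
    \<comment> \<open>\<open>(21/5)\<^sup>2 < 20\<close>, and \<open>5 / y\<^sup>2\<close> times \<open>4 y\<^sup>2\<close> is 20\<close>
    have "(4 - c)\<^sup>2 \<le> (21 / 5)\<^sup>2" using c by (intro power_mono) auto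
    then have "d\<^sup>2 + (4 - c)\<^sup>2 \<le> d\<^sup>2 + 20 + 4 * y\<^sup>2 + 5 / y\<^sup>2 * d\<^sup>2"
      by (simp add: power2_eq_square add_increasing2)
    also have "\<dots> = (1 + 5 / y\<^sup>2) * (d\<^sup>2 + 4 * y\<^sup>2)"
      using assms by (simp add: field_simps)
    finally have le: "d\<^sup>2 + (4 - c)\<^sup>2 \<le> (1 + 5 / y\<^sup>2) * (d\<^sup>2 + 4 * y\<^sup>2)" .
    have "1 / ((1 + 5 / y\<^sup>2) * (d\<^sup>2 + 4 * y\<^sup>2)) \<le> (12 - 4 * c) / ((1 + 5 / y\<^sup>2) * (d\<^sup>2 + 4 * y\<^sup>2))"
      using c pos by (intro divide_right_mono) auto
    also have "\<dots> \<le> (12 - 4 * c) / (d\<^sup>2 + (4 - c)\<^sup>2)"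
      using le pos c by (intro divide_left_mono mult_pos_pos) auto
    also have "\<dots> \<le> ln ((d\<^sup>2 + (4 - c)\<^sup>2) / (d\<^sup>2 + (2 - c)\<^sup>2))"
      using ln_ratio_bounds(2)[OF pos(1,2)] by (simp add: power2_eq_square algebra_simps)
    finally show ?thesis by simp
  qed
  have "growth_pair x \<rho> \<ge> (1 / (1 + 5 / y\<^sup>2) * (1 / (d\<^sup>2 + 4 * y\<^sup>2)) + 1 / (1 + 5 / y\<^sup>2) * (1 / (d\<^sup>2 + 4 * y\<^sup>2))) / 2"
    using 1[of B] 1[of "- B"] B unfolding growth_pair_def d_def[symmetric] B_def[symmetric]
    by (simp del: times_divide_eq_left times_divide_eq_right)
  then show ?thesis unfolding d_def power2_commute[of x] by (simp del: times_divide_eq_left times_divide_eq_right)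
qed

lemma growth_zprod:
  assumes strip: "\<And>\<rho>. f \<rho> = 0 \<Longrightarrow> \<bar>Im \<rho>\<bar> \<le> y" and y: "y \<le> 1 / 5"
  shows "2 * ln (norm (zprod R (Complex x 4)) / norm (zprod R (Complex x 2))) = (\<Sum>\<rho>\<in>zeros R. real (ord \<rho>) * growth_pair x \<rho>)"
    and "norm (zprod R (Complex x 2)) > 0" "norm (zprod R (Complex x 4)) > 0"
proof -
  define q where "q \<eta> \<rho> = sqrt (((x - Re \<rho>)\<^sup>2 + (\<eta> - Im \<rho>)\<^sup>2) * ((x - Re \<rho>)\<^sup>2 + (\<eta> + Im \<rho>)\<^sup>2)) / (norm \<rho>)\<^sup>2" for \<eta> \<rho>
  have pos1: "(x - Re \<rho>)\<^sup>2 + (\<eta> - Im \<rho>)\<^sup>2 > 0" "(x - Re \<rho>)\<^sup>2 + (\<eta> + Im \<rho>)\<^sup>2 > 0"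
    if "\<rho> \<in> zeros R" "\<eta> = 2 \<or> \<eta> = 4" for \<rho> \<eta>
  proof -
    have "\<bar>Im \<rho>\<bar> \<le> 1 / 5" using strip[of \<rho>] that y by (auto simp: zeros_def)
    then show "(x - Re \<rho>)\<^sup>2 + (\<eta> - Im \<rho>)\<^sup>2 > 0" "(x - Re \<rho>)\<^sup>2 + (\<eta> + Im \<rho>)\<^sup>2 > 0"
      using that(2) by (intro add_nonneg_pos; auto)+
  qed
  have qpos: "q \<eta> \<rho> > 0" if "\<rho> \<in> zeros R" "\<eta> = 2 \<or> \<eta> = 4" for \<rho> \<eta>
    unfolding q_def using pos1[OF that] that zero_nz[of \<rho>] by (auto simp: zeros_def)
  have P2: "(norm (zprod R (Complex x \<eta>)))\<^sup>2 = (\<Prod>\<rho>\<in>zeros R. q \<eta> \<rho> ^ ord \<rho>)" for \<eta>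
    unfolding norm_zprod_pair by (rule prod.cong) (auto simp: zeros_def pair_factor q_def)
  have Ppos2: "(norm (zprod R (Complex x \<eta>)))\<^sup>2 > 0" if "\<eta> = 2 \<or> \<eta> = 4" for \<eta>
    unfolding P2 using qpos that by (intro prod_pos zero_less_power) auto
  then show Ppos: "norm (zprod R (Complex x 2)) > 0" "norm (zprod R (Complex x 4)) > 0"
    by (auto simp: zero_less_power2)
  have "2 * ln (norm (zprod R (Complex x 4)) / norm (zprod R (Complex x 2))) =
      ln ((norm (zprod R (Complex x 4)))\<^sup>2) - ln ((norm (zprod R (Complex x 2)))\<^sup>2)"
    using Ppos by (simp add: ln_div ln_realpow)
  also have "\<dots> = (\<Sum>\<rho>\<in>zeros R. ln (q 4 \<rho> ^ ord \<rho>)) - (\<Sum>\<rho>\<in>zeros R. ln (q 2 \<rho> ^ ord \<rho>))"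
    unfolding P2 using qpos by (subst (1 2) ln_prod) (auto simp: finite_zeros less_imp_neq[symmetric] intro!: zero_less_power)
  also have "\<dots> = (\<Sum>\<rho>\<in>zeros R. real (ord \<rho>) * growth_pair x \<rho>)"
    unfolding sum_subtractf[symmetric]
  proof (rule sum.cong)
    fix \<rho> assume \<rho>: "\<rho> \<in> zeros R"
    have n: "norm \<rho> > 0" using \<rho> zero_nz[of \<rho>] by (auto simp: zeros_def)
    have l: "ln (q \<eta> \<rho>) = (ln ((x - Re \<rho>)\<^sup>2 + (\<eta> - Im \<rho>)\<^sup>2) + ln ((x - Re \<rho>)\<^sup>2 + (\<eta> + Im \<rho>)\<^sup>2)) / 2 - 2 * ln (norm \<rho>)"
      if "\<eta> = 2 \<or> \<eta> = 4" for \<eta>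
      unfolding q_def using pos1[OF \<rho> that] n
      by (subst ln_div) (auto simp: ln_sqrt ln_mult ln_realpow)
    have "ln (q 4 \<rho> ^ ord \<rho>) - ln (q 2 \<rho> ^ ord \<rho>) = real (ord \<rho>) * (ln (q 4 \<rho>) - ln (q 2 \<rho>))"
      using qpos[OF \<rho>] by (simp add: ln_realpow algebra_simps)
    also have "ln (q 4 \<rho>) - ln (q 2 \<rho>) = growth_pair x \<rho>"
    proof -
      have "ln (((x - Re \<rho>)\<^sup>2 + (4 - Im \<rho>)\<^sup>2) / ((x - Re \<rho>)\<^sup>2 + (2 - Im \<rho>)\<^sup>2)) =
        ln ((x - Re \<rho>)\<^sup>2 + (4 - Im \<rho>)\<^sup>2) - ln ((x - Re \<rho>)\<^sup>2 + (2 - Im \<rho>)\<^sup>2)"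
        using pos1[OF \<rho>, of 4] pos1[OF \<rho>, of 2] by (intro ln_divide_pos) simp_all
      moreover have "ln (((x - Re \<rho>)\<^sup>2 + (4 + Im \<rho>)\<^sup>2) / ((x - Re \<rho>)\<^sup>2 + (2 + Im \<rho>)\<^sup>2)) =
        ln ((x - Re \<rho>)\<^sup>2 + (4 + Im \<rho>)\<^sup>2) - ln ((x - Re \<rho>)\<^sup>2 + (2 + Im \<rho>)\<^sup>2)"
        using pos1[OF \<rho>, of 4] pos1[OF \<rho>, of 2] by (intro ln_divide_pos) simp_all
      ultimately show ?thesis using l[of 4] l[of 2] unfolding growth_pair_def by argo
    qed
    finally show "ln (q 4 \<rho> ^ ord \<rho>) - ln (q 2 \<rho> ^ ord \<rho>) = real (ord \<rho>) * growth_pair x \<rho>" .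
  qed auto
  finally show "2 * ln (norm (zprod R (Complex x 4)) / norm (zprod R (Complex x 2))) = (\<Sum>\<rho>\<in>zeros R. real (ord \<rho>) * growth_pair x \<rho>)" .
qed

context
  fixes z :: complex
  assumes z: "f z = 0" "0 < Im z" "Im z \<le> 1 / 5"
    and strip: "\<And>\<rho>. f \<rho> = 0 \<Longrightarrow> \<bar>Im \<rho>\<bar> \<le> Im z"
    and simple: "ord z = 1"
begin

text \<open>The logarithmic growth of \<open>f\<close> is half the limit of the partial sums of \<open>growth_pair\<close>: the factor \<open>exp h\<close> of \<open>product_approx\<close> is
  evaluated at two fixed points, where \<open>h\<close> is small.\<close>
lemma growth_approx:
  assumes "e > 0"
  shows "\<exists>R0. \<forall>R\<ge>R0. R > K \<and>
    \<bar>ln (norm (f (Complex x 4)) / norm (f (Complex x 2))) - (\<Sum>\<rho>\<in>zeros R. real (ord \<rho>) * growth_pair x \<rho>) / 2\<bar> \<le> e"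
proof -
  define K' where "K' = norm (Complex x 4) + norm (Complex x 2) + \<bar>K\<bar>"
  have K': "norm (Complex x 4) \<le> K'" "norm (Complex x 2) \<le> K'" "K \<le> K'"
    using norm_ge_zero[of "Complex x 4"] norm_ge_zero[of "Complex x 2"] abs_ge_self[of K] abs_ge_zero[of K]
    unfolding K'_def by linarith+
  obtain R0 where R0: "\<forall>R\<ge>R0. R > K' \<and> (\<exists>h. h holomorphic_on ball 0 R \<and> (\<forall>u\<in>ball 0 R. f u = f 0 * exp (h u) * zprod R u) \<and>
           (\<forall>w. norm w \<le> K' \<longrightarrow> norm (h w) \<le> e / 2 \<and> norm (deriv h w) \<le> e / 2))"
    using product_approx[of "e / 2" K'] assms by auto
  show ?thesis
  proof (intro exI[of _ R0] allI impI conjI)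
    fix R assume "R0 \<le> R"
    then obtain h where R: "R > K'" and h: "\<And>u. norm u < R \<Longrightarrow> f u = f 0 * exp (h u) * zprod R u"
       "\<And>w. norm w \<le> K' \<Longrightarrow> norm (h w) \<le> e / 2"
      using R0 by (metis dist_0_norm mem_ball)
    show "R > K" using R K' by linarith
    have n: "norm (f w) = norm (f 0) * exp (Re (h w)) * norm (zprod R w)" if "norm w \<le> K'" for w
      using h(1)[of w] that R by (simp add: norm_mult)
    note g = growth_zprod[OF strip z(3), of R x]
    have "ln (norm (f (Complex x 4)) / norm (f (Complex x 2))) =
       ln (exp (Re (h (Complex x 4))) * norm (zprod R (Complex x 4)) / (exp (Re (h (Complex x 2))) * norm (zprod R (Complex x 2))))"
      using n[OF K'(1)] n[OF K'(2)] nz0 by (simp add: mult.assoc)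
    also have "\<dots> = Re (h (Complex x 4)) - Re (h (Complex x 2)) + ln (norm (zprod R (Complex x 4)) / norm (zprod R (Complex x 2)))"
      using g(2,3) by (simp add: ln_div ln_mult)
    finally have "ln (norm (f (Complex x 4)) / norm (f (Complex x 2))) - (\<Sum>\<rho>\<in>zeros R. real (ord \<rho>) * growth_pair x \<rho>) / 2
       = Re (h (Complex x 4)) - Re (h (Complex x 2))" using g(1) by simp
    moreover have "\<bar>Re (h w)\<bar> \<le> e / 2" if "norm w \<le> K'" for w
      using h(2)[OF that] abs_Re_le_cmod[of "h w"] by linarith
    ultimately show "\<bar>ln (norm (f (Complex x 4)) / norm (f (Complex x 2))) - (\<Sum>\<rho>\<in>zeros R. real (ord \<rho>) * growth_pair x \<rho>) / 2\<bar> \<le> e"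
      using K' by (smt (verit, best) field_sum_of_halves)
  qed
qed

lemma G_summable: "G_term z summable_on others z"
proof -
  define x where "x = Re z"
  define l where "l = ln (norm (f (Complex x 4)) / norm (f (Complex x 2)))"
  define c where "c = 1 / (1 + 5 / (Im z)\<^sup>2)"
  have c: "c > 0" unfolding c_def by (intro divide_pos_pos add_pos_nonneg) auto
  obtain R0 where R0': "\<forall>R\<ge>R0. R > 0 \<and> \<bar>l - (\<Sum>\<rho>\<in>zeros R. real (ord \<rho>) * growth_pair x \<rho>) / 2\<bar> \<le> 1"
    using growth_approx[of 1 0 x, OF zero_less_one] unfolding l_def by (elim exE)
  have R0: "\<bar>l - (\<Sum>\<rho>\<in>zeros R. real (ord \<rho>) * growth_pair x \<rho>) / 2\<bar> \<le> 1" if "R \<ge> R0" for R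
    using R0'[rule_format, OF that] by (rule conjunct2)
  have "sum (G_term z) F \<le> (2 * l + 2) / c" if F: "finite F" "F \<subseteq> others z" for F
  proof -
    \<comment> \<open>a radius for which the disc contains all zeros in \<open>F\<close>\<close>
    define R where "R = max R0 (\<Sum>\<rho>\<in>F. norm \<rho>)"
    have "F \<subseteq> zeros R"
    proof
      fix \<rho> assume "\<rho> \<in> F"
      then have "norm \<rho> \<le> (\<Sum>\<rho>\<in>F. norm \<rho>)" using F by (intro member_le_sum) auto
      then show "\<rho> \<in> zeros R" using F \<open>\<rho> \<in> F\<close> by (auto simp: zeros_def R_def others_def)
    qed
    have "sum (G_term z) F \<le> sum (G_term z) (zeros R)"
      using \<open>F \<subseteq> zeros R\<close> finite_zeros by (intro sum_mono2) (auto simp: G_term_nonneg)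
    also have "\<dots> \<le> (\<Sum>\<rho>\<in>zeros R. real (ord \<rho>) * growth_pair x \<rho> / c)"
    proof (rule sum_mono)
      fix \<rho> assume "\<rho> \<in> zeros R"
      then have "\<bar>Im \<rho>\<bar> \<le> Im z" using strip by (auto simp: zeros_def)
      from growth_pair_lower[OF this z(2,3), of x]
      have "1 / ((Re \<rho> - x)\<^sup>2 + 4 * (Im z)\<^sup>2) \<le> growth_pair x \<rho> / c"
        using c unfolding c_def[symmetric] by (simp add: pos_le_divide_eq mult.commute)
      then have "real (ord \<rho>) * (1 / ((Re \<rho> - x)\<^sup>2 + 4 * (Im z)\<^sup>2)) \<le> real (ord \<rho>) * (growth_pair x \<rho> / c)"
        by (intro mult_left_mono) auto
      then show "G_term z \<rho> \<le> real (ord \<rho>) * growth_pair x \<rho> / c"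
        by (simp add: G_term_def x_def)
    qed
    also have "\<dots> = (\<Sum>\<rho>\<in>zeros R. real (ord \<rho>) * growth_pair x \<rho>) / c"
      by (simp add: sum_divide_distrib)
    also have "\<dots> \<le> (2 * l + 2) / c"
      using R0[of R] c by (intro divide_right_mono) (auto simp: R_def)
    finally show ?thesis .
  qed
  then show ?thesis
    by (intro nonneg_bdd_above_summable_on) (auto simp: G_term_nonneg intro!: bdd_aboveI)
qed

lemma sum_others_le: "(\<Sum>\<rho>\<in>zeros R - {z, cnj z}. G_term z \<rho>) \<le> infsum (G_term z) (others z)"
  by (rule finite_sum_le_infsum[OF G_summable])
     (use finite_zeros[of R] in \<open>auto simp: zeros_def others_def G_term_nonneg\<close>)

text \<open>The vertical growth bounds \<open>G\<close> from below.  The terms of \<open>z\<close> and \<open>cnj z\<close> are evaluated exactly, as \<open>z\<close> is simple.\<close>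
theorem growth_le_G:
  "ln (norm (f (Complex (Re z) 4)) / norm (f (Complex (Re z) 2))) \<le>
     6 * infsum (G_term z) (others z) + ln ((16 - (Im z)\<^sup>2) / (4 - (Im z)\<^sup>2))"
proof (rule field_le_epsilon)
  fix e :: real assume e: "e > 0"
  define x where "x = Re z"
  define g where "g \<rho> = real (ord \<rho>) * growth_pair x \<rho>" for \<rho>
  obtain R where R: "R > norm z" "ln (norm (f (Complex x 4)) / norm (f (Complex x 2))) - sum g (zeros R) / 2 \<le> e"
  proof -
    obtain R where "\<forall>R'\<ge>R. R' > norm z \<and> \<bar>ln (norm (f (Complex x 4)) / norm (f (Complex x 2))) - sum g (zeros R') / 2\<bar> \<le> e"
      using growth_approx[OF e, of "norm z" x] unfolding g_def by (elim exE)
    then have "R > norm z \<and> \<bar>ln (norm (f (Complex x 4)) / norm (f (Complex x 2))) - sum g (zeros R) / 2\<bar> \<le> e"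
      by (rule allE[of _ R]) simp
    then show ?thesis by (intro that[of R]) linarith+
  qed
  have zZ: "{z, cnj z} \<subseteq> zeros R" using R(1) z real[of z] by (auto simp: zeros_def)
  have ne: "z \<noteq> cnj z" using z by (auto simp: complex_eq_iff)
  have "sum g (zeros R) = sum g (zeros R - {z, cnj z}) + sum g {z, cnj z}"
    using zZ finite_zeros by (rule sum.subset_diff)
  moreover have "sum g (zeros R - {z, cnj z}) \<le> 12 * (\<Sum>\<rho>\<in>zeros R - {z, cnj z}. G_term z \<rho>)"
    unfolding sum_distrib_left
  proof (rule sum_mono)
    fix \<rho> assume "\<rho> \<in> zeros R - {z, cnj z}"
    then have "\<bar>Im \<rho>\<bar> \<le> Im z" using strip by (auto simp: zeros_def)
    then have "real (ord \<rho>) * growth_pair x \<rho> \<le> real (ord \<rho>) * (12 / ((Re \<rho> - x)\<^sup>2 + 4 * (Im z)\<^sup>2))"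
      using z by (intro mult_left_mono growth_pair_upper) auto
    then show "g \<rho> \<le> 12 * G_term z \<rho>" by (simp add: g_def G_term_def x_def mult.commute)
  qed
  moreover have "sum g {z, cnj z} = 2 * ln ((16 - (Im z)\<^sup>2) / (4 - (Im z)\<^sup>2))"
  proof -
    have p: "4 - Im z > 0" "4 + Im z > 0" "2 - Im z > 0" "2 + Im z > 0" using z by auto
    have "16 - (Im z)\<^sup>2 = (4 - Im z) * (4 + Im z)" "4 - (Im z)\<^sup>2 = (2 - Im z) * (2 + Im z)"
      by (auto simp: power2_eq_square algebra_simps)
    then have "ln ((16 - (Im z)\<^sup>2) / (4 - (Im z)\<^sup>2)) = ln (4 - Im z) + ln (4 + Im z) - ln (2 - Im z) - ln (2 + Im z)"
      using p by (simp add: ln_mult ln_div)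
    moreover have "sum g {z, cnj z} = g z + g (cnj z)" using ne by simp
    moreover have "g z = ln (4 - Im z) + ln (4 + Im z) - ln (2 - Im z) - ln (2 + Im z)"
      using p simple by (simp add: g_def growth_pair_def x_def ln_div ln_realpow)
    moreover have "g (cnj z) = g z"
      by (simp add: g_def growth_pair_def ord_cnj add.commute)
    ultimately show ?thesis by simp
  qed
  ultimately have "sum g (zeros R) \<le> 12 * infsum (G_term z) (others z) + 2 * ln ((16 - (Im z)\<^sup>2) / (4 - (Im z)\<^sup>2))"
    using sum_others_le[of R] by linarith
  then show "ln (norm (f (Complex (Re z) 4)) / norm (f (Complex (Re z) 2))) \<le>
     6 * infsum (G_term z) (others z) + ln ((16 - (Im z)\<^sup>2) / (4 - (Im z)\<^sup>2)) + e"
    using R(2) unfolding x_def by linarith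
qed

text \<open>With \<open>f w = (w - z) g w\<close> one has \<open>f'' / f' = 2 g' / g\<close> at \<open>z\<close>, and \<open>g' / g\<close> is the logarithmic derivative of the remaining product.\<close>
lemma log_deriv_formula:
  assumes R: "R > norm z" and h: "h holomorphic_on ball 0 R" "\<And>u. norm u < R \<Longrightarrow> f u = f 0 * exp (h u) * zprod R u"
  shows "deriv f z \<noteq> 0"
    "deriv (deriv f) z / deriv f z = 2 * (deriv h z + (\<Sum>\<rho>\<in>zeros R - {z}. of_nat (ord \<rho>) / (z - \<rho>)))"
proof -
  define k where "k u = - f 0 / z * exp (h u) * (\<Prod>\<rho>\<in>zeros R - {z}. (1 - u / \<rho>) ^ ord \<rho>)" for u
  define S where "S = ball (0::complex) R"
  have zS: "z \<in> S" "open S" using R by (auto simp: S_def)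
  have zZ: "z \<in> zeros R" using R z by (simp add: zeros_def)
  have z0: "z \<noteq> 0" using zero_nz z by blast
  have r0: "\<rho> \<noteq> 0" if "\<rho> \<in> zeros R" for \<rho> using that zero_nz by (auto simp: zeros_def)
  have fk: "f u = (u - z) * k u" if "u \<in> S" for u
  proof -
    have "zprod R u = (1 - u / z) * (\<Prod>\<rho>\<in>zeros R - {z}. (1 - u / \<rho>) ^ ord \<rho>)"
      unfolding zprod_def using zZ finite_zeros by (subst prod.remove[of _ z]) (auto simp: simple)
    moreover have "1 - u / z = (u - z) * (- 1 / z)" using z0 by (simp add: field_simps)
    ultimately show ?thesis using h(2)[of u] that by (simp add: S_def k_def mult_ac)
  qed
  have holk: "k holomorphic_on S"
    unfolding k_def S_def using r0 z0 by (intro holomorphic_intros h) auto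
  have kz: "k z \<noteq> 0"
    using nz0 z0 r0 finite_zeros by (auto simp: k_def)
  have dk: "(k has_field_derivative deriv k u) (at u)" if "u \<in> S" for u
    using holomorphic_derivI[OF holk zS(2) that] .
  have df: "deriv f u = k u + (u - z) * deriv k u" if "u \<in> S" for u
  proof (rule DERIV_imp_deriv)
    have "((\<lambda>u. (u - z) * k u) has_field_derivative k u + (u - z) * deriv k u) (at u)"
      using dk[OF that] by (auto intro!: derivative_eq_intros)
    then show "(f has_field_derivative k u + (u - z) * deriv k u) (at u)"
      by (rule has_field_derivative_transform_within_open[OF _ zS(2) that]) (simp add: fk)
  qed
  have f1: "deriv f z = k z" using df[OF zS(1)] by simp
  then show "deriv f z \<noteq> 0" using kz by simp
  have "deriv (deriv f) z = 2 * deriv k z"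
  proof (rule DERIV_imp_deriv)
    have "((\<lambda>u. k u + (u - z) * deriv k u) has_field_derivative 2 * deriv k z) (at z)"
      using dk[OF zS(1)] holomorphic_derivI[OF holomorphic_deriv[OF holk zS(2)] zS(2,1)]
      by (auto intro!: derivative_eq_intros)
    then show "(deriv f has_field_derivative 2 * deriv k z) (at z)"
      by (rule has_field_derivative_transform_within_open[OF _ zS(2,1)]) (simp add: df)
  qed
  moreover have "deriv k z = k z * (deriv h z + (\<Sum>\<rho>\<in>zeros R - {z}. of_nat (ord \<rho>) / (z - \<rho>)))"
  proof -
    have dh: "(h has_field_derivative deriv h z) (at z)"
      using holomorphic_derivI[OF h(1)] R by auto
    have fac: "((\<lambda>u. (1 - u / \<rho>) ^ ord \<rho>) has_field_derivative
        (1 - z / \<rho>) ^ ord \<rho> * (of_nat (ord \<rho>) / (z - \<rho>))) (at z)" if "\<rho> \<in> zeros R - {z}" for \<rho>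
    proof -
      have \<rho>: "\<rho> \<noteq> 0" "z \<noteq> \<rho>" using that r0 by auto
      then have nz: "1 - z / \<rho> \<noteq> 0" by (auto simp: field_simps)
      have "ord \<rho> \<ge> 1" using ord_pos[of \<rho>] that by (simp add: zeros_def)
      then obtain n where n: "ord \<rho> = Suc n" by (cases "ord \<rho>") auto
      have "of_nat (Suc n) * (- (1 / \<rho>) * (1 - z / \<rho>) ^ n) = (1 - z / \<rho>) ^ Suc n * (of_nat (Suc n) / (z - \<rho>))"
        using \<rho> nz by (simp add: field_simps)
      then show ?thesis unfolding n
        using \<rho> by (auto intro!: derivative_eq_intros simp del: power_Suc of_nat_Suc)
    qed
    define q where "q u = (\<Prod>\<rho>\<in>zeros R - {z}. (1 - u / \<rho>) ^ ord \<rho>)" for u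
    have "(q has_field_derivative q z * (\<Sum>\<rho>\<in>zeros R - {z}. of_nat (ord \<rho>) / (z - \<rho>))) (at z)"
    proof -
      have nz: "(1 - z / \<rho>) ^ ord \<rho> \<noteq> 0" if "\<rho> \<in> zeros R - {z}" for \<rho>
        using that r0[of \<rho>] by (auto simp: field_simps)
      have "(q has_field_derivative (\<Sum>\<rho>\<in>zeros R - {z}. (1 - z / \<rho>) ^ ord \<rho> * (of_nat (ord \<rho>) / (z - \<rho>)) *
           (\<Prod>\<sigma>\<in>zeros R - {z} - {\<rho>}. (1 - z / \<sigma>) ^ ord \<sigma>))) (at z)"
        unfolding q_def using fac by (rule has_field_derivative_prod)
      also have "(\<Sum>\<rho>\<in>zeros R - {z}. (1 - z / \<rho>) ^ ord \<rho> * (of_nat (ord \<rho>) / (z - \<rho>)) *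
           (\<Prod>\<sigma>\<in>zeros R - {z} - {\<rho>}. (1 - z / \<sigma>) ^ ord \<sigma>)) = q z * (\<Sum>\<rho>\<in>zeros R - {z}. of_nat (ord \<rho>) / (z - \<rho>))"
        unfolding sum_distrib_left
      proof (rule sum.cong)
        fix \<rho> assume \<rho>: "\<rho> \<in> zeros R - {z}"
        have "q z = (1 - z / \<rho>) ^ ord \<rho> * (\<Prod>\<sigma>\<in>zeros R - {z} - {\<rho>}. (1 - z / \<sigma>) ^ ord \<sigma>)"
          unfolding q_def using \<rho> finite_zeros by (intro prod.remove) auto
        then show "(1 - z / \<rho>) ^ ord \<rho> * (of_nat (ord \<rho>) / (z - \<rho>)) *
           (\<Prod>\<sigma>\<in>zeros R - {z} - {\<rho>}. (1 - z / \<sigma>) ^ ord \<sigma>) = q z * (of_nat (ord \<rho>) / (z - \<rho>))"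
          by simp
      qed auto
      finally show ?thesis .
    qed
    then have "((\<lambda>u. - f 0 / z * exp (h u) * q u) has_field_derivative
       k z * (deriv h z + (\<Sum>\<rho>\<in>zeros R - {z}. of_nat (ord \<rho>) / (z - \<rho>)))) (at z)"
      using dh z0 by (auto intro!: derivative_eq_intros simp: k_def q_def[symmetric] field_simps)
    then show ?thesis unfolding k_def q_def by (rule DERIV_imp_deriv)
  qed
  ultimately show "deriv (deriv f) z / deriv f z = 2 * (deriv h z + (\<Sum>\<rho>\<in>zeros R - {z}. of_nat (ord \<rho>) / (z - \<rho>)))"
    using f1 kz by simp
qed

text \<open>The downward pull on a zero at height \<open>y\<close> by a conjugate pair at heights \<open>\<plusminus> B\<close> and horizontal distance \<open>d\<close>.  The pull is
  weakest when the pair is as high as \<open>y\<close> itself, which gives the kernel in the definition of \<open>G\<close>.\<close>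
lemma repulsion_pair:
  fixes d B y :: real
  assumes "\<bar>B\<bar> \<le> y" "y > 0"
  shows "(y - B) / (d\<^sup>2 + (y - B)\<^sup>2) + (y + B) / (d\<^sup>2 + (y + B)\<^sup>2) \<ge> 2 * y / (d\<^sup>2 + 4 * y\<^sup>2)"
proof -
  have 1: "p / (d\<^sup>2 + 4 * y\<^sup>2) \<le> p / (d\<^sup>2 + p\<^sup>2)" if "0 \<le> p" "p \<le> 2 * y" for p
  proof (cases "p = 0")
    case False
    have "p\<^sup>2 \<le> (2 * y)\<^sup>2" using that by (intro power_mono) auto
    then show ?thesis using that False assms
      by (intro divide_left_mono) (auto simp: power_mult_distrib intro!: mult_pos_pos add_nonneg_pos)
  qed auto
  have "(y - B) / (d\<^sup>2 + 4 * y\<^sup>2) + (y + B) / (d\<^sup>2 + 4 * y\<^sup>2) = 2 * y / (d\<^sup>2 + 4 * y\<^sup>2)"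
    by (simp add: add_divide_distrib[symmetric])
  moreover have "0 \<le> y - B" "y - B \<le> 2 * y" "0 \<le> y + B" "y + B \<le> 2 * y" using assms by auto
  ultimately show ?thesis using 1[of "y - B"] 1[of "y + B"] by linarith
qed

text \<open>The first term is the attraction by \<open>cnj z\<close>; every other conjugate pair pulls down with at least \<open>2 y\<close> times its two terms in \<open>G\<close>
  (\<open>repulsion_pair\<close>), and the maximality of the height is what makes all these contributions point downwards.\<close>
theorem zero_velocity:
  "deriv f z \<noteq> 0"
  "Im (deriv (deriv f) z / deriv f z) \<le> - 1 / Im z - 2 * Im z * infsum (G_term z) (others z)"
proof -
  define y where "y = Im z"
  define Gz where "Gz = infsum (G_term z) (others z)"
  show "deriv f z \<noteq> 0"
  proof -
    obtain R where R: "\<forall>R'\<ge>R. R' > norm z \<and> (\<exists>h. h holomorphic_on ball 0 R' \<and> (\<forall>u\<in>ball 0 R'. f u = f 0 * exp (h u) * zprod R' u) \<and>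
           (\<forall>w. norm w \<le> norm z \<longrightarrow> norm (h w) \<le> 1 \<and> norm (deriv h w) \<le> 1))"
      using product_approx[of 1 "norm z", OF zero_less_one] by (elim exE)
    then obtain h where "R > norm z" "h holomorphic_on ball 0 R" "\<forall>u\<in>ball 0 R. f u = f 0 * exp (h u) * zprod R u"
      by blast
    then show ?thesis by (intro log_deriv_formula(1)[of R h]) auto
  qed
  show "Im (deriv (deriv f) z / deriv f z) \<le> - 1 / Im z - 2 * Im z * infsum (G_term z) (others z)"
  proof (rule field_le_epsilon)
    fix e :: real assume e: "e > 0"
    \<comment> \<open>the errors are \<open>2 e'\<close> from \<open>h'\<close> and \<open>2 y e'\<close> from truncating \<open>G\<close>\<close>
    define e' where "e' = e / (2 + 2 * y)"
    have e': "e' > 0" using e z by (auto simp: e'_def y_def)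
    have "(G_term z has_sum Gz) (others z)" unfolding Gz_def using G_summable by (rule has_sum_infsum)
    then have "\<forall>\<^sub>F F in finite_subsets_at_top (others z). sum (G_term z) F > Gz - e'"
      unfolding has_sum_def using e' by (intro order_tendstoD) auto
    then obtain F where F: "finite F" "F \<subseteq> others z" "sum (G_term z) F > Gz - e'"
      unfolding eventually_finite_subsets_at_top by blast
    obtain R0 where R0: "\<forall>R\<ge>R0. R > norm z \<and> (\<exists>h. h holomorphic_on ball 0 R \<and> (\<forall>u\<in>ball 0 R. f u = f 0 * exp (h u) * zprod R u) \<and>
           (\<forall>w. norm w \<le> norm z \<longrightarrow> norm (h w) \<le> e' \<and> norm (deriv h w) \<le> e'))"
      using product_approx[OF e', of "norm z"] by blast
    define R where "R = max R0 (\<Sum>\<rho>\<in>F. norm \<rho>)"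
    obtain h where R: "R > norm z" and h: "h holomorphic_on ball 0 R" "\<And>u. norm u < R \<Longrightarrow> f u = f 0 * exp (h u) * zprod R u"
      "norm (deriv h z) \<le> e'"
    proof -
      have "R0 \<le> R" by (simp add: R_def)
      then obtain h where "R > norm z" "h holomorphic_on ball 0 R" "\<forall>u\<in>ball 0 R. f u = f 0 * exp (h u) * zprod R u"
         "\<forall>w. norm w \<le> norm z \<longrightarrow> norm (h w) \<le> e' \<and> norm (deriv h w) \<le> e'"
        using R0 by blast
      then show ?thesis by (intro that[of h]) auto
    qed
    have zZ: "z \<in> zeros R" "cnj z \<in> zeros R" using R z real[of z] by (auto simp: zeros_def)
    have ne: "z \<noteq> cnj z" using z by (auto simp: complex_eq_iff)
    define Z' where "Z' = zeros R - {z, cnj z}"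
    have "F \<subseteq> Z'"
    proof
      fix \<rho> assume "\<rho> \<in> F"
      then have "norm \<rho> \<le> (\<Sum>\<rho>\<in>F. norm \<rho>)" using F by (intro member_le_sum) auto
      then show "\<rho> \<in> Z'" using F \<open>\<rho> \<in> F\<close> by (auto simp: zeros_def R_def others_def Z'_def)
    qed
    then have "sum (G_term z) F \<le> sum (G_term z) Z'"
      using finite_zeros by (intro sum_mono2) (auto simp: G_term_nonneg Z'_def)
    then have GZ': "sum (G_term z) Z' > Gz - e'" using F by linarith
    \<comment> \<open>the vertical component of the force exerted by \<open>\<rho>\<close>\<close>
    define p where "p \<rho> = (y - Im \<rho>) / ((Re z - Re \<rho>)\<^sup>2 + (y - Im \<rho>)\<^sup>2)" for \<rho>
    have Imp: "Im (of_nat (ord \<rho>) / (z - \<rho>)) = - (real (ord \<rho>) * p \<rho>)" for \<rho>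
      by (simp add: p_def y_def Im_divide cmod_power2 power2_eq_square)
    have bij: "bij_betw cnj Z' Z'"
      by (rule bij_betwI[where g = cnj]) (auto simp: zeros_def real Z'_def)
    have "(\<Sum>\<rho>\<in>Z'. real (ord \<rho>) * p \<rho>) = (\<Sum>\<rho>\<in>Z'. real (ord \<rho>) * p (cnj \<rho>))"
      using sum.reindex_bij_betw[OF bij, of "\<lambda>\<rho>. real (ord \<rho>) * p \<rho>"] by (simp add: ord_cnj)
    then have "2 * (\<Sum>\<rho>\<in>Z'. real (ord \<rho>) * p \<rho>) = (\<Sum>\<rho>\<in>Z'. real (ord \<rho>) * (p \<rho> + p (cnj \<rho>)))"
      by (simp add: distrib_left sum.distrib)
    also have "\<dots> \<ge> (\<Sum>\<rho>\<in>Z'. 2 * y * G_term z \<rho>)"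
    proof (rule sum_mono)
      fix \<rho> assume "\<rho> \<in> Z'"
      then have B: "\<bar>Im \<rho>\<bar> \<le> y" using strip by (auto simp: zeros_def Z'_def y_def)
      have "2 * y * G_term z \<rho> = real (ord \<rho>) * (2 * y / ((Re z - Re \<rho>)\<^sup>2 + 4 * y\<^sup>2))"
        by (simp add: G_term_def y_def power2_commute)
      also have "\<dots> \<le> real (ord \<rho>) * (p \<rho> + p (cnj \<rho>))"
        using repulsion_pair[OF B, of "Re z - Re \<rho>"] z by (intro mult_left_mono) (auto simp: p_def y_def)
      finally show "2 * y * G_term z \<rho> \<le> real (ord \<rho>) * (p \<rho> + p (cnj \<rho>))" .
    qed
    finally have pZ': "(\<Sum>\<rho>\<in>Z'. real (ord \<rho>) * p \<rho>) \<ge> y * sum (G_term z) Z'"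
      by (simp add: sum_distrib_left[symmetric])
    have "zeros R - {z} = insert (cnj z) Z'" using zZ ne by (auto simp: Z'_def)
    then have "(\<Sum>\<rho>\<in>zeros R - {z}. real (ord \<rho>) * p \<rho>) = p (cnj z) + (\<Sum>\<rho>\<in>Z'. real (ord \<rho>) * p \<rho>)"
      using finite_zeros simple by (simp add: Z'_def ord_cnj)
    also have "p (cnj z) = 1 / (2 * y)"
      using z by (simp add: p_def y_def power2_eq_square)
    finally have S0: "(\<Sum>\<rho>\<in>zeros R - {z}. real (ord \<rho>) * p \<rho>) = 1 / (2 * y) + (\<Sum>\<rho>\<in>Z'. real (ord \<rho>) * p \<rho>)" .
    have S: "(\<Sum>\<rho>\<in>zeros R - {z}. real (ord \<rho>) * p \<rho>) \<ge> 1 / (2 * y) + y * (Gz - e')"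
    proof -
      have "y * (Gz - e') \<le> y * sum (G_term z) Z'"
        using GZ' z by (intro mult_left_mono) (auto simp: y_def)
      then show ?thesis using S0 pZ' by linarith
    qed
    have "Im (deriv (deriv f) z / deriv f z) = 2 * (Im (deriv h z) - (\<Sum>\<rho>\<in>zeros R - {z}. real (ord \<rho>) * p \<rho>))"
      using log_deriv_formula(2)[OF R h(1,2)] by (simp add: Imp sum_negf)
    also have "\<dots> \<le> 2 * (e' - (1 / (2 * y) + y * (Gz - e')))"
      using S h(3) abs_Im_le_cmod[of "deriv h z"] by (intro mult_left_mono) auto
    also have "\<dots> = - 1 / y - 2 * y * Gz + e' * (2 + 2 * y)"
      by (simp add: algebra_simps)
    also have "e' * (2 + 2 * y) = e" using z by (simp add: e'_def y_def)
    finally show "Im (deriv (deriv f) z / deriv f z) \<le> - 1 / Im z - 2 * Im z * infsum (G_term z) (others z) + e"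
      by (simp add: y_def Gz_def)
  qed
qed

end

end

section \<open>Gaussian integrals and the inversion formula for the theta series\<close>

text \<open>Reduction to the characteristic function of the standard normal distribution.\<close>
lemma gauss_fourier:
  fixes a q :: real
  assumes a: "a > 0"
  shows "integrable lborel (\<lambda>w. of_real (exp (- a * w\<^sup>2)) * exp (\<i> * of_real (q * w)))"
    and "(LINT w|lborel. of_real (exp (- a * w\<^sup>2)) * exp (\<i> * of_real (q * w))) = of_real (sqrt (pi / a) * exp (- (q\<^sup>2) / (4 * a)))"
proof -
  define s where "s = sqrt (2 * a)"
  have s: "s > 0" "s\<^sup>2 = 2 * a" using a by (auto simp: s_def)
  define t where "t = q / s"
  define g where "g x = of_real (std_normal_density x) * exp (\<i> * of_real (t * x))" for x
  have g1: "integrable lborel g"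
  proof (rule Bochner_Integration.integrable_bound)
    show "integrable lborel (\<lambda>x. std_normal_density x)" by simp
    show "g \<in> borel_measurable lborel" unfolding g_def by measurable
    show "AE x in lborel. norm (g x) \<le> norm (std_normal_density x)"
      by (simp add: g_def norm_mult)
  qed
  have "char std_normal_distribution t = (LINT x|lborel. std_normal_density x *\<^sub>R exp (\<i> * of_real (t * x)))"
    unfolding char_def by (subst integral_density) (auto simp: normal_density_nonneg)
  then have g2: "(LINT x|lborel. g x) = of_real (exp (- (t\<^sup>2) / 2))"
    unfolding char_std_normal_distribution g_def by (simp add: scaleR_conv_of_real)
  have eq: "g (0 + s * w) = of_real (1 / sqrt (2 * pi)) * (of_real (exp (- a * w\<^sup>2)) * exp (\<i> * of_real (q * w)))" for w
    using s by (simp add: g_def std_normal_density_def t_def power_mult_distrib)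
  have "integrable lborel (\<lambda>w. g (0 + s * w))"
    using g1 s by (intro lborel_integrable_real_affine) auto
  then show "integrable lborel (\<lambda>w. of_real (exp (- a * w\<^sup>2)) * exp (\<i> * of_real (q * w)))"
  proof -
    assume "integrable lborel (\<lambda>w. g (0 + s * w))"
    then have "integrable lborel (\<lambda>w. of_real (sqrt (2 * pi)) * g (0 + s * w))"
      by (intro integrable_mult_right)
    moreover have "of_real (sqrt (2 * pi)) * g (0 + s * w) = of_real (exp (- a * w\<^sup>2)) * exp (\<i> * of_real (q * w))" for w
      unfolding eq mult.assoc[symmetric] of_real_mult[symmetric] by simp
    ultimately show ?thesis by simp
  qed
  have "of_real (exp (- (t\<^sup>2) / 2)) = \<bar>s\<bar> *\<^sub>R (LINT w|lborel. g (0 + s * w))"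
    unfolding g2[symmetric] using s by (intro lborel_integral_real_affine) auto
  also have "\<dots> = of_real (s / sqrt (2 * pi)) * (LINT w|lborel. of_real (exp (- a * w\<^sup>2)) * exp (\<i> * of_real (q * w)))"
    unfolding eq using s by (simp add: scaleR_conv_of_real)
  finally have "(LINT w|lborel. of_real (exp (- a * w\<^sup>2)) * exp (\<i> * of_real (q * w))) =
      of_real (exp (- (t\<^sup>2) / 2)) / of_real (s / sqrt (2 * pi))"
    using s by (simp add: field_simps)
  also have "t\<^sup>2 / 2 = q\<^sup>2 / (4 * a)" using s by (simp add: t_def power_divide)
  moreover have "1 / (s / sqrt (2 * pi)) = sqrt (pi / a)"
    using a by (simp add: s_def real_sqrt_mult real_sqrt_divide)
  ultimately show "(LINT w|lborel. of_real (exp (- a * w\<^sup>2)) * exp (\<i> * of_real (q * w))) = of_real (sqrt (pi / a) * exp (- (q\<^sup>2) / (4 * a)))"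
    by (metis (no_types, lifting) minus_divide_left mult.commute mult_1 of_real_divide times_divide_eq_left)
qed

text \<open>Completing the square in the real part of \<open>b\<close> leaves a Fourier integral.\<close>
lemma gauss_integral:
  fixes a :: real and b :: complex
  assumes a: "a > 0"
  shows "integrable lborel (\<lambda>v. exp (of_real (- a * v\<^sup>2) + b * of_real v))"
    and "(LINT v|lborel. exp (of_real (- a * v\<^sup>2) + b * of_real v)) = of_real (sqrt (pi / a)) * exp (b\<^sup>2 / of_real (4 * a))"
proof -
  define p q where "p = Re b" and "q = Im b"
  have b: "b = of_real p + \<i> * of_real q" by (simp add: p_def q_def complex_eq_iff)
  define g where "g v = exp (of_real (- a * v\<^sup>2) + b * of_real v)" for v
  define K where "K = exp (of_real (p\<^sup>2 / (4 * a)) + \<i> * of_real (q * p / (2 * a)))"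
  have eq: "g (p / (2 * a) + 1 * w) = K * (of_real (exp (- a * w\<^sup>2)) * exp (\<i> * of_real (q * w)))" for w
  proof -
    have "of_real (- a * (p / (2 * a) + w)\<^sup>2) + b * of_real (p / (2 * a) + w) =
      of_real (p\<^sup>2 / (4 * a)) + \<i> * of_real (q * p / (2 * a)) + (of_real (- a * w\<^sup>2) + \<i> * of_real (q * w))"
      unfolding b using a by (simp add: complex_eq_iff power2_eq_square field_simps)
    then show ?thesis unfolding g_def K_def mult_1 exp_of_real[symmetric] exp_add[symmetric] by simp
  qed
  have "integrable lborel (\<lambda>w. g (p / (2 * a) + 1 * w))"
    unfolding eq using gauss_fourier(1)[OF a, of q] by simp
  then show "integrable lborel (\<lambda>v. exp (of_real (- a * v\<^sup>2) + b * of_real v))"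
    using lborel_integrable_real_affine_iff[of 1 g "p / (2 * a)"] unfolding g_def[abs_def] by simp
  have "(LINT v|lborel. g v) = \<bar>1\<bar> *\<^sub>R (LINT w|lborel. g (p / (2 * a) + 1 * w))"
    by (rule lborel_integral_real_affine) auto
  also have "\<dots> = K * of_real (sqrt (pi / a) * exp (- (q\<^sup>2) / (4 * a)))"
    unfolding eq using gauss_fourier[OF a, of q] by simp
  also have "\<dots> = of_real (sqrt (pi / a)) * (K * exp (of_real (- (q\<^sup>2) / (4 * a))))"
    by (simp add: mult_ac flip: exp_of_real)
  also have "K * exp (of_real (- (q\<^sup>2) / (4 * a))) = exp (b\<^sup>2 / of_real (4 * a))"
    unfolding K_def exp_add[symmetric]
    by (rule arg_cong[where f = exp]) (use a in \<open>simp add: b complex_eq_iff power2_eq_square field_simps\<close>)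
  finally show "(LINT v|lborel. exp (of_real (- a * v\<^sup>2) + b * of_real v)) = of_real (sqrt (pi / a)) * exp (b\<^sup>2 / of_real (4 * a))"
    by (simp add: g_def)
qed

lemma gauss_integral_real:
  fixes a b :: real
  assumes a: "a > 0"
  shows "integrable lborel (\<lambda>v. exp (- a * v\<^sup>2 + b * v))"
    and "(LINT v|lborel. exp (- a * v\<^sup>2 + b * v)) = sqrt (pi / a) * exp (b\<^sup>2 / (4 * a))"
proof -
  have eq: "exp (of_real (- a * v\<^sup>2) + of_real b * of_real v) = complex_of_real (exp (- a * v\<^sup>2 + b * v))" for v
    by (simp flip: exp_of_real)
  have i: "integrable lborel (\<lambda>v. complex_of_real (exp (- a * v\<^sup>2 + b * v)))"
    using gauss_integral(1)[OF a, of "of_real b"] unfolding eq .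
  then show "integrable lborel (\<lambda>v. exp (- a * v\<^sup>2 + b * v))"
    using integrable_Re by fastforce
  have "complex_of_real (LINT v|lborel. exp (- a * v\<^sup>2 + b * v)) = of_real (sqrt (pi / a) * exp (b\<^sup>2 / (4 * a)))"
  proof -
    have "exp ((complex_of_real b)\<^sup>2 / complex_of_real (4 * a)) = of_real (exp (b\<^sup>2 / (4 * a)))"
      by (simp flip: exp_of_real)
    then show ?thesis
      using gauss_integral(2)[OF a, of "of_real b"] unfolding eq by (simp add: integral_complex_of_real)
  qed
  then show "(LINT v|lborel. exp (- a * v\<^sup>2 + b * v)) = sqrt (pi / a) * exp (b\<^sup>2 / (4 * a))"
    using of_real_eq_iff by blast
qed

text \<open>A translation by half a period, \<open>1 / (2 k)\<close>, changes the sign of the exponential.  So the integral is at most half the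
  \<open>L\<^sup>1\<close>-distance between \<open>H\<close> and its translate, which tends to 0 by dominated convergence.\<close>
lemma riemann_lebesgue:
  fixes H :: "real \<Rightarrow> complex" and s :: real
  assumes [measurable]: "H \<in> borel_measurable borel"
    and bd: "\<And>x. norm (H x) \<le> B" and supp: "\<And>x. x \<notin> {0..1} \<Longrightarrow> H x = 0"
    and cont: "AE x in lborel. isCont H x" and s: "s = 1 \<or> s = -1"
  shows "(\<lambda>k. LINT x|lborel. H x * exp (\<i> * of_real (2 * pi * s * real k * x))) \<longlonglongrightarrow> 0"
proof (rule Lim_null_comparison)
  have B: "B \<ge> 0" using bd[of 0] norm_ge_zero[of "H 0"] by linarith
  have int: "integrable lborel (\<lambda>x::real. B * indicator {- 1..1} x :: real)" for B
    by (intro integrable_mult_right integrable_real_indicator) auto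
  have iH: "integrable lborel (\<lambda>x. H (\<delta> + 1 * x) * exp (\<i> * of_real (c * x + d)))" if "0 \<le> \<delta>" "\<delta> \<le> 1" for \<delta> c d :: real
    by (rule Bochner_Integration.integrable_bound[OF int[of B]])
       (use bd supp B that in \<open>auto intro!: AE_I2 simp: norm_mult split: split_indicator\<close>)
  define e where "e k = (LINT x|lborel. norm (H x - H (1 / (2 * real k) + 1 * x)))" for k :: nat
  have "e \<longlonglongrightarrow> (LINT (x::real)|lborel. 0)"
    unfolding e_def
  proof (rule integral_dominated_convergence[where w = "\<lambda>x. 2 * B * indicator {- 1..1} x"])
    show "AE x in lborel. (\<lambda>k. norm (H x - H (1 / (2 * real k) + 1 * x))) \<longlonglongrightarrow> 0"
      using cont
    proof eventually_elim
      case (elim x)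
      have "(\<lambda>k. 1 / (2 * real k) + 1 * x) \<longlonglongrightarrow> x" by real_asymp
      then have "(\<lambda>k. H (1 / (2 * real k) + 1 * x)) \<longlonglongrightarrow> H x"
        using elim by (rule isCont_tendsto_compose[rotated])
      then have "(\<lambda>k. norm (H x - H (1 / (2 * real k) + 1 * x))) \<longlonglongrightarrow> norm (H x - H x)"
        by (intro tendsto_intros)
      then show ?case by simp
    qed
    show "AE x in lborel. norm (norm (H x - H (1 / (2 * real k) + 1 * x))) \<le> 2 * B * indicator {- 1..1} x" for k
    proof (rule AE_I2)
      fix x :: real
      have k: "0 \<le> 1 / (2 * real k)" "1 / (2 * real k) \<le> 1" by (cases "k = 0"; simp add: field_simps)+
      show "norm (norm (H x - H (1 / (2 * real k) + 1 * x))) \<le> 2 * B * indicator {- 1..1} x"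
      proof (cases "x \<in> {-1..1}")
        case True
        then show ?thesis
          using norm_triangle_ineq4[of "H x" "H (1 / (2 * real k) + 1 * x)"] bd[of x] bd[of "1 / (2 * real k) + 1 * x"] by simp
      next
        case False
        then have "x \<notin> {0..1}" "1 / (2 * real k) + 1 * x \<notin> {0..1}"
          using k unfolding atLeastAtMost_iff by linarith+
        then show ?thesis using supp B by simp
      qed
    qed
  qed (auto simp: int)
  then show "(\<lambda>k. e k / 2) \<longlonglongrightarrow> 0" by (auto intro!: tendsto_eq_intros)
  show "\<forall>\<^sub>F k in sequentially. norm (LINT x|lborel. H x * exp (\<i> * of_real (2 * pi * s * real k * x))) \<le> e k / 2"
  proof (rule eventually_mono[OF eventually_gt_at_top[of 0]])
    fix k :: nat assume k: "k > 0"
    define E where "E x = exp (\<i> * of_real (2 * pi * s * real k * x))" for x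
    define J where "J = (LINT x|lborel. H x * E x)"
    define \<delta> where "\<delta> = 1 / (2 * real k)"
    have \<delta>: "0 \<le> \<delta>" "\<delta> \<le> 1" using k by (auto simp: \<delta>_def field_simps)
    have "E (\<delta> + 1 * x) = - E x" for x
    proof -
      have "E (\<delta> + 1 * x) = exp (\<i> * of_real (pi * s)) * E x"
        unfolding E_def exp_add[symmetric]
        by (rule arg_cong[where f = exp]) (use k in \<open>simp add: \<delta>_def field_simps\<close>)
      moreover have "exp (\<i> * of_real (pi * s)) = - 1"
        using s by (auto simp: exp_minus mult.commute)
      ultimately show ?thesis by simp
    qed
    note E = this
    have i1: "integrable lborel (\<lambda>x. H x * E x)" using iH[of 0 "2 * pi * s * real k" 0] by (simp add: E_def)
    have i2: "integrable lborel (\<lambda>x. H (\<delta> + 1 * x) * E x)" using iH[OF \<delta>, of "2 * pi * s * real k" 0] by (simp add: E_def)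
    have "J = \<bar>1\<bar> *\<^sub>R (LINT x|lborel. H (\<delta> + 1 * x) * E (\<delta> + 1 * x))"
      unfolding J_def by (rule lborel_integral_real_affine) auto
    also have "\<dots> = - (LINT x|lborel. H (\<delta> + 1 * x) * E x)" unfolding E by simp
    finally have "2 * J = J - (LINT x|lborel. H (\<delta> + 1 * x) * E x)" by simp
    also have "\<dots> = (LINT x|lborel. (H x - H (\<delta> + 1 * x)) * E x)"
      unfolding J_def using i1 i2 by (simp add: left_diff_distrib)
    also have "norm \<dots> \<le> (LINT x|lborel. norm ((H x - H (\<delta> + 1 * x)) * E x))"
      by (rule integral_norm_bound)
    also have "\<dots> = e k" by (simp add: e_def \<delta>_def E_def norm_mult)
    finally show "norm (LINT x|lborel. H x * exp (\<i> * of_real (2 * pi * s * real k * x))) \<le> e k / 2"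
      by (simp add: J_def E_def norm_mult)
  qed
qed

lemma sum_int_symmetric:
  fixes g :: "int \<Rightarrow> 'a :: comm_monoid_add"
  shows "(\<Sum>n\<in>{- int N..int N}. g n) = g 0 + (\<Sum>k<N. g (int (Suc k)) + g (- int (Suc k)))"
proof (induction N)
  case (Suc N)
  have "{- int (Suc N)..int (Suc N)} = insert (int (Suc N)) (insert (- int (Suc N)) {- int N..int N})"
    by auto
  then show ?case using Suc by (simp add: add_ac)
qed auto

lemma sum_indicator_floor:
  "(\<Sum>n\<in>{- int N..int N}. indicator {0..<1} (x - of_int n) :: real) = indicator {- real N..<real N + 1} x"
proof -
  have "indicator {0..<1} (x - of_int n) = (if n = \<lfloor>x\<rfloor> then 1 else 0 :: real)" for n
    by (auto simp: indicator_def) linarith+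
  then have "(\<Sum>n\<in>{- int N..int N}. indicator {0..<1} (x - of_int n) :: real) = (if \<lfloor>x\<rfloor> \<in> {- int N..int N} then 1 else 0)"
    by simp
  also have "\<dots> = indicator {- real N..<real N + 1} x"
    by (auto simp: indicator_def le_floor_iff floor_le_iff)
  finally show ?thesis .
qed

text \<open>Integrating the sum of integer translates over a unit interval is integrating over the line.\<close>
lemma periodize:
  fixes F :: "real \<Rightarrow> complex"
  assumes F: "integrable lborel F"
  shows "(\<lambda>N. LINT x|lborel. indicator {0..<1} x *\<^sub>R (\<Sum>n\<in>{- int N..int N}. F (x + of_int n))) \<longlonglongrightarrow> (LINT x|lborel. F x)"
proof -
  have [measurable]: "F \<in> borel_measurable borel" using F by simp
  have iF: "integrable lborel (\<lambda>x. indicator A x *\<^sub>R F x)" if "A \<in> sets borel" for A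
    using F that by (intro integrable_mult_indicator) auto
  have shift: "integrable lborel (\<lambda>x. indicator {0..<1} x *\<^sub>R F (x + of_int n))"
    "(LINT x|lborel. indicator {0..<1} x *\<^sub>R F (x + of_int n)) = (LINT x|lborel. indicator {0..<1} (x - of_int n) *\<^sub>R F x)" for n
  proof -
    have i: "integrable lborel (\<lambda>x. indicator {of_int n..<of_int n + 1} x *\<^sub>R F x)" by (rule iF) auto
    have e: "indicator {of_int n..<of_int n + 1} (of_int n + 1 * x) = (indicator {0..<1} x :: real)"
            "indicator {of_int n..<of_int n + 1} x = (indicator {0..<1} (x - of_int n) :: real)" for x :: real
      by (auto simp: indicator_def)
    show "integrable lborel (\<lambda>x. indicator {0..<1} x *\<^sub>R F (x + of_int n))"
      using lborel_integrable_real_affine[OF i, of 1 "of_int n"] unfolding e by (simp add: add.commute)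
    have "(LINT x|lborel. indicator {of_int n..<of_int n + 1} x *\<^sub>R F x) = \<bar>1\<bar> *\<^sub>R
       (LINT x|lborel. indicator {of_int n..<of_int n + 1} (of_int n + 1 * x) *\<^sub>R F (of_int n + 1 * x))"
      by (rule lborel_integral_real_affine) auto
    then show "(LINT x|lborel. indicator {0..<1} x *\<^sub>R F (x + of_int n)) = (LINT x|lborel. indicator {0..<1} (x - of_int n) *\<^sub>R F x)"
      unfolding e by (simp add: add.commute)
  qed
  have "(LINT x|lborel. indicator {0..<1} x *\<^sub>R (\<Sum>n\<in>{- int N..int N}. F (x + of_int n))) =
        (LINT x|lborel. indicator {- real N..<real N + 1} x *\<^sub>R F x)" for N
  proof -
    have "(LINT x|lborel. indicator {0..<1} x *\<^sub>R (\<Sum>n\<in>{- int N..int N}. F (x + of_int n))) =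
       (\<Sum>n\<in>{- int N..int N}. LINT x|lborel. indicator {0..<1} (x - of_int n) *\<^sub>R F x)"
      unfolding scaleR_sum_right using shift by (subst Bochner_Integration.integral_sum) auto
    also have "\<dots> = (LINT x|lborel. (\<Sum>n\<in>{- int N..int N}. indicator {0..<1} (x - of_int n) *\<^sub>R F x))"
    proof (rule Bochner_Integration.integral_sum[symmetric])
      fix n :: int
      have "integrable lborel (\<lambda>x. indicator {of_int n..<of_int n + 1} x *\<^sub>R F x)" by (rule iF) auto
      also have "(\<lambda>x. indicator {of_int n..<of_int n + 1} x *\<^sub>R F x) = (\<lambda>x. indicator {0..<1} (x - of_int n) *\<^sub>R F x)"
        by (rule ext) (auto simp: indicator_def algebra_simps)
      finally show "integrable lborel (\<lambda>x. indicator {0..<1} (x - of_int n) *\<^sub>R F x)" .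
    qed
    also have "\<dots> = (LINT x|lborel. indicator {- real N..<real N + 1} x *\<^sub>R F x)"
      by (simp add: scaleR_sum_left[symmetric] sum_indicator_floor)
    finally show ?thesis .
  qed
  moreover have "(\<lambda>N. LINT x|lborel. indicator {- real N..<real N + 1} x *\<^sub>R F x) \<longlonglongrightarrow> (LINT x|lborel. F x)"
  proof (rule integral_dominated_convergence[where w = "\<lambda>x. norm (F x)"])
    show "AE x in lborel. (\<lambda>N. indicator {- real N..<real N + 1} x *\<^sub>R F x) \<longlonglongrightarrow> F x"
    proof (rule AE_I2)
      fix x :: real
      have "\<forall>\<^sub>F N in sequentially. indicator {- real N..<real N + 1} x *\<^sub>R F x = F x"
      proof (rule eventually_mono[OF eventually_ge_at_top[of "nat \<lceil>\<bar>x\<bar>\<rceil>"]])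
        fix N assume "N \<ge> nat \<lceil>\<bar>x\<bar>\<rceil>"
        then have "\<bar>x\<bar> \<le> real N" by linarith
        then show "indicator {- real N..<real N + 1} x *\<^sub>R F x = F x" by (auto simp: indicator_def)
      qed
      then show "(\<lambda>N. indicator {- real N..<real N + 1} x *\<^sub>R F x) \<longlonglongrightarrow> F x"
        by (rule tendsto_eventually)
    qed
  qed (use F in \<open>auto split: split_indicator\<close>)
  ultimately show ?thesis by simp
qed

text \<open>The exponent 4 covers the theta series, its derivatives and the series of \<open>Phi\<close>.\<close>
lemma summable_poly_exp_square:
  fixes b :: real
  assumes b: "b > 0" and j: "j \<le> 4"
  shows "summable (\<lambda>k. real (Suc k) ^ j * exp (- b * (real (Suc k))\<^sup>2))"
proof -
  have "(\<lambda>k. real (Suc k) ^ 4 * exp (- b * (real (Suc k))\<^sup>2)) \<in> O(\<lambda>k. 1 / real k ^ 2)"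
    using b by real_asymp
  moreover have "summable (\<lambda>k. norm (1 / real k ^ 2))"
    using inverse_power_summable[of 2, where ?'a = real] by (simp add: field_simps)
  ultimately have s: "summable (\<lambda>k. real (Suc k) ^ 4 * exp (- b * (real (Suc k))\<^sup>2))"
    by (rule summable_comparison_test_bigo[rotated])
  show ?thesis
  proof (rule summable_comparison_test'[OF s])
    fix k :: nat
    have "real (Suc k) ^ j \<le> real (Suc k) ^ 4" using j by (intro power_increasing) auto
    then show "norm (real (Suc k) ^ j * exp (- b * (real (Suc k))\<^sup>2)) \<le> real (Suc k) ^ 4 * exp (- b * (real (Suc k))\<^sup>2)"
      by (simp add: mult_right_mono)
  qed
qed

lemma jordan_sin_bound:
  fixes x :: real
  assumes "0 \<le> x" "x \<le> 1 / 2"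
  shows "2 * x \<le> sin (pi * x)"
proof -
  have "convex_on {0..pi / 2} (\<lambda>x. - sin x)"
  proof (rule f''_ge0_imp_convex)
    show "((\<lambda>x. - sin x) has_real_derivative - cos x) (at x)" for x :: real
      by (auto intro!: derivative_eq_intros)
    show "((\<lambda>x. - cos x) has_real_derivative sin x) (at x)" for x :: real
      by (auto intro!: derivative_eq_intros)
    show "0 \<le> sin x" if "x \<in> {0..pi / 2}" for x :: real
      using that by (intro sin_ge_zero) auto
  qed auto
  then have "- sin ((1 - 2 * x) *\<^sub>R 0 + (2 * x) *\<^sub>R (pi / 2)) \<le> (1 - 2 * x) * - sin 0 + (2 * x) * - sin (pi / 2)"
    using assms by (intro convex_onD) auto
  then show ?thesis by (simp add: mult.commute)
qed

text \<open>Shows that \<open>exp (2 \<pi> \<i> x) - 1\<close> vanishes only to first order at both ends of \<open>[0, 1]\<close>, which is what the quotient in \<open>gs_poisson\<close> needs.\<close>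
lemma norm_exp_minus_one_ge:
  fixes x :: real
  assumes "0 \<le> x" "x \<le> 1"
  shows "norm (exp (\<i> * of_real (2 * pi * x)) - 1) \<ge> 4 * min x (1 - x)"
proof -
  have "sin (pi * x) \<ge> 2 * min x (1 - x)"
  proof (cases "x \<le> 1 / 2")
    case True
    then show ?thesis using jordan_sin_bound[of x] assms by simp
  next
    case False
    have "sin (pi * (1 - x)) = sin (pi * x)" by (simp add: right_diff_distrib sin_diff)
    then show ?thesis using jordan_sin_bound[of "1 - x"] assms False by simp
  qed
  moreover have "norm (exp (\<i> * of_real (2 * pi * x)) - 1) = 2 * \<bar>sin (pi * x)\<bar>"
  proof -
    have "exp (\<i> * of_real (2 * pi * x)) - 1 =
        exp (\<i> * of_real (pi * x)) * (exp (\<i> * of_real (pi * x)) - exp (- (\<i> * of_real (pi * x))))"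
      by (simp add: right_diff_distrib exp_add[symmetric] mult_ac)
    also have "exp (\<i> * of_real (pi * x)) - exp (- (\<i> * of_real (pi * x))) = 2 * \<i> * of_real (sin (pi * x))"
      by (simp add: sin_exp_eq field_simps flip: sin_of_real)
    finally show ?thesis by (simp add: norm_mult)
  qed
  ultimately show ?thesis by simp
qed

lemma fourier_unit:
  "(LINT x|lborel. indicator {0..<1} x *\<^sub>R exp (\<i> * of_real (2 * pi * of_int k * x))) = (if k = 0 then 1 else 0)"
proof -
  define E where "E x = exp (\<i> * of_real (2 * pi * of_int k * x))" for x :: real
  have "(LINT x|lborel. indicator {0..<1} x *\<^sub>R E x) = (LINT x|lborel. indicator {0..1} x *\<^sub>R E x)"
  proof (rule integral_cong_AE)
    show "AE x in lborel. indicator {0..<1} x *\<^sub>R E x = indicator {0..1} x *\<^sub>R E x"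
      using AE_lborel_singleton[of "1::real"] by eventually_elim (auto simp: indicator_def)
  qed (auto simp: E_def)
  also have "\<dots> = (if k = 0 then 1 else 0)"
  proof (cases "k = 0")
    case True
    then show ?thesis using integral_FTC_atLeastAtMost[of 0 1 "\<lambda>x. of_real x" "\<lambda>x. 1 :: complex"]
      by (simp add: E_def has_vector_derivative_of_real)
  next
    case False
    define c where "c = \<i> * of_real (2 * pi * of_int k)"
    have c: "c \<noteq> 0" using False by (simp add: c_def)
    have E: "E x = exp (c * of_real x)" for x by (simp add: E_def c_def mult_ac)
    have "(LINT x|lborel. indicator {0..1} x *\<^sub>R E x) = exp (c * of_real 1) / c - exp (c * of_real 0) / c"
    proof (rule integral_FTC_atLeastAtMost)
      fix x :: real
      have "((\<lambda>z. exp (c * z) / c) has_field_derivative exp (c * of_real x)) (at (of_real x))"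
        using c by (auto intro!: derivative_eq_intros)
      then have "((\<lambda>z. exp (c * of_real z) / c) has_vector_derivative exp (c * of_real x)) (at x)"
        by (rule has_vector_derivative_real_field)
      then show "((\<lambda>x. exp (c * of_real x) / c) has_vector_derivative E x) (at x within {0..1})"
        unfolding E by (rule has_vector_derivative_at_within)
    qed (auto simp: E_def intro!: continuous_intros)
    moreover have "exp c = 1"
      unfolding c_def by (metis exp_two_pi_i' exp_integer_2pi Ints_of_int mult.assoc mult.commute of_real_mult of_real_of_int_eq of_real_numeral)
    ultimately show ?thesis using False by simp
  qed
  finally show ?thesis by (simp add: E_def)
qed

context
  fixes c :: real
  assumes c: "c > 0"
begin

definition gs :: "real \<Rightarrow> real" where "gs x = exp (- pi * c * x\<^sup>2)"

text \<open>The translates are summed in pairs \<open>\<plusminus> n\<close>, so that a periodic sum over the integers is an ordinary series.\<close>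
definition gs_pair :: "nat \<Rightarrow> real \<Rightarrow> real" where
  "gs_pair k x = gs (x + real (Suc k)) + gs (x - real (Suc k))"

definition gs_pair' :: "nat \<Rightarrow> real \<Rightarrow> real" where
  "gs_pair' k x = - 2 * pi * c * (x + real (Suc k)) * gs (x + real (Suc k)) + - 2 * pi * c * (x - real (Suc k)) * gs (x - real (Suc k))"

definition gs_per :: "real \<Rightarrow> real" where "gs_per x = gs x + (\<Sum>k. gs_pair k x)"

lemma gs_shift:
  assumes "\<bar>x\<bar> \<le> 2" "\<bar>n\<bar> = real m"
  shows "gs (x + n) \<le> exp (4 * pi * c) * exp (- (pi * c / 2) * (real m)\<^sup>2)"
proof -
  have "x\<^sup>2 \<le> 4" using assms(1) power_mono[of "\<bar>x\<bar>" 2 2] by simp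
  moreover have "0 \<le> (n + 2 * x)\<^sup>2" by simp
  moreover have "(real m)\<^sup>2 = n\<^sup>2" using assms(2) by (metis power2_abs)
  ultimately have "(x + n)\<^sup>2 \<ge> (real m)\<^sup>2 / 2 - 4" by (simp add: power2_eq_square algebra_simps)
  then have "(pi * c) * (x + n)\<^sup>2 \<ge> (pi * c) * ((real m)\<^sup>2 / 2 - 4)"
    using c by (intro mult_left_mono) auto
  then show ?thesis unfolding gs_def exp_add[symmetric] by (simp add: algebra_simps)
qed

lemma gs_pair_bound: "\<bar>x\<bar> \<le> 2 \<Longrightarrow> \<bar>gs_pair k x\<bar> \<le> 2 * exp (4 * pi * c) * (real (Suc k) ^ 0 * exp (- (pi * c / 2) * (real (Suc k))\<^sup>2))"
proof -
  assume x: "\<bar>x\<bar> \<le> 2"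
  have "gs (x - real (Suc k)) = gs (x + - real (Suc k))" by (simp only: add_uminus_conv_diff)
  moreover have "gs y \<ge> 0" for y by (simp add: gs_def)
  ultimately show ?thesis
    using gs_shift[OF x, of "real (Suc k)" "Suc k"] gs_shift[OF x, of "- real (Suc k)" "Suc k"]
    unfolding gs_pair_def power_0 mult_1 mult.assoc by (simp del: of_nat_Suc)
qed

lemma gs_pair'_bound:
  assumes x: "\<bar>x\<bar> \<le> 2"
  shows "\<bar>gs_pair' k x\<bar> \<le> 12 * pi * c * exp (4 * pi * c) * (real (Suc k) ^ 1 * exp (- (pi * c / 2) * (real (Suc k))\<^sup>2))"
proof -
  define M where "M = exp (4 * pi * c) * exp (- (pi * c / 2) * (real (Suc k))\<^sup>2)"
  have 1: "\<bar>- 2 * pi * c * (x + n) * gs (x + n)\<bar> \<le> 6 * pi * c * real (Suc k) * M" if n: "\<bar>n\<bar> = real (Suc k)" for n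
  proof -
    have "\<bar>x + n\<bar> \<le> \<bar>x\<bar> + \<bar>n\<bar>" by (rule abs_triangle_ineq)
    also have "\<dots> \<le> 2 + real (Suc k)" using x n by simp
    also have "\<dots> \<le> 3 * real (Suc k)" by simp
    finally have "\<bar>x + n\<bar> \<le> 3 * real (Suc k)" .
    moreover have "gs (x + n) \<le> M" unfolding M_def using x n by (rule gs_shift)
    ultimately have "\<bar>x + n\<bar> * gs (x + n) \<le> 3 * real (Suc k) * M"
      by (intro mult_mono) (auto simp: gs_def)
    then have "(2 * pi * c) * (\<bar>x + n\<bar> * gs (x + n)) \<le> (2 * pi * c) * (3 * real (Suc k) * M)"
      using c by (intro mult_left_mono) auto
    moreover have "\<bar>- 2 * pi * c * (x + n) * gs (x + n)\<bar> = (2 * pi * c) * (\<bar>x + n\<bar> * gs (x + n))"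
      using c by (simp add: abs_mult gs_def)
    moreover have "(2 * pi * c) * (3 * real (Suc k) * M) = 6 * pi * c * real (Suc k) * M"
      by (simp del: of_nat_Suc)
    ultimately show ?thesis by linarith
  qed
  have "\<bar>gs_pair' k x\<bar> \<le> 6 * pi * c * real (Suc k) * M + 6 * pi * c * real (Suc k) * M"
    unfolding gs_pair'_def
    using 1[of "real (Suc k)"] 1[of "- real (Suc k)"] by (intro order_trans[OF abs_triangle_ineq] add_mono) (simp_all only: add_uminus_conv_diff abs_minus_cancel abs_of_nat)
  then show ?thesis unfolding M_def by (simp only: power_one_right mult_ac)
qed

lemma gs_summable:
  "summable (\<lambda>k. C * (real (Suc k) ^ j * exp (- (pi * c / 2) * (real (Suc k))\<^sup>2)))" if "j \<le> 4"
  using that c by (intro summable_mult summable_poly_exp_square) auto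

lemma gs_pair_summable: "\<bar>x\<bar> \<le> 2 \<Longrightarrow> summable (\<lambda>k. gs_pair k x)"
  by (rule summable_comparison_test'[OF gs_summable[where j = 0 and C = "2 * exp (4 * pi * c)"]])
     (simp, simp only: real_norm_def gs_pair_bound)

lemma gs_per_deriv:
  "\<exists>L g'. \<forall>x. \<bar>x\<bar> < 2 \<longrightarrow> (gs_per has_real_derivative g' x) (at x) \<and> \<bar>g' x\<bar> \<le> L"
proof -
  define C where "C = 12 * pi * c * exp (4 * pi * c)"
  define M where "M k = C * (real (Suc k) ^ 1 * exp (- (pi * c / 2) * (real (Suc k))\<^sup>2))" for k
  have M: "summable M" unfolding M_def by (rule gs_summable) simp
  have bd: "\<bar>gs_pair' k x\<bar> \<le> M k" if "\<bar>x\<bar> \<le> 2" for k x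
    using gs_pair'_bound[OF that, of k] by (simp add: M_def C_def)
  define g' where "g' x = - 2 * pi * c * x * gs x + (\<Sum>k. gs_pair' k x)" for x
  have d: "(gs_pair k has_real_derivative gs_pair' k x) (at x within S)" for k x S
  proof -
    have g: "(gs has_real_derivative - 2 * pi * c * y * gs y) (at y within S)" for y S
      unfolding gs_def[abs_def] by (auto intro!: derivative_eq_intros)
    show ?thesis
      unfolding gs_pair_def[abs_def] gs_pair'_def
      by (auto intro!: derivative_eq_intros DERIV_chain2[OF g] simp del: of_nat_Suc)
  qed
  have der: "(gs_per has_real_derivative g' x) (at x)" if "\<bar>x\<bar> < 2" for x
  proof -
    have "((\<lambda>x. \<Sum>k. gs_pair k x) has_real_derivative (\<Sum>k. gs_pair' k x)) (at x)"
    proof (rule has_field_derivative_series'(2)[where S = "{-2..2}" and ?x0.0 = 0])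
      show "uniformly_convergent_on {- 2..2} (\<lambda>n x. \<Sum>i<n. gs_pair' i x)"
        by (rule Weierstrass_m_test'[OF _ M]) (use bd in auto)
    qed (use that in \<open>auto intro!: d gs_pair_summable\<close>)
    moreover have "(gs has_real_derivative - 2 * pi * c * x * gs x) (at x)"
      unfolding gs_def[abs_def] by (auto intro!: derivative_eq_intros)
    ultimately show ?thesis unfolding gs_per_def[abs_def] g'_def by (intro DERIV_add)
  qed
  have "\<bar>g' x\<bar> \<le> 4 * pi * c + suminf M" if x: "\<bar>x\<bar> < 2" for x
  proof -
    have "summable (\<lambda>k. \<bar>gs_pair' k x\<bar>)"
      by (rule summable_comparison_test'[OF M]) (use bd x in auto)
    then have "\<bar>\<Sum>k. gs_pair' k x\<bar> \<le> suminf M"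
      using bd x M by (intro order_trans[OF summable_rabs] suminf_le) auto
    moreover have "\<bar>- 2 * pi * c * x * gs x\<bar> \<le> 4 * pi * c"
    proof -
      have "\<bar>x\<bar> * gs x \<le> 2 * 1" using x c by (intro mult_mono) (auto simp: gs_def)
      then have "(2 * pi * c) * (\<bar>x\<bar> * gs x) \<le> (2 * pi * c) * 2" using c by (intro mult_left_mono) auto
      then show ?thesis using c by (simp add: abs_mult gs_def algebra_simps)
    qed
    ultimately show ?thesis unfolding g'_def by linarith
  qed
  then show ?thesis using der by blast
qed

definition gs_part :: "nat \<Rightarrow> real \<Rightarrow> real" where "gs_part N x = (\<Sum>n\<in>{- int N..int N}. gs (x + of_int n))"

lemma gs_part_eq: "gs_part N x = gs x + (\<Sum>k<N. gs_pair k x)"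
  unfolding gs_part_def sum_int_symmetric by (simp add: gs_pair_def del: of_nat_Suc)

lemma gs_part_lim: "\<bar>x\<bar> \<le> 2 \<Longrightarrow> (\<lambda>N. gs_part N x) \<longlonglongrightarrow> gs_per x"
  unfolding gs_part_eq gs_per_def by (intro tendsto_intros summable_LIMSEQ gs_pair_summable)

lemma gs_part_bound: "\<exists>B. \<forall>N x. \<bar>x\<bar> \<le> 2 \<longrightarrow> \<bar>gs_part N x\<bar> \<le> B"
proof -
  define M where "M k = 2 * exp (4 * pi * c) * (real (Suc k) ^ 0 * exp (- (pi * c / 2) * (real (Suc k))\<^sup>2))" for k
  have M: "summable M" unfolding M_def by (rule gs_summable) simp
  have "\<bar>gs_part N x\<bar> \<le> 1 + suminf M" if "\<bar>x\<bar> \<le> 2" for N x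
  proof -
    have "\<bar>\<Sum>k<N. gs_pair k x\<bar> \<le> (\<Sum>k<N. M k)"
      using gs_pair_bound[OF that] unfolding M_def by (intro order_trans[OF sum_abs] sum_mono) auto
    also have "\<dots> \<le> suminf M" by (rule sum_le_suminf[OF M]) (simp_all add: M_def)
    moreover have "0 \<le> gs x" "gs x \<le> 1" using c by (auto simp: gs_def)
    ultimately show ?thesis unfolding gs_part_eq by linarith
  qed
  then show ?thesis by blast
qed

lemma gs_per_1: "gs_per 1 = gs_per 0"
proof -
  have "gs_part N 1 = gs_part N 0 + gs (real (Suc N)) - gs (real N)" for N
  proof (induction N)
    case (Suc N)
    have e: "gs (1 - real (Suc N)) = gs (real N)" by (simp add: gs_def)
    have "gs (0 - real (Suc N)) = gs (real (Suc N))" by (simp add: gs_def del: of_nat_Suc)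
    moreover have "gs (1 + real (Suc N)) = gs (real (Suc (Suc N)))" by simp
    ultimately show ?case using Suc e
      unfolding gs_part_eq gs_pair_def sum.lessThan_Suc by (simp del: of_nat_Suc)
  qed (simp add: gs_part_def)
  moreover have "(\<lambda>N. gs (real (Suc N))) \<longlonglongrightarrow> 0" "(\<lambda>N. gs (real N)) \<longlonglongrightarrow> 0"
    unfolding gs_def using c by real_asymp+
  moreover have "(\<lambda>N. gs_part N 0) \<longlonglongrightarrow> gs_per 0" by (rule gs_part_lim) simp
  ultimately have l0: "(\<lambda>N. gs_part N 1) \<longlonglongrightarrow> gs_per 0 + 0 - 0"
    by (simp only:) (intro tendsto_intros)
  have l1: "(\<lambda>N. gs_part N 1) \<longlonglongrightarrow> gs_per 1" by (rule gs_part_lim) simp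
  show ?thesis using LIMSEQ_unique[OF l1 l0] by simp
qed

text \<open>Fourier coefficients of the periodised Gaussian: unfolding by \<open>periodize\<close>, since the exponential is 1-periodic.\<close>
lemma gs_per_fourier:
  "(LINT x|lborel. indicator {0..<1} x *\<^sub>R (of_real (gs_per x) * exp (\<i> * of_real (2 * pi * of_int k * x)))) =
     of_real (exp (- pi * (of_int k)\<^sup>2 / c) / sqrt c)"
    (is "?I = _")
proof -
  define E where "E x = exp (\<i> * of_real (2 * pi * of_int k * x))" for x :: real
  define F where "F x = of_real (gs x) * E x" for x
  have pc: "pi * c > 0" using c by simp
  have F: "integrable lborel F" "(LINT x|lborel. F x) = of_real (exp (- pi * (of_int k)\<^sup>2 / c) / sqrt c)"
    using gauss_fourier[OF pc, of "2 * pi * of_int k"] c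
    unfolding F_def E_def gs_def by (simp_all add: real_sqrt_divide field_simps power2_eq_square)
  have Ep: "E (x + of_int n) = E x" for x n
  proof -
    have "E (x + of_int n) = E x * exp (\<i> * of_real (2 * pi * of_int (k * n)))"
      unfolding E_def exp_add[symmetric] by (simp add: algebra_simps)
    also have "exp (\<i> * of_real (2 * pi * of_int (k * n))) = 1"
      using exp_integer_2pi[of "of_int (k * n)"] by (simp add: mult_ac)
    finally show ?thesis by simp
  qed
  have "(\<Sum>n\<in>{- int N..int N}. F (x + of_int n)) = of_real (gs_part N x) * E x" for N x
    by (simp add: F_def Ep gs_part_def sum_distrib_right)
  then have lim1: "(\<lambda>N. LINT x|lborel. indicator {0..<1} x *\<^sub>R (of_real (gs_part N x) * E x)) \<longlonglongrightarrow> (LINT x|lborel. F x)"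
    using periodize[OF F(1)] by simp
  obtain B where B: "\<And>N x. \<bar>x\<bar> \<le> 2 \<Longrightarrow> \<bar>gs_part N x\<bar> \<le> B" using gs_part_bound by blast
  have [measurable]: "gs_part N \<in> borel_measurable borel" for N
    unfolding gs_part_def[abs_def] gs_def by measurable
  have [measurable]: "gs_per \<in> borel_measurable borel"
    unfolding gs_per_def[abs_def] gs_pair_def gs_def by measurable
  have [measurable]: "E \<in> borel_measurable borel" unfolding E_def by measurable
  have "(\<lambda>N. LINT x|lborel. indicator {0..<1} x *\<^sub>R (of_real (gs_part N x) * E x)) \<longlonglongrightarrow>
     (LINT x|lborel. indicator {0..<1} x *\<^sub>R (of_real (gs_per x) * E x))"
  proof (rule integral_dominated_convergence[where w = "\<lambda>x. B * indicator {0..<1} x"])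
    show "AE x in lborel. (\<lambda>N. indicator {0..<1} x *\<^sub>R (of_real (gs_part N x) * E x)) \<longlonglongrightarrow>
      indicator {0..<1} x *\<^sub>R (of_real (gs_per x) * E x)"
    proof (rule AE_I2)
      fix x :: real
      show "(\<lambda>N. indicator {0..<1} x *\<^sub>R (of_real (gs_part N x) * E x)) \<longlonglongrightarrow>
        indicator {0..<1} x *\<^sub>R (of_real (gs_per x) * E x)"
        by (cases "x \<in> {0..<1}") (auto intro!: tendsto_intros gs_part_lim)
    qed
    show "integrable lborel (\<lambda>x::real. B * indicator {0..<1} x)"
      by (intro integrable_mult_right integrable_real_indicator) auto
    show "AE x in lborel. norm (indicator {0..<1} x *\<^sub>R (of_real (gs_part N x) * E x)) \<le> B * indicator {0..<1} x" for N
      using B by (auto intro!: AE_I2 simp: norm_mult E_def indicator_def)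
  qed measurable
  then show ?thesis using LIMSEQ_unique[OF lim1] F(2) by (simp add: E_def)
qed

lemma gs_per_lipschitz:
  "\<exists>L\<ge>0. (\<forall>x\<in>{0..1}. \<forall>y\<in>{0..1}. \<bar>gs_per x - gs_per y\<bar> \<le> L * \<bar>x - y\<bar>) \<and> (\<forall>x\<in>{0<..<1}. isCont gs_per x)"
proof -
  obtain L g' where g0: "\<forall>x. \<bar>x\<bar> < 2 \<longrightarrow> (gs_per has_real_derivative g' x) (at x) \<and> \<bar>g' x\<bar> \<le> L"
    using gs_per_deriv by (elim exE)
  have "norm (gs_per x - gs_per y) \<le> L * norm (x - y)" if "x \<in> {0..1}" "y \<in> {0..1}" for x y
  proof (rule field_differentiable_bound[where S = "{0..1}" and f' = g' and f = gs_per and x = x and y = y])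
    show "(gs_per has_field_derivative g' z) (at z within {0..1})" if "z \<in> {0..1}" for z
      by (rule has_field_derivative_at_within[OF g0[rule_format, THEN conjunct1]]) (use that in simp)
    show "norm (g' z) \<le> L" if "z \<in> {0..1}" for z
      unfolding real_norm_def using that by (intro g0[rule_format, THEN conjunct2]) simp
    show "convex {0..1::real}" by simp
  qed (rule that)+
  moreover have "L \<ge> 0" 
  proof -
    have "\<bar>g' 0\<bar> \<le> L" by (rule g0[rule_format, THEN conjunct2]) simp
    then show ?thesis by linarith
  qed
  moreover have "isCont gs_per x" if "x \<in> {0<..<1}" for x
    by (rule DERIV_isCont[OF g0[rule_format, THEN conjunct1]]) (use that in simp)
  ultimately show ?thesis by (intro exI[of _ L]) simp
qed

text \<open>Poisson summation for the Gaussian without a theorem on Fourier series.  The periodised Gaussian minus its value at 0, divided by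
  \<open>exp (2 \<pi> \<i> x) - 1\<close>, is bounded because the numerator is Lipschitz and vanishes at both ends.  The Fourier coefficients of the
  numerator are differences of consecutive coefficients \<open>J k\<close> of the quotient, so their sum telescopes, and the end terms
  tend to 0 by the Riemann--Lebesgue lemma.\<close>
lemma gs_poisson: "(\<lambda>N. \<Sum>k\<in>{- int N..int N}. exp (- pi * (of_int k)\<^sup>2 / c) / sqrt c) \<longlonglongrightarrow> gs_per 0"
proof -
  obtain L where L: "L \<ge> 0" and lip0: "\<forall>x\<in>{0..1}. \<forall>y\<in>{0..1}. \<bar>gs_per x - gs_per y\<bar> \<le> L * \<bar>x - y\<bar>"
     and cont: "\<forall>x\<in>{0<..<1}. isCont gs_per x"
    using gs_per_lipschitz by blast
  have lip: "\<bar>gs_per x - gs_per y\<bar> \<le> L * \<bar>x - y\<bar>" if "x \<in> {0..1}" "y \<in> {0..1}" for x y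
    using lip0 that by blast
  define H where "H x = (if 0 < x \<and> x < 1 then of_real (gs_per x - gs_per 0) / (exp (\<i> * of_real (2 * pi * x)) - 1) else 0)" for x
  have nz: "exp (\<i> * of_real (2 * pi * x)) - 1 \<noteq> 0" if "0 < x" "x < 1" for x
    using norm_exp_minus_one_ge[of x] that by (auto simp: min_def split: if_splits)
  have [measurable]: "gs_per \<in> borel_measurable borel"
    unfolding gs_per_def[abs_def] gs_pair_def gs_def by measurable
  have Hm [measurable]: "H \<in> borel_measurable borel" unfolding H_def[abs_def] by measurable
  have Hb: "norm (H x) \<le> L" for x
  proof (cases "0 < x \<and> x < 1")
    case True
    have "\<bar>gs_per x - gs_per 0\<bar> \<le> L * min x (1 - x)"
      using lip[of x 0] lip[of x 1] gs_per_1 True by (auto simp: min_def)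
    also have "\<dots> \<le> L * norm (exp (\<i> * of_real (2 * pi * x)) - 1)"
    proof (rule mult_left_mono[OF _ L])
      have "0 \<le> min x (1 - x)" "0 \<le> x" "x \<le> 1" using True by auto
      then show "min x (1 - x) \<le> norm (exp (\<i> * of_real (2 * pi * x)) - 1)"
        using norm_exp_minus_one_ge[OF \<open>0 \<le> x\<close> \<open>x \<le> 1\<close>] by (rule_tac order_trans) simp_all
    qed
    finally show ?thesis using True nz[of x] by (simp add: H_def norm_divide divide_le_eq flip: of_real_diff)
  qed (auto simp: H_def L)
  have Hc: "AE x in lborel. isCont H x"
    using AE_lborel_singleton[of "0::real"] AE_lborel_singleton[of "1::real"]
  proof eventually_elim
    case (elim x)
    consider "x < 0" | "x > 1" | "0 < x" "x < 1" using elim by linarith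
    then show ?case
    proof cases
      case 1
      have "\<forall>\<^sub>F y in nhds x. H y = 0"
        using eventually_nhds_in_open[of "{..<0}" x] 1 by (auto elim!: eventually_mono simp: H_def)
      then show ?thesis by (simp add: isCont_cong)
    next
      case 2
      have "\<forall>\<^sub>F y in nhds x. H y = 0"
        using eventually_nhds_in_open[of "{1<..}" x] 2 by (auto elim!: eventually_mono simp: H_def)
      then show ?thesis by (simp add: isCont_cong)
    next
      case 3
      have "\<forall>\<^sub>F y in nhds x. H y = of_real (gs_per y - gs_per 0) / (exp (\<i> * of_real (2 * pi * y)) - 1)"
        using eventually_nhds_in_open[of "{0<..<1}" x] 3 by (auto elim!: eventually_mono simp: H_def)
      moreover have "isCont gs_per x" using cont 3 by simp
      then have "isCont (\<lambda>y. of_real (gs_per y - gs_per 0) / (exp (\<i> * of_real (2 * pi * y)) - 1) :: complex) x"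
        using nz[OF 3] by (intro continuous_intros) auto
      ultimately show ?thesis by (simp add: isCont_cong)
    qed
  qed
  define E where "E k x = exp (\<i> * of_real (2 * pi * of_int k * x))" for k :: int and x :: real
  have [measurable]: "E k \<in> borel_measurable borel" for k unfolding E_def[abs_def] by measurable
  have nE: "norm (E k x) = 1" for k x by (simp add: E_def)
  define J where "J k = (LINT x|lborel. H x * E k x)" for k
  have iB: "integrable lborel (\<lambda>x::real. B * indicator {0..<1} x :: real)" for B
    by (intro integrable_mult_right integrable_real_indicator) auto
  have iJ: "integrable lborel (\<lambda>x. H x * E k x)" for k
  proof (rule Bochner_Integration.integrable_bound[OF iB[of L]])
    show "AE x in lborel. norm (H x * E k x) \<le> norm (L * indicator {0..<1} x)"
    proof (rule AE_I2)
      fix x :: real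
      show "norm (H x * E k x) \<le> norm (L * indicator {0..<1} x)"
      proof (cases "x \<in> {0..<1}")
        case True
        then show ?thesis using Hb[of x] L by (simp add: norm_mult nE)
      next
        case False
        then have "H x = 0" by (auto simp: H_def)
        then show ?thesis by simp
      qed
    qed
  qed measurable
  obtain B where B: "\<And>N x. \<bar>x\<bar> \<le> 2 \<Longrightarrow> \<bar>gs_part N x\<bar> \<le> B" using gs_part_bound by blast
  have B': "\<bar>gs_per x\<bar> \<le> B" if "\<bar>x\<bar> \<le> 2" for x
    by (rule Lim_bounded[of "\<lambda>N. \<bar>gs_part N x\<bar>" _ 0]) (use B that in \<open>auto intro!: tendsto_intros gs_part_lim\<close>)
  have i1: "integrable lborel (\<lambda>x. indicator {0..<1} x *\<^sub>R (of_real (gs_per x) * E k x))" for k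
    by (rule Bochner_Integration.integrable_bound[OF iB[of B]])
       (auto intro!: AE_I2 order_trans[OF B' abs_ge_self] simp: norm_mult nE indicator_def)
  have i2: "integrable lborel (\<lambda>x. indicator {0..<1} x *\<^sub>R E k x)" for k
    by (rule Bochner_Integration.integrable_bound[OF iB[of 1]])
       (auto intro!: AE_I2 simp: norm_mult nE indicator_def)
  \<comment> \<open>multiplication by \<open>exp (2 \<pi> \<i> x) - 1\<close> is a shift of the index minus the identity\<close>
  have tele: "of_real (exp (- pi * (of_int k)\<^sup>2 / c) / sqrt c) - of_real (gs_per 0) * (if k = 0 then 1 else 0) = J (k + 1) - J k" for k
  proof -
    have "J (k + 1) - J k = (LINT x|lborel. H x * E (k + 1) x - H x * E k x)"
      unfolding J_def using iJ by simp
    also have "\<dots> = (LINT x|lborel. indicator {0..<1} x *\<^sub>R (of_real (gs_per x) * E k x) - of_real (gs_per 0) * (indicator {0..<1} x *\<^sub>R E k x))"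
    proof (rule integral_cong_AE)
      show "AE x in lborel. H x * E (k + 1) x - H x * E k x =
        indicator {0..<1} x *\<^sub>R (of_real (gs_per x) * E k x) - of_real (gs_per 0) * (indicator {0..<1} x *\<^sub>R E k x)"
        using AE_lborel_singleton[of "0::real"]
      proof eventually_elim
        case (elim x)
        have "E (k + 1) x = E k x * exp (\<i> * of_real (2 * pi * x))"
          unfolding E_def exp_add[symmetric] by (simp add: algebra_simps)
        then have "H x * E (k + 1) x - H x * E k x = H x * (exp (\<i> * of_real (2 * pi * x)) - 1) * E k x"
          by (simp add: algebra_simps)
        also have "\<dots> = indicator {0..<1} x *\<^sub>R (of_real (gs_per x - gs_per 0) * E k x)"
          using nz[of x] elim by (auto simp: H_def indicator_def)
        finally show ?case by (simp add: algebra_simps)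
      qed
    qed measurable
    also have "\<dots> = (LINT x|lborel. indicator {0..<1} x *\<^sub>R (of_real (gs_per x) * E k x)) - of_real (gs_per 0) * (LINT x|lborel. indicator {0..<1} x *\<^sub>R E k x)"
      by (subst Bochner_Integration.integral_diff[OF i1 integrable_mult_right[OF i2]], subst integral_mult_right_zero, rule refl)
    also have "\<dots> = of_real (exp (- pi * (of_int k)\<^sup>2 / c) / sqrt c) - of_real (gs_per 0) * (if k = 0 then 1 else 0)"
      unfolding E_def gs_per_fourier fourier_unit by simp
    finally show ?thesis by simp
  qed
  have sum: "(\<Sum>k\<in>{- int N..int N}. of_real (exp (- pi * (of_int k)\<^sup>2 / c) / sqrt c)) =
     of_real (gs_per 0) + J (int (Suc N)) - J (- int N)" for N
  proof -
    have "(\<Sum>k\<in>{- int N..int N}. J (k + 1) - J k) = J (int (Suc N)) - J (- int N)"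
    proof (induction N)
      case (Suc N)
      have "{- int (Suc N)..int (Suc N)} = insert (int (Suc N)) (insert (- int (Suc N)) {- int N..int N})"
        by auto
      then show ?case using Suc by (simp add: add_ac)
    qed simp
    moreover have "(\<Sum>k\<in>{- int N..int N}. of_real (gs_per 0) * (if k = 0 then 1 else 0)) = (of_real (gs_per 0) :: complex)"
      by (simp add: sum_distrib_left[symmetric] sum.delta)
    ultimately show ?thesis unfolding tele[symmetric] sum_subtractf by (simp add: algebra_simps)
  qed
  have supp: "x \<notin> {0..1} \<Longrightarrow> H x = 0" for x by (auto simp: H_def)
  have "(\<lambda>N. J (int N)) \<longlonglongrightarrow> 0"
    using riemann_lebesgue[OF Hm Hb supp Hc, of 1] by (simp add: J_def E_def)
  then have "(\<lambda>N. J (int (Suc N))) \<longlonglongrightarrow> 0" by (rule LIMSEQ_Suc)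
  moreover have "(\<lambda>N. J (- int N)) \<longlonglongrightarrow> 0"
    using riemann_lebesgue[OF Hm Hb supp Hc, of "-1"] by (simp add: J_def E_def)
  ultimately have "(\<lambda>N. of_real (gs_per 0) + J (int (Suc N)) - J (- int N)) \<longlonglongrightarrow> of_real (gs_per 0) + 0 - 0"
    by (intro tendsto_intros)
  then have "(\<lambda>N. complex_of_real (\<Sum>k\<in>{- int N..int N}. exp (- pi * (of_int k)\<^sup>2 / c) / sqrt c)) \<longlonglongrightarrow> of_real (gs_per 0)"
    unfolding sum[symmetric] by simp
  then show ?thesis by (simp only: tendsto_of_real_iff)
qed

lemma jacobi_theta_aux:
  "1 + 2 * (\<Sum>k. exp (- pi * c * (real (Suc k))\<^sup>2)) = (1 + 2 * (\<Sum>k. exp (- pi * (1 / c) * (real (Suc k))\<^sup>2))) / sqrt c"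
proof -
  have s: "summable (\<lambda>k. exp (- b * (real (Suc k))\<^sup>2))" if "b > 0" for b
    using summable_poly_exp_square[OF that, of 0] by simp
  have "pi / c > 0" using c by simp
  have "(\<lambda>N. (1 + (\<Sum>k<N. 2 * exp (- (pi / c) * (real (Suc k))\<^sup>2))) / sqrt c) \<longlonglongrightarrow>
     (1 + (\<Sum>k. 2 * exp (- (pi / c) * (real (Suc k))\<^sup>2))) / sqrt c"
    using c by (intro tendsto_intros summable_LIMSEQ summable_mult s \<open>pi / c > 0\<close>) auto
  moreover have "(\<Sum>k\<in>{- int N..int N}. exp (- pi * (of_int k)\<^sup>2 / c) / sqrt c) =
     (1 + (\<Sum>k<N. 2 * exp (- (pi / c) * (real (Suc k))\<^sup>2))) / sqrt c" for N
    unfolding sum_int_symmetric by (simp add: add_divide_distrib sum_divide_distrib del: of_nat_Suc)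
  ultimately have "gs_per 0 = (1 + (\<Sum>k. 2 * exp (- (pi / c) * (real (Suc k))\<^sup>2))) / sqrt c"
    using gs_poisson LIMSEQ_unique by simp
  moreover have "gs_per 0 = 1 + (\<Sum>k. 2 * exp (- (pi * c) * (real (Suc k))\<^sup>2))"
    by (simp add: gs_per_def gs_pair_def gs_def del: of_nat_Suc)
  moreover have "pi * c > 0" using c by simp
  ultimately show ?thesis
    using s[of "pi * c"] s[of "pi / c"] \<open>pi / c > 0\<close> by (simp add: suminf_mult)
qed

end

text \<open>The inversion formula of Jacobi's theta function.\<close>
lemma jacobi_theta:
  fixes c :: real
  assumes "c > 0"
  shows "1 + 2 * (\<Sum>k. exp (- pi * c * (real (Suc k))\<^sup>2)) = (1 + 2 * (\<Sum>k. exp (- pi * (1 / c) * (real (Suc k))\<^sup>2))) / sqrt c"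
  using jacobi_theta_aux[OF assms] .

section \<open>Evenness, positivity and decay of the kernel\<close>

text \<open>The theta series in exponential coordinates, \<open>exp u * \<theta> (exp (4 u))\<close>, termwise, with its first two derivatives.
  The operator \<open>d\<^sup>2/du\<^sup>2 - 1\<close> annihilates \<open>exp (\<plusminus> u)\<close> and maps the theta term to 8 times the term of \<open>Phi\<close> (\<open>K_term2_eq\<close>).\<close>
definition K_term :: "nat \<Rightarrow> real \<Rightarrow> real" where
  "K_term n u = exp (u - pi * (real (Suc n))\<^sup>2 * exp (4 * u))"
definition K_term1 :: "nat \<Rightarrow> real \<Rightarrow> real" where
  "K_term1 n u = (1 - 4 * (pi * (real (Suc n))\<^sup>2) * exp (4 * u)) * K_term n u"
definition K_term2 :: "nat \<Rightarrow> real \<Rightarrow> real" where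
  "K_term2 n u = (1 - 24 * (pi * (real (Suc n))\<^sup>2) * exp (4 * u) + 16 * (pi * (real (Suc n))\<^sup>2)\<^sup>2 * (exp (4 * u))\<^sup>2) * K_term n u"

definition Phi_term :: "nat \<Rightarrow> real \<Rightarrow> real" where
  "Phi_term n u = (2 * pi\<^sup>2 * real (Suc n) ^ 4 * exp (9 * u) - 3 * pi * real (Suc n) ^ 2 * exp (5 * u))
                  * exp (- pi * real (Suc n) ^ 2 * exp (4 * u))"

lemma Phi_eq: "Phi u = (\<Sum>n. Phi_term n u)"
  by (simp add: Phi_def Phi_term_def)

lemma K_term2_eq: "K_term2 n u = K_term n u + 8 * Phi_term n u"
proof -
  have e: "exp (9 * u) = exp u * (exp (4 * u))\<^sup>2" "exp (5 * u) = exp u * exp (4 * u)"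
    by (simp_all add: power2_eq_square flip: exp_add)
  have K: "K_term n u = exp u * exp (- pi * real (Suc n) ^ 2 * exp (4 * u))"
    by (simp add: K_term_def flip: exp_add)
  show ?thesis
    unfolding K_term2_def Phi_term_def e K
    by (simp add: algebra_simps power2_eq_square power4_eq_xxxx del: of_nat_Suc)
qed

lemma K_derivs:
  "(K_term n has_real_derivative K_term1 n u) (at u within S)"
  "(K_term1 n has_real_derivative K_term2 n u) (at u within S)"
proof -
  define p where "p = pi * (real (Suc n))\<^sup>2"
  have 1: "(K_term n has_real_derivative K_term1 n u) (at u within S)" for u S
    unfolding K_term_def[abs_def] K_term1_def p_def[symmetric]
    by (auto intro!: derivative_eq_intros simp: K_term_def p_def[symmetric])
  then show "(K_term n has_real_derivative K_term1 n u) (at u within S)" .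
  show "(K_term1 n has_real_derivative K_term2 n u) (at u within S)"
  proof -
    have e1: "K_term1 n = (\<lambda>u. (1 - 4 * p * exp (4 * u)) * K_term n u)"
      by (simp add: K_term1_def[abs_def] p_def)
    have e2: "K_term2 n u = (1 - 24 * p * exp (4 * u) + 16 * p\<^sup>2 * (exp (4 * u))\<^sup>2) * K_term n u"
      by (simp add: K_term2_def p_def)
    have "((\<lambda>u. (1 - 4 * p * exp (4 * u)) * K_term n u) has_real_derivative
       (- (4 * p * (exp (4 * u) * 4))) * K_term n u + K_term1 n u * (1 - 4 * p * exp (4 * u))) (at u within S)"
      by (intro DERIV_mult 1) (auto intro!: derivative_eq_intros)
    then show ?thesis unfolding e1 e2 by (simp add: algebra_simps power2_eq_square)
  qed
qed

text \<open>One summable majorant for the terms and their first two derivatives on a bounded interval, for differentiation under the sum.\<close>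
lemma K_bounds:
  assumes u: "\<bar>u\<bar> \<le> A"
  defines "M \<equiv> \<lambda>n. (1 + 24 * pi * exp (4 * A) + 16 * pi\<^sup>2 * exp (8 * A)) * exp A * (real (Suc n) ^ 4 * exp (- (pi * exp (- 4 * A)) * (real (Suc n))\<^sup>2))"
  shows "\<bar>K_term n u\<bar> \<le> M n" "\<bar>K_term1 n u\<bar> \<le> M n" "\<bar>K_term2 n u\<bar> \<le> M n" "summable M"
proof -
  define N where "N = real (Suc n)"
  have N: "N \<ge> 1" by (simp add: N_def)
  have N2: "1 \<le> N ^ 4" "N\<^sup>2 \<le> N ^ 4" using N by (auto intro!: power_increasing simp: one_le_power)
  define E where "E = exp (4 * u)"
  define B where "B = exp (4 * A)"
  have E: "0 < E" "E \<le> B" "exp (- 4 * A) \<le> E" using u by (auto simp: E_def B_def)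
  have B2: "exp (8 * A) = B\<^sup>2" by (simp add: B_def power2_eq_square flip: exp_add)
  have E2: "E\<^sup>2 \<le> B\<^sup>2" using E by (intro power_mono) auto
  define p where "p = pi * N\<^sup>2"
  have p: "p \<ge> 0" by (simp add: p_def)
  have p2: "p\<^sup>2 = pi\<^sup>2 * N ^ 4" by (simp add: p_def power_mult_distrib)
  have K0: "0 < K_term n u" by (simp add: K_term_def)
  have K: "K_term n u \<le> exp A * exp (- (pi * exp (- 4 * A)) * N\<^sup>2)"
  proof -
    have "pi * N\<^sup>2 * exp (- 4 * A) \<le> pi * N\<^sup>2 * E" using E by (intro mult_left_mono) auto
    moreover have "- (pi * exp (- 4 * A)) * N\<^sup>2 = - (pi * N\<^sup>2 * exp (- 4 * A))" by simp
    moreover have "u \<le> A" using u by simp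
    ultimately have "u - pi * N\<^sup>2 * E \<le> A + - (pi * exp (- 4 * A)) * N\<^sup>2" by linarith
    then show ?thesis unfolding K_term_def exp_add[symmetric] N_def E_def exp_le_cancel_iff .
  qed
  have c1: "24 * p * E \<le> 24 * pi * B * N ^ 4"
  proof -
    have "p * E \<le> (pi * N ^ 4) * B" unfolding p_def using E N2 by (intro mult_mono) auto
    then show ?thesis by (simp add: mult_ac)
  qed
  have c2: "16 * p\<^sup>2 * E\<^sup>2 \<le> 16 * pi\<^sup>2 * B\<^sup>2 * N ^ 4"
    unfolding p2 using E2 mult_left_mono[of "E\<^sup>2" "B\<^sup>2" "16 * (pi\<^sup>2 * N ^ 4)"] by (simp add: mult_ac)
  have pE: "p * E \<ge> 0" "p\<^sup>2 * E\<^sup>2 \<ge> 0" using p E by auto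
  have gen: "\<bar>c * K_term n u\<bar> \<le> M n" if "\<bar>c\<bar> \<le> 1 + 24 * p * E + 16 * p\<^sup>2 * E\<^sup>2" for c
  proof -
    have "\<bar>c\<bar> \<le> (1 + 24 * pi * B + 16 * pi\<^sup>2 * B\<^sup>2) * N ^ 4"
      using that c1 c2 N2 by (simp add: algebra_simps)
    then have "\<bar>c\<bar> * K_term n u \<le> ((1 + 24 * pi * B + 16 * pi\<^sup>2 * B\<^sup>2) * N ^ 4) * (exp A * exp (- (pi * exp (- 4 * A)) * N\<^sup>2))"
      using K K0 by (intro mult_mono) auto
    then show ?thesis using K0 unfolding M_def B2 B_def[symmetric] N_def[symmetric]
      by (simp add: abs_mult mult_ac)
  qed
  show "\<bar>K_term n u\<bar> \<le> M n" using gen[of 1] pE by simp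
  show "\<bar>K_term1 n u\<bar> \<le> M n"
    using gen[of "1 - 4 * p * E"] pE unfolding K_term1_def p_def N_def E_def by (simp add: abs_le_iff)
  show "\<bar>K_term2 n u\<bar> \<le> M n"
    using gen[of "1 - 24 * p * E + 16 * p\<^sup>2 * E\<^sup>2"] pE unfolding K_term2_def p_def N_def E_def by (simp add: abs_le_iff)
  show "summable M"
    unfolding M_def by (intro summable_mult summable_poly_exp_square) auto
qed

definition Kf where "Kf u = (\<Sum>n. K_term n u)"
definition Kf1 where "Kf1 u = (\<Sum>n. K_term1 n u)"
definition Kf2 where "Kf2 u = (\<Sum>n. K_term2 n u)"

lemma K_summable: "summable (\<lambda>n. K_term n u)" "summable (\<lambda>n. K_term1 n u)" "summable (\<lambda>n. K_term2 n u)"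
  by (rule summable_comparison_test'[OF K_bounds(4)[OF order_refl]], simp only: real_norm_def, rule K_bounds(1)[OF order_refl],
      rule summable_comparison_test'[OF K_bounds(4)[OF order_refl]], simp only: real_norm_def, rule K_bounds(2)[OF order_refl],
      rule summable_comparison_test'[OF K_bounds(4)[OF order_refl]], simp only: real_norm_def, rule K_bounds(3)[OF order_refl])

lemma Kf_derivs:
  "(Kf has_real_derivative Kf1 u) (at u)" "(Kf1 has_real_derivative Kf2 u) (at u)"
proof -
  define A where "A = \<bar>u\<bar> + 1"
  have u: "u \<in> interior {- A..A}" "0 \<in> {- A..A}" by (auto simp: A_def)
  show "(Kf has_real_derivative Kf1 u) (at u)"
    unfolding Kf_def[abs_def] Kf1_def
    by (rule has_field_derivative_series'(2)[where S = "{-A..A}" and ?x0.0 = 0, OF _ K_derivs(1) Weierstrass_m_test'[OF _ K_bounds(4)[of u "A"]] _ K_summable(1)])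
       (use u K_bounds(2)[of _ A] in \<open>auto simp: A_def\<close>)
  show "(Kf1 has_real_derivative Kf2 u) (at u)"
    unfolding Kf1_def[abs_def] Kf2_def
    by (rule has_field_derivative_series'(2)[where S = "{-A..A}" and ?x0.0 = 0, OF _ K_derivs(2) Weierstrass_m_test'[OF _ K_bounds(4)[of u "A"]] _ K_summable(2)])
       (use u K_bounds(3)[of _ A] in \<open>auto simp: A_def\<close>)
qed

lemma Phi_term_summable: "summable (\<lambda>n. Phi_term n u)"
proof -
  have "summable (\<lambda>n. (K_term2 n u - K_term n u) / 8)"
    by (intro summable_divide summable_diff K_summable)
  then show ?thesis by (simp add: K_term2_eq)
qed

lemma Kf2_eq: "Kf2 u = Kf u + 8 * Phi u"
  unfolding Kf2_def Kf_def Phi_eq K_term2_eq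
  using K_summable(1) Phi_term_summable by (subst suminf_add[symmetric]) (auto simp: suminf_mult intro: summable_mult)

text \<open>The theta inversion formula at \<open>c = exp (4 u)\<close>.\<close>
lemma Kf_functional: "exp u + 2 * Kf u = exp (- u) + 2 * Kf (- u)"
proof -
  have K: "Kf u = exp u * (\<Sum>k. exp (- pi * exp (4 * u) * (real (Suc k))\<^sup>2))" for u
  proof -
    have "summable (\<lambda>k. exp (- (pi * exp (4 * u)) * (real (Suc k))\<^sup>2))"
      using summable_poly_exp_square[of "pi * exp (4 * u)" 0] by simp
    then have "exp u * (\<Sum>k. exp (- (pi * exp (4 * u)) * (real (Suc k))\<^sup>2)) = (\<Sum>k. exp u * exp (- (pi * exp (4 * u)) * (real (Suc k))\<^sup>2))"
      by (rule suminf_mult[symmetric])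
    then show ?thesis by (simp add: Kf_def K_term_def mult_ac flip: exp_add)
  qed
  have "sqrt (exp (4 * u)) = exp (2 * u)"
    by (rule real_sqrt_unique) (auto simp: power2_eq_square simp flip: exp_add)
  then have J: "1 + 2 * (\<Sum>k. exp (- pi * exp (4 * u) * (real (Suc k))\<^sup>2)) =
      (1 + 2 * (\<Sum>k. exp (- pi * exp (4 * (- u)) * (real (Suc k))\<^sup>2))) / exp (2 * u)"
    using jacobi_theta[of "exp (4 * u)"] by (simp add: exp_minus inverse_eq_divide)
  have "exp u + 2 * Kf u = exp u * (1 + 2 * (\<Sum>k. exp (- pi * exp (4 * u) * (real (Suc k))\<^sup>2)))"
    unfolding K by (simp add: algebra_simps)
  also have "\<dots> = (exp u / exp (2 * u)) * (1 + 2 * (\<Sum>k. exp (- pi * exp (4 * (- u)) * (real (Suc k))\<^sup>2)))"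
    unfolding J by simp
  also have "exp u / exp (2 * u) = exp (- u)" by (simp flip: exp_diff)
  also have "exp (- u) * (1 + 2 * (\<Sum>k. exp (- pi * exp (4 * (- u)) * (real (Suc k))\<^sup>2))) = exp (- u) + 2 * Kf (- u)"
    unfolding K by (simp add: algebra_simps)
  finally show ?thesis .
qed

text \<open>\<open>exp u + 2 Kf u\<close> is even.  Applying \<open>d\<^sup>2/du\<^sup>2 - 1\<close>, which preserves evenness and kills \<open>exp u\<close>, gives \<open>16 Phi\<close>.\<close>
lemma Phi_even: "Phi (- u) = Phi u"
proof -
  have neg: "((\<lambda>u. f (- u)) has_real_derivative - f' (- u)) (at u)"
    if "\<And>u. (f has_real_derivative f' u) (at u)" for f f' :: "real \<Rightarrow> real" and u
  proof -
    have "((\<lambda>u. f (- u)) has_real_derivative f' (- u) * (- 1)) (at u)"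
      by (rule DERIV_chain2[where f = f and g = "\<lambda>u. - u", OF that]) (auto intro!: derivative_eq_intros)
    then show ?thesis by simp
  qed
  have 1: "exp u + 2 * Kf1 u + exp (- u) + 2 * Kf1 (- u) = 0" for u
  proof -
    have "((\<lambda>u. exp u + 2 * Kf u - exp (- u) - 2 * Kf (- u)) has_real_derivative
        exp u + 2 * Kf1 u - - exp (- u) - 2 * - Kf1 (- u)) (at u)"
      by (intro DERIV_diff DERIV_add DERIV_cmult neg Kf_derivs) (auto intro!: derivative_eq_intros)
    moreover have "(\<lambda>u. exp u + 2 * Kf u - exp (- u) - 2 * Kf (- u)) = (\<lambda>_. 0)"
    proof
      fix u show "exp u + 2 * Kf u - exp (- u) - 2 * Kf (- u) = 0" using Kf_functional[of u] by simp
    qed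
    ultimately show ?thesis using DERIV_unique[OF _ DERIV_const[of 0]] by fastforce
  qed
  have "((\<lambda>u. exp u + 2 * Kf1 u + exp (- u) + 2 * Kf1 (- u)) has_real_derivative
        exp u + 2 * Kf2 u + - exp (- u) + 2 * - Kf2 (- u)) (at u)"
    by (intro DERIV_diff DERIV_add DERIV_cmult neg Kf_derivs) (auto intro!: derivative_eq_intros)
  moreover have "(\<lambda>u. exp u + 2 * Kf1 u + exp (- u) + 2 * Kf1 (- u)) = (\<lambda>_. 0)"
    using 1 by (intro ext) simp
  ultimately have "exp u + 2 * Kf2 u + - exp (- u) + 2 * - Kf2 (- u) = 0"
    using DERIV_unique[OF _ DERIV_const[of 0]] by fastforce
  then show ?thesis using Kf_functional[of u] by (simp add: Kf2_eq)
qed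

text \<open>For \<open>u \<ge> 0\<close> the positive part of a term dominates since \<open>2 \<pi> > 3\<close>.  The upper bound separates the variables by
  \<open>n\<^sup>2 E \<ge> n\<^sup>2 + E - 1\<close> for \<open>n\<^sup>2\<close>, \<open>E \<ge> 1\<close>.\<close>
lemma Phi_term_bounds:
  assumes u: "u \<ge> 0"
  shows "Phi_term n u > 0" "Phi_term n u \<le> 2 * pi\<^sup>2 * exp pi * exp (9 * u - pi * exp (4 * u)) * (real (Suc n) ^ 4 * exp (- pi * (real (Suc n))\<^sup>2))"
proof -
  define N where "N = real (Suc n)"
  define E where "E = exp (4 * u)"
  have N: "N\<^sup>2 \<ge> 1" by (simp add: N_def one_le_power)
  have E: "E \<ge> 1" using u by (simp add: E_def)
  have e: "exp (9 * u) = exp (5 * u) * E" by (simp add: E_def flip: exp_add)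
  have "3 < 2 * pi * (1 * 1)" using pi_gt3 by simp
  also have "\<dots> \<le> 2 * pi * (N\<^sup>2 * E)" using N E by (intro mult_left_mono mult_mono) auto
  finally have 3: "2 * pi * (N\<^sup>2 * E) - 3 > 0" by simp
  have "2 * pi\<^sup>2 * N ^ 4 * exp (9 * u) - 3 * pi * N\<^sup>2 * exp (5 * u) = pi * N\<^sup>2 * exp (5 * u) * (2 * pi * (N\<^sup>2 * E) - 3)"
    unfolding e by (simp add: algebra_simps power2_eq_square power4_eq_xxxx)
  also have "\<dots> > 0" using 3 N by (intro mult_pos_pos) auto
  finally show "Phi_term n u > 0" unfolding Phi_term_def N_def by simp
  have "Phi_term n u \<le> 2 * pi\<^sup>2 * N ^ 4 * exp (9 * u) * exp (- pi * N\<^sup>2 * E)"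
    unfolding Phi_term_def N_def E_def by (intro mult_right_mono) auto
  also have "\<dots> \<le> 2 * pi\<^sup>2 * N ^ 4 * exp (9 * u) * (exp pi * exp (- (pi * E)) * exp (- pi * N\<^sup>2))"
  proof -
    have "0 \<le> (N\<^sup>2 - 1) * (E - 1)" using N E by auto
    then have "0 \<le> pi * ((N\<^sup>2 - 1) * (E - 1))" by simp
    then have "- pi * N\<^sup>2 * E \<le> pi + - (pi * E) + - pi * N\<^sup>2" by (simp add: algebra_simps)
    then show ?thesis unfolding exp_add[symmetric] by (intro mult_left_mono) (auto simp: N_def)
  qed
  also have "\<dots> = 2 * pi\<^sup>2 * exp pi * exp (9 * u - pi * E) * (N ^ 4 * exp (- pi * N\<^sup>2))"
    by (simp add: exp_diff exp_minus field_simps)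
  finally show "Phi_term n u \<le> 2 * pi\<^sup>2 * exp pi * exp (9 * u - pi * exp (4 * u)) * (real (Suc n) ^ 4 * exp (- pi * (real (Suc n))\<^sup>2))"
    by (simp add: N_def E_def)
qed

text \<open>Termwise for \<open>u \<ge> 0\<close>; the terms change sign for negative \<open>u\<close>, and evenness takes over.\<close>
lemma Phi_pos: "Phi u > 0"
proof -
  have "Phi u > 0" if "u \<ge> 0" for u
    unfolding Phi_eq using Phi_term_bounds(1)[OF that] Phi_term_summable by (intro suminf_pos) auto
  from this[of u] this[of "- u"] show ?thesis using Phi_even[of u] by (cases "u \<ge> 0") auto
qed

text \<open>The double exponential decay beats every Gaussian; this makes \<open>H t\<close> meaningful for all \<open>t\<close> and keeps its growth below every \<open>exp (e \<bar>z\<bar>\<^sup>2)\<close>.\<close>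
lemma Phi_gaussian: "\<exists>C. C \<ge> 0 \<and> (\<forall>u. Phi u \<le> C * exp (- a * u\<^sup>2))"
proof -
  define S where "S = (\<Sum>n. real (Suc n) ^ 4 * exp (- pi * (real (Suc n))\<^sup>2))"
  \<comment> \<open>the constants of the two completed squares \<open>(u - 9/2)\<^sup>2\<close> and \<open>(u\<^sup>2 - (a + 1)/2)\<^sup>2\<close>\<close>
  define D where "D = 81 / 4 + (a + 1)\<^sup>2 / 4"
  define C where "C = 2 * pi\<^sup>2 * exp pi * S * exp D"
  have sS: "summable (\<lambda>n. real (Suc n) ^ 4 * exp (- pi * (real (Suc n))\<^sup>2))"
    by (rule summable_poly_exp_square) auto
  have S: "S \<ge> 0" unfolding S_def by (intro suminf_nonneg sS) auto
  have 1: "Phi u \<le> C * exp (- a * u\<^sup>2)" if u: "u \<ge> 0" for u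
  proof -
    have "Phi u \<le> (\<Sum>n. 2 * pi\<^sup>2 * exp pi * exp (9 * u - pi * exp (4 * u)) * (real (Suc n) ^ 4 * exp (- pi * (real (Suc n))\<^sup>2)))"
      unfolding Phi_eq by (intro suminf_le Phi_term_bounds u Phi_term_summable summable_mult sS)
    also have "\<dots> = 2 * pi\<^sup>2 * exp pi * exp (9 * u - pi * exp (4 * u)) * S"
      unfolding S_def by (rule suminf_mult[OF sS])
    also have "\<dots> \<le> 2 * pi\<^sup>2 * exp pi * exp (D - a * u\<^sup>2) * S"
    proof -
      have "(1 + u) ^ 4 \<le> exp u ^ 4" using u by (intro power_mono exp_ge_add_one_self) auto
      also have "\<dots> = exp (4 * u)" by (simp add: exp_of_nat_mult[symmetric])
      finally have "(1 + u) ^ 4 \<le> exp (4 * u)" .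
      moreover have "u ^ 4 \<le> (1 + u) ^ 4" using u by (intro power_mono) auto
      moreover have "exp (4 * u) \<le> pi * exp (4 * u)" using pi_gt3 by simp
      ultimately have "u ^ 4 \<le> pi * exp (4 * u)" by linarith
      moreover have "9 * u \<le> u\<^sup>2 + 81 / 4" using zero_le_power2[of "u - 9 / 2"] by (simp add: power2_eq_square algebra_simps)
      moreover have "(a + 1) * u\<^sup>2 \<le> u ^ 4 + (a + 1)\<^sup>2 / 4"
        using zero_le_power2[of "u\<^sup>2 - (a + 1) / 2"] by (simp add: power2_eq_square power4_eq_xxxx algebra_simps add_divide_distrib)
      ultimately have "9 * u - pi * exp (4 * u) \<le> D - a * u\<^sup>2"
        unfolding D_def by (simp add: algebra_simps)
      then show ?thesis using S by (intro mult_right_mono mult_left_mono) auto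
    qed
    finally show ?thesis by (simp add: C_def exp_diff exp_minus field_simps)
  qed
  have "Phi u \<le> C * exp (- a * u\<^sup>2)" for u
    using 1[of u] 1[of "- u"] Phi_even[of u] by (cases "u \<ge> 0") auto
  moreover have "C \<ge> 0" using S by (simp add: C_def)
  ultimately show ?thesis by blast
qed

lemma Phi_measurable [measurable]: "Phi \<in> borel_measurable borel"
  unfolding Phi_def[abs_def] by measurable

lemma Phi_integrable:
  "integrable lborel (\<lambda>u. Phi u * \<bar>u\<bar> ^ j * exp (t * u\<^sup>2 + b * \<bar>u\<bar>))"
proof -
  define D where "D = \<bar>b\<bar> + 1"
  obtain C where C: "C \<ge> 0" "\<And>u. Phi u \<le> C * exp (- (t + 2) * u\<^sup>2)" using Phi_gaussian[of "t + 2"] by blast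
  have i: "integrable lborel (\<lambda>u. C * fact j * exp (D\<^sup>2) * exp (- 1 * u\<^sup>2 + 0 * u))"
    by (intro integrable_mult_right gauss_integral_real) auto
  show ?thesis
  proof (rule Bochner_Integration.integrable_bound[OF i])
    show "AE u in lborel. norm (Phi u * \<bar>u\<bar> ^ j * exp (t * u\<^sup>2 + b * \<bar>u\<bar>)) \<le> norm (C * fact j * exp (D\<^sup>2) * exp (- 1 * u\<^sup>2 + 0 * u))"
    proof (rule AE_I2)
      fix u :: real
      have uj: "\<bar>u\<bar> ^ j \<le> fact j * exp \<bar>u\<bar>"
      proof -
        have "\<bar>u\<bar> ^ j / fact j \<le> (\<Sum>n. \<bar>u\<bar> ^ n /\<^sub>R fact n)"
          using sum_le_suminf[OF summable_exp_generic[of "\<bar>u\<bar>"], of "{j}"] by (simp add: divide_inverse mult.commute)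
        then show ?thesis by (simp add: exp_def field_simps)
      qed
      have ub: "exp \<bar>u\<bar> * exp (b * \<bar>u\<bar>) \<le> exp (D\<^sup>2) * exp (u\<^sup>2)"
      proof -
        have "\<bar>u\<bar> + b * \<bar>u\<bar> \<le> D * \<bar>u\<bar>" by (simp add: D_def algebra_simps mult_right_mono)
        also have "\<dots> \<le> D\<^sup>2 + u\<^sup>2"
        proof -
          have "0 \<le> (D - \<bar>u\<bar>)\<^sup>2" "0 \<le> D * \<bar>u\<bar>" by (auto simp: D_def)
          then show ?thesis by (simp add: power2_eq_square algebra_simps)
        qed
        finally show ?thesis by (simp flip: exp_add)
      qed
      have "Phi u * \<bar>u\<bar> ^ j * exp (t * u\<^sup>2 + b * \<bar>u\<bar>) \<le> (C * exp (- (t + 2) * u\<^sup>2)) * (fact j * exp \<bar>u\<bar>) * exp (t * u\<^sup>2 + b * \<bar>u\<bar>)"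
        using C(1) C(2)[of u] uj Phi_pos[of u] by (intro mult_mono mult_nonneg_nonneg) auto
      also have "\<dots> = C * fact j * (exp (- (t + 2) * u\<^sup>2) * exp (t * u\<^sup>2) * (exp \<bar>u\<bar> * exp (b * \<bar>u\<bar>)))"
        by (simp add: exp_add)
      also have "\<dots> \<le> C * fact j * (exp (- (t + 2) * u\<^sup>2) * exp (t * u\<^sup>2) * (exp (D\<^sup>2) * exp (u\<^sup>2)))"
        using ub C(1) by (intro mult_left_mono) auto
      also have "\<dots> = C * fact j * exp (D\<^sup>2) * exp (- 1 * u\<^sup>2 + 0 * u)"
        by (simp add: algebra_simps flip: exp_add)
      finally show "norm (Phi u * \<bar>u\<bar> ^ j * exp (t * u\<^sup>2 + b * \<bar>u\<bar>)) \<le> norm (C * fact j * exp (D\<^sup>2) * exp (- 1 * u\<^sup>2 + 0 * u))"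
        using Phi_pos[of u] C(1) by (simp add: abs_mult)
    qed
  qed measurable
qed

section \<open>Analyticity, heat equation and Gaussian averaging\<close>

text \<open>Differentiability from a quadratic remainder, for differentiation under the integral sign in two variables at once.\<close>
lemma has_derivative_quadratic:
  fixes f :: "'a :: real_normed_vector \<Rightarrow> 'b :: real_normed_vector"
  assumes D: "bounded_linear D"
    and bd: "\<And>h. norm h \<le> 1 \<Longrightarrow> norm (f (x + h) - f x - D h) \<le> C * (norm h)\<^sup>2"
  shows "(f has_derivative D) (at x)"
  unfolding has_derivative_at
proof (rule conjI[OF D], rule Lim_null_comparison)
  have "\<forall>\<^sub>F h::'a in at 0. norm h < 1"
    using eventually_at_ball[of 1 "0::'a" UNIV] by simp
  then show "\<forall>\<^sub>F h in at 0. norm (norm (f (x + h) - f x - D h) / norm h) \<le> C * norm h"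
  proof eventually_elim
    case (elim h)
    then show ?case using bd[of h] by (cases "h = 0") (auto simp: divide_le_eq power2_eq_square mult.assoc)
  qed
  show "((\<lambda>h. C * norm h) \<longlongrightarrow> 0) (at 0)"
    by (auto intro!: tendsto_eq_intros)
qed

lemma norm_exp_remainder: "norm (exp z - 1 - z) \<le> exp \<bar>Re z\<bar> * (norm z)\<^sup>2" for z :: complex
  using Taylor_exp[of z 1] by (simp add: numeral_2_eq_2 diff_diff_eq)

definition Hm_fun :: "nat \<Rightarrow> real \<Rightarrow> complex \<Rightarrow> real \<Rightarrow> complex" where
  "Hm_fun j t z u = of_real (Phi u * u ^ j) * exp (of_real (t * u\<^sup>2) - \<i> * z * of_real u)"

text \<open>The moments \<open>\<integral> Phi u u\<^sup>j exp (t u\<^sup>2 - \<i> z u) du / 2\<close> over the whole line.  As \<open>Phi\<close> is even, the case \<open>j = 0\<close> is \<open>H\<close>, and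
  differentiation in \<open>z\<close> and in \<open>t\<close> raises \<open>j\<close> by 1 and 2.\<close>
definition Hm :: "nat \<Rightarrow> real \<Rightarrow> complex \<Rightarrow> complex" where
  "Hm j t z = (LINT u|lborel. Hm_fun j t z u) / 2"

lemma Hm_fun_measurable [measurable]: "Hm_fun j t z \<in> borel_measurable borel"
  unfolding Hm_fun_def[abs_def] by measurable

lemma norm_Hm_fun: "norm (Hm_fun j t z u) = Phi u * \<bar>u\<bar> ^ j * exp (t * u\<^sup>2 + Im z * u)"
  using Phi_pos[of u] by (simp add: Hm_fun_def norm_mult norm_power power_abs abs_mult del: of_real_mult of_real_power)

lemma norm_Hm_fun_le: "norm (Hm_fun j t z u) \<le> Phi u * \<bar>u\<bar> ^ j * exp (t * u\<^sup>2 + norm z * \<bar>u\<bar>)"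
proof -
  have "Im z * u \<le> \<bar>Im z\<bar> * \<bar>u\<bar>" by (metis abs_ge_self abs_mult)
  also have "\<dots> \<le> norm z * \<bar>u\<bar>" by (intro mult_right_mono abs_Im_le_cmod) auto
  finally show ?thesis unfolding norm_Hm_fun using Phi_pos[of u] by (intro mult_left_mono) auto
qed

lemma Hm_integrable: "integrable lborel (Hm_fun j t z)"
  by (rule Bochner_Integration.integrable_bound[OF Phi_integrable[of j t "norm z"]])
     (use norm_Hm_fun_le Phi_pos in \<open>auto intro!: AE_I2 order_trans[OF norm_Hm_fun_le]\<close>)

text \<open>Joint differentiability in \<open>(t, z)\<close>.  For \<open>j = 0\<close> it contains the backward heat equation, as \<open>\<partial>\<^sub>t H = Hm 2 = - H''\<close>.\<close>
lemma Hm_has_derivative: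
  "((\<lambda>p. Hm j (fst p) (snd p)) has_derivative (\<lambda>q. of_real (fst q) * Hm (j + 2) t z - \<i> * snd q * Hm (j + 1) t z)) (at (t, z))"
proof -
  \<comment> \<open>a majorant for the quadratic remainder, uniform over increments of norm at most 1\<close>
  define W where "W u = Phi u * \<bar>u\<bar> ^ j * exp ((t + 1) * u\<^sup>2 + (norm z + 1) * \<bar>u\<bar>) * (u\<^sup>2 + \<bar>u\<bar>)\<^sup>2" for u
  have W_eq: "W = (\<lambda>u. Phi u * \<bar>u\<bar> ^ (j + 4) * exp ((t + 1) * u\<^sup>2 + (norm z + 1) * \<bar>u\<bar>)
     + 2 * (Phi u * \<bar>u\<bar> ^ (j + 3) * exp ((t + 1) * u\<^sup>2 + (norm z + 1) * \<bar>u\<bar>))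
     + Phi u * \<bar>u\<bar> ^ (j + 2) * exp ((t + 1) * u\<^sup>2 + (norm z + 1) * \<bar>u\<bar>))"
  proof
    fix u :: real
    have "(u\<^sup>2 + \<bar>u\<bar>)\<^sup>2 = \<bar>u\<bar> ^ 4 + 2 * \<bar>u\<bar> ^ 3 + \<bar>u\<bar> ^ 2"
      by (simp add: power2_eq_square power3_eq_cube power4_eq_xxxx algebra_simps abs_mult_self_eq)
    then show "W u = Phi u * \<bar>u\<bar> ^ (j + 4) * exp ((t + 1) * u\<^sup>2 + (norm z + 1) * \<bar>u\<bar>)
     + 2 * (Phi u * \<bar>u\<bar> ^ (j + 3) * exp ((t + 1) * u\<^sup>2 + (norm z + 1) * \<bar>u\<bar>))
     + Phi u * \<bar>u\<bar> ^ (j + 2) * exp ((t + 1) * u\<^sup>2 + (norm z + 1) * \<bar>u\<bar>)"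
      unfolding W_def power_add by (simp only: distrib_left distrib_right mult_ac)
  qed
  have W: "integrable lborel W"
    unfolding W_eq by (intro Bochner_Integration.integrable_add integrable_mult_right Phi_integrable)
  show ?thesis
  proof (rule has_derivative_quadratic)
    show "bounded_linear (\<lambda>q. of_real (fst q) * Hm (j + 2) t z - \<i> * snd q * Hm (j + 1) t z)"
      by (intro bounded_linear_intros bounded_linear_compose[OF bounded_linear_of_real])
    fix p :: "real \<times> complex" assume p: "norm p \<le> 1"
    define k h where "k = fst p" and "h = snd p"
    define d where "d = norm p"
    have kh: "\<bar>k\<bar> \<le> d" "norm h \<le> d" "0 \<le> d" "d \<le> 1"
      using p norm_fst_le[of "fst p" "snd p"] norm_snd_le[of "snd p" "fst p"] by (auto simp: k_def h_def d_def)
    define q where "q u = of_real (k * u\<^sup>2) - \<i> * h * of_real u" for u :: real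
    have q: "norm (q u) \<le> d * (u\<^sup>2 + \<bar>u\<bar>)" for u
    proof -
      have "norm (q u) \<le> \<bar>k\<bar> * u\<^sup>2 + norm h * \<bar>u\<bar>"
        unfolding q_def by (rule order_trans[OF norm_triangle_ineq4]) (simp add: norm_mult norm_power abs_mult)
      also have "\<dots> \<le> d * u\<^sup>2 + d * \<bar>u\<bar>" using kh by (intro add_mono mult_right_mono) auto
      finally show ?thesis by (simp add: algebra_simps)
    qed
    have eq: "Hm_fun j (t + k) (z + h) u - Hm_fun j t z u - (of_real k * Hm_fun (j + 2) t z u - \<i> * h * Hm_fun (j + 1) t z u)
        = Hm_fun j t z u * (exp (q u) - 1 - q u)" for u
    proof -
      have "of_real ((t + k) * u\<^sup>2) - \<i> * (z + h) * of_real u = (of_real (t * u\<^sup>2) - \<i> * z * of_real u) + q u"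
        by (simp add: q_def algebra_simps)
      then have 1: "Hm_fun j (t + k) (z + h) u = Hm_fun j t z u * exp (q u)"
        by (simp only: Hm_fun_def exp_add mult.assoc)
      have 2: "of_real k * Hm_fun (j + 2) t z u - \<i> * h * Hm_fun (j + 1) t z u = Hm_fun j t z u * q u"
        by (simp add: Hm_fun_def q_def power2_eq_square algebra_simps)
      show ?thesis unfolding 1 2 by (simp add: algebra_simps)
    qed
    have bd: "norm (Hm_fun j t z u * (exp (q u) - 1 - q u)) \<le> d\<^sup>2 * W u" for u
    proof -
      have q1: "norm (q u) \<le> u\<^sup>2 + \<bar>u\<bar>"
        using q[of u] mult_right_mono[of d 1 "u\<^sup>2 + \<bar>u\<bar>"] kh by simp
      have "norm (exp (q u) - 1 - q u) \<le> exp \<bar>Re (q u)\<bar> * (norm (q u))\<^sup>2" by (rule norm_exp_remainder)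
      also have "\<dots> \<le> exp (u\<^sup>2 + \<bar>u\<bar>) * (d * (u\<^sup>2 + \<bar>u\<bar>))\<^sup>2"
        using q1 q[of u] abs_Re_le_cmod[of "q u"] by (intro mult_mono power_mono) auto
      finally have e: "norm (exp (q u) - 1 - q u) \<le> exp (u\<^sup>2 + \<bar>u\<bar>) * (d * (u\<^sup>2 + \<bar>u\<bar>))\<^sup>2" .
      have "norm (Hm_fun j t z u * (exp (q u) - 1 - q u)) \<le>
          (Phi u * \<bar>u\<bar> ^ j * exp (t * u\<^sup>2 + norm z * \<bar>u\<bar>)) * (exp (u\<^sup>2 + \<bar>u\<bar>) * (d * (u\<^sup>2 + \<bar>u\<bar>))\<^sup>2)"
        unfolding norm_mult using e Phi_pos[of u] by (intro mult_mono norm_Hm_fun_le) auto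
      also have "\<dots> = d\<^sup>2 * (Phi u * \<bar>u\<bar> ^ j * (exp (t * u\<^sup>2 + norm z * \<bar>u\<bar>) * exp (u\<^sup>2 + \<bar>u\<bar>)) * (u\<^sup>2 + \<bar>u\<bar>)\<^sup>2)"
        by (simp only: power_mult_distrib mult_ac)
      also have "exp (t * u\<^sup>2 + norm z * \<bar>u\<bar>) * exp (u\<^sup>2 + \<bar>u\<bar>) = exp ((t + 1) * u\<^sup>2 + (norm z + 1) * \<bar>u\<bar>)"
        by (simp add: algebra_simps flip: exp_add)
      finally show ?thesis by (simp add: W_def)
    qed
    have eqI: "(LINT u|lborel. Hm_fun j t z u * (exp (q u) - 1 - q u)) =
      (LINT u|lborel. Hm_fun j (t + k) (z + h) u) - (LINT u|lborel. Hm_fun j t z u)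
      - (of_real k * (LINT u|lborel. Hm_fun (j + 2) t z u) - \<i> * h * (LINT u|lborel. Hm_fun (j + 1) t z u))"
      unfolding eq[symmetric] using Hm_integrable
      by (subst Bochner_Integration.integral_diff | simp)+
    have "Hm j (t + k) (z + h) - Hm j t z - (of_real k * Hm (j + 2) t z - \<i> * h * Hm (j + 1) t z)
      = (LINT u|lborel. Hm_fun j t z u * (exp (q u) - 1 - q u)) / 2"
      unfolding eqI Hm_def by (simp add: diff_divide_distrib)
    also have "norm \<dots> \<le> (LINT u|lborel. norm (Hm_fun j t z u * (exp (q u) - 1 - q u))) / 2"
      by (simp add: norm_divide integral_norm_bound)
    also have "\<dots> \<le> (LINT u|lborel. d\<^sup>2 * W u) / 2"
    proof (intro divide_right_mono integral_mono_AE' AE_I2)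
      show "integrable lborel (\<lambda>u. d\<^sup>2 * W u)" using W by (intro integrable_mult_right)
      show "0 \<le> d\<^sup>2 * W u" for u using Phi_pos[of u] by (auto simp: W_def)
    qed (use bd in auto)
    also have "\<dots> = (integral\<^sup>L lborel W / 2) * (norm p)\<^sup>2" by (simp add: d_def)
    finally show "norm (Hm j (fst ((t, z) + p)) (snd ((t, z) + p)) - Hm j (fst (t, z)) (snd (t, z)) -
       (of_real (fst p) * Hm (j + 2) t z - \<i> * snd p * Hm (j + 1) t z)) \<le> (integral\<^sup>L lborel W / 2) * (norm p)\<^sup>2"
      by (simp add: k_def h_def)
  qed
qed

lemma Hm_continuous: "continuous_on S (\<lambda>p. Hm j (fst p) (snd p))"
proof (intro continuous_at_imp_continuous_on ballI)
  fix p :: "real \<times> complex"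
  obtain t z where p: "p = (t, z)" by (cases p)
  show "isCont (\<lambda>p. Hm j (fst p) (snd p)) p"
    unfolding p by (rule has_derivative_continuous[OF Hm_has_derivative])
qed

lemma Hm_field_derivative: "(Hm j t has_field_derivative - \<i> * Hm (j + 1) t z) (at z)"
proof -
  have "((\<lambda>z. (t, z)) has_derivative (\<lambda>h. (0, h))) (at z)"
    by (auto intro!: derivative_eq_intros)
  from has_derivative_compose[OF this Hm_has_derivative[of j t z]]
  have "(Hm j t has_derivative (\<lambda>h. - \<i> * h * Hm (j + 1) t z)) (at z)" by simp
  moreover have "(\<lambda>h. - \<i> * h * Hm (j + 1) t z) = (*) (- \<i> * Hm (j + 1) t z)"
    by (simp add: fun_eq_iff mult_ac)
  ultimately show ?thesis by (simp add: has_field_derivative_def)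
qed

lemma Hm_even: "Hm 0 t (- z) = Hm 0 t z"
proof -
  have "(LINT u|lborel. Hm_fun 0 t z u) = \<bar>- 1\<bar> *\<^sub>R (LINT u|lborel. Hm_fun 0 t z (0 + - 1 * u))"
    by (rule lborel_integral_real_affine) simp
  moreover have "(\<lambda>u. Hm_fun 0 t z (0 + - 1 * u)) = Hm_fun 0 t (- z)"
    by (simp add: Hm_fun_def Phi_even fun_eq_iff)
  ultimately show ?thesis by (simp add: Hm_def)
qed

lemma Hm_cnj: "Hm 0 t (cnj z) = cnj (Hm 0 t z)"
proof -
  have "cnj (Hm_fun 0 t z u) = Hm_fun 0 t (- cnj z) u" for u
    by (simp add: Hm_fun_def exp_cnj)
  then have "(LINT u|lborel. cnj (Hm_fun 0 t z u)) = (LINT u|lborel. Hm_fun 0 t (- cnj z) u)"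
    by (simp only:)
  then have "cnj (Hm 0 t z) = Hm 0 t (- cnj z)"
    by (simp add: Hm_def)
  then show ?thesis by (simp add: Hm_even)
qed

lemma H_eq: "H t z = Hm 0 t z"
proof -
  define g where "g u = of_real (exp (t * u\<^sup>2) * Phi u) * cos (z * of_real u)" for u
  have g: "g u = (Hm_fun 0 t z u + Hm_fun 0 t (- z) u) / 2" for u
  proof -
    have "cos (z * of_real u) = (exp (\<i> * (z * of_real u)) + exp (- \<i> * (z * of_real u))) / 2"
      by (simp add: cos_exp_eq)
    moreover have "Hm_fun 0 t z u = of_real (exp (t * u\<^sup>2) * Phi u) * exp (- \<i> * (z * of_real u))"
      "Hm_fun 0 t (- z) u = of_real (exp (t * u\<^sup>2) * Phi u) * exp (\<i> * (z * of_real u))"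
      by (simp_all add: Hm_fun_def exp_diff exp_add exp_minus exp_of_real[symmetric] field_simps)
    ultimately show ?thesis unfolding g_def by (simp only: distrib_left[symmetric] times_divide_eq_right add.commute)
  qed
  have ig: "integrable lborel g" unfolding g[abs_def] using Hm_integrable by (intro Bochner_Integration.integrable_add integrable_divide) auto
  have [measurable]: "g \<in> borel_measurable borel" using ig by simp
  have "(LINT u|lborel. g u) = ((LINT u|lborel. Hm_fun 0 t z u) + (LINT u|lborel. Hm_fun 0 t (- z) u)) / 2"
    unfolding g using Hm_integrable by simp
  also have "\<dots> = 2 * Hm 0 t z"
    using Hm_even[of t z] by (simp add: Hm_def)
  finally have 1: "(LINT u|lborel. g u) = 2 * Hm 0 t z" .
  have i: "integrable lborel (\<lambda>u. indicator A u *\<^sub>R g u)" if "A \<in> sets borel" for A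
    using ig that by (intro integrable_mult_indicator) auto
  have "(LINT u|lborel. g u) = (LINT u|lborel. indicator {0..} u *\<^sub>R g u + indicator {..<0} u *\<^sub>R g u)"
    by (rule Bochner_Integration.integral_cong) (auto simp: indicator_def)
  also have "\<dots> = (LINT u|lborel. indicator {0..} u *\<^sub>R g u) + (LINT u|lborel. indicator {..<0} u *\<^sub>R g u)"
    using i by (intro Bochner_Integration.integral_add) auto
  also have "(LINT u|lborel. indicator {..<0} u *\<^sub>R g u) = \<bar>- 1\<bar> *\<^sub>R (LINT u|lborel. indicator {..<0} (0 + - 1 * u) *\<^sub>R g (0 + - 1 * u))"
    by (rule lborel_integral_real_affine) simp
  also have "\<dots> = (LINT u|lborel. indicator {0<..} u *\<^sub>R g u)"
    by (simp add: g_def Phi_even indicator_def)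
  also have "\<dots> = (LINT u|lborel. indicator {0..} u *\<^sub>R g u)"
  proof (rule integral_cong_AE)
    show "AE u in lborel. indicator {0<..} u *\<^sub>R g u = indicator {0..} u *\<^sub>R g u"
      using AE_lborel_singleton[of "0::real"] by eventually_elim (auto simp: indicator_def)
  qed measurable
  finally have "(LINT u|lborel. indicator {0..} u *\<^sub>R g u) = Hm 0 t z" using 1 by simp
  then show ?thesis by (simp add: H_def set_lebesgue_integral_def g_def)
qed

lemma H_eq': "H t = Hm 0 t"
  by (rule ext) (rule H_eq)

lemma deriv_H: "deriv (H t) = (\<lambda>z. - \<i> * Hm 1 t z)"
  unfolding H_eq' using Hm_field_derivative[of 0 t] by (auto intro!: ext DERIV_imp_deriv)

lemma deriv_deriv_H: "deriv (deriv (H t)) = (\<lambda>z. - Hm 2 t z)"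
proof
  fix z
  have "((\<lambda>z. - \<i> * Hm 1 t z) has_field_derivative - \<i> * (- \<i> * Hm (1 + 1) t z)) (at z)"
    by (intro DERIV_cmult Hm_field_derivative)
  then show "deriv (deriv (H t)) z = - Hm 2 t z"
    unfolding deriv_H by (auto intro!: DERIV_imp_deriv simp: numeral_2_eq_2)
qed

text \<open>\<open>H t 0 > 0\<close> by the positivity of \<open>Phi\<close>, and the growth condition follows from
  \<open>\<bar>z\<bar> \<bar>u\<bar> \<le> e \<bar>z\<bar>\<^sup>2 + u\<^sup>2 / (4 e)\<close>, whose last term is absorbed by \<open>Phi\<close>.\<close>
lemma H_real_even_entire: "real_even_entire (H t)"
proof
  show "H t holomorphic_on UNIV"
    unfolding H_eq' holomorphic_on_def field_differentiable_def using Hm_field_derivative by blast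
  show "H t (- z) = H t z" "H t (cnj z) = cnj (H t z)" for z
    unfolding H_eq by (rule Hm_even, rule Hm_cnj)
  show "H t 0 \<noteq> 0"
  proof
    assume "H t 0 = 0"
    have eq: "Hm_fun 0 t 0 u = complex_of_real (Phi u * exp (t * u\<^sup>2))" for u
      by (simp add: Hm_fun_def exp_of_real[symmetric])
    have i: "integrable lborel (\<lambda>u. Phi u * exp (t * u\<^sup>2))"
      using Phi_integrable[of 0 t 0] by simp
    have "(LINT u|lborel. Phi u * exp (t * u\<^sup>2)) = 0"
      using \<open>H t 0 = 0\<close> unfolding H_eq Hm_def eq by (simp add: integral_complex_of_real del: of_real_mult)
    then have "AE u in lborel. Phi u * exp (t * u\<^sup>2) = 0"
      using i Phi_pos by (subst (asm) integral_nonneg_eq_0_iff_AE) (auto intro!: AE_I2 mult_nonneg_nonneg less_imp_le)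
    moreover have "Phi u * exp (t * u\<^sup>2) \<noteq> 0" for u using Phi_pos[of u] by simp
    ultimately have "AE u in lborel. (u::real) \<noteq> u" by simp
    then show False
      using AE_iff_measurable[of UNIV "lborel :: real measure"] by (simp add: eventually_False trivial_limit_def[symmetric] ae_filter_eq_bot_iff)
  qed
  show "\<exists>C. \<forall>z. norm (H t z) \<le> C * exp (e * (norm z)\<^sup>2)" if e: "e > 0" for e
  proof (intro exI allI)
    fix z
    define s where "s = t + 1 / (4 * e)"
    have le: "norm (Hm_fun 0 t z u) \<le> exp (e * (norm z)\<^sup>2) * (Phi u * exp (s * u\<^sup>2))" for u
    proof -
      have "0 \<le> (sqrt e * norm z - \<bar>u\<bar> / (2 * sqrt e))\<^sup>2" by simp
      also have "\<dots> = e * (norm z)\<^sup>2 - norm z * \<bar>u\<bar> + u\<^sup>2 / (4 * e)"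
        using e by (simp add: power2_diff power_mult_distrib power_divide)
      finally have "t * u\<^sup>2 + norm z * \<bar>u\<bar> \<le> e * (norm z)\<^sup>2 + s * u\<^sup>2"
        by (simp add: s_def algebra_simps)
      then have "Phi u * exp (t * u\<^sup>2 + norm z * \<bar>u\<bar>) \<le> Phi u * exp (e * (norm z)\<^sup>2 + s * u\<^sup>2)"
        using Phi_pos[of u] by (intro mult_left_mono) auto
      then show ?thesis using norm_Hm_fun_le[of 0 t z u] by (simp add: exp_add mult_ac)
    qed
    have "norm (H t z) \<le> (LINT u|lborel. norm (Hm_fun 0 t z u)) / 2"
      unfolding H_eq Hm_def by (simp add: norm_divide integral_norm_bound)
    also have "\<dots> \<le> (LINT u|lborel. exp (e * (norm z)\<^sup>2) * (Phi u * exp (s * u\<^sup>2))) / 2"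
    proof (intro divide_right_mono integral_mono_AE' AE_I2)
      show "integrable lborel (\<lambda>u. exp (e * (norm z)\<^sup>2) * (Phi u * exp (s * u\<^sup>2)))"
        using Phi_integrable[of 0 s 0] by (intro integrable_mult_right) simp
    qed (use le Phi_pos in \<open>auto intro!: mult_nonneg_nonneg less_imp_le\<close>)
    also have "\<dots> = ((LINT u|lborel. Phi u * exp ((t + 1 / (4 * e)) * u\<^sup>2)) / 2) * exp (e * (norm z)\<^sup>2)"
      by (simp add: s_def)
    finally show "norm (H t z) \<le> ((LINT u|lborel. Phi u * exp ((t + 1 / (4 * e)) * u\<^sup>2)) / 2) * exp (e * (norm z)\<^sup>2)" .
  qed
qed

text \<open>The density of the normal distribution with variance \<open>t / 2\<close>.\<close>
definition gauss :: "real \<Rightarrow> real \<Rightarrow> real" where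
  "gauss t v = exp (- v\<^sup>2 / t) / sqrt (pi * t)"

lemma gauss_exp_integral:
  fixes b :: complex
  assumes t: "t > 0"
  shows "integrable lborel (\<lambda>v. of_real (gauss t (v - h)) * exp (b * of_real v))"
    "(LINT v|lborel. of_real (gauss t (v - h)) * exp (b * of_real v)) = exp (b * of_real h + b\<^sup>2 * of_real t / 4)"
proof -
  have a: "1 / t > 0" using t by simp
  define B where "B = b + of_real (2 * h / t)"
  define K where "K = complex_of_real (exp (- h\<^sup>2 / t) / sqrt (pi * t))"
  have eq: "of_real (gauss t (v - h)) * exp (b * of_real v) = K * exp (of_real (- (1 / t) * v\<^sup>2) + B * of_real v)" for v
  proof -
    have "complex_of_real (exp (- (v - h)\<^sup>2 / t)) = exp (of_real (- (v - h)\<^sup>2 / t))" by (simp only: exp_of_real)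
    moreover have "of_real (- (v - h)\<^sup>2 / t) + b * of_real v = of_real (- h\<^sup>2 / t) + (of_real (- (1 / t) * v\<^sup>2) + B * of_real v)"
      using t by (simp add: B_def power2_eq_square field_simps)
    ultimately have "complex_of_real (exp (- (v - h)\<^sup>2 / t)) * exp (b * of_real v) = exp (of_real (- h\<^sup>2 / t) + (of_real (- (1 / t) * v\<^sup>2) + B * of_real v))"
      by (simp only: exp_add[symmetric])
    also have "\<dots> = of_real (exp (- h\<^sup>2 / t)) * exp (of_real (- (1 / t) * v\<^sup>2) + B * of_real v)"
      by (simp only: exp_add exp_of_real)
    finally have "complex_of_real (exp (- (v - h)\<^sup>2 / t)) * exp (b * of_real v) = of_real (exp (- h\<^sup>2 / t)) * exp (of_real (- (1 / t) * v\<^sup>2) + B * of_real v)" .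
    then show ?thesis by (simp add: gauss_def K_def)
  qed
  show "integrable lborel (\<lambda>v. of_real (gauss t (v - h)) * exp (b * of_real v))"
    unfolding eq by (intro integrable_mult_right gauss_integral(1)[OF a])
  have "(LINT v|lborel. of_real (gauss t (v - h)) * exp (b * of_real v)) = K * (of_real (sqrt (pi / (1 / t))) * exp (B\<^sup>2 / of_real (4 * (1 / t))))"
    unfolding eq using gauss_integral[OF a, of B] by simp
  also have "\<dots> = of_real (exp (- h\<^sup>2 / t)) * exp (B\<^sup>2 * of_real t / 4)"
    using t by (simp add: K_def)
  also have "\<dots> = exp (of_real (- h\<^sup>2 / t) + B\<^sup>2 * of_real t / 4)"
    by (simp only: exp_add exp_of_real)
  also have "of_real (- h\<^sup>2 / t) + B\<^sup>2 * of_real t / 4 = b * of_real h + b\<^sup>2 * of_real t / 4"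
    using t by (simp add: B_def power2_eq_square field_simps)
  finally show "(LINT v|lborel. of_real (gauss t (v - h)) * exp (b * of_real v)) = exp (b * of_real h + b\<^sup>2 * of_real t / 4)" .
qed

lemma gauss_nonneg: "t > 0 \<Longrightarrow> gauss t v \<ge> 0" by (simp add: gauss_def)

lemma gauss_measurable [measurable]: "gauss t \<in> borel_measurable borel"
  unfolding gauss_def[abs_def] by measurable

text \<open>The heat flow as a Gaussian average along a vertical line.  Vertical lines appear because
  \<open>exp (t u\<^sup>2)\<close> is the average of the real exponentials \<open>exp (2 u v)\<close>, which are produced by imaginary shifts of the argument.\<close>
lemma H_gauss_average:
  assumes t: "t > 0"
  shows "integrable lborel (\<lambda>v. of_real (gauss t (v - h)) * H 0 (Complex x (2 * v)))"
    and "H t (Complex x (2 * h)) = (LINT v|lborel. of_real (gauss t (v - h)) * H 0 (Complex x (2 * v)))"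
proof -
  define F where "F u v = of_real (gauss t (v - h)) * Hm_fun 0 0 (Complex x (2 * v)) u" for u v :: real
  have Fe: "F u v = of_real (Phi u) * exp (- \<i> * of_real (x * u)) * (of_real (gauss t (v - h)) * exp (of_real (2 * u) * of_real v))" for u v
  proof -
    have "Hm_fun 0 0 (Complex x (2 * v)) u = of_real (Phi u) * (exp (- \<i> * of_real (x * u)) * exp (of_real (2 * u) * of_real v))"
      unfolding Hm_fun_def exp_add[symmetric] by (simp add: Complex_eq algebra_simps)
    then show ?thesis by (simp add: F_def)
  qed
  have Fm: "(\<lambda>(u, v). F u v) \<in> borel_measurable (lborel \<Otimes>\<^sub>M lborel)"
    unfolding Fe by measurable
  have i1: "integrable lborel (\<lambda>v. F u v)" for u
    unfolding Fe by (intro integrable_mult_right gauss_exp_integral(1)[OF t])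
  have I1: "(LINT v|lborel. F u v) = Hm_fun 0 t (Complex x (2 * h)) u" for u
  proof -
    have "(LINT v|lborel. F u v) = of_real (Phi u) * exp (- \<i> * of_real (x * u)) * exp (of_real (2 * u) * of_real h + (of_real (2 * u))\<^sup>2 * of_real t / 4)"
      unfolding Fe by (subst integral_mult_right_zero) (simp only: gauss_exp_integral(2)[OF t])
    also have "\<dots> = of_real (Phi u) * (exp (- \<i> * of_real (x * u)) * exp (of_real (2 * u) * of_real h + (of_real (2 * u))\<^sup>2 * of_real t / 4))"
      by (simp only: mult.assoc)
    also have "\<dots> = Hm_fun 0 t (Complex x (2 * h)) u"
      unfolding Hm_fun_def exp_add[symmetric] by (simp add: Complex_eq algebra_simps power2_eq_square)
    finally show ?thesis .
  qed
  have nF: "norm (F u v) = Re (of_real (Phi u) * (of_real (gauss t (v - h)) * exp (of_real (2 * u) * of_real v)))" for u v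
  proof -
    have "exp (complex_of_real (2 * u) * of_real v) = of_real (exp (2 * u * v))" by (simp flip: exp_of_real)
    then show ?thesis using Phi_pos[of u] gauss_nonneg[OF t, of "v - h"] unfolding Fe by (simp add: norm_mult)
  qed
  have nI: "(LINT v|lborel. norm (F u v)) = Phi u * exp (t * u\<^sup>2 + 2 * h * u)" for u
  proof -
    have "(LINT v|lborel. norm (F u v)) = Re (LINT v|lborel. of_real (Phi u) * (of_real (gauss t (v - h)) * exp (of_real (2 * u) * of_real v)))"
      unfolding nF by (rule integral_Re) (intro integrable_mult_right gauss_exp_integral(1)[OF t])
    also have "\<dots> = Re (of_real (Phi u) * exp (of_real (2 * u) * of_real h + (of_real (2 * u))\<^sup>2 * of_real t / 4))"
      by (subst integral_mult_right_zero) (simp only: gauss_exp_integral(2)[OF t])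
    also have "exp (of_real (2 * u) * of_real h + (of_real (2 * u))\<^sup>2 * of_real t / 4) = complex_of_real (exp (t * u\<^sup>2 + 2 * h * u))"
      by (simp add: power2_eq_square algebra_simps flip: exp_of_real)
    finally show ?thesis by simp
  qed
  have "integrable lborel (\<lambda>u. Phi u * exp (t * u\<^sup>2 + 2 * h * u))"
  proof (rule Bochner_Integration.integrable_bound[OF Phi_integrable[of 0 t "\<bar>2 * h\<bar>"]])
    show "AE u in lborel. norm (Phi u * exp (t * u\<^sup>2 + 2 * h * u)) \<le> norm (Phi u * \<bar>u\<bar> ^ 0 * exp (t * u\<^sup>2 + \<bar>2 * h\<bar> * \<bar>u\<bar>))"
    proof (rule AE_I2)
      fix u :: real
      have "2 * h * u \<le> \<bar>2 * h\<bar> * \<bar>u\<bar>" by (metis abs_ge_self abs_mult)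
      then have "Phi u * exp (t * u\<^sup>2 + 2 * h * u) \<le> Phi u * exp (t * u\<^sup>2 + \<bar>2 * h\<bar> * \<bar>u\<bar>)"
        using Phi_pos[of u] by (intro mult_left_mono) auto
      then show "norm (Phi u * exp (t * u\<^sup>2 + 2 * h * u)) \<le> norm (Phi u * \<bar>u\<bar> ^ 0 * exp (t * u\<^sup>2 + \<bar>2 * h\<bar> * \<bar>u\<bar>))"
        using Phi_pos[of u] by (simp add: norm_mult)
    qed
  qed measurable
  then have iF: "integrable (lborel \<Otimes>\<^sub>M lborel) (\<lambda>(u, v). F u v)"
    by (intro lborel_pair.Fubini_integrable Fm) (use i1 nI in auto)
  have Hv: "of_real (gauss t (v - h)) * H 0 (Complex x (2 * v)) = (LINT u|lborel. F u v) / 2" for v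
    unfolding H_eq Hm_def F_def using Hm_integrable by simp
  show "integrable lborel (\<lambda>v. of_real (gauss t (v - h)) * H 0 (Complex x (2 * v)))"
    unfolding Hv by (intro integrable_divide lborel_pair.integrable_snd[OF iF])
  have "(LINT v|lborel. of_real (gauss t (v - h)) * H 0 (Complex x (2 * v))) = (LINT v|lborel. (LINT u|lborel. F u v)) / 2"
    unfolding Hv by simp
  also have "\<dots> = (LINT u|lborel. (LINT v|lborel. F u v)) / 2"
    by (simp add: lborel_pair.Fubini_integral[OF iF])
  also have "\<dots> = H t (Complex x (2 * h))" unfolding I1 H_eq Hm_def ..
  finally show "H t (Complex x (2 * h)) = (LINT v|lborel. of_real (gauss t (v - h)) * H 0 (Complex x (2 * v)))" ..
qed

section \<open>The initial function and the zeta series\<close>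

text \<open>Euler's integral after the substitution \<open>exp x\<close>, as an integral over the line.\<close>
lemma Gamma_integral_line:
  fixes w :: complex
  assumes w: "Re w > 0"
  shows "integrable lborel (\<lambda>x. exp (w * of_real x - of_real (exp x)))"
    and "(LINT x|lborel. exp (w * of_real x - of_real (exp x))) = Gamma w"
proof -
  define f where "f t = of_real t powr (w - 1) / of_real (exp t)" for t :: real
  define g where "g x = exp (w * of_real x - of_real (exp x))" for x :: real
  have eq: "\<bar>exp x\<bar> *\<^sub>R f (exp x) = g x" for x :: real
  proof -
    have "complex_of_real (exp x) powr (w - 1) = exp ((w - 1) * of_real x)"
      by (simp add: powr_def Ln_of_real)
    then show ?thesis
      by (simp add: f_def g_def scaleR_conv_of_real exp_diff left_diff_distrib exp_of_real[symmetric])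
  qed
  have range: "exp ` (UNIV :: real set) = {0<..}"
    by (auto simp: image_def intro!: exI[of _ "ln _"] exp_ln[symmetric])
  have "f absolutely_integrable_on {0<..} \<and> integral {0<..} f = Gamma w"
    using absolutely_integrable_Gamma_integral'[OF w] Gamma_integral_complex'[OF w]
    unfolding f_def by (auto intro: integral_unique)
  then have "(\<lambda>x. \<bar>exp x\<bar> *\<^sub>R f (exp x)) absolutely_integrable_on UNIV \<and> integral UNIV (\<lambda>x. \<bar>exp x\<bar> *\<^sub>R f (exp x)) = Gamma w"
    unfolding range[symmetric]
    by (subst has_absolute_integral_change_of_variables_real) (auto intro!: derivative_eq_intros inj_onI)
  then have g: "g absolutely_integrable_on UNIV" "integral UNIV g = Gamma w"
    unfolding eq by auto
  have [measurable]: "g \<in> borel_measurable borel" unfolding g_def by measurable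
  have "integrable lebesgue g"
    using g(1) by (simp add: set_integrable_def)
  then have i: "integrable lborel g"
    by (subst (asm) integrable_completion) auto
  then show "integrable lborel (\<lambda>x. exp (w * of_real x - of_real (exp x)))" unfolding g_def[abs_def] .
  show "(LINT x|lborel. exp (w * of_real x - of_real (exp x))) = Gamma w"
    using integral_lborel[OF i] g(2) by (simp add: g_def)
qed

text \<open>The building block of the Mellin transform: with \<open>p = \<pi> n\<^sup>2\<close> both parts of a term of \<open>Phi\<close> have this form.\<close>
definition Gexp :: "complex \<Rightarrow> real \<Rightarrow> real \<Rightarrow> complex" where
  "Gexp w p u = exp (4 * w * of_real u - of_real (p * exp (4 * u)))"

lemma Gexp_integral:
  assumes w: "Re w > 0" and p: "p > 0"
  shows "integrable lborel (Gexp w p)"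
    and "(LINT u|lborel. Gexp w p u) = exp (- w * of_real (ln p)) * Gamma w / 4"
proof -
  define g where "g x = exp (w * of_real x - of_real (exp x))" for x :: real
  have eq: "Gexp w p u = exp (- w * of_real (ln p)) * g (ln p + 4 * u)" for u
  proof -
    have "- w * of_real (ln p) + (w * of_real (ln p + 4 * u) - of_real (exp (ln p + 4 * u))) = 4 * w * of_real u - of_real (p * exp (4 * u))"
      using p by (simp add: exp_add algebra_simps)
    then show ?thesis unfolding Gexp_def g_def exp_add[symmetric] by simp
  qed
  have g: "integrable lborel g" "(LINT x|lborel. g x) = Gamma w"
    unfolding g_def using Gamma_integral_line[OF w] by auto
  have i: "integrable lborel (\<lambda>u. g (ln p + 4 * u))"
    using g(1) by (intro lborel_integrable_real_affine) auto
  then show "integrable lborel (Gexp w p)" unfolding eq[abs_def] by (intro integrable_mult_right)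
  have "Gamma w = \<bar>4\<bar> *\<^sub>R (LINT u|lborel. g (ln p + 4 * u))"
    unfolding g(2)[symmetric] by (rule lborel_integral_real_affine) simp
  then show "(LINT u|lborel. Gexp w p u) = exp (- w * of_real (ln p)) * Gamma w / 4"
    unfolding eq by (simp add: scaleR_conv_of_real)
qed

lemma norm_Gexp: "norm (Gexp w p u) = Re (Gexp (of_real (Re w)) p u)"
proof -
  have "Gexp (of_real (Re w)) p u = of_real (exp (4 * Re w * u - p * exp (4 * u)))"
    unfolding Gexp_def by (simp flip: exp_of_real)
  then show ?thesis by (simp add: Gexp_def)
qed

lemma norm_Gexp_integral:
  assumes w: "Re w > 0" and p: "p > 0"
  shows "integrable lborel (\<lambda>u. norm (Gexp w p u))"
    "(LINT u|lborel. norm (Gexp w p u)) = exp (- Re w * ln p) * (Re (Gamma (of_real (Re w))) / 4)"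
proof -
  show "integrable lborel (\<lambda>u. norm (Gexp w p u))"
    using Gexp_integral(1)[OF assms] by (rule integrable_norm)
  have w': "Re (of_real (Re w)) > 0" using w by simp
  have e: "exp (- complex_of_real (Re w) * of_real (ln p)) = of_real (exp (- Re w * ln p))"
    by (simp flip: exp_of_real)
  show "(LINT u|lborel. norm (Gexp w p u)) = exp (- Re w * ln p) * (Re (Gamma (of_real (Re w))) / 4)"
    unfolding norm_Gexp integral_Re[OF Gexp_integral(1)[OF w' p]] Gexp_integral(2)[OF w' p] e
    by (simp del: of_real_exp)
qed

text \<open>The Dirichlet series of the Riemann zeta function.\<close>
definition zeta_sum :: "complex \<Rightarrow> complex" where "zeta_sum s = (\<Sum>n. exp (- s * of_real (ln (real (Suc n)))))"

lemma norm_zeta_sum_term: "norm (exp (- s * of_real (ln (real (Suc n))))) = real (Suc n) powr (- Re s)"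
  by (simp add: powr_def)

lemma zeta_sum_summable: "Re s > 1 \<Longrightarrow> summable (\<lambda>n. norm (exp (- s * of_real (ln (real (Suc n))))))"
  unfolding norm_zeta_sum_term using summable_real_powr_iff[of "- Re s"]
  by (subst summable_Suc_iff[where f = "\<lambda>n. real n powr (- Re s)"]) simp

text \<open>The Gamma factor in \<open>\<xi>(s) = s (s - 1) / 2 \<pi>\<^sup>-\<^sup>s\<^sup>/\<^sup>2 \<Gamma>(s/2) \<zeta>(s)\<close>, divided by 8, with one factor \<open>s/2\<close> absorbed into
  \<open>\<Gamma>\<close> so that it has no singularity for \<open>Re s > -2\<close>.\<close>
definition xi_factor :: "complex \<Rightarrow> complex" where
  "xi_factor s = (s - 1) / 8 * exp (- (s / 2) * of_real (ln pi)) * Gamma (1 + s / 2)"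

text \<open>Riemann's formula in the half plane of absolute convergence: the integral of each term of \<open>Phi\<close> is a combination of
  \<open>\<Gamma>(2 + s/2)\<close> and \<open>\<Gamma>(1 + s/2)\<close> with a common factor \<open>n\<^sup>-\<^sup>s\<close>.\<close>
lemma H0_eq_zeta:
  assumes s: "Re s > 1"
  shows "H 0 (\<i> * (2 * s - 1)) = xi_factor s * zeta_sum s"
proof -
  define p where "p n = pi * (real (Suc n))\<^sup>2" for n
  have p: "p n > 0" for n by (simp add: p_def)
  define w1 w2 where "w1 = 2 + s / 2" and "w2 = 1 + s / 2"
  have w: "Re w1 > 0" "Re w2 > 0" using s by (auto simp: w1_def w2_def)
  define \<phi> where "\<phi> n u = of_real (Phi_term n u) * exp ((2 * s - 1) * of_real u)" for n u
  have \<phi>: "\<phi> n u = of_real (2 * (p n)\<^sup>2) * Gexp w1 (p n) u - of_real (3 * p n) * Gexp w2 (p n) u" for n u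
  proof -
    have e: "of_real (exp (a * u)) * of_real (exp (- p n * exp (4 * u))) * exp ((2 * s - 1) * of_real u) = Gexp w (p n) u"
      if "4 * w = of_real a + 2 * s - 1" for a w
    proof -
      have "of_real (a * u) + of_real (- p n * exp (4 * u)) + (2 * s - 1) * of_real u = 4 * w * of_real u - of_real (p n * exp (4 * u))"
        unfolding that by (simp add: algebra_simps)
      then show ?thesis unfolding Gexp_def by (simp only: exp_add exp_of_real[symmetric] flip: exp_add)
    qed
    have "Phi_term n u = 2 * (p n)\<^sup>2 * (exp (9 * u) * exp (- p n * exp (4 * u))) - 3 * p n * (exp (5 * u) * exp (- p n * exp (4 * u)))"
      by (simp add: Phi_term_def p_def power_mult_distrib algebra_simps del: of_nat_Suc)
    then have "\<phi> n u = of_real (2 * (p n)\<^sup>2) * (of_real (exp (9 * u)) * of_real (exp (- p n * exp (4 * u))) * exp ((2 * s - 1) * of_real u))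
       - of_real (3 * p n) * (of_real (exp (5 * u)) * of_real (exp (- p n * exp (4 * u))) * exp ((2 * s - 1) * of_real u))"
      unfolding \<phi>_def by (simp add: left_diff_distrib mult.assoc del: of_real_exp)
    then show ?thesis using e[of w1 9] e[of w2 5] by (simp add: w1_def w2_def)
  qed
  have i\<phi>: "integrable lborel (\<phi> n)" for n
    unfolding \<phi>[abs_def] by (intro Bochner_Integration.integrable_diff integrable_mult_right Gexp_integral w p)
  have I\<phi>: "(LINT u|lborel. \<phi> n u) = 2 * xi_factor s * exp (- s * of_real (ln (real (Suc n))))" for n
  proof -
    have lnp: "ln (p n) = ln pi + 2 * ln (real (Suc n))" by (simp add: p_def ln_mult ln_realpow del: of_nat_Suc)
    have e: "of_real (p n ^ k) * exp (- (of_nat k + s / 2) * of_real (ln (p n))) = exp (- (s / 2) * of_real (ln pi)) * exp (- s * of_real (ln (real (Suc n))))" for k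
    proof -
      have "complex_of_real (p n ^ k) = exp (of_nat k * of_real (ln (p n)))"
        using p[of n] by (simp add: exp_of_nat_mult exp_of_real)
      moreover have "of_nat k * of_real (ln (p n)) + (- (of_nat k + s / 2) * of_real (ln (p n))) = - (s / 2) * of_real (ln pi) + (- s * of_real (ln (real (Suc n))))"
        unfolding lnp by (simp add: algebra_simps del: of_nat_Suc)
      ultimately show ?thesis by (simp only: exp_add[symmetric])
    qed
    have "(LINT u|lborel. \<phi> n u) = of_real (2 * (p n)\<^sup>2) * (exp (- w1 * of_real (ln (p n))) * Gamma w1 / 4) - of_real (3 * p n) * (exp (- w2 * of_real (ln (p n))) * Gamma w2 / 4)"
      unfolding \<phi>
      by (subst Bochner_Integration.integral_diff[OF integrable_mult_right[OF Gexp_integral(1)[OF w(1) p]] integrable_mult_right[OF Gexp_integral(1)[OF w(2) p]]],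
          subst (1 2) integral_mult_right_zero, simp only: Gexp_integral(2)[OF w(1) p] Gexp_integral(2)[OF w(2) p])
    also have "\<dots> = (of_real (p n ^ 2) * exp (- (of_nat 2 + s / 2) * of_real (ln (p n)))) * Gamma w1 / 2 - (of_real (p n ^ 1) * exp (- (of_nat 1 + s / 2) * of_real (ln (p n)))) * Gamma w2 * 3 / 4"
      by (simp add: w1_def w2_def mult_ac)
    also have "\<dots> = exp (- (s / 2) * of_real (ln pi)) * exp (- s * of_real (ln (real (Suc n)))) * (Gamma w1 / 2 - Gamma w2 * 3 / 4)"
      unfolding e by (simp add: right_diff_distrib)
    also have "Gamma w1 = w2 * Gamma w2"
    proof -
      have "w2 \<notin> \<int>\<^sub>\<le>\<^sub>0" using w(2) by (auto elim!: nonpos_Ints_cases)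
      then show ?thesis using Gamma_plus1[of w2] by (simp add: w1_def w2_def add.commute add.assoc[symmetric])
    qed
    also have "w2 * Gamma w2 / 2 - Gamma w2 * 3 / 4 = (s - 1) / 4 * Gamma w2"
      by (simp add: w2_def field_simps)
    finally show ?thesis by (simp add: xi_factor_def w2_def mult_ac)
  qed
  have n\<phi>: "(LINT u|lborel. norm (\<phi> n u)) \<le> (Re (Gamma (of_real (Re w1))) / 2 + 3 * Re (Gamma (of_real (Re w2))) / 4) * exp (- (Re s / 2) * ln pi) * norm (exp (- s * of_real (ln (real (Suc n)))))" for n
  proof -
    define g1 g2 where "g1 = Re (Gamma (of_real (Re w1))) / 4" and "g2 = Re (Gamma (of_real (Re w2))) / 4"
    have lnp: "ln (p n) = ln pi + 2 * ln (real (Suc n))" by (simp add: p_def ln_mult ln_realpow del: of_nat_Suc)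
    have e: "p n ^ k * exp (- (real k + Re s / 2) * ln (p n)) = exp (- (Re s / 2) * ln pi) * norm (exp (- s * of_real (ln (real (Suc n)))))" for k
    proof -
      have "p n ^ k = exp (real k * ln (p n))"
        using p[of n] by (simp add: exp_of_nat_mult)
      moreover have "real k * ln (p n) + (- (real k + Re s / 2) * ln (p n)) = - (Re s / 2) * ln pi + (- Re s * ln (real (Suc n)))"
        unfolding lnp by (simp add: algebra_simps del: of_nat_Suc)
      moreover have "norm (exp (- s * of_real (ln (real (Suc n))))) = exp (- Re s * ln (real (Suc n)))" by simp
      ultimately show ?thesis by (simp only: exp_add[symmetric])
    qed
    have "(LINT u|lborel. norm (\<phi> n u)) \<le> (LINT u|lborel. 2 * (p n)\<^sup>2 * norm (Gexp w1 (p n) u) + 3 * p n * norm (Gexp w2 (p n) u))"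
    proof (rule integral_mono_AE')
      show "integrable lborel (\<lambda>u. 2 * (p n)\<^sup>2 * norm (Gexp w1 (p n) u) + 3 * p n * norm (Gexp w2 (p n) u))"
        by (intro Bochner_Integration.integrable_add integrable_mult_right norm_Gexp_integral w p)
      show "AE u in lborel. norm (\<phi> n u) \<le> 2 * (p n)\<^sup>2 * norm (Gexp w1 (p n) u) + 3 * p n * norm (Gexp w2 (p n) u)"
      proof (rule AE_I2)
        fix u
        have "norm (\<phi> n u) \<le> norm (of_real (2 * (p n)\<^sup>2) * Gexp w1 (p n) u) + norm (of_real (3 * p n) * Gexp w2 (p n) u)"
          unfolding \<phi> by (rule norm_triangle_ineq4)
        then show "norm (\<phi> n u) \<le> 2 * (p n)\<^sup>2 * norm (Gexp w1 (p n) u) + 3 * p n * norm (Gexp w2 (p n) u)"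
          using p[of n] by (simp add: norm_mult norm_power)
      qed
      show "AE u in lborel. 0 \<le> 2 * (p n)\<^sup>2 * norm (Gexp w1 (p n) u) + 3 * p n * norm (Gexp w2 (p n) u)"
        using p[of n] by (intro AE_I2 add_nonneg_nonneg mult_nonneg_nonneg) auto
    qed
    also have "\<dots> = 2 * (p n)\<^sup>2 * (exp (- Re w1 * ln (p n)) * g1) + 3 * p n * (exp (- Re w2 * ln (p n)) * g2)"
      unfolding g1_def g2_def
      by (subst Bochner_Integration.integral_add[OF integrable_mult_right[OF norm_Gexp_integral(1)[OF w(1) p]] integrable_mult_right[OF norm_Gexp_integral(1)[OF w(2) p]]],
          subst (1 2) integral_mult_right_zero, simp only: norm_Gexp_integral(2)[OF w(1) p] norm_Gexp_integral(2)[OF w(2) p])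
    also have "\<dots> = 2 * (p n ^ 2 * exp (- (real 2 + Re s / 2) * ln (p n))) * g1 + 3 * (p n ^ 1 * exp (- (real 1 + Re s / 2) * ln (p n))) * g2"
      by (simp add: w1_def w2_def)
    also have "\<dots> = (2 * g1 + 3 * g2) * (exp (- (Re s / 2) * ln pi) * norm (exp (- s * of_real (ln (real (Suc n))))))"
      unfolding e by (simp only: algebra_simps)
    finally show ?thesis by (simp add: g1_def g2_def mult_ac)
  qed
  have "(LINT u|lborel. (\<Sum>n. \<phi> n u)) = (\<Sum>n. LINT u|lborel. \<phi> n u)"
  proof (rule integral_suminf)
    show "integrable lborel (\<phi> n)" for n by (rule i\<phi>)
    show "AE u in lborel. summable (\<lambda>n. norm (\<phi> n u))"
    proof (rule AE_I2)
      fix u :: real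
      define M where "M n = (1 + 24 * pi * exp (4 * \<bar>u\<bar>) + 16 * pi\<^sup>2 * exp (8 * \<bar>u\<bar>)) * exp \<bar>u\<bar> * (real (Suc n) ^ 4 * exp (- (pi * exp (- 4 * \<bar>u\<bar>)) * (real (Suc n))\<^sup>2))" for n
      have M: "summable M" "\<And>n. \<bar>K_term n u\<bar> \<le> M n" "\<And>n. \<bar>K_term2 n u\<bar> \<le> M n"
        unfolding M_def by (rule K_bounds(4)[OF order_refl], rule K_bounds(1)[OF order_refl], rule K_bounds(3)[OF order_refl])
      have "summable (\<lambda>n. \<bar>Phi_term n u\<bar>)"
      proof (rule summable_comparison_test'[OF M(1)])
        fix n
        have "8 * Phi_term n u = K_term2 n u - K_term n u" by (simp add: K_term2_eq)
        then show "norm \<bar>Phi_term n u\<bar> \<le> M n" using M(2)[of n] M(3)[of n] by simp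
      qed
      then have "summable (\<lambda>n. \<bar>Phi_term n u\<bar> * norm (exp ((2 * s - 1) * of_real u)))"
        by (rule summable_mult2)
      then show "summable (\<lambda>n. norm (\<phi> n u))" by (simp add: \<phi>_def norm_mult del: norm_exp_eq_Re)
    qed
    show "summable (\<lambda>n. LINT u|lborel. norm (\<phi> n u))"
      by (rule summable_comparison_test'[OF summable_mult[OF zeta_sum_summable[OF s]]])
         (use n\<phi> in \<open>auto simp: integral_nonneg_AE\<close>)
  qed
  moreover have "(\<Sum>n. \<phi> n u) = Hm_fun 0 0 (\<i> * (2 * s - 1)) u" for u
  proof -
    have "(\<Sum>n. \<phi> n u) = (\<Sum>n. of_real (Phi_term n u)) * exp ((2 * s - 1) * of_real u)"
      unfolding \<phi>_def by (rule suminf_mult2[symmetric]) (intro summable_of_real Phi_term_summable)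
    also have "(\<Sum>n. of_real (Phi_term n u)) = complex_of_real (Phi u)"
      unfolding Phi_eq by (rule suminf_of_real[symmetric]) (rule Phi_term_summable)
    finally show ?thesis by (simp add: Hm_fun_def algebra_simps)
  qed
  ultimately have "2 * H 0 (\<i> * (2 * s - 1)) = (\<Sum>n. 2 * xi_factor s * exp (- s * of_real (ln (real (Suc n)))))"
    unfolding I\<phi> by (simp add: H_eq Hm_def)
  also have "\<dots> = 2 * xi_factor s * zeta_sum s"
    unfolding zeta_sum_def by (rule suminf_mult) (rule summable_norm_cancel[OF zeta_sum_summable[OF s]])
  finally show ?thesis by simp
qed

lemma inverse_square_tail: "summable (\<lambda>n. 1 / (real n + 3)\<^sup>2)" "(\<Sum>n. 1 / (real n + 3)\<^sup>2) \<le> 2 / 5"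
proof -
  define c where "c n = 1 / (real n + 5 / 2)" for n :: nat
  have le: "1 / (real n + 3)\<^sup>2 \<le> c n - c (Suc n)" for n
  proof -
    have "c n - c (Suc n) = 1 / ((real n + 5 / 2) * (real n + 7 / 2))"
      by (simp add: c_def field_simps)
    moreover have "(real n + 5 / 2) * (real n + 7 / 2) \<le> (real n + 3)\<^sup>2"
      by (simp add: power2_eq_square algebra_simps)
    ultimately show ?thesis by (auto intro!: divide_left_mono mult_pos_pos)
  qed
  have "c \<longlonglongrightarrow> 0" unfolding c_def by real_asymp
  then have sums: "(\<lambda>n. c n - c (Suc n)) sums (c 0 - 0)" by (rule telescope_sums')
  then show s: "summable (\<lambda>n. 1 / (real n + 3)\<^sup>2)"
    by (intro summable_comparison_test'[OF sums_summable[OF sums]]) (use le in auto)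
  show "(\<Sum>n. 1 / (real n + 3)\<^sup>2) \<le> 2 / 5"
    using suminf_le[OF le s sums_summable[OF sums]] sums_unique[OF sums] by (simp add: c_def)
qed

text \<open>The first term \<open>2 powr (- Re s)\<close> is split off, and \<open>(n / 2) powr (- Re s) \<le> (n / 2) powr (- 2)\<close> in the tail.\<close>
lemma zeta_sum_minus_one:
  assumes s: "Re s \<ge> 2"
  shows "norm (zeta_sum s - 1) \<le> 13 / 5 * 2 powr (- Re s)"
proof -
  define a where "a n = exp (- s * of_real (ln (real (Suc n))))" for n
  have sm: "summable (\<lambda>n. norm (a n))" unfolding a_def using s by (intro zeta_sum_summable) auto
  then have sa: "summable a" by (rule summable_norm_cancel)
  have "zeta_sum s = a 0 + a 1 + (\<Sum>n. a (n + 2))"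
    unfolding zeta_sum_def a_def[symmetric] using suminf_split_initial_segment[OF sa, of 2] by (simp add: numeral_2_eq_2)
  then have "zeta_sum s - 1 = a 1 + (\<Sum>n. a (n + 2))" by (simp add: a_def)
  moreover have "norm (a 1) = 2 powr (- Re s)" unfolding a_def norm_zeta_sum_term by simp
  moreover have "norm (\<Sum>n. a (n + 2)) \<le> 8 / 5 * 2 powr (- Re s)"
  proof -
    have le: "norm (a (n + 2)) \<le> 4 * 2 powr (- Re s) * (1 / (real n + 3)\<^sup>2)" for n
    proof -
      have "norm (a (n + 2)) = (real n + 3) powr (- Re s)" unfolding a_def norm_zeta_sum_term by (simp add: add_ac)
      also have "\<dots> = 2 powr (- Re s) * ((real n + 3) / 2) powr (- Re s)"
      proof -
        have "2 * ((real n + 3) / 2) = real n + 3" by simp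
        then show ?thesis using powr_mult[of 2 "(real n + 3) / 2" "- Re s"] by metis
      qed
      also have "\<dots> \<le> 2 powr (- Re s) * ((real n + 3) / 2) powr (- 2)"
        using s by (intro mult_left_mono powr_mono) auto
      also have "((real n + 3) / 2) powr (- 2) = 4 * (1 / (real n + 3)\<^sup>2)"
        by (simp add: powr_minus powr_numeral power_divide field_simps)
      finally show ?thesis by (simp only: mult_ac)
    qed
    have s2: "summable (\<lambda>n. 4 * 2 powr (- Re s) * (1 / (real n + 3)\<^sup>2))" by (intro summable_mult inverse_square_tail)
    have "norm (\<Sum>n. a (n + 2)) \<le> (\<Sum>n. norm (a (n + 2)))"
      by (rule summable_norm[OF summable_ignore_initial_segment[OF sm]])
    also have "\<dots> \<le> (\<Sum>n. 4 * 2 powr (- Re s) * (1 / (real n + 3)\<^sup>2))"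
      by (rule suminf_le[OF le summable_ignore_initial_segment[OF sm] s2])
    also have "\<dots> = 4 * 2 powr (- Re s) * (\<Sum>n. 1 / (real n + 3)\<^sup>2)" by (rule suminf_mult[OF inverse_square_tail(1)])
    also have "\<dots> \<le> 4 * 2 powr (- Re s) * (2 / 5)" by (intro mult_left_mono inverse_square_tail(2)) auto
    finally show ?thesis by simp
  qed
  ultimately show ?thesis using norm_triangle_ineq[of "a 1" "\<Sum>n. a (n + 2)"] by simp
qed

text \<open>The sum over odd integers from 3 telescopes against \<open>1 / sqrt (2 n + 2)\<close> and stays below \<open>1 / sqrt 2\<close>.\<close>
lemma odd_tail: "summable (\<lambda>n. (2 * real n + 3) powr (- 3 / 2))" "(\<Sum>n. (2 * real n + 3) powr (- 3 / 2)) < 1"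
proof -
  define c where "c n = 1 / sqrt (2 * real n + 2)" for n :: nat
  have le: "(2 * real n + 3) powr (- 3 / 2) \<le> c n - c (Suc n)" for n
  proof -
    define m where "m = 2 * real n + 3"
    define a b where "a = sqrt (m - 1)" and "b = sqrt (m + 1)"
    have m: "m \<ge> 3" by (simp add: m_def)
    have ab: "a > 0" "b > 0" "a\<^sup>2 = m - 1" "b\<^sup>2 = m + 1" using m by (auto simp: a_def b_def)
    have "(a * b)\<^sup>2 \<le> m\<^sup>2" unfolding power_mult_distrib ab by (simp add: power2_eq_square algebra_simps)
    then have 1: "a * b \<le> m" using m by (auto intro: power2_le_imp_le)
    have "(a + b)\<^sup>2 = a\<^sup>2 + b\<^sup>2 + 2 * (a * b)" by (simp add: power2_eq_square algebra_simps)
    then have "(a + b)\<^sup>2 \<le> (2 * sqrt m)\<^sup>2" unfolding ab power_mult_distrib using 1 m by simp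
    then have 2: "a + b \<le> 2 * sqrt m" using m by (auto intro: power2_le_imp_le)
    have "c n - c (Suc n) = 1 / a - 1 / b" by (simp add: c_def a_def b_def m_def add_ac)
    also have "\<dots> = (b\<^sup>2 - a\<^sup>2) / (a * b * (a + b))"
    proof -
      have "b\<^sup>2 - a\<^sup>2 = (b - a) * (a + b)" by (simp add: power2_eq_square algebra_simps)
      moreover have "(b - a) * (a + b) / (a * b * (a + b)) = (b - a) / (a * b)" using ab(1,2) by simp
      moreover have "(b - a) / (a * b) = 1 / a - 1 / b" using ab(1,2) by (simp add: diff_divide_distrib)
      ultimately show ?thesis by simp
    qed
    also have "b\<^sup>2 - a\<^sup>2 = 2" using ab by simp
    also have "2 / (m * (2 * sqrt m)) \<le> 2 / (a * b * (a + b))"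
      using ab 1 2 m by (intro divide_left_mono mult_mono mult_pos_pos) auto
    finally have "1 / (m * sqrt m) \<le> c n - c (Suc n)" by simp
    moreover have "m powr (- 3 / 2) = 1 / (m * sqrt m)"
    proof -
      have "m powr (3 / 2) = m powr (1 + 1 / 2)" by simp
      also have "\<dots> = m * sqrt m" using m by (simp only: powr_add) (simp add: powr_half_sqrt)
      finally show ?thesis by (simp add: powr_minus_divide)
    qed
    ultimately show ?thesis by (simp add: m_def)
  qed
  have "c \<longlonglongrightarrow> 0" unfolding c_def by real_asymp
  then have sums: "(\<lambda>n. c n - c (Suc n)) sums (c 0 - 0)" by (rule telescope_sums')
  then show s: "summable (\<lambda>n. (2 * real n + 3) powr (- 3 / 2))"
    by (intro summable_comparison_test'[OF sums_summable[OF sums]]) (use le in auto)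
  have "(\<Sum>n. (2 * real n + 3) powr (- 3 / 2)) \<le> c 0"
    using suminf_le[OF le s sums_summable[OF sums]] sums_unique[OF sums] by simp
  also have "c 0 < 1" by (simp add: c_def)
  finally show "(\<Sum>n. (2 * real n + 3) powr (- 3 / 2)) < 1" .
qed

text \<open>Multiplying by \<open>1 - 2 powr (- s)\<close> removes the even integers; the remaining tail is less than the first term 1.\<close>
lemma zeta_sum_nonzero:
  assumes s: "Re s \<ge> 3 / 2"
  shows "zeta_sum s \<noteq> 0"
proof
  assume z: "zeta_sum s = 0"
  define a where "a n = exp (- s * of_real (ln (real (Suc n))))" for n
  have sm: "summable (\<lambda>n. norm (a n))" unfolding a_def using s by (intro zeta_sum_summable) auto
  then have sa: "summable a" by (rule summable_norm_cancel)
  have a2: "a (2 * n + 1) = exp (- s * of_real (ln 2)) * a n" for n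
  proof -
    have "ln (real (Suc (2 * n + 1))) = ln (2 * real (Suc n))" by simp
    also have "\<dots> = ln 2 + ln (real (Suc n))" by (rule ln_mult_pos) auto
    finally show ?thesis unfolding a_def exp_add[symmetric] by (simp only: of_real_add distrib_left)
  qed
  have "a sums 0" using sa z unfolding zeta_sum_def a_def[symmetric] by (simp add: sums_iff)
  then have "(\<lambda>n. \<Sum>k\<in>{n * 2..<n * 2 + 2}. a k) sums 0" by (rule sums_group) simp
  then have 1: "(\<lambda>n. a (2 * n) + a (2 * n + 1)) sums 0" by (simp add: numeral_2_eq_2 mult.commute)
  have m: "(\<lambda>n. exp (- s * of_real (ln 2)) * a n) sums 0"
    using sums_mult[OF \<open>a sums 0\<close>, of "exp (- s * of_real (ln 2))"] by simp
  have "(\<lambda>n. (a (2 * n) + a (2 * n + 1)) - exp (- s * of_real (ln 2)) * a n) sums (0 - 0)"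
    by (rule sums_diff[OF 1 m])
  \<comment> \<open>the terms of odd index, \<open>2 n + 1\<close>, belong to the even integers\<close>
  then have odd: "(\<lambda>n. a (2 * n)) sums 0" unfolding a2 by simp
  then have "(\<lambda>n. a (2 * n)) sums ((0 - a 0) + a (2 * 0))" by simp
  then have "(\<lambda>n. a (2 * Suc n)) sums (0 - a 0)"
    using iffD2[OF sums_Suc_iff[of "\<lambda>n. a (2 * n)" "0 - a 0"]] by blast
  then have eq: "(\<Sum>n. a (2 * Suc n)) = - 1"
  proof -
    assume "(\<lambda>n. a (2 * Suc n)) sums (0 - a 0)"
    then have "(\<Sum>n. a (2 * Suc n)) = 0 - a 0" by (rule sums_unique[symmetric])
    moreover have "a 0 = 1" by (simp add: a_def)
    ultimately show ?thesis by simp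
  qed
  have le: "norm (a (2 * Suc n)) \<le> (2 * real n + 3) powr (- 3 / 2)" for n
  proof -
    have "norm (a (2 * Suc n)) = (2 * real n + 3) powr (- Re s)" unfolding a_def norm_zeta_sum_term by (simp add: add_ac)
    also have "\<dots> \<le> (2 * real n + 3) powr (- 3 / 2)" using s by (intro powr_mono) auto
    finally show ?thesis .
  qed
  have sn: "summable (\<lambda>n. norm (a (2 * Suc n)))"
    by (rule summable_comparison_test'[OF odd_tail(1)]) (use le in auto)
  have "1 = norm (\<Sum>n. a (2 * Suc n))" using eq by simp
  also have "\<dots> \<le> (\<Sum>n. norm (a (2 * Suc n)))" by (rule summable_norm[OF sn])
  also have "\<dots> \<le> (\<Sum>n. (2 * real n + 3) powr (- 3 / 2))" by (rule suminf_le[OF le sn odd_tail(1)])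
  also have "\<dots> < 1" by (rule odd_tail(2))
  finally show False by simp
qed

lemma xi_factor_nonzero: "Re s > 1 \<Longrightarrow> xi_factor s \<noteq> 0"
  by (auto simp: xi_factor_def Gamma_eq_zero_iff elim!: nonpos_Ints_cases) (auto simp: complex_eq_iff)

text \<open>The half plane \<open>Re s \<ge> 3/2\<close> corresponds to \<open>Im \<rho> \<ge> 2\<close>.\<close>
lemma H0_zero_strip:
  assumes "H 0 \<rho> = 0"
  shows "\<bar>Im \<rho>\<bar> \<le> 2"
proof (rule ccontr)
  assume n: "\<not> \<bar>Im \<rho>\<bar> \<le> 2"
  have False if "Im \<rho> > 2" "H 0 \<rho> = 0" for \<rho>
  proof -
    define s where "s = 1 / 2 - \<i> * \<rho> / 2"
    have s: "Re s \<ge> 3 / 2" using that by (simp add: s_def)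
    have "\<i> * (2 * s - 1) = \<rho>" by (simp add: s_def algebra_simps)
    then have "H 0 \<rho> = xi_factor s * zeta_sum s" using H0_eq_zeta[of s] s by simp
    then show False using that zeta_sum_nonzero[OF s] xi_factor_nonzero[of s] s by simp
  qed
  moreover have "Im \<rho> > 2 \<or> Im (- \<rho>) > 2" using n by auto
  moreover have "H 0 (- \<rho>) = 0" using assms real_even_entire.even[OF H_real_even_entire, of 0 \<rho>] by simp
  ultimately show False using assms by blast
qed

text \<open>A substitute for bounds of \<open>\<zeta>\<close> in the critical strip: by \<open>modulus_mono\<close> with the strip of height 2, as \<open>2 \<cdot> 2\<^sup>2 \<le> 3\<^sup>2\<close>.\<close>
lemma H0_modulus_le:
  assumes "\<bar>\<eta>\<bar> \<le> 3"
  shows "norm (H 0 (Complex x \<eta>)) \<le> norm (H 0 (Complex x 3))"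
  by (rule real_even_entire.modulus_mono[OF H_real_even_entire, where b = 2]) (use H0_zero_strip assms in auto)

section \<open>The Gamma factor on a vertical line\<close>

lemma half_plane_off_nonpos: "Re w > 0 \<Longrightarrow> w \<notin> \<int>\<^sub>\<le>\<^sub>0" "Re w > 0 \<Longrightarrow> w \<notin> \<real>\<^sub>\<le>\<^sub>0" for w :: complex
  by (auto elim!: nonpos_Ints_cases nonpos_Reals_cases)

text \<open>An elementary replacement for Stirling's series: sums of \<open>1 / ((k + 1)\<^sup>2 + q\<^sup>2)\<close> are compared with a telescoping series.\<close>
lemma telescoping_bound:
  fixes q :: real
  assumes "q > 0"
  shows "(\<lambda>k. 2 / (real k + q) - 2 / (real (Suc k) + q)) sums (2 / q)"
    and "1 / ((real k + 1)\<^sup>2 + q\<^sup>2) \<le> 2 / (real k + q) - 2 / (real (Suc k) + q)"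
proof -
  have "(\<lambda>k. 2 / (real k + q)) \<longlonglongrightarrow> 0" by real_asymp
  from telescope_sums'[OF this] show "(\<lambda>k. 2 / (real k + q) - 2 / (real (Suc k) + q)) sums (2 / q)" by simp
  have "2 / (real k + q) - 2 / (real (Suc k) + q) = 2 / ((real k + q) * (real k + 1 + q))"
    using assms by (simp add: field_simps)
  also have "\<dots> = 1 / ((real k + q) * (real k + 1 + q) / 2)" by simp
  also have "\<dots> \<ge> 1 / ((real k + 1)\<^sup>2 + q\<^sup>2)"
  proof (intro divide_left_mono)
    have "0 \<le> (real k + 1 - q)\<^sup>2" by simp
    moreover have "0 \<le> real k + 1 + q" using assms by simp
    ultimately have "0 \<le> (real k + 1 - q)\<^sup>2 + (real k + 1 + q)" by simp
    then show "(real k + q) * (real k + 1 + q) / 2 \<le> (real k + 1)\<^sup>2 + q\<^sup>2"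
      by (simp add: power2_eq_square algebra_simps)
    show "0 < ((real k + 1)\<^sup>2 + q\<^sup>2) * ((real k + q) * (real k + 1 + q) / 2)"
      using assms by (intro mult_pos_pos divide_pos_pos add_pos_pos add_nonneg_pos) auto
  qed auto
  finally show "1 / ((real k + 1)\<^sup>2 + q\<^sup>2) \<le> 2 / (real k + q) - 2 / (real (Suc k) + q)" .
qed

text \<open>A horizontal half-line in the lower half plane.  With \<open>q = T / 2\<close> the arguments \<open>1 + s / 2\<close> of \<open>\<Gamma>\<close> for \<open>s\<close> of ordinate \<open>- T\<close> and
  real part at least \<open>0\<close> lie on it; it is convex, so Taylor estimates can be made along it.\<close>
definition gline :: "real \<Rightarrow> complex set" where "gline q = {w. Re w \<ge> 1 \<and> Im w = - q}"

context
  fixes q :: real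
  assumes q: "q > 0"
begin

lemma gline_norm: "w \<in> gline q \<Longrightarrow> (norm (w + of_nat k))\<^sup>2 \<ge> (real k + 1)\<^sup>2 + q\<^sup>2"
proof -
  assume "w \<in> gline q"
  then have w: "Re w \<ge> 1" "Im w = - q" by (auto simp: gline_def)
  have "(real k + 1)\<^sup>2 \<le> (Re w + real k)\<^sup>2" using w by (intro power_mono) auto
  then show ?thesis using w by (simp add: cmod_power2)
qed

lemma gline_convex: "convex (gline q)"
proof (rule convexI)
  fix x y :: complex and u v :: real
  assume *: "x \<in> gline q" "y \<in> gline q" "0 \<le> u" "0 \<le> v" "u + v = 1"
  have "u * 1 + v * 1 \<le> u * Re x + v * Re y"
    using * by (intro add_mono mult_left_mono) (auto simp: gline_def)
  moreover have "u * - q + v * - q = - ((u + v) * q)" by (simp add: algebra_simps)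
  ultimately show "u *\<^sub>R x + v *\<^sub>R y \<in> gline q" using * by (auto simp: gline_def)
qed

lemma gline_pos: "(real k + 1)\<^sup>2 + q\<^sup>2 > 0"
  using q by (intro add_nonneg_pos) auto

lemma gline_inverse: "w \<in> gline q \<Longrightarrow> norm (inverse ((w + of_nat k)\<^sup>2)) \<le> 1 / ((real k + 1)\<^sup>2 + q\<^sup>2)"
  using divide_left_mono[OF gline_norm[of w k], of 1] mult_pos_pos[OF less_le_trans[OF gline_pos gline_norm] gline_pos]
  by (simp add: norm_inverse norm_power inverse_eq_divide norm_divide)

lemma Polygamma_1_bound:
  assumes w: "w \<in> gline q"
  shows "norm (Polygamma 1 w) \<le> 2 / q"
proof -
  note tb = telescoping_bound[OF q]
  have le: "norm (inverse ((w + of_nat k)\<^sup>2)) \<le> 2 / (real k + q) - 2 / (real (Suc k) + q)" for k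
    using gline_inverse[OF w, of k] tb(2)[of k] by linarith
  have s: "summable (\<lambda>k. norm (inverse ((w + of_nat k)\<^sup>2)))"
    by (rule summable_comparison_test'[OF sums_summable[OF tb(1)]]) (use le in simp)
  have "Polygamma 1 w = (\<Sum>k. inverse ((w + of_nat k)\<^sup>2))"
    by (simp add: Polygamma_def numeral_2_eq_2)
  also have "norm \<dots> \<le> (\<Sum>k. norm (inverse ((w + of_nat k)\<^sup>2)))" by (rule summable_norm[OF s])
  also have "\<dots> \<le> (\<Sum>k. 2 / (real k + q) - 2 / (real (Suc k) + q))" by (rule suminf_le[OF le s sums_summable[OF tb(1)]])
  also have "\<dots> = 2 / q" using sums_unique[OF tb(1)] by simp
  finally show ?thesis .
qed

text \<open>The imaginary parts of the terms \<open>1 / (w + k)\<close> all have the same sign and sum to about \<open>arg w\<close>; only boundedness matters.\<close>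
lemma Digamma_Im_bound:
  assumes w: "w \<in> gline q"
  shows "\<bar>Im (Digamma w)\<bar> \<le> 2"
proof -
  note tb = telescoping_bound[OF q]
  have "Re w > 0" using w by (simp add: gline_def)
  then have "w \<noteq> 0" by auto
  then have lim: "(\<lambda>m. Im (of_real (ln (real m)) - (\<Sum>k<m. inverse (w + of_nat k)))) \<longlonglongrightarrow> Im (Digamma w)"
    by (intro tendsto_Im Digamma_LIMSEQ)
  have "\<bar>Im (of_real (ln (real m)) - (\<Sum>k<m. inverse (w + of_nat k)))\<bar> \<le> 2" for m
  proof -
    have 1: "\<bar>Im (inverse (w + of_nat k))\<bar> \<le> q * (2 / (real k + q) - 2 / (real (Suc k) + q))" for k
    proof -
      have "Im w = - q" using w by (simp add: gline_def)
      then have "\<bar>Im (inverse (w + of_nat k))\<bar> = q * (1 / (norm (w + of_nat k))\<^sup>2)"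
        using q by (simp add: cmod_power2)
      also have "\<dots> \<le> q * (1 / ((real k + 1)\<^sup>2 + q\<^sup>2))"
        using q by (intro mult_left_mono divide_left_mono[OF gline_norm[OF w]] mult_pos_pos[OF less_le_trans[OF gline_pos gline_norm[OF w]] gline_pos]) auto
      also have "\<dots> \<le> q * (2 / (real k + q) - 2 / (real (Suc k) + q))"
        using tb(2)[of k] q by (intro mult_left_mono) auto
      finally show ?thesis .
    qed
    have nn: "0 \<le> 2 / (real k + q) - 2 / (real (Suc k) + q)" for k
      by (rule order_trans[OF _ tb(2)]) simp
    have "\<bar>Im (of_real (ln (real m)) - (\<Sum>k<m. inverse (w + of_nat k)))\<bar> = \<bar>\<Sum>k<m. Im (inverse (w + of_nat k))\<bar>"
      by simp
    also have "\<dots> \<le> (\<Sum>k<m. q * (2 / (real k + q) - 2 / (real (Suc k) + q)))"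
      using 1 by (intro order_trans[OF sum_abs] sum_mono) auto
    also have "\<dots> = q * (\<Sum>k<m. 2 / (real k + q) - 2 / (real (Suc k) + q))" by (simp only: sum_distrib_left)
    also have "\<dots> \<le> q * (2 / q)"
    proof (intro mult_left_mono)
      have "(\<Sum>k<m. 2 / (real k + q) - 2 / (real (Suc k) + q)) \<le> (\<Sum>k. 2 / (real k + q) - 2 / (real (Suc k) + q))"
        using nn by (intro sum_le_suminf sums_summable[OF tb(1)]) auto
      then show "(\<Sum>k<m. 2 / (real k + q) - 2 / (real (Suc k) + q)) \<le> 2 / q"
        using sums_unique[OF tb(1)] by simp
    qed (use q in simp)
    finally show ?thesis using q by simp
  qed
  then show ?thesis using tendsto_rabs[OF lim] by (intro LIMSEQ_le_const2) auto
qed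

text \<open>Second-order Taylor estimate from \<open>\<bar>Polygamma 1\<bar> \<le> 2 / q\<close>.\<close>
lemma ln_Gamma_taylor:
  assumes a: "a \<in> gline q" and w: "w \<in> gline q"
  shows "norm (ln_Gamma w - ln_Gamma a - (w - a) * Digamma a) \<le> 2 / q * (norm (w - a))\<^sup>2"
proof -
  define B where "B = gline q \<inter> cball a (norm (w - a))"
  have B: "convex B" unfolding B_def by (intro convex_Int gline_convex convex_cball)
  have aB: "a \<in> B" "w \<in> B" using a w by (auto simp: B_def dist_norm norm_minus_commute)
  have off: "u \<notin> \<int>\<^sub>\<le>\<^sub>0" "u \<notin> \<real>\<^sub>\<le>\<^sub>0" if "u \<in> B" for u
    using that half_plane_off_nonpos[of u] by (auto simp: B_def gline_def)
  have 1: "norm (Digamma u - Digamma a) \<le> 2 / q * norm (u - a)" if "u \<in> B" for u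
  proof (rule field_differentiable_bound[where f = Digamma and f' = "Polygamma 1" and S = B and x = u and y = a])
    show "(Digamma has_field_derivative Polygamma 1 v) (at v within B)" if "v \<in> B" for v
      using has_field_derivative_Polygamma[OF off(1)[OF that], of 0 B] by simp
    show "norm (Polygamma 1 v) \<le> 2 / q" if "v \<in> B" for v
      using that by (intro Polygamma_1_bound) (auto simp: B_def)
  qed (use B aB that in auto)
  have "norm ((ln_Gamma w - w * Digamma a) - (ln_Gamma a - a * Digamma a)) \<le> 2 / q * norm (w - a) * norm (w - a)"
  proof (rule field_differentiable_bound[where f = "\<lambda>u. ln_Gamma u - u * Digamma a" and f' = "\<lambda>u. Digamma u - Digamma a" and S = B and x = w and y = a])
    show "((\<lambda>u. ln_Gamma u - u * Digamma a) has_field_derivative (Digamma v - Digamma a)) (at v within B)" if "v \<in> B" for v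
    proof (rule has_field_derivative_at_within)
      show "((\<lambda>u. ln_Gamma u - u * Digamma a) has_field_derivative (Digamma v - Digamma a)) (at v)"
        by (rule DERIV_diff[OF has_field_derivative_ln_Gamma_complex[OF off(2)[OF that]]]) (auto intro!: derivative_eq_intros)
    qed
    show "norm (Digamma v - Digamma a) \<le> 2 / q * norm (w - a)" if v: "v \<in> B" for v
    proof -
      have "norm (v - a) \<le> norm (w - a)" using v by (auto simp: B_def dist_norm norm_minus_commute)
      then have "2 / q * norm (v - a) \<le> 2 / q * norm (w - a)" using q by (intro mult_left_mono) auto
      then show ?thesis using 1[OF v] by linarith
    qed
  qed (use B aB in auto)
  then show ?thesis by (simp add: power2_eq_square algebra_simps)
qed

text \<open>\<open>ln a = ln_Gamma (a + 1) - ln_Gamma a\<close> up to a multiple of \<open>2 \<pi> \<i>\<close>, which the real part does not see; a Taylor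
  step of length 1 replaces the difference by \<open>Digamma a\<close>.\<close>
lemma Digamma_Re:
  assumes a: "a \<in> gline q"
  shows "\<bar>ln (norm a) - Re (Digamma a)\<bar> \<le> 2 / q"
proof -
  have a1: "a + 1 \<in> gline q" using a by (auto simp: gline_def)
  have R: "Re a > 0" using a by (simp add: gline_def)
  then have nz: "a \<noteq> 0" by auto
  have G: "Gamma a = exp (ln_Gamma a)" "Gamma (a + 1) = exp (ln_Gamma (a + 1))"
    using half_plane_off_nonpos(1)[of a] half_plane_off_nonpos(1)[of "a + 1"] R by (auto simp: Gamma_complex_altdef)
  have "Gamma (a + 1) = a * Gamma a"
    using half_plane_off_nonpos(1)[OF R] by (rule Gamma_plus1)
  then have "exp (ln_Gamma (a + 1) - ln_Gamma a) = a" unfolding G by (simp add: exp_diff)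
  then have "norm a = exp (Re (ln_Gamma (a + 1) - ln_Gamma a))" by (metis norm_exp_eq_Re)
  then have "ln (norm a) = Re (ln_Gamma (a + 1) - ln_Gamma a)" by simp
  then have "ln (norm a) - Re (Digamma a) = Re (ln_Gamma (a + 1) - ln_Gamma a - ((a + 1) - a) * Digamma a)" by simp
  then have "\<bar>ln (norm a) - Re (Digamma a)\<bar> \<le> norm (ln_Gamma (a + 1) - ln_Gamma a - ((a + 1) - a) * Digamma a)"
    by (simp only: abs_Re_le_cmod)
  also have "\<dots> \<le> 2 / q * (norm ((a + 1) - a))\<^sup>2" by (rule ln_Gamma_taylor[OF a a1])
  finally show ?thesis by simp
qed

end

text \<open>On the vertical line \<open>Re = 2 T\<close> the point \<open>Complex (2 T) (2 v)\<close> corresponds to \<open>s = sv T v\<close> in Riemann's formula.  \<open>av T\<close> is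
  the argument \<open>1 + s/2\<close> of \<open>\<Gamma>\<close> on the critical line, \<open>lam T\<close> is the logarithmic derivative of the Gamma factor there
  (apart from the rational factor), and \<open>mT T\<close> is its value.\<close>
definition av :: "real \<Rightarrow> complex" where "av T = Complex (5 / 4) (- T / 2)"
definition lam :: "real \<Rightarrow> complex" where "lam T = Digamma (av T) / 2 - of_real (ln pi / 2)"
definition sv :: "real \<Rightarrow> real \<Rightarrow> complex" where "sv T v = Complex (1 / 2 + v) (- T)"
definition mT :: "real \<Rightarrow> complex" where "mT T = xi_factor (sv T 0)"

lemma av_gline: "av T \<in> gline (T / 2)" by (simp add: gline_def av_def)

lemma lam_Im: "T > 0 \<Longrightarrow> \<bar>Im (lam T)\<bar> \<le> 1"
  using Digamma_Im_bound[OF _ av_gline, of T] by (simp add: lam_def)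

lemma lam_Re: 
  assumes "T > 0"
  shows "\<bar>Re (lam T) - ln (norm (av T) / pi) / 2\<bar> \<le> 2 / T"
proof -
  have n: "norm (av T) > 0" by (auto simp: av_def complex_eq_iff)
  have "\<bar>ln (norm (av T)) - Re (Digamma (av T))\<bar> \<le> 4 / T"
    using Digamma_Re[OF _ av_gline, of T] assms by simp
  moreover have "Re (lam T) - ln (norm (av T) / pi) / 2 = - (ln (norm (av T)) - Re (Digamma (av T))) / 2"
    using n by (simp add: lam_def ln_divide_pos field_simps)
  ultimately show ?thesis by simp
qed

text \<open>The Gamma factor at distance \<open>v\<close> from the critical line is its value on the line times an exponential in \<open>v\<close>;
  \<open>R\<close> is the Taylor remainder of \<open>ln_Gamma\<close>, and \<open>w\<close> comes from the factor \<open>s - 1\<close>.\<close>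
lemma xi_factor_expansion:
  assumes T: "T > 0" and v: "v \<ge> 0"
  shows "\<exists>R w. norm R \<le> v\<^sup>2 / T \<and> norm w \<le> v / T \<and>
     xi_factor (sv T v) = mT T * exp (lam T * of_real v) * ((1 + w) * exp R)"
proof -
  define b where "b = av T + of_real (v / 2)"
  have b: "b \<in> gline (T / 2)" using v by (simp add: gline_def av_def b_def)
  have eq: "1 + sv T v / 2 = b" "1 + sv T 0 / 2 = av T"
    by (auto simp: sv_def av_def b_def complex_eq_iff field_simps)
  define R where "R = ln_Gamma b - ln_Gamma (av T) - (b - av T) * Digamma (av T)"
  have "norm R \<le> 2 / (T / 2) * (norm (b - av T))\<^sup>2"
    unfolding R_def using T by (intro ln_Gamma_taylor av_gline b) auto
  also have "norm (b - av T) = v / 2" using v by (simp add: b_def)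
  finally have R: "norm R \<le> v\<^sup>2 / T" by (simp add: power2_eq_square)
  have G: "Gamma (av T) = exp (ln_Gamma (av T))" "Gamma b = exp (ln_Gamma b)"
    using half_plane_off_nonpos(1)[of "av T"] half_plane_off_nonpos(1)[of b] v
    by (auto simp: Gamma_complex_altdef av_def b_def)
  have "ln_Gamma b = ln_Gamma (av T) + (of_real (v / 2) * Digamma (av T) + R)"
    by (simp add: R_def b_def)
  then have Gb: "Gamma b = Gamma (av T) * (exp (of_real (v / 2) * Digamma (av T)) * exp R)"
    unfolding G by (simp only: exp_add)
  define c where "c = sv T 0 - 1"
  have c: "norm c \<ge> T" "c \<noteq> 0" using abs_Im_le_cmod[of c] T by (auto simp: c_def sv_def complex_eq_iff)
  define w where "w = of_real v / c"
  have w: "norm w \<le> v / T" using c v T by (simp add: w_def norm_divide frac_le)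
  have s1: "sv T v - 1 = c * (1 + w)" 
  proof -
    have "c * (1 + w) = c + of_real v" using c by (simp add: w_def distrib_left)
    then show ?thesis by (simp add: c_def sv_def complex_eq_iff)
  qed
  have p: "exp (- (sv T v / 2) * of_real (ln pi)) = exp (- (sv T 0 / 2) * of_real (ln pi)) * exp (- of_real (v / 2) * of_real (ln pi))"
    unfolding exp_add[symmetric] by (rule arg_cong[where f = exp]) (simp add: sv_def complex_eq_iff algebra_simps)
  have l: "exp (lam T * of_real v) = exp (- of_real (v / 2) * of_real (ln pi)) * exp (of_real (v / 2) * Digamma (av T))"
    unfolding exp_add[symmetric] by (rule arg_cong[where f = exp]) (simp add: lam_def algebra_simps)
  have "xi_factor (sv T v) = mT T * exp (lam T * of_real v) * ((1 + w) * exp R)"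
    unfolding xi_factor_def mT_def eq Gb s1 p l c_def[symmetric] by (simp only: mult_ac times_divide_eq_left times_divide_eq_right)
  then show ?thesis using R w by blast
qed

definition inv_sqrt :: "real \<Rightarrow> real" where "inv_sqrt T = 1 / sqrt T"

lemma inv_sqrt: "T \<ge> 1 \<Longrightarrow> 0 < inv_sqrt T" "T \<ge> 1 \<Longrightarrow> inv_sqrt T \<le> 1" "T \<ge> 1 \<Longrightarrow> (inv_sqrt T)\<^sup>2 = 1 / T"
  by (auto simp: inv_sqrt_def power_divide)

lemma norm_exp_diff_one: "norm (exp z - 1) \<le> exp (norm z) - 1" for z :: complex
proof -
  define f where "f n = inverse (fact (Suc n)) *\<^sub>R z ^ Suc n" for n
  define g where "g n = inverse (fact (Suc n)) *\<^sub>R norm z ^ Suc n" for n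
  have n: "norm (f n) = g n" for n by (simp add: f_def g_def norm_mult norm_power)
  have "summable g"
    unfolding g_def using summable_ignore_initial_segment[OF summable_exp_generic[of "norm z"], of 1] by simp
  then have "norm (\<Sum>n. f n) \<le> (\<Sum>n. g n)"
    using summable_norm[of f] unfolding n by blast
  moreover have "exp z = 1 + (\<Sum>n. f n)" "exp (norm z) = 1 + (\<Sum>n. g n)"
    unfolding f_def g_def by (rule exp_first_term)+
  ultimately show ?thesis by simp
qed

text \<open>Used with \<open>\<theta> = 1 / sqrt T\<close> to trade the exponent \<open>\<theta>\<^sup>2 y\<close> for a small factor \<open>\<theta>\<close> and the exponent \<open>\<theta> y\<close>.\<close>
lemma exp_convex_bound:
  fixes \<theta> y :: real
  assumes "0 \<le> \<theta>" "\<theta> \<le> 1"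
  shows "exp (\<theta> * y) - 1 \<le> \<theta> * (exp y - 1)"
proof -
  have "exp ((1 - \<theta>) *\<^sub>R 0 + \<theta> *\<^sub>R y) \<le> (1 - \<theta>) * exp 0 + \<theta> * exp y"
    using assms by (intro convex_onD[OF exp_convex]) auto
  then show ?thesis by (simp add: algebra_simps)
qed

text \<open>The errors of \<open>xi_factor_expansion\<close> in a form that survives integration against a Gaussian: a small factor
  \<open>\<theta> = 1 / sqrt T\<close> and a Gaussian-integrable factor \<open>exp (\<theta> (v + v\<^sup>2))\<close>, for all \<open>v\<close> and not only for bounded ones.\<close>
lemma xi_factor_approx:
  assumes T: "T \<ge> 1" and v: "v \<ge> 0"
  defines "\<theta> \<equiv> inv_sqrt T" and "\<alpha> \<equiv> Re (lam T)"
  shows "norm (xi_factor (sv T v) - mT T * exp (lam T * of_real v)) \<le> norm (mT T) * exp (\<alpha> * v) * (\<theta> * exp (\<theta> * (v + v\<^sup>2)))"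
    and "norm (xi_factor (sv T v)) \<le> norm (mT T) * exp (\<alpha> * v) * ((1 + \<theta>) * exp (\<theta> * (v + v\<^sup>2)))"
proof -
  note inv_sqrt = inv_sqrt[OF T, folded \<theta>_def]
  obtain R w where R: "norm R \<le> v\<^sup>2 / T" "norm w \<le> v / T"
    and eq: "xi_factor (sv T v) = mT T * exp (lam T * of_real v) * ((1 + w) * exp R)"
    using xi_factor_expansion[of T v] T v by auto
  have n: "norm (exp (lam T * of_real v)) = exp (\<alpha> * v)" by (simp add: \<alpha>_def)
  have "norm ((1 + w) * exp R - 1) \<le> exp (norm w + norm R) - 1"
  proof -
    have "(1 + w) * exp R - 1 = (exp R - 1) + w * exp R" by (simp add: algebra_simps)
    also have "norm \<dots> \<le> norm (exp R - 1) + norm w * norm (exp R)"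
      by (rule order_trans[OF norm_triangle_ineq]) (simp add: norm_mult)
    also have "\<dots> \<le> (exp (norm R) - 1) + norm w * exp (norm R)"
      using norm_exp_diff_one[of R] norm_exp[of R] by (intro add_mono mult_left_mono) auto
    also have "\<dots> = (1 + norm w) * exp (norm R) - 1" by (simp add: algebra_simps)
    also have "\<dots> \<le> exp (norm w) * exp (norm R) - 1"
      using exp_ge_add_one_self[of "norm w"] by (intro diff_right_mono mult_right_mono) auto
    finally show ?thesis by (simp add: exp_add)
  qed
  also have "\<dots> \<le> exp (\<theta> * (\<theta> * (v + v\<^sup>2))) - 1"
  proof -
    have "\<theta> * (\<theta> * (v + v\<^sup>2)) = \<theta>\<^sup>2 * (v + v\<^sup>2)" by (simp add: power2_eq_square)
    also have "\<dots> = v / T + v\<^sup>2 / T" unfolding inv_sqrt(3) by (simp add: add_divide_distrib)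
    finally show ?thesis using R by simp
  qed
  also have "\<dots> \<le> \<theta> * (exp (\<theta> * (v + v\<^sup>2)) - 1)" using inv_sqrt by (intro exp_convex_bound) auto
  finally have e: "norm ((1 + w) * exp R - 1) \<le> \<theta> * (exp (\<theta> * (v + v\<^sup>2)) - 1)" .
  have E1: "exp (\<theta> * (v + v\<^sup>2)) \<ge> 1" using inv_sqrt v by simp
  have "xi_factor (sv T v) - mT T * exp (lam T * of_real v) = mT T * exp (lam T * of_real v) * ((1 + w) * exp R - 1)"
    unfolding eq by (simp add: algebra_simps)
  then have "norm (xi_factor (sv T v) - mT T * exp (lam T * of_real v)) = norm (mT T) * exp (\<alpha> * v) * norm ((1 + w) * exp R - 1)"
    by (simp only: norm_mult n)
  also have "\<dots> \<le> norm (mT T) * exp (\<alpha> * v) * (\<theta> * exp (\<theta> * (v + v\<^sup>2)))"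
    using e inv_sqrt by (intro mult_left_mono) (auto simp: algebra_simps)
  finally show "norm (xi_factor (sv T v) - mT T * exp (lam T * of_real v)) \<le> norm (mT T) * exp (\<alpha> * v) * (\<theta> * exp (\<theta> * (v + v\<^sup>2)))" .
  have "norm ((1 + w) * exp R) \<le> 1 + norm ((1 + w) * exp R - 1)"
    using norm_triangle_ineq[of 1 "(1 + w) * exp R - 1"] by simp
  also have "\<dots> \<le> (1 + \<theta>) * exp (\<theta> * (v + v\<^sup>2))"
  proof -
    have *: "1 + N \<le> (1 + \<theta>) * E" if "N \<le> \<theta> * (E - 1)" "1 \<le> E" for N E :: real
      using that inv_sqrt(1,2) unfolding ring_distribs by linarith
    show ?thesis using e E1 by (rule *)
  qed
  finally have "norm (mT T) * exp (\<alpha> * v) * norm ((1 + w) * exp R) \<le> norm (mT T) * exp (\<alpha> * v) * ((1 + \<theta>) * exp (\<theta> * (v + v\<^sup>2)))"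
    by (intro mult_left_mono) auto
  then show "norm (xi_factor (sv T v)) \<le> norm (mT T) * exp (\<alpha> * v) * ((1 + \<theta>) * exp (\<theta> * (v + v\<^sup>2)))"
    unfolding eq norm_mult[of _ "(1 + w) * exp R"] norm_mult[of "mT T"] n .
qed

lemma H0_sv: "v > 1 / 2 \<Longrightarrow> H 0 (Complex (2 * T) (2 * v)) = xi_factor (sv T v) * zeta_sum (sv T v)"
  using H0_eq_zeta[of "sv T v"] by (simp add: sv_def Complex_eq algebra_simps)

text \<open>Pointwise comparison of \<open>H 0\<close> with an exponential on a vertical line.  To the right of \<open>v = 3/2\<close> this is Riemann's formula;
  to the left the modulus is at most its value at \<open>3/2\<close>, by \<open>H0_modulus_le\<close>.\<close>
lemma H0_approx:
  assumes T: "T \<ge> 10 ^ 10" and \<alpha>0: "Re (lam T) \<ge> 0"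
  defines "\<theta> \<equiv> inv_sqrt T" and "\<alpha> \<equiv> Re (lam T)"
  shows "norm (indicator {0<..} v *\<^sub>R H 0 (Complex (2 * T) (2 * v)) - mT T * exp (lam T * of_real v))
    \<le> norm (mT T) * (exp (\<alpha> * v) * exp (\<theta> * (v + v\<^sup>2)) * ((1 + \<theta>) * (13 / 5 * 2 powr (- 1 / 2 - v)) + \<theta>) + 27 / 10 * exp (3 / 2 * \<alpha>))"
proof -
  have T1: "T \<ge> 1" using T by simp
  note inv_sqrt = inv_sqrt[OF T1, folded \<theta>_def]
  have th5: "\<theta> \<le> 1 / 10 ^ 5"
  proof -
    have "\<theta>\<^sup>2 \<le> (1 / 10 ^ 5)\<^sup>2" unfolding inv_sqrt(3) using T by (simp add: power_divide divide_simps)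
    then show ?thesis by (rule power2_le_imp_le) simp
  qed
  have n: "norm (mT T * exp (lam T * of_real v)) = norm (mT T) * exp (\<alpha> * v)" for v
    by (simp add: \<alpha>_def norm_mult)
  define A where "A = exp (\<alpha> * v) * exp (\<theta> * (v + v\<^sup>2)) * ((1 + \<theta>) * (13 / 5 * 2 powr (- 1 / 2 - v)) + \<theta>)"
  have A0: "A \<ge> 0" unfolding A_def using inv_sqrt by (intro mult_nonneg_nonneg add_nonneg_nonneg) auto
  show ?thesis
  proof (cases "v \<ge> 3 / 2")
    case True
    define x where "x = xi_factor (sv T v)"
    have z: "norm (zeta_sum (sv T v) - 1) \<le> 13 / 5 * 2 powr (- 1 / 2 - v)"
      using zeta_sum_minus_one[of "sv T v"] True by (simp add: sv_def)
    have H: "H 0 (Complex (2 * T) (2 * v)) = x * zeta_sum (sv T v)" unfolding x_def by (rule H0_sv) (use True in simp)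
    have xb: "norm (x - mT T * exp (lam T * of_real v)) \<le> norm (mT T) * exp (\<alpha> * v) * (\<theta> * exp (\<theta> * (v + v\<^sup>2)))"
      "norm x \<le> norm (mT T) * exp (\<alpha> * v) * ((1 + \<theta>) * exp (\<theta> * (v + v\<^sup>2)))"
      unfolding x_def \<alpha>_def \<theta>_def using True by (intro xi_factor_approx T1; simp)+
    have "indicator {0<..} v *\<^sub>R H 0 (Complex (2 * T) (2 * v)) - mT T * exp (lam T * of_real v) = x * (zeta_sum (sv T v) - 1) + (x - mT T * exp (lam T * of_real v))"
    proof -
      have "indicator {0<..} v *\<^sub>R H 0 (Complex (2 * T) (2 * v)) = x * zeta_sum (sv T v)" using True H by simp
      then show ?thesis by (simp add: right_diff_distrib)
    qed
    also have "norm \<dots> \<le> norm x * norm (zeta_sum (sv T v) - 1) + norm (x - mT T * exp (lam T * of_real v))"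
      by (rule order_trans[OF norm_triangle_ineq]) (simp add: norm_mult)
    also have "\<dots> \<le> norm (mT T) * exp (\<alpha> * v) * ((1 + \<theta>) * exp (\<theta> * (v + v\<^sup>2))) * (13 / 5 * 2 powr (- 1 / 2 - v)) + norm (mT T) * exp (\<alpha> * v) * (\<theta> * exp (\<theta> * (v + v\<^sup>2)))"
      using xb z inv_sqrt by (intro add_mono mult_mono mult_nonneg_nonneg) auto
    also have "\<dots> = norm (mT T) * A" unfolding A_def by (simp only: algebra_simps)
    also have "\<dots> \<le> norm (mT T) * (A + 27 / 10 * exp (3 / 2 * \<alpha>))" by (intro mult_left_mono) auto
    finally show ?thesis unfolding A_def .
  next
    \<comment> \<open>the two terms are estimated separately; \<open>27/10\<close> is \<open>17/10\<close> for \<open>H 0\<close> at \<open>3/2\<close> plus 1 for the exponential\<close>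
    case False
    have m1: "norm (mT T * exp (lam T * of_real v)) \<le> norm (mT T) * exp (3 / 2 * \<alpha>)"
    proof -
      have "\<alpha> * v \<le> \<alpha> * (3 / 2)" using False \<alpha>0 by (intro mult_left_mono) (auto simp: \<alpha>_def)
      then show ?thesis unfolding n by (intro mult_left_mono) (auto simp: mult.commute)
    qed
    have m2: "norm (indicator {0<..} v *\<^sub>R H 0 (Complex (2 * T) (2 * v))) \<le> norm (mT T) * (17 / 10 * exp (3 / 2 * \<alpha>))"
    proof (cases "v > 0")
      case True
      have "norm (H 0 (Complex (2 * T) (2 * v))) \<le> norm (H 0 (Complex (2 * T) 3))"
        using True False by (intro H0_modulus_le) auto
      also have "H 0 (Complex (2 * T) 3) = xi_factor (sv T (3 / 2)) * zeta_sum (sv T (3 / 2))"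
        using H0_sv[of "3 / 2" T] by simp
      also have "norm \<dots> \<le> (norm (mT T) * exp (\<alpha> * (3 / 2)) * ((1 + \<theta>) * exp (\<theta> * (3 / 2 + (3 / 2)\<^sup>2)))) * (33 / 20)"
        unfolding norm_mult
      proof (intro mult_mono)
        show "norm (xi_factor (sv T (3 / 2))) \<le> norm (mT T) * exp (\<alpha> * (3 / 2)) * ((1 + \<theta>) * exp (\<theta> * (3 / 2 + (3 / 2)\<^sup>2)))"
          unfolding \<alpha>_def \<theta>_def by (rule xi_factor_approx(2)[OF T1]) simp
        have "norm (zeta_sum (sv T (3 / 2)) - 1) \<le> 13 / 5 * 2 powr (- 2)"
          using zeta_sum_minus_one[of "sv T (3 / 2)"] by (simp add: sv_def)
        then have "norm (zeta_sum (sv T (3 / 2)) - 1) \<le> 13 / 20" by (simp add: powr_minus powr_numeral)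
        then show "norm (zeta_sum (sv T (3 / 2))) \<le> 33 / 20"
          using norm_triangle_ineq[of 1 "zeta_sum (sv T (3 / 2)) - 1"] by simp
      qed (use inv_sqrt in auto)
      also have "\<dots> \<le> norm (mT T) * exp (\<alpha> * (3 / 2)) * (17 / 10)"
      proof -
        have "\<theta> * (3 / 2 + (3 / 2)\<^sup>2) \<le> 4 / 10 ^ 5" using th5 by (simp add: power2_eq_square)
        then have "exp (\<theta> * (3 / 2 + (3 / 2)\<^sup>2)) \<le> exp (4 / 10 ^ 5)" by simp
        also have "\<dots> \<le> 1001 / 1000"
          using exp_bound[of "4 / 10 ^ 5"] by (simp add: power2_eq_square)
        finally have "exp (\<theta> * (3 / 2 + (3 / 2)\<^sup>2)) \<le> 1001 / 1000" .
        then have "(1 + \<theta>) * exp (\<theta> * (3 / 2 + (3 / 2)\<^sup>2)) \<le> (1 + 1 / 10 ^ 5) * (1001 / 1000)"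
          using th5 inv_sqrt by (intro mult_mono) auto
        then have "((1 + \<theta>) * exp (\<theta> * (3 / 2 + (3 / 2)\<^sup>2))) * (33 / 20) \<le> 17 / 10" by simp
        then show ?thesis unfolding mult.assoc[of _ _ "33 / 20"] by (intro mult_left_mono) auto
      qed
      finally show ?thesis using True by (simp add: mult_ac)
    qed auto
    have "norm (indicator {0<..} v *\<^sub>R H 0 (Complex (2 * T) (2 * v)) - mT T * exp (lam T * of_real v)) \<le> norm (mT T) * (27 / 10 * exp (3 / 2 * \<alpha>))"
      using norm_triangle_ineq4[of "indicator {0<..} v *\<^sub>R H 0 (Complex (2 * T) (2 * v))" "mT T * exp (lam T * of_real v)"] m1 m2
      by (simp add: algebra_simps)
    also have "\<dots> \<le> norm (mT T) * (A + 27 / 10 * exp (3 / 2 * \<alpha>))" using A0 by (intro mult_left_mono) auto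
    finally show ?thesis unfolding A_def .
  qed
qed

lemma gauss_quad_integral:
  assumes t: "t > 0" and \<theta>: "0 \<le> \<theta>" "\<theta> * t < 1"
  shows "integrable lborel (\<lambda>v. gauss t (v - h) * exp (b * v + \<theta> * v\<^sup>2))"
    "(LINT v|lborel. gauss t (v - h) * exp (b * v + \<theta> * v\<^sup>2)) = 1 / sqrt (1 - \<theta> * t) * exp ((h * b + b\<^sup>2 * t / 4 + \<theta> * h\<^sup>2) / (1 - \<theta> * t))"
proof -
  define a where "a = 1 / t - \<theta>"
  have a: "a > 0" using t \<theta> by (simp add: a_def field_simps)
  define c where "c = 1 - \<theta> * t"
  have c: "c > 0" "a * t = c" using t \<theta> by (auto simp: c_def a_def field_simps)
  define K where "K = exp (- h\<^sup>2 / t) / sqrt (pi * t)"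
  have eq: "gauss t (v - h) * exp (b * v + \<theta> * v\<^sup>2) = K * exp (- a * v\<^sup>2 + (b + 2 * h / t) * v)" for v
  proof -
    have "- (v - h)\<^sup>2 / t + (b * v + \<theta> * v\<^sup>2) = - h\<^sup>2 / t + (- a * v\<^sup>2 + (b + 2 * h / t) * v)"
      using t by (simp add: a_def power2_eq_square field_simps)
    then have "exp (- (v - h)\<^sup>2 / t) * exp (b * v + \<theta> * v\<^sup>2) = exp (- h\<^sup>2 / t) * exp (- a * v\<^sup>2 + (b + 2 * h / t) * v)"
      by (simp only: exp_add[symmetric])
    then show ?thesis by (simp add: gauss_def K_def)
  qed
  show "integrable lborel (\<lambda>v. gauss t (v - h) * exp (b * v + \<theta> * v\<^sup>2))"
    unfolding eq by (intro integrable_mult_right gauss_integral_real a)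
  have "(LINT v|lborel. gauss t (v - h) * exp (b * v + \<theta> * v\<^sup>2)) = K * (sqrt (pi / a) * exp ((b + 2 * h / t)\<^sup>2 / (4 * a)))"
    unfolding eq by (subst integral_mult_right_zero) (simp only: gauss_integral_real(2)[OF a])
  also have "\<dots> = (sqrt (pi / a) / sqrt (pi * t)) * (exp (- h\<^sup>2 / t) * exp ((b + 2 * h / t)\<^sup>2 / (4 * a)))"
    by (simp add: K_def)
  also have "sqrt (pi / a) / sqrt (pi * t) = 1 / sqrt c"
  proof -
    have "sqrt (pi / a) / sqrt (pi * t) = sqrt ((pi / a) / (pi * t))" by (rule real_sqrt_divide[symmetric])
    also have "(pi / a) / (pi * t) = 1 / c" using c(2)[symmetric] by simp
    finally show ?thesis by (simp add: real_sqrt_divide)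
  qed
  also have "exp (- h\<^sup>2 / t) * exp ((b + 2 * h / t)\<^sup>2 / (4 * a)) = exp ((h * b + b\<^sup>2 * t / 4 + \<theta> * h\<^sup>2) / c)"
  proof -
    have at: "a = c / t" using c(2) t by (simp add: field_simps)
    have "- h\<^sup>2 / t + (b + 2 * h / t)\<^sup>2 / (4 * a) = (h * b + b\<^sup>2 * t / 4 + \<theta> * h\<^sup>2) / c"
    proof -
      have "(b + 2 * h / t)\<^sup>2 / (4 * a) = (b\<^sup>2 * t / 4 + b * h + h\<^sup>2 / t) / c"
        unfolding at using t c by (simp add: power2_eq_square field_simps)
      moreover have "- h\<^sup>2 / t = (- h\<^sup>2 / t + \<theta> * h\<^sup>2) / c"
      proof -
        have "(- h\<^sup>2 / t) * c = - h\<^sup>2 / t + \<theta> * h\<^sup>2" using t by (simp add: c_def field_simps)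
        then show ?thesis using c by (simp add: eq_divide_eq)
      qed
      ultimately have "- h\<^sup>2 / t + (b + 2 * h / t)\<^sup>2 / (4 * a) = ((- h\<^sup>2 / t + \<theta> * h\<^sup>2) + (b\<^sup>2 * t / 4 + b * h + h\<^sup>2 / t)) / c"
        by (simp only: add_divide_distrib)
      then show ?thesis by (simp add: mult.commute add_ac)
    qed
    then show ?thesis by (simp only: exp_add[symmetric])
  qed
  finally show "(LINT v|lborel. gauss t (v - h) * exp (b * v + \<theta> * v\<^sup>2)) = 1 / sqrt (1 - \<theta> * t) * exp ((h * b + b\<^sup>2 * t / 4 + \<theta> * h\<^sup>2) / (1 - \<theta> * t))"
    by (simp add: c_def)
qed

text \<open>A quadratic perturbation \<open>\<theta> v\<^sup>2\<close> of the exponent with \<open>\<theta>\<close> small compared with \<open>b\<^sup>-\<^sup>2\<close> changes the Gaussian average of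
  \<open>exp (b v)\<close> by at most one per cent.\<close>
lemma gauss_quad_bound:
  assumes t: "0 < t" "t \<le> 1 / 5" and h: "\<bar>h\<bar> \<le> 2" and b: "b \<ge> 0" and \<theta>: "0 \<le> \<theta>" "\<theta> * (b + 10)\<^sup>2 \<le> 1 / 1000"
  shows "(LINT v|lborel. gauss t (v - h) * exp (b * v + \<theta> * v\<^sup>2)) \<le> 101 / 100 * exp (h * b + b\<^sup>2 * t / 4)"
proof -
  define X where "X = h * b + b\<^sup>2 * t / 4"
  have h2: "h\<^sup>2 \<le> 4" using h abs_le_imp_square_le[of h 2] by simp
  have "100 \<le> (b + 10)\<^sup>2" using b power_mono[of 10 "b + 10" 2] by simp
  then have "\<theta> * 100 \<le> \<theta> * (b + 10)\<^sup>2" using \<theta> by (intro mult_left_mono) auto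
  then have th5: "\<theta> \<le> 1 / 100000" using \<theta> by simp
  have tt: "\<theta> * t \<le> 1 / 100000 * (1 / 5)" using th5 t \<theta> by (intro mult_mono) auto
  then have c: "\<theta> * t < 1" "1 - \<theta> * t \<ge> 99 / 100" by auto
  have X: "\<bar>X\<bar> \<le> (b + 10)\<^sup>2"
  proof -
    have "\<bar>h * b\<bar> \<le> 2 * b" using h b by (simp add: abs_mult mult_right_mono)
    moreover have "0 \<le> b\<^sup>2 * t" "b\<^sup>2 * t \<le> b\<^sup>2 * 1" using t by (simp, intro mult_left_mono) auto
    moreover have "(b + 10)\<^sup>2 = b\<^sup>2 + 20 * b + 100" by (simp add: power2_eq_square algebra_simps)
    ultimately show ?thesis unfolding X_def using b by (simp add: abs_le_iff)
  qed
  have "(X + \<theta> * h\<^sup>2) / (1 - \<theta> * t) - X = (\<theta> * h\<^sup>2 + t * (\<theta> * X)) / (1 - \<theta> * t)"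
    using c by (simp add: field_simps)
  also have "\<dots> \<le> (1 / 1000) / (99 / 100)"
  proof (intro frac_le)
    have "\<theta> * h\<^sup>2 \<le> (1 / 100000) * 4" using th5 h2 \<theta> by (intro mult_mono) auto
    moreover have "t * (\<theta> * X) \<le> (1 / 5) * (1 / 1000)"
    proof -
      have "\<theta> * X \<le> \<theta> * (b + 10)\<^sup>2" using X \<theta> by (intro mult_left_mono) auto
      then have "\<theta> * X \<le> 1 / 1000" using \<theta> by simp
      then have "t * (\<theta> * X) \<le> t * (1 / 1000)" using t by (intro mult_left_mono) auto
      then show ?thesis using t by linarith
    qed
    ultimately show "\<theta> * h\<^sup>2 + t * (\<theta> * X) \<le> 1 / 1000" by simp
  qed (use c in auto)
  finally have "(X + \<theta> * h\<^sup>2) / (1 - \<theta> * t) - X \<le> (1 / 1000) / (99 / 100)" .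
  moreover have "Q \<le> X + 2 / 1000" if "Q - X \<le> (1 / 1000) / (99 / 100)" for Q using that by simp
  ultimately have "(X + \<theta> * h\<^sup>2) / (1 - \<theta> * t) \<le> X + 2 / 1000" by blast
  then have e: "exp ((X + \<theta> * h\<^sup>2) / (1 - \<theta> * t)) \<le> exp X * (1003 / 1000)"
  proof -
    assume "(X + \<theta> * h\<^sup>2) / (1 - \<theta> * t) \<le> X + 2 / 1000"
    then have "exp ((X + \<theta> * h\<^sup>2) / (1 - \<theta> * t)) \<le> exp X * exp (2 / 1000)" by (simp flip: exp_add)
    also have "\<dots> \<le> exp X * (1003 / 1000)" using exp_bound[of "2 / 1000"] by (intro mult_left_mono) (auto simp: power2_eq_square)
    finally show ?thesis .
  qed
  have s: "1 / sqrt (1 - \<theta> * t) \<le> 1005 / 1000"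
  proof -
    have "(1000 / 1005)\<^sup>2 \<le> 1 - \<theta> * t" using tt by (simp add: power2_eq_square)
    then have "1000 / 1005 \<le> sqrt (1 - \<theta> * t)" by (rule real_le_rsqrt)
    then have "1 / sqrt (1 - \<theta> * t) \<le> 1 / (1000 / 1005)" using c by (intro divide_left_mono) auto
    then show ?thesis by simp
  qed
  have "1 / sqrt (1 - \<theta> * t) * exp ((X + \<theta> * h\<^sup>2) / (1 - \<theta> * t)) \<le> 1005 / 1000 * (exp X * (1003 / 1000))"
    using s e by (intro mult_mono) auto
  also have "\<dots> \<le> 101 / 100 * exp X" by simp
  finally show ?thesis unfolding gauss_quad_integral(2)[OF t(1) \<theta>(1) c(1)] X_def .
qed

text \<open>The part of the Gaussian average over the right half of the vertical line.  Splitting at the critical line, and not further to the right,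
  lets the functional equation supply the other half.\<close>
definition H_right :: "real \<Rightarrow> real \<Rightarrow> real \<Rightarrow> complex" where
  "H_right T t h = (LINT v|lborel. of_real (gauss t (v - h)) * (indicator {0<..} v *\<^sub>R H 0 (Complex (2 * T) (2 * v))))"

lemma H_right_integrable: "t > 0 \<Longrightarrow> A \<in> sets borel \<Longrightarrow> integrable lborel (\<lambda>v. of_real (gauss t (v - h)) * (indicator A v *\<^sub>R H 0 (Complex (2 * T) (2 * v))))"
  using integrable_mult_indicator[OF _ H_gauss_average(1)[of t h "2 * T"], of A] by (simp add: mult_scaleR_right)

text \<open>By evenness and reality \<open>H 0\<close> takes conjugate values at reflected points of the line, so the left half is the conjugate of a
  right half with opposite \<open>h\<close>: an analogue of the Riemann--Siegel formula.\<close>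
lemma H_eq_H_right:
  assumes t: "t > 0"
  shows "H t (Complex (2 * T) (2 * h)) = H_right T t h + cnj (H_right T t (- h))"
proof -
  define f where "f v = H 0 (Complex (2 * T) (2 * v))" for v
  have fneg: "f (- v) = cnj (f v)" for v
    unfolding f_def using real_even_entire.real[OF H_real_even_entire, of 0 "Complex (2 * T) (2 * v)"] by (simp add: complex_cnj)
  have meas: "(\<lambda>v. of_real (gauss t (v - h)) * (indicator A v *\<^sub>R f v)) \<in> borel_measurable lborel" if "A \<in> sets borel" for A
    using borel_measurable_integrable[OF H_right_integrable[OF t that, of h T]] by (simp add: f_def)
  have "H t (Complex (2 * T) (2 * h)) = (LINT v|lborel. of_real (gauss t (v - h)) * f v)"
    unfolding f_def by (rule H_gauss_average(2)[OF t])
  also have "\<dots> = (LINT v|lborel. of_real (gauss t (v - h)) * (indicator {0<..} v *\<^sub>R f v) + of_real (gauss t (v - h)) * (indicator {..0} v *\<^sub>R f v))"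
    by (rule Bochner_Integration.integral_cong) (auto simp: indicator_def)
  also have "\<dots> = H_right T t h + (LINT v|lborel. of_real (gauss t (v - h)) * (indicator {..0} v *\<^sub>R f v))"
    unfolding H_right_def f_def by (rule Bochner_Integration.integral_add) (intro H_right_integrable t; simp)+
  also have "(LINT v|lborel. of_real (gauss t (v - h)) * (indicator {..0} v *\<^sub>R f v)) = (LINT v|lborel. of_real (gauss t (v - h)) * (indicator {..<0} v *\<^sub>R f v))"
  proof (rule integral_cong_AE)
    show "AE v in lborel. of_real (gauss t (v - h)) * (indicator {..0} v *\<^sub>R f v) = of_real (gauss t (v - h)) * (indicator {..<0} v *\<^sub>R f v)"
      using AE_lborel_singleton[of "0::real"] by eventually_elim (auto simp: indicator_def)
  qed (rule meas; simp)+
  also have "\<dots> = \<bar>- 1\<bar> *\<^sub>R (LINT v|lborel. of_real (gauss t ((0 + - 1 * v) - h)) * (indicator {..<0} (0 + - 1 * v) *\<^sub>R f (0 + - 1 * v)))"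
    by (rule lborel_integral_real_affine) simp
  also have "\<dots> = (LINT v|lborel. cnj (of_real (gauss t (v - - h)) * (indicator {0<..} v *\<^sub>R f v)))"
  proof -
    have g: "gauss t (- v - h) = gauss t (v + h)" for v by (simp add: gauss_def power2_eq_square algebra_simps)
    show ?thesis by (simp add: fneg g indicator_def)
  qed
  also have "\<dots> = cnj (H_right T t (- h))" unfolding H_right_def f_def by (rule Bochner_Integration.integral_cnj)
  finally show ?thesis .
qed

text \<open>\<open>Re (lam T)\<close> is at most about \<open>ln T / 2\<close>, so the left-hand side is about \<open>(ln T / 2 + 10)\<^sup>2 / sqrt T\<close>, which is decreasing; at \<open>T = 10\<^sup>1\<^sup>2\<close> it
  is below \<open>1 / 1000\<close>.\<close>
lemma inv_sqrt_lam_small: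
  assumes T: "T \<ge> 10 ^ 12" and \<alpha>: "Re (lam T) \<ge> 0"
  shows "inv_sqrt T * (Re (lam T) + inv_sqrt T + 10)\<^sup>2 \<le> 1 / 1000"
proof -
  have T0: "T > 0" "T \<ge> 1" using T by auto
  define L where "L = ln T / 2"
  have av: "norm (av T) \<le> T"
  proof -
    have "norm (av T) \<le> \<bar>Re (av T)\<bar> + \<bar>Im (av T)\<bar>" by (rule cmod_le)
    then show ?thesis using T by (simp add: av_def)
  qed
  have avp: "norm (av T) > 0" by (auto simp: av_def complex_eq_iff)
  have "norm (av T) / pi \<le> T / 1"
    using av pi_ge_two T by (intro frac_le) auto
  then have "ln (norm (av T) / pi) \<le> ln T" using avp by (intro ln_mono) auto
  moreover have "2 / T \<le> 1 / 100" using T by (simp add: field_simps)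
  ultimately have aL: "Re (lam T) \<le> L + 1 / 100" using lam_Re[OF T0(1)] by (simp add: L_def)
  have the: "inv_sqrt T = exp (- L)"
  proof -
    have "sqrt T = exp L"
      by (rule real_sqrt_unique) (use T0 in \<open>auto simp: L_def power2_eq_square simp flip: exp_add\<close>)
    then show ?thesis by (simp add: inv_sqrt_def exp_minus inverse_eq_divide)
  qed
  have th5: "inv_sqrt T \<le> 1 / 100"
  proof -
    have "(inv_sqrt T)\<^sup>2 \<le> (1 / 100)\<^sup>2" using T T0 by (subst inv_sqrt(3)) (auto simp: field_simps power2_eq_square)
    then show ?thesis by (rule power2_le_imp_le) simp
  qed
  \<comment> \<open>\<open>exp 13.8\<close> is slightly less than \<open>10\<^sup>6\<close>, the square root of the least \<open>T\<close>\<close>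
  define d where "d = L - 138 / 10"
  have e138: "exp (138 / 10 :: real) \<le> 10 ^ 6" and e138': "exp (138 / 10 :: real) \<ge> 7 * 10 ^ 5"
  proof -
    have "inverse (2 ^ 32 :: real) \<le> 1 / 100" by simp
    then have "\<bar>exp 1 - 5837465777 / 2147483648\<bar> \<le> (1 / 100 :: real)" using e_approx_32 by linarith
    then have e1: "exp (1 :: real) \<le> 272 / 100" "27 / 10 \<le> exp (1 :: real)" using e_less_272 by linarith+
    have e14: "exp (14 :: real) = exp 1 ^ 14" by (simp flip: exp_of_nat_mult)
    have "exp (14 :: real) = exp (138 / 10) * exp (2 / 10)" by (simp flip: exp_add)
    moreover have "122 / 100 \<le> exp (2 / 10 :: real)" "exp (2 / 10 :: real) \<le> 124 / 100"
      using exp_lower_Taylor_quadratic[of "2 / 10"] exp_bound[of "2 / 10"] by (auto simp: power2_eq_square)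
    ultimately have "exp (138 / 10) * (122 / 100) \<le> exp (14 :: real)" "exp (14 :: real) \<le> exp (138 / 10) * (124 / 100)"
      by (auto intro!: mult_left_mono)
    moreover have "exp (14 :: real) \<le> (272 / 100) ^ 14" "(27 / 10) ^ 14 \<le> exp (14 :: real)"
      unfolding e14 using e1 by (auto intro!: power_mono)
    ultimately show "exp (138 / 10 :: real) \<le> 10 ^ 6" "exp (138 / 10 :: real) \<ge> 7 * 10 ^ 5" by (simp_all add: power_divide)
  qed
  have d: "d \<ge> 0"
  proof -
    have "exp (2 * (138 / 10)) = (exp (138 / 10 :: real))\<^sup>2" by (simp add: power2_eq_square flip: exp_add)
    also have "\<dots> \<le> (10 ^ 6)\<^sup>2" using e138 by (intro power_mono) auto
    also have "\<dots> \<le> T" using T by simp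
    finally have "2 * (138 / 10) \<le> ln T" using T0 by (subst ln_ge_iff) auto
    then show ?thesis by (simp add: d_def L_def)
  qed
  \<comment> \<open>linear growth in \<open>d\<close> is dominated by \<open>exp (d / 20)\<close>, and \<open>inv_sqrt T\<close> decays like \<open>exp (- d)\<close>\<close>
  have "Re (lam T) + inv_sqrt T + 10 \<le> 24 * (1 + d / 20)"
    using aL th5 d unfolding d_def by argo
  also have "\<dots> \<le> 24 * exp (d / 20)" by (intro mult_left_mono exp_ge_add_one_self) auto
  finally have "(Re (lam T) + inv_sqrt T + 10)\<^sup>2 \<le> (24 * exp (d / 20))\<^sup>2"
    using \<alpha> T0 by (intro power_mono) (auto simp: inv_sqrt_def)
  also have "\<dots> = 576 * exp (d / 10)" by (simp add: power_mult_distrib power2_eq_square flip: exp_add)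
  also have "\<dots> \<le> 576 * exp d" using d by simp
  finally have "inv_sqrt T * (Re (lam T) + inv_sqrt T + 10)\<^sup>2 \<le> inv_sqrt T * (576 * exp d)"
    using T0 by (intro mult_left_mono) (auto simp: inv_sqrt_def)
  also have "\<dots> = 576 / exp (138 / 10)" unfolding the d_def exp_diff exp_minus by (simp add: divide_simps)
  also have "\<dots> \<le> 576 / (7 * 10 ^ 5)" using e138' by (intro divide_left_mono) auto
  finally show ?thesis by simp
qed

text \<open>The main analytic estimate.  Integrating \<open>H0_approx\<close> against the Gaussian, the exponential \<open>exp (\<lambda> v)\<close> averages to
  \<open>exp (\<lambda> h + \<lambda>\<^sup>2 t / 4)\<close>, and the correction \<open>\<zeta> - 1\<close>, of size \<open>2\<^sup>-\<^sup>v\<close>, averages to a smaller exponential: replacing \<open>\<alpha>\<close> by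
  \<open>\<alpha> - ln 2\<close> gains the factor \<open>2\<^sup>-\<^sup>h 2\<^sup>-\<^sup>\<alpha>\<^sup>t\<^sup>/\<^sup>2\<close>.  The last term comes from the part of the line left of \<open>3/2\<close>.\<close>
lemma H_right_estimate:
  assumes T: "T \<ge> 10 ^ 12" and \<alpha>0: "Re (lam T) \<ge> 1" and t: "0 < t" "t \<le> 1 / 5" and h: "\<bar>h\<bar> \<le> 2"
  defines "\<alpha> \<equiv> Re (lam T)" 
  shows "norm (H_right T t h - mT T * exp (lam T * of_real h + (lam T)\<^sup>2 * of_real t / 4)) \<le>
    norm (mT T) * ((2 * 2 powr (- h) * 2 powr (- \<alpha> * t / 2) + 1 / 1000) * exp (\<alpha> * h + \<alpha>\<^sup>2 * t / 4) + 27 / 10 * exp (3 / 2 * \<alpha>))"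
proof -
  have T1: "T \<ge> 1" "T \<ge> 10 ^ 10" using T by auto
  define \<theta> where "\<theta> = inv_sqrt T"
  have \<theta>: "0 < \<theta>" "\<theta> \<le> 1 / 10000"
  proof -
    show "0 < \<theta>" using T1 by (simp add: \<theta>_def inv_sqrt_def)
    have "\<theta>\<^sup>2 \<le> (1 / 10000)\<^sup>2" unfolding \<theta>_def inv_sqrt(3)[OF T1(1)] using T by (simp add: field_simps power2_eq_square)
    then show "\<theta> \<le> 1 / 10000" by (rule power2_le_imp_le) simp
  qed
  have \<alpha>: "\<alpha> \<ge> 1" using \<alpha>0 by (simp add: \<alpha>_def)
  have small: "\<theta> * (\<alpha> + \<theta> + 10)\<^sup>2 \<le> 1 / 1000"
    unfolding \<theta>_def \<alpha>_def by (rule inv_sqrt_lam_small) (use T \<alpha>0 in auto)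
  define l2 where "l2 = ln (2 :: real)"
  have l2: "0 < l2" "l2 \<le> 7 / 10" using ln_2_less_1 ln2_le_25_over_36 by (auto simp: l2_def)
  \<comment> \<open>the exponents of the two error terms: \<open>2 powr (- v)\<close> shifts \<open>\<alpha>\<close> by \<open>ln 2\<close>\<close>
  define b1 b2 where "b1 = \<alpha> + \<theta> - l2" and "b2 = \<alpha> + \<theta>"
  have b: "b1 \<ge> 0" "b2 \<ge> 0" "b1 \<le> b2" using \<alpha> \<theta> l2 by (auto simp: b1_def b2_def)
  have sm2: "\<theta> * (b2 + 10)\<^sup>2 \<le> 1 / 1000" using small by (simp add: b2_def)
  have sm1: "\<theta> * (b1 + 10)\<^sup>2 \<le> 1 / 1000"
  proof -
    have "(b1 + 10)\<^sup>2 \<le> (b2 + 10)\<^sup>2" using b by (intro power_mono) auto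
    then have "\<theta> * (b1 + 10)\<^sup>2 \<le> \<theta> * (b2 + 10)\<^sup>2" using \<theta> by (intro mult_left_mono) auto
    then show ?thesis using sm2 by simp
  qed
  have \<theta>t: "\<theta> * t < 1"
  proof -
    have "\<theta> * t \<le> 1 / 10000 * (1 / 5)" using \<theta> t by (intro mult_mono) auto
    then show ?thesis by simp
  qed
  define g where "g v = gauss t (v - h)" for v
  have g0: "g v \<ge> 0" for v using gauss_nonneg[OF t(1)] by (simp add: g_def)
  define I where "I b = (LINT v|lborel. g v * exp (b * v + \<theta> * v\<^sup>2))" for b
  have iI: "integrable lborel (\<lambda>v. g v * exp (b * v + \<theta> * v\<^sup>2))" for b
    unfolding g_def using gauss_quad_integral(1)[OF t(1) _ \<theta>t] \<theta> by simp
  have ig: "integrable lborel g" "(LINT v|lborel. g v) = 1"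
    using gauss_quad_integral[OF t(1), of 0 h 0] by (simp_all add: g_def[abs_def])
  define c1 where "c1 = (1 + \<theta>) * (13 / 5) * 2 powr (- 1 / 2)"
  \<comment> \<open>the majorant of \<open>H0_approx\<close> times the Gaussian, sorted by exponents\<close>
  define W where "W v = c1 * (g v * exp (b1 * v + \<theta> * v\<^sup>2)) + \<theta> * (g v * exp (b2 * v + \<theta> * v\<^sup>2)) + 27 / 10 * exp (3 / 2 * \<alpha>) * g v" for v
  have W: "g v * (exp (\<alpha> * v) * exp (\<theta> * (v + v\<^sup>2)) * ((1 + \<theta>) * (13 / 5 * 2 powr (- 1 / 2 - v)) + \<theta>) + 27 / 10 * exp (3 / 2 * \<alpha>)) = W v" for v
  proof -
    have e2: "exp (\<alpha> * v) * exp (\<theta> * (v + v\<^sup>2)) = exp (b2 * v + \<theta> * v\<^sup>2)"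
      by (simp add: b2_def algebra_simps flip: exp_add)
    have "2 powr (- 1 / 2 - v) = 2 powr (- 1 / 2) * exp (- l2 * v)"
      by (simp add: powr_def l2_def algebra_simps flip: exp_add)
    moreover have "exp (b2 * v + \<theta> * v\<^sup>2) * exp (- l2 * v) = exp (b1 * v + \<theta> * v\<^sup>2)"
      by (simp add: b2_def b1_def algebra_simps flip: exp_add)
    ultimately have e1: "exp (b2 * v + \<theta> * v\<^sup>2) * 2 powr (- 1 / 2 - v) = 2 powr (- 1 / 2) * exp (b1 * v + \<theta> * v\<^sup>2)"
      by (simp add: mult_ac)
    have "g v * (exp (b2 * v + \<theta> * v\<^sup>2) * ((1 + \<theta>) * (13 / 5 * 2 powr (- 1 / 2 - v)) + \<theta>) + 27 / 10 * exp (3 / 2 * \<alpha>))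
      = (1 + \<theta>) * (13 / 5) * (g v * (exp (b2 * v + \<theta> * v\<^sup>2) * 2 powr (- 1 / 2 - v))) + \<theta> * (g v * exp (b2 * v + \<theta> * v\<^sup>2)) + 27 / 10 * exp (3 / 2 * \<alpha>) * g v"
      by (simp add: algebra_simps)
    then show ?thesis unfolding e2 e1 W_def c1_def by (simp add: mult_ac)
  qed
  have iW: "integrable lborel W"
    unfolding W_def[abs_def] by (intro Bochner_Integration.integrable_add integrable_mult_right iI ig)
  have IW: "(LINT v|lborel. W v) = c1 * I b1 + \<theta> * I b2 + 27 / 10 * exp (3 / 2 * \<alpha>)"
    unfolding W_def I_def using iI ig by simp
  define X where "X = \<alpha> * h + \<alpha>\<^sup>2 * t / 4"
  have I2: "I b2 \<le> 101 / 100 * exp (h * b2 + b2\<^sup>2 * t / 4)" and I1: "I b1 \<le> 101 / 100 * exp (h * b1 + b1\<^sup>2 * t / 4)"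
    unfolding I_def g_def using t h b sm1 sm2 \<theta> by (intro gauss_quad_bound; simp)+
  have small2: "h * \<theta> + (2 * \<alpha> * \<theta> + \<theta>\<^sup>2) * t / 4 \<le> 1 / 500"
  proof -
    have "\<theta> * 20 * \<alpha> \<le> \<theta> * (\<alpha> + \<theta> + 10)\<^sup>2"
    proof -
      have "20 * \<alpha> \<le> (\<alpha> + \<theta> + 10)\<^sup>2"
      proof -
        have "(\<alpha> + 10)\<^sup>2 \<le> (\<alpha> + \<theta> + 10)\<^sup>2" using \<alpha> \<theta> by (intro power_mono) auto
        moreover have "(\<alpha> + 10)\<^sup>2 = \<alpha>\<^sup>2 + 20 * \<alpha> + 100" by (simp add: power2_eq_square algebra_simps)
        ultimately show ?thesis using zero_le_power2[of \<alpha>] by linarith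
      qed
      then show ?thesis using \<theta> by (simp add: mult.assoc mult_left_mono)
    qed
    then have "\<alpha> * \<theta> \<le> 1 / 20000" using small by (simp add: mult_ac)
    moreover have "\<theta>\<^sup>2 \<le> (1 / 10000)\<^sup>2" using \<theta> by (intro power_mono) auto
    ultimately have "2 * \<alpha> * \<theta> + \<theta>\<^sup>2 \<le> 1 / 1000" by (simp add: power2_eq_square)
    then have "(2 * \<alpha> * \<theta> + \<theta>\<^sup>2) * t \<le> 1 / 1000 * (1 / 5)" using t \<alpha> \<theta> by (intro mult_mono) auto
    moreover have "\<bar>h\<bar> * \<theta> \<le> 2 * (1 / 10000)" using h \<theta> by (intro mult_mono) auto
    moreover have "h * \<theta> \<le> \<bar>h\<bar> * \<theta>" using \<theta> by (intro mult_right_mono) auto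
    ultimately show ?thesis by linarith
  qed
  have ex: "exp (1 / 500 :: real) \<le> 1003 / 1000" using exp_bound[of "1 / 500"] by (simp add: power2_eq_square)
  have J2: "I b2 \<le> 102 / 100 * exp X"
  proof -
    have "h * b2 + b2\<^sup>2 * t / 4 = X + (h * \<theta> + (2 * \<alpha> * \<theta> + \<theta>\<^sup>2) * t / 4)"
      by (simp add: b2_def X_def power2_eq_square algebra_simps add_divide_distrib)
    then have "exp (h * b2 + b2\<^sup>2 * t / 4) \<le> exp X * exp (1 / 500)" using small2 by (simp flip: exp_add)
    also have "\<dots> \<le> exp X * (1003 / 1000)" using ex by (intro mult_left_mono) auto
    finally have *: "exp (h * b2 + b2\<^sup>2 * t / 4) \<le> exp X * (1003 / 1000)" .
    have "I b2 \<le> 101 / 100 * (exp X * (1003 / 1000))" by (rule order_trans[OF I2 mult_left_mono[OF *]]) simp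
    also have "\<dots> \<le> 102 / 100 * exp X" by simp
    finally show ?thesis .
  qed
  have J1: "I b1 \<le> 104 / 100 * (2 powr (- h) * 2 powr (- \<alpha> * t / 2) * exp X)"
  proof -
    have "h * b1 + b1\<^sup>2 * t / 4 = X + (h * \<theta> + (2 * \<alpha> * \<theta> + \<theta>\<^sup>2) * t / 4) + (- h * l2) + (- \<alpha> * t / 2 * l2) + (l2\<^sup>2 * t / 4 - \<theta> * l2 * t / 2)"
      by (simp add: b1_def X_def power2_eq_square algebra_simps add_divide_distrib diff_divide_distrib)
    also have "\<dots> \<le> X + 1 / 500 + (- h * l2) + (- \<alpha> * t / 2 * l2) + 1 / 40"
    proof -
      have "l2\<^sup>2 * t \<le> (7 / 10)\<^sup>2 * (1 / 5)" using l2 t by (intro mult_mono power_mono) auto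
      moreover have "0 \<le> \<theta> * l2 * t" using \<theta> l2 t by simp
      ultimately have "l2\<^sup>2 * t / 4 - \<theta> * l2 * t / 2 \<le> 1 / 40" by (simp add: power2_eq_square)
      then show ?thesis using small2 by linarith
    qed
    finally have "exp (h * b1 + b1\<^sup>2 * t / 4) \<le> exp (X + 1 / 500 + (- h * l2) + (- \<alpha> * t / 2 * l2) + 1 / 40)" by simp
    also have "\<dots> = exp X * (2 powr (- h) * 2 powr (- \<alpha> * t / 2)) * (exp (1 / 500) * exp (1 / 40))"
      by (simp add: powr_def l2_def algebra_simps flip: exp_add)
    also have "\<dots> \<le> exp X * (2 powr (- h) * 2 powr (- \<alpha> * t / 2)) * (1003 / 1000 * (1026 / 1000))"
      using ex exp_bound[of "1 / 40"] by (intro mult_left_mono mult_mono) (auto simp: power2_eq_square)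
    finally have *: "exp (h * b1 + b1\<^sup>2 * t / 4) \<le> exp X * (2 powr (- h) * 2 powr (- \<alpha> * t / 2)) * (1003 / 1000 * (1026 / 1000))" .
    have "I b1 \<le> 101 / 100 * (exp X * (2 powr (- h) * 2 powr (- \<alpha> * t / 2)) * (1003 / 1000 * (1026 / 1000)))"
      by (rule order_trans[OF I1 mult_left_mono[OF *]]) simp
    also have "\<dots> = (101 / 100 * (1003 / 1000 * (1026 / 1000))) * (2 powr (- h) * 2 powr (- \<alpha> * t / 2) * exp X)" by (simp only: mult_ac)
    also have "\<dots> \<le> 104 / 100 * (2 powr (- h) * 2 powr (- \<alpha> * t / 2) * exp X)" by (intro mult_right_mono) auto
    finally show ?thesis .
  qed
  have c1: "c1 \<le> 19 / 10" "0 \<le> c1"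
  proof -
    have "2 powr (- 1 / 2 :: real) = 1 / sqrt 2" by (simp add: powr_minus_divide powr_half_sqrt)
    also have "\<dots> \<le> 1 / (1414 / 1000)"
    proof (intro divide_left_mono)
      show "1414 / 1000 \<le> sqrt (2::real)" by (rule real_le_rsqrt) (simp add: power2_eq_square)
    qed auto
    finally have "2 powr (- 1 / 2 :: real) \<le> 1000 / 1414" by simp
    moreover have "(1 + \<theta>) * (13 / 5) \<le> (1 + 1 / 10000) * (13 / 5)" using \<theta> by simp
    ultimately have "c1 \<le> ((1 + 1 / 10000) * (13 / 5)) * (1000 / 1414)" unfolding c1_def using \<theta> by (intro mult_mono) auto
    then show "c1 \<le> 19 / 10" by simp
    show "0 \<le> c1" unfolding c1_def using \<theta> by simp
  qed
  define p where "p = 2 powr (- h) * 2 powr (- \<alpha> * t / 2)"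
  have p: "p \<ge> 0" by (simp add: p_def)
  have pX: "0 \<le> p * exp X" using p by simp
  have "c1 * I b1 \<le> 19 / 10 * (104 / 100 * (p * exp X))"
    using c1 J1 pX unfolding p_def[symmetric] by (intro mult_mono') (auto simp: I_def g0 intro!: integral_nonneg_AE)
  moreover have "\<theta> * I b2 \<le> 1 / 10000 * (102 / 100 * exp X)"
    using \<theta> J2 by (intro mult_mono') (auto simp: I_def g0 intro!: integral_nonneg_AE)
  ultimately have IW2: "(LINT v|lborel. W v) \<le> (2 * p + 1 / 1000) * exp X + 27 / 10 * exp (3 / 2 * \<alpha>)"
  proof -
    assume a: "c1 * I b1 \<le> 19 / 10 * (104 / 100 * (p * exp X))" and b: "\<theta> * I b2 \<le> 1 / 10000 * (102 / 100 * exp X)"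
    have "c1 * I b1 + \<theta> * I b2 \<le> 2 * (p * exp X) + 1 / 1000 * exp X"
      using a b pX exp_gt_zero[of X] by linarith
    then show ?thesis unfolding IW by (simp add: distrib_right)
  qed
  have main: "(LINT v|lborel. of_real (g v) * exp (lam T * of_real v)) = exp (lam T * of_real h + (lam T)\<^sup>2 * of_real t / 4)"
    and imain: "integrable lborel (\<lambda>v. of_real (g v) * exp (lam T * of_real v))"
    unfolding g_def using gauss_exp_integral[OF t(1)] by auto
  define f where "f v = indicator {0<..} v *\<^sub>R H 0 (Complex (2 * T) (2 * v))" for v
  have iF: "integrable lborel (\<lambda>v. of_real (g v) * f v)"
    unfolding g_def f_def by (rule H_right_integrable[OF t(1)]) simp
  have iM: "integrable lborel (\<lambda>v. mT T * (of_real (g v) * exp (lam T * of_real v)))"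
    using imain by (rule integrable_mult_right)
  have "H_right T t h - mT T * exp (lam T * of_real h + (lam T)\<^sup>2 * of_real t / 4) =
      (LINT v|lborel. of_real (g v) * f v) - (LINT v|lborel. mT T * (of_real (g v) * exp (lam T * of_real v)))"
    unfolding main[symmetric] H_right_def g_def f_def by simp
  also have "\<dots> = (LINT v|lborel. of_real (g v) * f v - mT T * (of_real (g v) * exp (lam T * of_real v)))"
    by (rule Bochner_Integration.integral_diff[OF iF iM, symmetric])
  also have "norm \<dots> \<le> (LINT v|lborel. norm (of_real (g v) * f v - mT T * (of_real (g v) * exp (lam T * of_real v))))"
    by (rule integral_norm_bound)
  also have "\<dots> \<le> (LINT v|lborel. norm (mT T) * W v)"
  proof (rule integral_mono_AE')
    show "integrable lborel (\<lambda>v. norm (mT T) * W v)" using iW by (rule integrable_mult_right)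
    have le: "norm (of_real (g v) * f v - mT T * (of_real (g v) * exp (lam T * of_real v))) \<le> norm (mT T) * W v" for v
    proof -
      have "of_real (g v) * f v - mT T * (of_real (g v) * exp (lam T * of_real v)) = of_real (g v) * (f v - mT T * exp (lam T * of_real v))"
        by (simp add: algebra_simps)
      also have "norm \<dots> = g v * norm (f v - mT T * exp (lam T * of_real v))" using g0 by (simp add: norm_mult)
      also have "\<dots> \<le> g v * (norm (mT T) * (exp (\<alpha> * v) * exp (\<theta> * (v + v\<^sup>2)) * ((1 + \<theta>) * (13 / 5 * 2 powr (- 1 / 2 - v)) + \<theta>) + 27 / 10 * exp (3 / 2 * \<alpha>)))"
        unfolding f_def \<alpha>_def \<theta>_def using g0 \<alpha>0 by (intro mult_left_mono H0_approx T1) auto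
      also have "\<dots> = norm (mT T) * W v" unfolding W[symmetric] by (simp only: mult_ac)
      finally show ?thesis .
    qed
    then show "AE v in lborel. norm (of_real (g v) * f v - mT T * (of_real (g v) * exp (lam T * of_real v))) \<le> norm (mT T) * W v"
      by (intro AE_I2)
    show "AE v in lborel. 0 \<le> norm (mT T) * W v"
      using le norm_ge_zero order_trans by (intro AE_I2) blast
  qed
  also have "\<dots> = norm (mT T) * (LINT v|lborel. W v)" by simp
  also have "\<dots> \<le> norm (mT T) * ((2 * p + 1 / 1000) * exp X + 27 / 10 * exp (3 / 2 * \<alpha>))"
    using IW2 by (intro mult_left_mono) auto
  finally show ?thesis by (simp add: p_def X_def mult.assoc)
qed

section \<open>Vertical growth and the lower bound for G\<close>

lemma exp_one_bounds: "27182 / 10000 \<le> exp (1 :: real)" "exp (1 :: real) \<le> 27183 / 10000"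
proof -
  have "inverse (2 ^ 32 :: real) \<le> 1 / 1000000" by simp
  then have "\<bar>exp 1 - 5837465777 / 2147483648\<bar> \<le> (1 / 1000000 :: real)" using e_approx_32 by linarith
  then show "27182 / 10000 \<le> exp (1 :: real)" "exp (1 :: real) \<le> 27183 / 10000" by linarith+
qed

lemma exp_nat_bounds: "(27182 / 10000) ^ n \<le> exp (real n)" "exp (real n) \<le> (27183 / 10000) ^ n"
proof -
  have "exp (real n) = exp 1 ^ n" by (simp flip: exp_of_nat_mult)
  then show "(27182 / 10000) ^ n \<le> exp (real n)" "exp (real n) \<le> (27183 / 10000) ^ n"
    using exp_one_bounds by (auto intro!: power_mono)
qed

text \<open>\<open>Re (lam T)\<close> is about \<open>ln (T / 2 \<pi>) / 2\<close>, so the bound amounts to \<open>exp 26.82 \<le> 4.7 \<cdot> 10\<^sup>1\<^sup>1\<close>.\<close>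
lemma lam_Re_lower:
  assumes "T \<ge> 3 * 10 ^ 12" shows "Re (lam T) \<ge> 67 / 5"
proof -
  have T: "T > 0" using assms by simp
  have "\<bar>Im (av T)\<bar> \<le> norm (av T)" by (rule abs_Im_le_cmod)
  then have a: "norm (av T) \<ge> T / 2" using T by (simp add: av_def)
  have "47 * 10 ^ 10 \<le> (T / 2) / (315 / 100)" using assms by simp
  also have "\<dots> \<le> norm (av T) / pi" using a T pi_approx by (intro frac_le) auto
  finally have b: "47 * 10 ^ 10 \<le> norm (av T) / pi" .
  have "exp (2682 / 100) * exp (18 / 100) = exp (real 27)" by (simp flip: exp_add)
  moreover have "119 / 100 \<le> exp (18 / 100 :: real)"
    using exp_lower_Taylor_quadratic[of "18 / 100"] by (simp add: power2_eq_square)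
  then have "exp (2682 / 100) * (119 / 100) \<le> exp (2682 / 100) * exp (18 / 100 :: real)"
    by (rule mult_left_mono) simp
  ultimately have "exp (2682 / 100) * (119 / 100) \<le> (27183 / 10000 :: real) ^ 27"
    using exp_nat_bounds(2)[of 27] by linarith
  then have "exp (2682 / 100 :: real) \<le> 47 * 10 ^ 10" by (simp add: power_divide)
  with b have "exp (2682 / 100) \<le> norm (av T) / pi" by linarith
  then have "ln (exp (2682 / 100)) \<le> ln (norm (av T) / pi)" by (intro ln_mono) auto
  then have "2682 / 100 \<le> ln (norm (av T) / pi)" by (simp only: ln_exp)
  moreover have "2 / T \<le> 1 / 100" using assms by (simp add: field_simps)
  ultimately show ?thesis using lam_Re[OF T] by (simp add: abs_le_iff)
qed

lemma exp_lam_exponent: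
  "norm (exp (lam T * of_real h + (lam T)\<^sup>2 * of_real t / 4)) = exp (Re (lam T) * h + ((Re (lam T))\<^sup>2 - (Im (lam T))\<^sup>2) * t / 4)"
  by (simp add: power2_eq_square algebra_simps)

lemma H_right_upper:
  assumes T: "T \<ge> 10 ^ 12" and \<alpha>: "Re (lam T) = \<alpha>" "\<alpha> \<ge> 1" and t: "0 < t" "t \<le> 1 / 5" and h: "\<bar>h\<bar> \<le> 2"
  shows "norm (H_right T t h) \<le> norm (mT T) * ((1 + 2 * 2 powr (- h) * 2 powr (- \<alpha> * t / 2) + 1 / 1000) * exp (\<alpha> * h + \<alpha>\<^sup>2 * t / 4) + 27 / 10 * exp (3 / 2 * \<alpha>))"
proof -
  define M where "M = mT T * exp (lam T * of_real h + (lam T)\<^sup>2 * of_real t / 4)"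
  have "((Re (lam T))\<^sup>2 - (Im (lam T))\<^sup>2) * t \<le> \<alpha>\<^sup>2 * t" using t \<alpha> by (intro mult_right_mono) auto
  then have "norm M \<le> norm (mT T) * exp (\<alpha> * h + \<alpha>\<^sup>2 * t / 4)"
    unfolding M_def norm_mult exp_lam_exponent using \<alpha> by (intro mult_left_mono) auto
  moreover have "norm (H_right T t h) \<le> norm M + norm (H_right T t h - M)" using norm_triangle_ineq[of M "H_right T t h - M"] by simp
  moreover have "norm (H_right T t h - M) \<le> norm (mT T) * ((2 * 2 powr (- h) * 2 powr (- \<alpha> * t / 2) + 1 / 1000) * exp (\<alpha> * h + \<alpha>\<^sup>2 * t / 4) + 27 / 10 * exp (3 / 2 * \<alpha>))"
    unfolding M_def using H_right_estimate[OF T _ t h] \<alpha> by simp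
  ultimately have "norm (H_right T t h) \<le> norm (mT T) * exp (\<alpha> * h + \<alpha>\<^sup>2 * t / 4) + norm (mT T) * ((2 * 2 powr (- h) * 2 powr (- \<alpha> * t / 2) + 1 / 1000) * exp (\<alpha> * h + \<alpha>\<^sup>2 * t / 4) + 27 / 10 * exp (3 / 2 * \<alpha>))"
    by linarith
  then show ?thesis by (simp only: ring_distribs mult_1_left mult_1_right add_ac)
qed

lemma mT_nonzero: "T > 0 \<Longrightarrow> mT T \<noteq> 0"
  by (auto simp: mT_def xi_factor_def Gamma_eq_zero_iff sv_def elim!: nonpos_Ints_cases) (auto simp: complex_eq_iff)

text \<open>At the heights 2 and 4, that is for \<open>h = 1\<close> and \<open>h = 2\<close>, the main term of \<open>H t\<close> is
  \<open>mT T * exp (\<alpha> h + \<alpha>\<^sup>2 t / 4)\<close> up to a phase.  So the quotient is about \<open>exp \<alpha> \<ge> 650000\<close>, and the error terms cost a factor of at most 7.  In units of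
  \<open>\<bar>mT T\<bar> * exp (\<alpha> h) * B\<close>, the four contributions are at most \<open>3.121\<close> and \<open>1.66\<close> at height 2, at least \<open>0.695\<close> and at most \<open>0.001\<close> at height 4.\<close>
lemma H_growth_ratio:
  assumes T: "T \<ge> 3 * 10 ^ 12" and t: "129 / 800 \<le> t" "t \<le> 1 / 5"
  shows "norm (H t (Complex (2 * T) 4)) > 90000 * norm (H t (Complex (2 * T) 2))"
proof -
  define \<alpha> where "\<alpha> = Re (lam T)"
  have \<alpha>: "\<alpha> \<ge> 67 / 5" unfolding \<alpha>_def by (rule lam_Re_lower[OF T])
  have \<alpha>1: "Re (lam T) = \<alpha>" "\<alpha> \<ge> 1" "Re (lam T) \<ge> 1" using \<alpha> by (auto simp: \<alpha>_def)
  have T12: "T \<ge> 10 ^ 12" using T by simp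
  have t0: "0 < t" using t by simp
  define u where "u = exp \<alpha>"
  have u: "u \<ge> 650000"
  proof -
    have "exp (67 / 5 :: real) = exp (real 13) * exp (4 / 10)" by (simp flip: exp_add)
    moreover have "148 / 100 \<le> exp (4 / 10 :: real)" 
      using exp_lower_Taylor_quadratic[of "4 / 10"] by (simp add: power2_eq_square)
    ultimately have "(27182 / 10000) ^ 13 * (148 / 100) \<le> exp (67 / 5 :: real)"
      using exp_nat_bounds(1)[of 13] by (simp only:) (intro mult_mono, auto)
    then have "650000 \<le> exp (67 / 5 :: real)" by (simp add: power_divide)
    also have "\<dots> \<le> u" unfolding u_def using \<alpha> by simp
    finally show ?thesis .
  qed
  define B where "B = exp (\<alpha>\<^sup>2 * t / 4)"
  have B: "B > 0" by (simp add: B_def)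
  define q where "q = 2 powr (- \<alpha> * t / 2)"
  \<comment> \<open>the exponents \<open>\<alpha> t / 2 \<ge> 1\<close> and \<open>\<alpha> t / 4 - 1/2 \<ge> 0.04\<close> make the zeta correction and the strip term harmless\<close>
  have at: "67 / 5 * (129 / 800) \<le> \<alpha> * t" using \<alpha> t by (intro mult_mono) auto
  have q: "0 < q" "q \<le> 1 / 2"
  proof -
    have "q \<le> 2 powr (- 1)" unfolding q_def using at by (intro powr_mono) auto
    then show "q \<le> 1 / 2" by (simp add: powr_minus)
  qed (simp add: q_def)
  have e32: "exp (3 / 2 * \<alpha>) \<le> 6 / 10 * (u * B)"
  proof -
    have "67 / 5 * (4 / 100) \<le> \<alpha> * (\<alpha> * t / 4 - 1 / 2)" using \<alpha> at by (intro mult_mono) auto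
    then have e: "3 / 2 * \<alpha> \<le> \<alpha> + \<alpha>\<^sup>2 * t / 4 - 53 / 100" by (simp add: power2_eq_square algebra_simps)
    have "exp (3 / 2 * \<alpha>) \<le> u * B * exp (- (53 / 100))"
      using e unfolding u_def B_def by (simp flip: exp_add)
    also have "exp (- (53 / 100)) \<le> (6 / 10 :: real)"
    proof -
      have "10 / 6 \<le> exp (53 / 100 :: real)"
        using exp_lower_Taylor_quadratic[of "53 / 100"] by (simp add: power2_eq_square)
      then have "inverse (exp (53 / 100 :: real)) \<le> inverse (10 / 6)" by (rule le_imp_inverse_le) simp
      then show ?thesis by (simp add: exp_minus)
    qed
    finally show ?thesis using u B by (simp add: mult_ac)
  qed
  define m where "m = norm (mT T)"
  have m: "m > 0" using mT_nonzero[of T] T by (simp add: m_def)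
  have p: "2 powr - (1::real) = 1 / 2" "2 powr - (- 1 ::real) = 2" "2 powr - (2::real) = 1 / 4" "2 powr - (-2::real) = 4"
    by (simp_all add: powr_minus powr_numeral)
  have E: "exp (\<alpha> * 1 + \<alpha>\<^sup>2 * t / 4) = u * B" "exp (\<alpha> * - 1 + \<alpha>\<^sup>2 * t / 4) = inverse u * B"
    "exp (\<alpha> * 2 + \<alpha>\<^sup>2 * t / 4) = u\<^sup>2 * B" "exp (\<alpha> * - 2 + \<alpha>\<^sup>2 * t / 4) = inverse (u\<^sup>2) * B"
    by (simp_all only: u_def B_def exp_add exp_minus[symmetric] exp_of_nat2_mult[symmetric] mult_minus_right mult_1_right)
      (simp_all add: exp_minus exp_double mult.commute[of \<alpha>] flip: exp_add)
  have uB: "u * B > 0" and BuB: "B \<le> u * B" using u B by simp_all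
  have iu: "inverse u \<le> 1 / 100" "inverse u > 0" "inverse (u\<^sup>2) \<le> 1 / 100"
  proof -
    have "1 * 650000 \<le> u * u" using u by (intro mult_mono) auto
    then show "inverse u \<le> 1 / 100" "inverse u > 0" "inverse (u\<^sup>2) \<le> 1 / 100"
      using u by (auto simp: field_simps power2_eq_square)
  qed
  \<comment> \<open>at height 2, where both halves of the line contribute\<close>
  have F1: "norm (H_right T t 1) \<le> m * (3121 / 1000 * (u * B))"
  proof -
    have "norm (H_right T t 1) \<le> m * ((1 + q + 1 / 1000) * (u * B) + 27 / 10 * exp (3 / 2 * \<alpha>))"
      using H_right_upper[OF T12 \<alpha>1(1,2) t0 t(2), of 1] unfolding E p q_def m_def by simp
    also have "\<dots> \<le> m * ((1501 / 1000) * (u * B) + 27 / 10 * (6 / 10 * (u * B)))"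
      using q e32 m uB by (intro mult_left_mono add_mono mult_right_mono) auto
    finally show ?thesis by (simp add: algebra_simps)
  qed
  have F1': "norm (H_right T t (- 1)) \<le> m * (166 / 100 * (u * B))"
  proof -
    have "norm (H_right T t (- 1)) \<le> m * ((1 + 4 * q + 1 / 1000) * (inverse u * B) + 27 / 10 * exp (3 / 2 * \<alpha>))"
      using H_right_upper[OF T12 \<alpha>1(1,2) t0 t(2), of "- 1"] unfolding E p q_def m_def by simp
    also have "\<dots> \<le> m * (4 * (1 / 100 * (u * B)) + 27 / 10 * (6 / 10 * (u * B)))"
      using q e32 m uB iu B BuB by (intro mult_left_mono add_mono mult_mono) auto
    finally show ?thesis by (simp add: algebra_simps)
  qed
  \<comment> \<open>at height 4, where the left half is negligible\<close>
  have uuB: "u * B \<le> 1 / 10000 * (u\<^sup>2 * B)" using u B by (simp add: power2_eq_square)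
  have F2': "norm (H_right T t (- 2)) \<le> m * (1 / 1000 * (u\<^sup>2 * B))"
  proof -
    have "norm (H_right T t (- 2)) \<le> m * ((1 + 8 * q + 1 / 1000) * (inverse (u\<^sup>2) * B) + 27 / 10 * exp (3 / 2 * \<alpha>))"
      using H_right_upper[OF T12 \<alpha>1(1,2) t0 t(2), of "- 2"] unfolding E p q_def m_def by simp
    also have "\<dots> \<le> m * (6 * (1 / 100 * (u * B)) + 27 / 10 * (6 / 10 * (u * B)))"
      using q e32 m uB iu B BuB by (intro mult_left_mono add_mono mult_mono) auto
    also have "\<dots> = m * (168 / 100 * (u * B))" by simp
    also have "\<dots> \<le> m * (168 / 100 * (1 / 10000 * (u\<^sup>2 * B)))" using uuB m by (intro mult_left_mono) auto
    also have "\<dots> \<le> m * (1 / 1000 * (u\<^sup>2 * B))" using m B by (intro mult_left_mono) auto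
    finally show ?thesis .
  qed
  have F2: "norm (H_right T t 2) \<ge> m * (695 / 1000 * (u\<^sup>2 * B))"
  proof -
    define M where "M = mT T * exp (lam T * of_real 2 + (lam T)\<^sup>2 * of_real t / 4)"
    have "(Im (lam T))\<^sup>2 \<le> 1\<^sup>2" using lam_Im[of T] T by (intro abs_le_imp_square_le) auto
    then have "(Im (lam T))\<^sup>2 * t \<le> 1\<^sup>2 * (1 / 5)" using t t0 by (intro mult_mono) auto
    then have "\<alpha> * 2 + \<alpha>\<^sup>2 * t / 4 - 1 / 20 \<le> \<alpha> * 2 + (\<alpha>\<^sup>2 - (Im (lam T))\<^sup>2) * t / 4"
      by (simp add: left_diff_distrib)
    then have "exp (\<alpha> * 2 + \<alpha>\<^sup>2 * t / 4 - 1 / 20) \<le> exp (\<alpha> * 2 + (\<alpha>\<^sup>2 - (Im (lam T))\<^sup>2) * t / 4)" by simp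
    moreover have "exp (\<alpha> * 2 + \<alpha>\<^sup>2 * t / 4 - 1 / 20) = u\<^sup>2 * B * exp (- 1 / 20)"
      unfolding E(3)[symmetric] by (simp flip: exp_add)
    moreover have "u\<^sup>2 * B * (95 / 100) \<le> u\<^sup>2 * B * exp (- 1 / 20)"
      using exp_ge_add_one_self[of "- 1 / 20"] B by (intro mult_left_mono) auto
    ultimately have "u\<^sup>2 * B * (95 / 100) \<le> exp (\<alpha> * 2 + (\<alpha>\<^sup>2 - (Im (lam T))\<^sup>2) * t / 4)" by argo
    then have "m * (95 / 100 * (u\<^sup>2 * B)) \<le> m * exp (\<alpha> * 2 + (\<alpha>\<^sup>2 - (Im (lam T))\<^sup>2) * t / 4)"
      using m unfolding mult.commute[of "95 / 100"] by (intro mult_left_mono) auto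
    then have "m * (95 / 100 * (u\<^sup>2 * B)) \<le> norm M"
      unfolding M_def norm_mult exp_lam_exponent m_def \<alpha>_def .
    moreover have "norm (H_right T t 2 - M) \<le> m * (252 / 1000 * (u\<^sup>2 * B))"
    proof -
      have "norm (H_right T t 2 - M) \<le> m * ((q / 2 + 1 / 1000) * (u\<^sup>2 * B) + 27 / 10 * exp (3 / 2 * \<alpha>))"
        using H_right_estimate[OF T12 \<alpha>1(3) t0 t(2), of 2] unfolding \<alpha>1(1) E p q_def m_def M_def by simp
      also have "\<dots> \<le> m * (251 / 1000 * (u\<^sup>2 * B) + 27 / 10 * (6 / 10 * (1 / 10000 * (u\<^sup>2 * B))))"
        using q m B order_trans[OF e32 mult_left_mono[OF uuB]] by (intro mult_left_mono add_mono mult_right_mono) auto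
      also have "\<dots> \<le> m * (252 / 1000 * (u\<^sup>2 * B))" using m B by (intro mult_left_mono) auto
      finally show ?thesis .
    qed
    moreover have "norm M \<le> norm (H_right T t 2) + norm (H_right T t 2 - M)"
      using norm_triangle_ineq4[of "H_right T t 2" "H_right T t 2 - M"] by simp
    moreover define K where "K = m * (u\<^sup>2 * B)"
    moreover have "m * (r * (u\<^sup>2 * B)) = r * K" for r by (simp add: K_def)
    moreover have "K > 0" using m u B by (simp add: K_def)
    ultimately show ?thesis by simp
  qed
  define L where "L = m * (u * B)"
  have L: "L > 0" using m uB by (simp add: L_def)
  have H2: "norm (H t (Complex (2 * T) 2)) \<le> 4781 / 1000 * L"
  proof -
    have "norm (H t (Complex (2 * T) 2)) \<le> norm (H_right T t 1) + norm (H_right T t (- 1))"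
      using H_eq_H_right[OF t0, of T 1] norm_triangle_ineq[of "H_right T t 1" "cnj (H_right T t (- 1))"] by simp
    also have "\<dots> \<le> m * (3121 / 1000 * (u * B)) + m * (166 / 100 * (u * B))" using F1 F1' by (rule add_mono)
    finally show ?thesis by (simp add: L_def mult_ac)
  qed
  have H4: "norm (H t (Complex (2 * T) 4)) \<ge> 69 / 100 * (u * L)"
  proof -
    have "m * (695 / 1000 * (u\<^sup>2 * B)) - m * (1 / 1000 * (u\<^sup>2 * B)) \<le> norm (H_right T t 2) - norm (H_right T t (- 2))" using F2 F2' by (rule diff_mono)
    also have "\<dots> \<le> norm (H t (Complex (2 * T) 4))"
      using H_eq_H_right[OF t0, of T 2] norm_diff_ineq[of "H_right T t 2" "cnj (H_right T t (- 2))"] by simp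
    finally have "694 / 1000 * (u * L) \<le> norm (H t (Complex (2 * T) 4))" by (simp add: L_def power2_eq_square mult_ac)
    moreover have "u * L > 0" using u L by simp
    ultimately show ?thesis by linarith
  qed
  have "90000 * norm (H t (Complex (2 * T) 2)) \<le> 90000 * (4781 / 1000 * L)" using H2 by simp
  also have "\<dots> < 69 / 100 * (650000 * L)" using L by simp
  also have "\<dots> \<le> 69 / 100 * (u * L)" using u L by simp
  also note H4
  finally show ?thesis .
qed

text \<open>The growth of \<open>H t\<close> from height 2 to height 4 contradicts \<open>growth_le_G\<close> if \<open>G\<close> is too small: \<open>H_growth_ratio\<close> gives
  \<open>ln 90000 \<le> 6 G + ln 4.04\<close>, and \<open>exp 9.602 * 4.04 \<le> 90000\<close>.\<close>
lemma maximal_zero_repulsion: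
  assumes x: "Re z \<ge> 6000000185827" and y: "(Im z)\<^sup>2 \<le> 87677 / 2500000" and t: "129 / 800 \<le> t" "t \<le> 1 / 5"
    and s: "simple_zero t z" and mh: "max_height_zero t z"
  shows "G t z > 1.60028669"
    and "deriv (H t) z \<noteq> 0" "Im (deriv (deriv (H t)) z / deriv (H t) z) \<le> - 1 / Im z - 2 * Im z * G t z"
proof -
  interpret real_even_entire "H t" by (rule H_real_even_entire)
  have G: "G t z = infsum (G_term z) (others z)"
    unfolding G_def others_def G_term_def of_int_zorder by simp
  have z: "H t z = 0" "0 < Im z" "\<And>\<rho>. H t \<rho> = 0 \<Longrightarrow> \<bar>Im \<rho>\<bar> \<le> Im z"
    using mh by (auto simp: max_height_zero_def)
  have o: "ord z = 1" using s by (simp add: simple_zero_def ord_def)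
  have "(Im z)\<^sup>2 \<le> (1 / 5)\<^sup>2" by (rule order_trans[OF y]) (simp add: power_divide)
  then have y5: "Im z \<le> 1 / 5" by (rule power2_le_imp_le) simp
  show "deriv (H t) z \<noteq> 0" "Im (deriv (deriv (H t)) z / deriv (H t) z) \<le> - 1 / Im z - 2 * Im z * G t z"
    unfolding G using zero_velocity[OF z(1,2) y5 z(3) o] by blast+
  have nz: "norm (H t (Complex (Re z) 2)) > 0" using z(3)[of "Complex (Re z) 2"] y5 by auto
  define r where "r = norm (H t (Complex (Re z) 4) / H t (Complex (Re z) 2))"
  have r: "r > 90000"
    using H_growth_ratio[of "Re z / 2" t] x t nz by (simp add: r_def norm_divide field_simps)
  have "ln r \<le> 6 * G t z + ln ((16 - (Im z)\<^sup>2) / (4 - (Im z)\<^sup>2))"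
    using growth_le_G[OF z(1,2) y5 z(3) o] unfolding G r_def norm_divide by simp
  moreover have "ln ((16 - (Im z)\<^sup>2) / (4 - (Im z)\<^sup>2)) \<le> ln (404 / 100)"
    using y by (intro ln_mono) (auto simp: field_simps)
  moreover have "ln r > 6 * 1.60028669 + ln (404 / 100)"
  proof -
    have "exp (9602 / 1000) * exp (398 / 1000) = exp (real 10)" by (simp flip: exp_add)
    moreover have "147 / 100 \<le> exp (398 / 1000 :: real)"
      using exp_lower_Taylor_quadratic[of "398 / 1000"] by (simp add: power2_eq_square)
    then have "exp (9602 / 1000) * (147 / 100) \<le> exp (9602 / 1000) * exp (398 / 1000 :: real)"
      by (rule mult_left_mono) simp
    ultimately have "exp (9602 / 1000) * (147 / 100) \<le> (27183 / 10000 :: real) ^ 10"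
      using exp_nat_bounds(2)[of 10] by linarith
    then have "exp (9602 / 1000 :: real) * (404 / 100) \<le> 90000" by (simp add: power_divide)
    with r have "exp (9602 / 1000) * (404 / 100) < r" by linarith
    then have "ln (exp (9602 / 1000) * (404 / 100)) < ln r" using r by (subst ln_less_cancel_iff) auto
    then have "9602 / 1000 + ln (404 / 100) < ln r" by (subst (asm) ln_mult) auto
    then show ?thesis by simp
  qed
  ultimately show "G t z > 1.60028669" by linarith
qed

section \<open>Local continuation and limits of branches of zeros\<close>

text \<open>The inverse function theorem for \<open>(t, w) \<mapsto> (t, H t w)\<close>, whose derivative at a simple zero is invertible.\<close>
lemma zero_curve_local:
  assumes z: "H b w0 = 0" and d: "deriv (H b) w0 \<noteq> 0"
  obtains \<delta> \<zeta> where "\<delta> > 0" "continuous_on {b..b + \<delta>} \<zeta>" "\<zeta> b = w0" "\<And>s. s \<in> {b..b + \<delta>} \<Longrightarrow> H s (\<zeta> s) = 0"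
proof -
  define f where "f p = (fst p, Hm 0 (fst p) (snd p))" for p :: "real \<times> complex"
  define D where "D p q = (fst q, of_real (fst q) * Hm 2 (fst p) (snd p) - \<i> * snd q * Hm 1 (fst p) (snd p))" for p q :: "real \<times> complex"
  have der: "(f has_derivative D p) (at p)" for p
  proof -
    have "((\<lambda>p. Hm 0 (fst p) (snd p)) has_derivative (\<lambda>q. of_real (fst q) * Hm 2 (fst p) (snd p) - \<i> * snd q * Hm 1 (fst p) (snd p))) (at p)"
      using Hm_has_derivative[of 0 "fst p" "snd p"] by (simp add: numeral_2_eq_2)
    then show ?thesis unfolding f_def[abs_def] D_def[abs_def]
      by (intro has_derivative_Pair has_derivative_fst has_derivative_ident)
  qed
  define f' where "f' p = Blinfun (D p)" for p
  have f': "blinfun_apply (f' p) = D p" for p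
    unfolding f'_def by (rule bounded_linear_Blinfun_apply[OF has_derivative_bounded_linear[OF der]])
  have contf: "continuous_on UNIV f'"
    by (rule continuous_on_blinfun_componentwise) (simp add: f' D_def[abs_def], intro continuous_intros Hm_continuous)
  define c where "c = - \<i> * Hm 1 b w0"
  have c: "c \<noteq> 0" using d by (simp add: c_def deriv_H)
  define I where "I q = (fst q, (snd q - of_real (fst q) * Hm 2 b w0) / c)" for q :: "real \<times> complex"
  have bI: "bounded_linear I"
    unfolding I_def[abs_def] 
    by (intro bounded_linear_Pair bounded_linear_fst bounded_linear_divide[THEN bounded_linear_compose] bounded_linear_sub bounded_linear_snd bounded_linear_mult_const[THEN bounded_linear_compose] bounded_linear_of_real[THEN bounded_linear_compose] bounded_linear_ident)
  have ID: "I (D (b, w0) q) = q" for q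
  proof -
    have "- (\<i> * snd q * Hm 1 b w0) = c * snd q" by (simp add: c_def)
    then show ?thesis using c by (simp add: I_def D_def prod_eq_iff)
  qed
  have inv: "Blinfun I o\<^sub>L f' (b, w0) = id_blinfun"
    by (rule blinfun_eqI) (simp add: blinfun_apply_blinfun_compose bounded_linear_Blinfun_apply[OF bI] f' ID)
  obtain U' V g g' where g: "open V" "f (b, w0) \<in> V" "homeomorphism U' V f g" "(b, w0) \<in> U'"
    using inverse_function_theorem[OF open_UNIV _ contf UNIV_I inv, of f] der unfolding f' by metis
  have fb: "f (b, w0) = (b, 0)" using z by (simp add: f_def H_eq)
  define Q where "Q = (\<lambda>s. (s, 0 :: complex)) -` V"
  have "open Q" unfolding Q_def by (intro open_vimage g) (intro continuous_intros)
  moreover have "b \<in> Q" using g(2) by (simp add: Q_def fb)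
  ultimately obtain e where e: "e > 0" "cball b e \<subseteq> Q" using open_contains_cball by blast
  have sub: "{b..b + e} \<subseteq> Q" using e by (auto simp: subset_iff cball_def dist_real_def)
  define \<zeta> where "\<zeta> s = snd (g (s, 0))" for s
  have "continuous_on {b..b + e} \<zeta>"
    unfolding \<zeta>_def
    by (intro continuous_on_snd continuous_on_compose2[OF homeomorphism_cont2[OF g(3)]] continuous_intros) (use sub in \<open>auto simp: Q_def\<close>)
  moreover have "\<zeta> b = w0"
    using homeomorphism_apply1[OF g(3,4)] by (simp add: \<zeta>_def fb)
  moreover have "H s (\<zeta> s) = 0" if "s \<in> {b..b + e}" for s
  proof -
    have "f (g (s, 0)) = (s, 0)" using homeomorphism_apply2[OF g(3)] that sub by (auto simp: Q_def)
    then show ?thesis by (auto simp: f_def \<zeta>_def H_eq)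
  qed
  ultimately show ?thesis using that e(1) by blast
qed

text \<open>Implicit differentiation along an arbitrary continuous branch, one-sided at the ends of its domain: continuity first gives
  \<open>\<bar>\<Delta>z\<bar> = O(\<bar>\<Delta>t\<bar>)\<close>, and then the quotient converges.  The heat equation turns \<open>- \<partial>\<^sub>t H / H'\<close> into \<open>H'' / H'\<close>.\<close>
lemma zero_branch_derivative:
  assumes t: "t \<in> S" and cont: "continuous (at t within S) z" and zero: "\<And>s. s \<in> S \<Longrightarrow> H s (z s) = 0"
    and d: "deriv (H t) (z t) \<noteq> 0"
  shows "(z has_vector_derivative (deriv (deriv (H t)) (z t) / deriv (H t) (z t))) (at t within S)"
proof -
  define c where "c = deriv (H t) (z t)"
  define a where "a = Hm 2 t (z t)"
  have c: "c \<noteq> 0" using d by (simp add: c_def)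
  have rhs: "deriv (deriv (H t)) (z t) / deriv (H t) (z t) = - a / c" by (simp add: deriv_deriv_H a_def c_def)
  define D where "D q = of_real (fst q) * a + c * snd q" for q :: "real \<times> complex"
  have "((\<lambda>p. Hm 0 (fst p) (snd p)) has_derivative D) (at (t, z t))"
    using Hm_has_derivative[of 0 t "z t"] by (simp add: D_def[abs_def] a_def c_def deriv_H numeral_2_eq_2 mult_ac)
  then have F: "\<exists>d>0. \<forall>p. norm (p - (t, z t)) < d \<longrightarrow> norm (Hm 0 (fst p) (snd p) - Hm 0 t (z t) - D (p - (t, z t))) \<le> e * norm (p - (t, z t))"
    if "e > 0" for e
    using that unfolding has_derivative_at_alt by simp
  define q where "q = norm (a / c)"
  have q: "q \<ge> 0" by (simp add: q_def)
  show ?thesis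
    unfolding has_vector_derivative_def has_derivative_within_alt rhs
  proof (intro conjI allI impI bounded_linear_scaleR_left)
    fix \<epsilon> :: real assume \<epsilon>: "\<epsilon> > 0"
    \<comment> \<open>\<open>\<eta> \<le> 1/2\<close> allows absorbing the error term that contains the increment of \<open>z\<close>\<close>
    define \<eta> where "\<eta> = min (1 / 2) (\<epsilon> / (2 * (1 + q)))"
    have \<eta>: "\<eta> > 0" "\<eta> \<le> 1 / 2" "2 * \<eta> * (1 + q) \<le> \<epsilon>"
    proof -
      show "\<eta> > 0" using \<epsilon> q by (auto simp: \<eta>_def)
      show "\<eta> \<le> 1 / 2" unfolding \<eta>_def by (rule min.cobounded1)
      have "\<eta> \<le> \<epsilon> / (2 * (1 + q))" by (simp add: \<eta>_def)
      then show "2 * \<eta> * (1 + q) \<le> \<epsilon>" using q by (simp add: field_simps)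
    qed
    have "norm c * \<eta> > 0" using c \<eta> by simp
    from F[OF this] obtain d where d: "d > 0" 
      "\<And>p. norm (p - (t, z t)) < d \<Longrightarrow> norm (Hm 0 (fst p) (snd p) - Hm 0 t (z t) - D (p - (t, z t))) \<le> norm c * \<eta> * norm (p - (t, z t))" by blast
    obtain d2 where d2: "d2 > 0" "\<And>s. s \<in> S \<Longrightarrow> dist s t < d2 \<Longrightarrow> dist (z s) (z t) < d / 2"
      using cont d(1) unfolding continuous_within_eps_delta by (meson half_gt_zero)
    show "\<exists>d>0. \<forall>y\<in>S. norm (y - t) < d \<longrightarrow> norm (z y - z t - (y - t) *\<^sub>R (- a / c)) \<le> \<epsilon> * norm (y - t)"
    proof (intro exI[of _ "min d2 (d / 2)"] conjI ballI impI)
      fix s assume s: "s \<in> S" "norm (s - t) < min d2 (d / 2)"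
      define \<Delta> where "\<Delta> = z s - z t"
      define E where "E = norm (z s - z t - (s - t) *\<^sub>R (- a / c))"
      have "norm \<Delta> < d / 2" using d2(2)[OF s(1)] s(2) by (simp add: \<Delta>_def dist_norm)
      moreover have np: "norm ((s, z s) - (t, z t)) \<le> \<bar>s - t\<bar> + norm \<Delta>"
        using norm_Pair_le[of "s - t" \<Delta>] by (simp add: \<Delta>_def)
      ultimately have "norm ((s, z s) - (t, z t)) < d" using s(2) by simp
      from d(2)[OF this] have "norm (D (s - t, \<Delta>)) \<le> norm c * \<eta> * norm ((s, z s) - (t, z t))"
        using zero[OF s(1)] zero[OF t] by (simp add: H_eq \<Delta>_def)
      also have "\<dots> \<le> norm c * \<eta> * (\<bar>s - t\<bar> + norm \<Delta>)" using np \<eta> by (intro mult_left_mono) auto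
      finally have "norm (D (s - t, \<Delta>)) \<le> norm c * (\<eta> * (\<bar>s - t\<bar> + norm \<Delta>))" by (simp only: mult.assoc)
      moreover have "D (s - t, \<Delta>) = c * (z s - z t - (s - t) *\<^sub>R (- a / c))"
        using c by (simp add: D_def \<Delta>_def scaleR_conv_of_real field_simps)
      ultimately have "norm c * E \<le> norm c * (\<eta> * (\<bar>s - t\<bar> + norm \<Delta>))" by (simp add: E_def norm_mult)
      then have E1: "E \<le> \<eta> * (\<bar>s - t\<bar> + norm \<Delta>)" using c by simp
      have "norm \<Delta> \<le> E + norm ((s - t) *\<^sub>R (- a / c))"
        using norm_triangle_ineq[of "z s - z t - (s - t) *\<^sub>R (- a / c)" "(s - t) *\<^sub>R (- a / c)"] by (simp only: E_def \<Delta>_def diff_add_cancel)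
      also have "norm ((s - t) *\<^sub>R (- a / c)) = \<bar>s - t\<bar> * q" by (simp add: q_def norm_divide)
      finally have "\<eta> * (\<bar>s - t\<bar> + norm \<Delta>) \<le> \<eta> * (\<bar>s - t\<bar> + (E + \<bar>s - t\<bar> * q))" using \<eta> by (intro mult_left_mono) auto
      also have "\<dots> = \<eta> * (1 + q) * \<bar>s - t\<bar> + \<eta> * E" by (simp add: algebra_simps)
      also have "\<eta> * E \<le> 1 / 2 * E" using \<eta> by (intro mult_right_mono) (auto simp: E_def)
      finally have "E \<le> 2 * (\<eta> * (1 + q) * \<bar>s - t\<bar>)" using E1 by linarith
      also have "\<dots> = (2 * \<eta> * (1 + q)) * \<bar>s - t\<bar>" by simp
      also have "\<dots> \<le> \<epsilon> * \<bar>s - t\<bar>" using \<eta> by (intro mult_right_mono) auto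
      finally show "norm (z s - z t - (s - t) *\<^sub>R (- a / c)) \<le> \<epsilon> * norm (s - t)" by (simp add: E_def)
    qed (use d d2 in auto)
  qed
qed

text \<open>A bounded branch has a limit point \<open>w\<close>, which is an isolated zero of \<open>H b\<close>.  On a small circle around \<open>w\<close> there are no zeros of \<open>H t\<close> for
  \<open>t\<close> near \<open>b\<close>, so the branch cannot leave the disc once it has entered it.\<close>
lemma zero_branch_limit:
  assumes ab: "a < b" and cont: "continuous_on {a..<b} z" and zero: "\<And>s. s \<in> {a..<b} \<Longrightarrow> H s (z s) = 0"
    and bdd: "bounded (z ` {a..<b})"
  obtains w where "(z \<longlongrightarrow> w) (at_left b)" "H b w = 0"
proof -
  interpret real_even_entire "H b" by (rule H_real_even_entire)
  \<comment> \<open>any sequence of times that tends to \<open>b\<close>\<close>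
  define \<tau> where "\<tau> n = b - (b - a) / real (Suc n)" for n
  have \<tau>: "\<tau> n \<in> {a..<b}" for n using ab by (simp add: \<tau>_def field_simps mult_right_mono)
  have lim\<tau>: "\<tau> \<longlonglongrightarrow> b"
  proof -
    have "\<tau> \<longlonglongrightarrow> b - (b - a) * 0"
      unfolding \<tau>_def divide_inverse by (intro tendsto_intros LIMSEQ_inverse_real_of_nat)
    then show ?thesis by simp
  qed
  have "compact (closure (z ` {a..<b}))" using bdd by simp
  then have "seq_compact (closure (z ` {a..<b}))" by (rule compact_imp_seq_compact)
  moreover have "\<forall>n. z (\<tau> n) \<in> closure (z ` {a..<b})" using \<tau> closure_subset by blast
  ultimately obtain w r where r: "strict_mono r" "((\<lambda>n. z (\<tau> n)) \<circ> r) \<longlonglongrightarrow> w" by (rule seq_compactE)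
  have \<tau>r: "(\<lambda>n. \<tau> (r n)) \<longlonglongrightarrow> b" using LIMSEQ_subseq_LIMSEQ[OF lim\<tau> r(1)] by (simp add: o_def)
  have zr: "(\<lambda>n. z (\<tau> (r n))) \<longlonglongrightarrow> w" using r(2) by (simp add: o_def)
  have Hw: "H b w = 0"
  proof -
    have "(\<lambda>n. Hm 0 (fst (\<tau> (r n), z (\<tau> (r n)))) (snd (\<tau> (r n), z (\<tau> (r n))))) \<longlonglongrightarrow> Hm 0 (fst (b, w)) (snd (b, w))"
      by (rule continuous_on_tendsto_compose[OF Hm_continuous[of UNIV 0] tendsto_Pair[OF \<tau>r zr]]) auto
    then have "(\<lambda>n. 0) \<longlonglongrightarrow> H b w" using zero[OF \<tau>] by (simp add: H_eq)
    then show ?thesis by (simp add: LIMSEQ_const_iff)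
  qed
  have "(z \<longlongrightarrow> w) (at_left b)"
  proof (rule tendstoI)
    fix e :: real assume e: "e > 0"
    obtain \<rho> where \<rho>: "\<rho> > 0" "\<And>v. v \<in> ball w \<rho> - {w} \<Longrightarrow> H b v \<noteq> 0"
      using isolated_zeros[of "H b" UNIV w 0] hol nz0 Hw by auto
    define \<epsilon> where "\<epsilon> = min e \<rho> / 2"
    have \<epsilon>: "0 < \<epsilon>" "\<epsilon> < e" "\<epsilon> < \<rho>" using e \<rho> by (auto simp: \<epsilon>_def)
    have nz: "Hm 0 b v \<noteq> 0" if "v \<in> sphere w \<epsilon>" for v
      using \<rho>(2)[of v] that \<epsilon> by (auto simp: H_eq)
    define W where "W = {p. Hm 0 (fst p) (snd p) \<noteq> 0}"
    have W: "open W" unfolding W_def by (intro open_Collect_neq Hm_continuous continuous_on_const)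
    have sub: "{b} \<times> sphere w \<epsilon> \<subseteq> W" using nz by (auto simp: W_def)
    obtain X0 where X0: "b \<in> X0" "open X0" "X0 \<times> sphere w \<epsilon> \<subseteq> W"
      using Elementary_Topology.tube_lemma[OF compact_sphere W sub] by blast
    then obtain \<delta> where \<delta>: "\<delta> > 0" "ball b \<delta> \<subseteq> X0" using open_contains_ball by blast
    have "\<forall>\<^sub>F n in sequentially. dist (\<tau> (r n)) b < \<delta> \<and> dist (z (\<tau> (r n))) w < \<epsilon>"
      using tendstoD[OF \<tau>r \<delta>(1)] tendstoD[OF zr \<epsilon>(1)] by eventually_elim auto
    then obtain n where n: "dist (\<tau> (r n)) b < \<delta>" "dist (z (\<tau> (r n))) w < \<epsilon>"
      by (auto simp: eventually_sequentially)
    define c where "c = \<tau> (r n)"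
    have c: "a \<le> c" "c < b" using \<tau>[of "r n"] by (auto simp: c_def)
    have "dist (z t) w < \<epsilon>" if t: "c < t" "t < b" for t
    proof (rule ccontr)
      assume "\<not> dist (z t) w < \<epsilon>"
      moreover have "continuous_on {c..t} (\<lambda>s. dist (z s) w)"
        by (intro continuous_intros continuous_on_subset[OF cont]) (use t c in auto)
      ultimately obtain s where s: "c \<le> s" "s \<le> t" "dist (z s) w = \<epsilon>"
        using IVT'[of "\<lambda>s. dist (z s) w" c \<epsilon> t] n(2) t by (auto simp: c_def)
      have "s \<in> ball b \<delta>" using s t n(1) by (auto simp: c_def dist_real_def)
      then have "(s, z s) \<in> X0 \<times> sphere w \<epsilon>" using s(3) \<delta>(2) by (auto simp: dist_commute)
      then have "(s, z s) \<in> W" using X0(3) by blast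
      then have "H s (z s) \<noteq> 0" by (simp add: H_eq W_def)
      then show False using zero[of s] s t c by auto
    qed
    then show "\<forall>\<^sub>F t in at_left b. dist (z t) w < e"
      unfolding eventually_at_left_field using c \<epsilon> by (meson less_trans)
  qed
  then show ?thesis using Hw that by blast
qed

section \<open>Branches of zeros do not escape to infinity\<close>

text \<open>A continuous logarithm of \<open>mT\<close>; a principal value would jump as the argument decreases without bound.\<close>
definition log_mT :: "real \<Rightarrow> complex" where
  "log_mT T = Ln (sv T 0 - 1) - of_real (ln 8) - sv T 0 / 2 * of_real (ln pi) + ln_Gamma (av T)"

lemma mT_eq_exp_log_mT:
  assumes "T > 0" shows "mT T = exp (log_mT T)"
proof -
  have n: "sv T 0 - 1 \<noteq> 0" using assms by (auto simp: sv_def complex_eq_iff)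
  have a: "1 + sv T 0 / 2 = av T" by (simp add: sv_def av_def complex_eq_iff)
  have g: "av T \<notin> \<int>\<^sub>\<le>\<^sub>0" by (rule half_plane_off_nonpos) (simp add: av_def)
  have e: "exp (log_mT T) = exp (Ln (sv T 0 - 1)) / exp (of_real (ln 8)) * exp (- (sv T 0 / 2 * of_real (ln pi))) * exp (ln_Gamma (av T))"
    unfolding log_mT_def by (simp only: exp_add exp_diff exp_minus divide_inverse)
  have "exp (of_real (ln 8)) = (8 :: complex)" by (simp add: exp_of_real)
  then show ?thesis unfolding e mT_def xi_factor_def a using n g by (simp add: Gamma_complex_altdef)
qed

text \<open>The derivative of the Gamma factor along the critical line is again governed by \<open>lam\<close>: its argument decreases at the rate
  \<open>Re (lam T)\<close>.  The bounded argument of \<open>s - 1\<close> is left out.\<close>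
lemma arg_mT_derivative:
  assumes T: "T > 0"
  shows "((\<lambda>T. Im (log_mT T) - Im (Ln (sv T 0 - 1))) has_real_derivative - Re (lam T)) (at T)"
proof -
  have av: "(av has_vector_derivative (- \<i> / 2)) (at T)"
  proof -
    have "((\<lambda>T. Complex (5 / 4) (- T / 2)) has_vector_derivative Complex 0 (- 1 / 2)) (at T)"
      unfolding Complex_eq by (auto intro!: derivative_eq_intros simp: has_vector_derivative_def scaleR_conv_of_real)
    moreover have "Complex 0 (- 1 / 2) = - \<i> / 2" by (simp add: complex_eq_iff)
    ultimately show ?thesis by (simp add: av_def[abs_def])
  qed
  have R: "Re (av T) > 0" by (simp add: av_def)
  have "(ln_Gamma has_field_derivative Digamma (av T)) (at (av T))"
    by (rule has_field_derivative_ln_Gamma_complex) (rule half_plane_off_nonpos(2)[OF R])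
  then have "((ln_Gamma \<circ> av) has_vector_derivative (- \<i> / 2) * Digamma (av T)) (at T)"
    by (rule field_vector_diff_chain_at[OF av])
  then have "((\<lambda>T. Im (ln_Gamma (av T))) has_vector_derivative Im ((- \<i> / 2) * Digamma (av T))) (at T)"
    using bounded_linear.has_vector_derivative[OF bounded_linear_Im] by (fastforce simp: o_def)
  then have "((\<lambda>T. Im (ln_Gamma (av T))) has_real_derivative - Re (Digamma (av T)) / 2) (at T)"
    by (simp add: has_real_derivative_iff_has_vector_derivative)
  then have "((\<lambda>T. Im (ln_Gamma (av T)) + T / 2 * ln pi) has_real_derivative - Re (Digamma (av T)) / 2 + 1 / 2 * ln pi) (at T)"
    by (intro DERIV_add DERIV_cmult_right DERIV_cdivide DERIV_ident)
  moreover have "Im (log_mT T) - Im (Ln (sv T 0 - 1)) = Im (ln_Gamma (av T)) + T / 2 * ln pi" for T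
    by (simp add: log_mT_def sv_def)
  moreover have "- Re (Digamma (av T)) / 2 + 1 / 2 * ln pi = - Re (lam T)" by (simp add: lam_def)
  ultimately show ?thesis by simp
qed

text \<open>The argument of the main term \<open>mT T * exp ((lam T)\<^sup>2 t / 4)\<close> of \<open>H_right T t 0\<close>, continuous in both variables.\<close>
definition phase :: "real \<Rightarrow> real \<Rightarrow> real" where
  "phase T t = Im (log_mT T + (lam T)\<^sup>2 * of_real t / 4)"

text \<open>By \<open>H_eq_H_right\<close> and \<open>H_right_estimate\<close>, \<open>H t\<close> is up to a relative error of one half the sum of two terms with arguments
  \<open>\<plusminus> phase + Im \<lambda> h\<close>.  When the phase is a multiple of \<open>\<pi>\<close> the two terms have the same direction and cannot cancel.\<close>
lemma H_nonzero_at_phase: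
  assumes T: "T \<ge> 10 ^ 12" and \<alpha>: "Re (lam T) \<ge> 50" and t: "129 / 800 \<le> t" "t \<le> 1 / 5" and h: "\<bar>h\<bar> \<le> 1 / 10"
    and ph: "sin (phase T t) = 0"
  shows "H t (Complex (2 * T) (2 * h)) \<noteq> 0"
proof
  assume H0: "H t (Complex (2 * T) (2 * h)) = 0"
  have t0: "t > 0" using t by simp
  define \<alpha> where "\<alpha> = Re (lam T)"
  define \<beta> where "\<beta> = Im (lam T)"
  have \<alpha>50: "\<alpha> \<ge> 50" using \<alpha> by (simp add: \<alpha>_def)
  define M where "M h = mT T * exp (lam T * of_real h + (lam T)\<^sup>2 * of_real t / 4)" for h
  define p where "p = Re (log_mT T + (lam T)\<^sup>2 * of_real t / 4)"
  have M: "M h = of_real (exp (p + \<alpha> * h)) * cis (phase T t + \<beta> * h)" for h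
  proof -
    have "M h = exp (log_mT T + (lam T * of_real h + (lam T)\<^sup>2 * of_real t / 4))"
      unfolding M_def exp_add using T by (simp add: mT_eq_exp_log_mT)
    also have "\<dots> = of_real (exp (p + \<alpha> * h)) * cis (phase T t + \<beta> * h)"
      unfolding exp_eq_polar by (simp add: p_def \<alpha>_def phase_def \<beta>_def algebra_simps)
    finally show ?thesis .
  qed
  have nM: "norm (M h) = exp (p + \<alpha> * h)" for h by (simp add: M norm_mult)
  have "cis (- phase T t) = cis (phase T t)" using ph by (simp add: complex_eq_iff)
  then have c2: "cis (- phase T t + \<beta> * h) = cis (phase T t + \<beta> * h)" by (simp only: cis_mult[symmetric])
  have "- (phase T t + \<beta> * - h) = - phase T t + \<beta> * h" by simp
  then have cM: "cnj (M (- h)) = of_real (exp (p - \<alpha> * h)) * cis (phase T t + \<beta> * h)"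
    unfolding M complex_cnj_mult cis_cnj complex_cnj_complex_of_real c2[symmetric] by simp
  have nsum: "norm (M h + cnj (M (- h))) = exp (p + \<alpha> * h) + exp (p - \<alpha> * h)"
  proof -
    have "M h + cnj (M (- h)) = of_real (exp (p + \<alpha> * h) + exp (p - \<alpha> * h)) * cis (phase T t + \<beta> * h)"
      unfolding cM unfolding M by (simp add: distrib_right)
    then show ?thesis by (simp only: norm_mult norm_of_real norm_cis) (simp add: add_pos_pos)
  qed
  \<comment> \<open>\<open>\<alpha> \<ge> 50\<close> makes the zeta correction about \<open>1/4\<close> at most and the strip term negligible\<close>
  have err: "norm (H_right T t k - M k) \<le> 1 / 2 * exp (p + \<alpha> * k)" if k: "\<bar>k\<bar> \<le> 1 / 10" for k
  proof -
    have b2: "\<beta>\<^sup>2 * t / 4 \<le> 1 / 20"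
    proof -
      have "\<beta>\<^sup>2 \<le> 1\<^sup>2" using lam_Im[of T] T unfolding \<beta>_def by (intro abs_le_imp_square_le) auto
      then have "\<beta>\<^sup>2 * t \<le> 1\<^sup>2 * (1 / 5)" using t t0 by (intro mult_mono) auto
      then have "\<beta>\<^sup>2 * t / 4 \<le> 1\<^sup>2 * (1 / 5) / 4" by (rule divide_right_mono) simp
      then show ?thesis by simp
    qed
    define E where "E = norm (mT T) * exp (\<alpha> * k + \<alpha>\<^sup>2 * t / 4)"
    have E0: "E \<ge> 0" by (simp add: E_def)
    have Eb: "E \<le> 11 / 10 * exp (p + \<alpha> * k)"
    proof -
      have "E = norm (mT T) * exp (\<alpha> * k + (\<alpha>\<^sup>2 - \<beta>\<^sup>2) * t / 4) * exp (\<beta>\<^sup>2 * t / 4)"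
        unfolding E_def mult.assoc exp_add[symmetric] by (simp add: algebra_simps diff_divide_distrib)
      also have "norm (mT T) * exp (\<alpha> * k + (\<alpha>\<^sup>2 - \<beta>\<^sup>2) * t / 4) = exp (p + \<alpha> * k)"
        unfolding nM[symmetric] unfolding M_def norm_mult exp_lam_exponent \<alpha>_def \<beta>_def ..
      also have "exp (\<beta>\<^sup>2 * t / 4) \<le> exp (1 / 20)" using b2 by simp
      also have "exp (1 / 20) \<le> (11 / 10 :: real)" using exp_bound[of "1 / 20"] by (simp add: power2_eq_square)
      finally show ?thesis by (simp add: mult.commute)
    qed
    have at: "50 * (129 / 800) \<le> \<alpha> * t" using \<alpha>50 t by (intro mult_mono) auto
    have q1: "2 powr (- \<alpha> * t / 2) \<le> 1 / 16"
    proof -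
      have "2 powr (- \<alpha> * t / 2) \<le> 2 powr (- 4 :: real)" using at by (intro powr_mono) auto
      then show ?thesis by (simp add: powr_minus powr_numeral)
    qed
    have q2: "2 powr (- k) \<le> (2 :: real)"
    proof -
      have "2 powr (- k) \<le> 2 powr (1 :: real)" using k by (intro powr_mono) auto
      then show ?thesis by simp
    qed
    have q3: "27 / 10 * exp (3 / 2 * \<alpha>) \<le> 1 / 10 * exp (\<alpha> * k + \<alpha>\<^sup>2 * t / 4)"
    proof -
      have "50 * (4 / 10) \<le> \<alpha> * (\<alpha> * t / 4 - 16 / 10)" using \<alpha>50 at by (intro mult_mono) auto
      moreover have "\<alpha> * (- (1 / 10)) \<le> \<alpha> * k" using k \<alpha>50 by (intro mult_left_mono) auto
      ultimately have "3 / 2 * \<alpha> + 20 \<le> \<alpha> * k + \<alpha>\<^sup>2 * t / 4" by (simp add: power2_eq_square algebra_simps)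
      then have e: "exp (3 / 2 * \<alpha> + 20) \<le> exp (\<alpha> * k + \<alpha>\<^sup>2 * t / 4)" by simp
      have "1 + 20 + 20\<^sup>2 / 2 \<le> exp (20 :: real)" by (rule exp_lower_Taylor_quadratic) simp
      then have "exp (3 / 2 * \<alpha>) * 27 \<le> exp (3 / 2 * \<alpha>) * exp 20" by (intro mult_left_mono) auto
      also have "\<dots> = exp (3 / 2 * \<alpha> + 20)" by (simp only: exp_add)
      also note e
      finally show ?thesis by simp
    qed
    have "norm (H_right T t k - M k) \<le> norm (mT T) * ((2 * 2 powr (- k) * 2 powr (- \<alpha> * t / 2) + 1 / 1000) * exp (\<alpha> * k + \<alpha>\<^sup>2 * t / 4) + 27 / 10 * exp (3 / 2 * \<alpha>))"
      unfolding M_def \<alpha>_def using T t0 t k \<alpha> by (intro H_right_estimate) auto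
    also have "\<dots> \<le> norm (mT T) * ((2 * 2 * (1 / 16) + 1 / 1000) * exp (\<alpha> * k + \<alpha>\<^sup>2 * t / 4) + 1 / 10 * exp (\<alpha> * k + \<alpha>\<^sup>2 * t / 4))"
    proof (rule mult_left_mono[OF add_mono[OF _ q3]])
      have "2 * 2 powr (- k) * 2 powr (- \<alpha> * t / 2) \<le> 2 * 2 * (1 / 16)"
        using q1 q2 by (intro mult_mono) auto
      then show "(2 * 2 powr (- k) * 2 powr (- \<alpha> * t / 2) + 1 / 1000) * exp (\<alpha> * k + \<alpha>\<^sup>2 * t / 4) \<le> (2 * 2 * (1 / 16) + 1 / 1000) * exp (\<alpha> * k + \<alpha>\<^sup>2 * t / 4)"
        by (intro mult_right_mono) auto
    qed simp
    also have "\<dots> = 351 / 1000 * E" by (simp add: E_def)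
    also have "\<dots> \<le> 1 / 2 * exp (p + \<alpha> * k)" using Eb exp_gt_zero[of "p + \<alpha> * k"] by linarith
    finally show ?thesis .
  qed
  have "M h + cnj (M (- h)) = - ((H_right T t h - M h) + cnj (H_right T t (- h) - M (- h)))"
    using H0 unfolding H_eq_H_right[OF t0] by (simp add: algebra_simps eq_neg_iff_add_eq_0)
  then have "exp (p + \<alpha> * h) + exp (p - \<alpha> * h) \<le> norm (H_right T t h - M h) + norm (H_right T t (- h) - M (- h))"
    using nsum norm_triangle_ineq[of "H_right T t h - M h" "cnj (H_right T t (- h) - M (- h))"] by (simp only: norm_minus_cancel complex_mod_cnj)
  also have "\<dots> \<le> 1 / 2 * exp (p + \<alpha> * h) + 1 / 2 * exp (p - \<alpha> * h)"
    using err[of h] err[of "- h"] h by simp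
  finally show False using exp_gt_zero[of "p + \<alpha> * h"] exp_gt_zero[of "p - \<alpha> * h"] by linarith
qed

lemma lam_Re_large:
  obtains T1 where "T1 \<ge> 10 ^ 12" "\<And>T. T \<ge> T1 \<Longrightarrow> Re (lam T) \<ge> 50" "\<And>T. T \<ge> T1 \<Longrightarrow> Re (lam T) \<le> T"
proof -
  have "\<forall>\<^sub>F T in at_top. ln (T / 2 / pi) / 2 - 2 / T \<ge> (50 :: real)"
    by real_asymp
  moreover have "\<forall>\<^sub>F T in at_top. ln ((T / 2 + 5 / 4) / pi) / 2 + 2 / T \<le> (T :: real)"
    by real_asymp
  ultimately have "\<forall>\<^sub>F T in at_top. ln (T / 2 / pi) / 2 - 2 / T \<ge> (50 :: real) \<and> ln ((T / 2 + 5 / 4) / pi) / 2 + 2 / T \<le> T"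
    by eventually_elim auto
  then obtain T0 where T0: "\<And>T. T \<ge> T0 \<Longrightarrow> ln (T / 2 / pi) / 2 - 2 / T \<ge> (50 :: real) \<and> ln ((T / 2 + 5 / 4) / pi) / 2 + 2 / T \<le> T"
    unfolding eventually_at_top_linorder by blast
  show ?thesis
  proof (rule that[of "max T0 (10 ^ 12)"])
    fix T assume T: "T \<ge> max T0 (10 ^ 12)"
    then have Tp: "T > 0" by simp
    have a: "T / 2 \<le> norm (av T)" "norm (av T) \<le> T / 2 + 5 / 4"
      using abs_Im_le_cmod[of "av T"] cmod_le[of "av T"] Tp by (auto simp: av_def)
    have "ln (T / 2 / pi) \<le> ln (norm (av T) / pi)" using a Tp by (intro ln_mono divide_right_mono) auto
    then show "Re (lam T) \<ge> 50" using lam_Re[OF Tp] T0[of T] T by (simp add: abs_le_iff)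
    have "norm (av T) > 0" using a Tp by linarith
    then have "ln (norm (av T) / pi) \<le> ln ((T / 2 + 5 / 4) / pi)" using a by (intro ln_mono divide_right_mono) auto
    then show "Re (lam T) \<le> T" using lam_Re[OF Tp] T0[of T] T by (simp add: abs_le_iff)
  qed simp
qed

lemma phase_continuous: "continuous_on {p. fst p > 0} (\<lambda>p. phase (fst p) (snd p))"
proof -
  have avc: "continuous_on S (\<lambda>p. av (fst p))" for S :: "(real \<times> real) set"
    unfolding av_def Complex_eq by (intro continuous_intros) auto
  have svc: "continuous_on S (\<lambda>p. sv (fst p) 0)" for S :: "(real \<times> real) set"
    unfolding sv_def Complex_eq by (intro continuous_intros)
  have R: "av T \<notin> \<int>\<^sub>\<le>\<^sub>0" "av T \<notin> \<real>\<^sub>\<le>\<^sub>0" for T by (rule half_plane_off_nonpos; simp add: av_def)+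
  have lg: "continuous_on {p. fst p > (0::real)} (\<lambda>p :: real \<times> real. ln_Gamma (av (fst p)))"
  proof (rule continuous_on_compose2[OF _ avc, of "- \<real>\<^sub>\<le>\<^sub>0"])
    show "continuous_on (- \<real>\<^sub>\<le>\<^sub>0) (ln_Gamma :: complex \<Rightarrow> complex)"
      by (intro continuous_at_imp_continuous_on ballI) (auto intro: DERIV_isCont[OF has_field_derivative_ln_Gamma_complex])
  qed (auto simp: R)
  have dg: "continuous_on {p. fst p > (0::real)} (\<lambda>p :: real \<times> real. Digamma (av (fst p)))"
    by (rule continuous_on_compose2[OF _ avc, of "- \<int>\<^sub>\<le>\<^sub>0"]) (auto intro!: continuous_on_Polygamma simp: R)
  have ln: "continuous_on {p. fst p > (0::real)} (\<lambda>p :: real \<times> real. Ln (sv (fst p) 0 - 1))"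
    by (intro continuous_on_Ln continuous_intros svc) (auto simp: sv_def complex_nonpos_Reals_iff)
  show ?thesis unfolding phase_def log_mT_def lam_def by (intro continuous_intros lg dg ln svc) auto
qed

text \<open>The argument of \<open>mT\<close> decreases at a rate of at least 50, while the contribution \<open>Re \<lambda> Im \<lambda> t / 2\<close> of the heat flow is at most \<open>T\<close>.\<close>
lemma phase_to_minus_infinity:
  obtains T1 where "T1 \<ge> 10 ^ 12" "\<And>T. T \<ge> T1 \<Longrightarrow> Re (lam T) \<ge> 50"
    "\<And>C. \<exists>T2\<ge>T1. \<forall>T\<ge>T2. \<forall>t\<in>{0..1/5}. phase T t \<le> C"
proof -
  obtain T1 where T1: "T1 \<ge> 10 ^ 12" "\<And>T. T \<ge> T1 \<Longrightarrow> Re (lam T) \<ge> 50" "\<And>T. T \<ge> T1 \<Longrightarrow> Re (lam T) \<le> T"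
    using lam_Re_large by blast
  define g where "g T = Im (log_mT T) - Im (Ln (sv T 0 - 1))" for T
  have g: "g T \<le> g T1 - 50 * (T - T1)" if T: "T \<ge> T1" for T
  proof -
    have "g T + 50 * T \<le> g T1 + 50 * T1"
    proof (rule DERIV_nonpos_imp_nonincreasing[OF T, of "\<lambda>T. g T + 50 * T"])
      fix x assume x: "T1 \<le> x" "x \<le> T"
      then have "((\<lambda>T. g T + 50 * T) has_real_derivative - Re (lam x) + 50 * 1) (at x)"
        unfolding g_def using T1(1) by (intro DERIV_add arg_mT_derivative DERIV_cmult DERIV_ident) auto
      then show "\<exists>y. ((\<lambda>T. g T + 50 * T) has_real_derivative y) (at x) \<and> y \<le> 0"
        using T1(2)[OF x(1)] by (intro exI[of _ "- Re (lam x) + 50 * 1"]) auto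
    qed
    then show ?thesis by simp
  qed
  have ub: "phase T t \<le> g T1 + 50 * T1 + 4 - 49 * T" if T: "T \<ge> T1" and t: "t \<in> {0..1/5}" for T t
  proof -
    have "Im (Ln (sv T 0 - 1)) \<le> pi" using T T1(1) by (intro Im_Ln_le_pi) (auto simp: sv_def complex_eq_iff)
    moreover have "Re (lam T) * Im (lam T) * t / 2 \<le> T"
    proof -
      have "Re (lam T) * Im (lam T) \<le> T * 1"
        using T1(2,3)[OF T] lam_Im[of T] T T1(1) by (intro order_trans[OF mult_left_mono mult_right_mono]) auto
      then have "Re (lam T) * Im (lam T) * t \<le> T * t" using t by (intro mult_right_mono) auto
      also have "\<dots> \<le> T * 1" using t T T1(1) by (intro mult_left_mono) auto
      finally show ?thesis using T T1(1) by simp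
    qed
    moreover have "phase T t = g T + Im (Ln (sv T 0 - 1)) + Re (lam T) * Im (lam T) * t / 2"
      by (simp add: phase_def g_def power2_eq_square algebra_simps)
    moreover have "P \<le> g T1 + 50 * T1 + 4 - 49 * T" if "L \<le> pi" "Q \<le> T" "P = g T + L + Q" for L Q P
      using that g[OF T] pi_less_4 by (simp add: right_diff_distrib)
    ultimately show ?thesis by blast
  qed
  show ?thesis
  proof (rule that[of T1])
    fix C
    show "\<exists>T2\<ge>T1. \<forall>T\<ge>T2. \<forall>t\<in>{0..1/5}. phase T t \<le> C"
    proof (intro exI[of _ "max T1 ((g T1 + 50 * T1 + 4 - C) / 49)"] conjI allI impI ballI)
      fix T t :: real assume T: "T \<ge> max T1 ((g T1 + 50 * T1 + 4 - C) / 49)" and t: "t \<in> {0..1/5}"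
      then have "(g T1 + 50 * T1 + 4 - C) / 49 \<le> T" "T \<ge> T1" by auto
      then show "phase T t \<le> C" using ub[of T t] t by simp
    qed simp
  qed (use T1 in auto)
qed

text \<open>If the real part were unbounded, the branch would run from a point with bounded phase to one with an arbitrarily negative phase
  while staying in the region of \<open>H_nonzero_at_phase\<close>.  By continuity it would pass a point where the phase is a multiple of \<open>\<pi>\<close>.\<close>
lemma no_escape:
  assumes ab: "129 / 800 \<le> a" "a < b" "b \<le> 1 / 5" and cont: "continuous_on {a..<b} z" and zero: "\<And>s. s \<in> {a..<b} \<Longrightarrow> H s (z s) = 0"
    and strip: "\<And>s. s \<in> {a..<b} \<Longrightarrow> \<bar>Im (z s)\<bar> \<le> 1 / 5"
  shows "\<exists>M. \<forall>s\<in>{a..<b}. Re (z s) \<le> M"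
proof (rule ccontr)
  assume "\<not> ?thesis"
  then have unb: "\<exists>s\<in>{a..<b}. Re (z s) > M" for M by (meson not_le)
  obtain T1 where T1: "T1 \<ge> 10 ^ 12" "\<And>T. T \<ge> T1 \<Longrightarrow> Re (lam T) \<ge> 50"
    "\<And>C. \<exists>T2\<ge>T1. \<forall>T\<ge>T2. \<forall>t\<in>{0..1/5}. phase T t \<le> C"
    by (rule phase_to_minus_infinity) blast
  define x where "x s = Re (z s) / 2" for s
  have xc: "continuous_on {a..<b} x" unfolding x_def by (intro continuous_intros cont) auto
  \<comment> \<open>beyond \<open>M\<close> the asymptotics hold, and the branch starts at or before \<open>M\<close>\<close>
  define M where "M = max T1 (x a)"
  have M: "M \<ge> T1" "M > 0" using T1(1) by (auto simp: M_def)
  have "compact ((\<lambda>t. phase M t) ` {0..1/5})"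
  proof (rule compact_continuous_image)
    have "continuous_on {0..1/5} ((\<lambda>p. phase (fst p) (snd p)) \<circ> (\<lambda>t. (M, t)))"
      by (intro continuous_on_compose continuous_on_subset[OF phase_continuous] continuous_intros) (use M in auto)
    then show "continuous_on {0..1/5} (phase M)" by (simp add: o_def)
  qed simp
  then have "bounded (phase M ` {0..1/5})" by (rule compact_imp_bounded)
  then obtain C where C: "\<And>t. t \<in> {0..1/5} \<Longrightarrow> \<bar>phase M t\<bar> \<le> C"
    unfolding bounded_iff ball_simps real_norm_def by blast
  obtain T2 where T2: "T2 \<ge> T1" "\<And>T t. T \<ge> T2 \<Longrightarrow> t \<in> {0..1/5} \<Longrightarrow> phase T t \<le> - C - 2 * pi"
    using T1(3)[of "- C - 2 * pi"] by blast
  obtain s2 where s2: "a \<le> s2" "s2 < b" "x s2 > max T2 M" using unb[of "2 * max T2 M"] by (auto simp: x_def)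
  \<comment> \<open>\<open>s1\<close>, the maximum of \<open>S\<close>, is the last time at which the branch is not beyond \<open>M\<close>\<close>
  define S where "S = {s \<in> {a..s2}. x s \<le> M}"
  have xc2: "continuous_on {a..s2} x" by (rule continuous_on_subset[OF xc]) (use s2 in auto)
  have "compact S"
  proof -
    have "S = {a..s2} \<inter> x -` {..M}" by (auto simp: S_def)
    moreover have "closed ({a..s2} \<inter> x -` {..M})" by (rule continuous_closed_preimage[OF xc2]) auto
    moreover have "bounded S" by (rule bounded_subset[OF bounded_closed_interval[of a s2]]) (auto simp: S_def)
    ultimately show ?thesis by (simp add: compact_eq_bounded_closed)
  qed
  moreover have "a \<in> S" using s2 by (simp add: S_def M_def)
  ultimately obtain s1 where s1: "s1 \<in> S" "\<And>s. s \<in> S \<Longrightarrow> s \<le> s1" using compact_attains_sup[of S] by blast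
  have s1': "a \<le> s1" "s1 \<le> s2" "x s1 \<le> M" using s1(1) by (auto simp: S_def)
  have s12: "s1 < s2" using s1' s2(3) by (cases "s1 = s2") auto
  have above: "x s > M" if "s1 < s" "s \<le> s2" for s
    using s1(2)[of s] that s1' by (force simp: S_def)
  have xs1: "x s1 = M"
  proof (rule ccontr)
    assume "x s1 \<noteq> M"
    then have "x s1 < M" using s1' by simp
    moreover have "continuous_on {s1..s2} x" by (rule continuous_on_subset[OF xc2]) (use s1' in auto)
    ultimately obtain s where "s1 \<le> s" "s \<le> s2" "x s = M" using IVT'[of x s1 M s2] s12 s2(3) by auto
    then show False using above[of s] \<open>x s1 \<noteq> M\<close> by (cases "s = s1") auto
  qed
  have ge: "x s \<ge> M" if "s \<in> {s1..s2}" for s using above[of s] xs1 that by (cases "s = s1") auto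
  define f where "f s = phase (x s) s" for s
  have fc: "continuous_on {s1..s2} f"
  proof -
    have "continuous_on {s1..s2} ((\<lambda>p. phase (fst p) (snd p)) \<circ> (\<lambda>s. (x s, s)))"
      by (intro continuous_on_compose continuous_on_subset[OF phase_continuous] continuous_on_Pair continuous_on_id continuous_on_subset[OF xc2])
        (use ge M s1' in force)+
    then show ?thesis by (simp add: o_def f_def[abs_def])
  qed
  have f1: "f s1 \<ge> - C" using C[of s1] s1' s2 ab by (simp add: f_def xs1 abs_le_iff)
  have f2: "f s2 \<le> - C - 2 * pi" unfolding f_def using T2(2)[of "x s2" s2] s2 ab by auto
  define k where "k = \<lfloor>- C / pi\<rfloor>"
  have k: "of_int k * pi \<le> - C" "- C - pi \<le> of_int k * pi"
  proof -
    have "of_int k \<le> - C / pi" "- C / pi \<le> of_int k + 1" unfolding k_def by linarith+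
    then show "of_int k * pi \<le> - C" "- C - pi \<le> of_int k * pi" using pi_gt_zero by (simp_all add: field_simps)
  qed
  have "f s2 \<le> of_int k * pi" "of_int k * pi \<le> f s1" using f1 f2 k pi_gt_zero by linarith+
  then obtain s where s: "s1 \<le> s" "s \<le> s2" "f s = of_int k * pi" using IVT2'[OF _ _ _ fc] s12 by auto
  have xs: "x s \<ge> T1" using ge[of s] s M by simp
  have "H s (Complex (2 * x s) (2 * (Im (z s) / 2))) \<noteq> 0"
  proof (rule H_nonzero_at_phase)
    show "sin (phase (x s) s) = 0" using s(3) by (simp add: f_def sin_zero_iff_int2)
    show "\<bar>Im (z s) / 2\<bar> \<le> 1 / 10" using strip[of s] s s1' s2 by auto
  qed (use xs T1 s s1' s2 ab in auto)
  then show False using zero[of s] s s1' s2 by (simp add: x_def)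
qed

section \<open>Descent to the real axis\<close>

text \<open>Six terms of the series of \<open>ln ((1 + y) / (1 - y))\<close> at \<open>y = 263031 / 5263031 \<approx> 1/20\<close>; the remainder is about \<open>10\<^sup>-\<^sup>1\<^sup>8\<close>, whereas the
  value lies within \<open>10\<^sup>-\<^sup>1\<^sup>6\<close> of the lower end of the interval.\<close>
lemma ln_numeric_bounds:
  "ln (11052124 / 10000000 :: real) \<in> {6 * (0.1779229222821547 - 129 / 800)..<6 * (0.1779229222821548 - 129 / 800)}"
proof -
  define x where "x = (11052124 / 10000000 :: real)"
  have y: "(x - 1) / (x + 1) = 263031 / 5263031" by (simp add: x_def)
  define S where "S = (\<Sum>k<6. 2 * (263031 / 5263031 :: real) ^ (2 * k + 1) / of_nat (2 * k + 1))"
  define d where "d = (263031 / 5263031 :: real) ^ (2 * 6 + 1) / (1 - (263031 / 5263031)\<^sup>2) / of_nat (2 * 6 + 1)"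
  have "x > 1" by (simp add: x_def)
  from ln_approx_bounds[OF this, of 6] have "ln x \<in> {S..S + 2 * d}"
    unfolding y S_def d_def by simp
  moreover have "6 * (0.1779229222821547 - 129 / 800) \<le> S"
    unfolding S_def by (simp add: lessThan_nat_numeral power_divide)
  moreover have "S + 2 * d < 6 * (0.1779229222821548 - 129 / 800)"
    unfolding S_def d_def by (simp add: lessThan_nat_numeral power_divide)
  ultimately show ?thesis unfolding x_def by auto
qed

text \<open>With \<open>y = Im z\<close> the hypothesis reads \<open>(y\<^sup>2)' \<le> - 2 - 6 y\<^sup>2\<close>, that is, \<open>(y\<^sup>2 + 1/3)' \<le> - 6 (y\<^sup>2 + 1/3)\<close>.\<close>
lemma height_decay:
  fixes z :: "real \<Rightarrow> complex"
  assumes ab: "a \<le> b"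
    and der: "\<And>t. t \<in> {a..b} \<Longrightarrow> (z has_vector_derivative D t) (at t within {a..b})"
    and pos: "\<And>t. t \<in> {a..b} \<Longrightarrow> Im (z t) > 0"
    and vel: "\<And>t. t \<in> {a..b} \<Longrightarrow> Im (D t) \<le> - 1 / Im (z t) - 3 * Im (z t)"
  shows "((Im (z b))\<^sup>2 + 1 / 3) * exp (6 * b) \<le> ((Im (z a))\<^sup>2 + 1 / 3) * exp (6 * a)"
proof -
  define f where "f t = ((Im (z t))\<^sup>2 + 1 / 3) * exp (6 * t)" for t
  define f' where "f' t = (2 * Im (z t) * Im (D t) + 6 * ((Im (z t))\<^sup>2 + 1 / 3)) * exp (6 * t)" for t
  have df: "(f has_real_derivative f' t) (at t within {a..b})" if "t \<in> {a..b}" for t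
  proof -
    have "((\<lambda>t. Im (z t)) has_vector_derivative Im (D t)) (at t within {a..b})"
      by (rule bounded_linear.has_vector_derivative[OF bounded_linear_Im der[OF that]])
    then have y: "((\<lambda>t. Im (z t)) has_real_derivative Im (D t)) (at t within {a..b})"
      by (simp add: has_real_derivative_iff_has_vector_derivative)
    have e: "((\<lambda>t. exp (6 * t)) has_real_derivative 6 * exp (6 * t)) (at t within {a..b})"
      by (auto intro!: derivative_eq_intros)
    have "((\<lambda>t. (Im (z t) * Im (z t) + 1 / 3) * exp (6 * t)) has_real_derivative f' t) (at t within {a..b})"
      by (rule DERIV_cong[OF DERIV_mult[OF DERIV_add[OF DERIV_mult[OF y y] DERIV_const] e]])
        (simp add: f'_def power2_eq_square algebra_simps)
    then show ?thesis by (simp add: f_def[abs_def] power2_eq_square)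
  qed
  have f'0: "f' t \<le> 0" if t: "t \<in> {a..b}" for t
  proof -
    define y where "y = Im (z t)"
    have y: "y > 0" using pos[OF t] by (simp add: y_def)
    have "2 * y * Im (D t) \<le> 2 * y * (- 1 / y - 3 * y)"
      using vel[OF t] y unfolding y_def[symmetric] by (intro mult_left_mono) auto
    also have "\<dots> = - 2 - 6 * y\<^sup>2" using y by (simp add: field_simps power2_eq_square)
    finally show ?thesis unfolding f'_def y_def[symmetric] by (intro mult_nonpos_nonneg) auto
  qed
  have "\<exists>t\<in>{a..b}. f b - f a = f' t * (b - a)"
    by (rule mvt_very_simple[OF ab]) (use df in \<open>auto simp: has_field_derivative_def\<close>)
  then obtain t where t: "t \<in> {a..b}" "f b - f a = f' t * (b - a)" by blast
  moreover have "f' t * (b - a) \<le> 0" using f'0[OF t(1)] ab by (intro mult_nonpos_nonneg) auto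
  ultimately show ?thesis by (simp add: f_def)
qed

text \<open>A branch that contains its last, simple zero continues beyond it.\<close>
lemma extend_closed_branch:
  assumes J: "zero_branch_from a {a..b} z" and d: "deriv (H b) (z b) \<noteq> 0"
  shows "\<exists>J' z'. zero_branch_from a J' z' \<and> {a..b} \<subset> J' \<and> (\<forall>t\<in>{a..b}. z' t = z t)"
proof -
  have z: "a \<le> b" "continuous_on {a..b} z" "\<And>t. t \<in> {a..b} \<Longrightarrow> H t (z t) = 0"
    using J by (auto simp: zero_branch_from_def)
  obtain \<delta> \<zeta> where \<zeta>: "\<delta> > 0" "continuous_on {b..b + \<delta>} \<zeta>" "\<zeta> b = z b" "\<And>s. s \<in> {b..b + \<delta>} \<Longrightarrow> H s (\<zeta> s) = 0"
    by (rule zero_curve_local[OF z(3) d]) (use z in auto)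
  define z' where "z' t = (if t \<le> b then z t else \<zeta> t)" for t
  have u: "{a..b} \<union> {b..b + \<delta>} = {a..b + \<delta>}" using z(1) \<zeta>(1) by auto
  have "continuous_on ({a..b} \<union> {b..b + \<delta>}) z'"
    unfolding z'_def by (rule continuous_on_cases) (use z \<zeta> in auto)
  then have "zero_branch_from a {a..b + \<delta>} z'"
    using z \<zeta> unfolding zero_branch_from_def u by (auto simp: z'_def is_interval_cc)
  moreover have "{a..b} \<subset> {a..b + \<delta>}" using z(1) \<zeta>(1) by auto
  ultimately show ?thesis by (intro exI[of _ "{a..b + \<delta>}"] exI[of _ z']) (auto simp: z'_def)
qed

text \<open>A branch in a strip, on a half-open interval, continues at least by its limit at the missing end point.\<close>
lemma extend_open_branch:
  assumes ab: "129 / 800 \<le> a" "a < b" "b \<le> 1 / 5" and J: "zero_branch_from a {a..<b} z"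
    and lower: "\<And>t. t \<in> {a..<b} \<Longrightarrow> Re (z t) \<ge> 0" and strip: "\<And>t. t \<in> {a..<b} \<Longrightarrow> \<bar>Im (z t)\<bar> \<le> 1 / 5"
  shows "\<exists>J' z'. zero_branch_from a J' z' \<and> {a..<b} \<subset> J' \<and> (\<forall>t\<in>{a..<b}. z' t = z t)"
proof -
  have z: "continuous_on {a..<b} z" "\<And>t. t \<in> {a..<b} \<Longrightarrow> H t (z t) = 0"
    using J by (auto simp: zero_branch_from_def)
  obtain M where M: "\<And>t. t \<in> {a..<b} \<Longrightarrow> Re (z t) \<le> M" using no_escape[OF ab z strip] by blast
  have "bounded (z ` {a..<b})"
  proof (rule boundedI)
    fix w assume "w \<in> z ` {a..<b}"
    then obtain t where t: "t \<in> {a..<b}" "w = z t" by auto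
    show "norm w \<le> M + 1 / 5"
      using cmod_le[of w] M[OF t(1)] lower[OF t(1)] strip[OF t(1)] t(2) by simp
  qed
  then obtain w where w: "(z \<longlongrightarrow> w) (at_left b)" "H b w = 0" using zero_branch_limit[OF ab(2) z] by blast
  define z' where "z' t = (if t < b then z t else w)" for t
  have "continuous_on {a..b} z'"
    unfolding continuous_on_def
  proof
    fix t assume t: "t \<in> {a..b}"
    show "(z' \<longlongrightarrow> z' t) (at t within {a..b})"
    proof (cases "t = b")
      case True
      have "\<forall>\<^sub>F s in at_left b. z s = z' s"
        unfolding eventually_at_filter by (auto simp: z'_def)
      with w(1) have "(z' \<longlongrightarrow> w) (at_left b)" by (rule Lim_transform_eventually)
      then show ?thesis using True ab(2) by (simp add: z'_def at_within_Icc_at_left)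
    next
      case False
      then have tb: "t \<in> {a..<b}" using t by auto
      have "continuous_on {a..<b} z'"
        using z(1) by (rule continuous_on_eq) (auto simp: z'_def)
      then have "(z' \<longlongrightarrow> z' t) (at t within {a..<b})" using tb by (auto simp: continuous_on_def)
      moreover have "at t within {a..b} = at t within {a..<b}"
        by (rule at_within_nhd[of t "{..<b}"]) (use tb in auto)
      ultimately show ?thesis by simp
    qed
  qed
  then have "zero_branch_from a {a..b} z'"
    using z w ab(2) unfolding zero_branch_from_def by (auto simp: z'_def is_interval_cc)
  moreover have "{a..<b} \<subset> {a..b}" using ab(2) by auto
  ultimately show ?thesis by (intro exI[of _ "{a..b}"] exI[of _ z']) (auto simp: z'_def)
qed

text \<open>If no real point occurs up to time \<open>T\<close>, all hypotheses hold along the branch up to \<open>T\<close>.  \<open>height_decay\<close> excludes \<open>T\<close> from its domain, as the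
  height there would be 0.  So the domain ends before \<open>T\<close> without a real point, and each of the two kinds of ends admits a continuation.\<close>
lemma maximal_branch_reaches_axis:
  fixes z :: "real \<Rightarrow> complex"
  assumes y0: "y0\<^sup>2 = 87677 / 2500000" "y0 > 0"
    and J: "zero_branch_from (129 / 800) J z" and followed: "followed_while_nonreal (129 / 800) J z"
    and good: "\<And>t. t \<in> J \<Longrightarrow> (\<And>s. s \<in> {129 / 800..t} \<Longrightarrow> Im (z s) \<noteq> 0) \<Longrightarrow>
      simple_zero t (z t) \<and> max_height_zero t (z t) \<and> Re (z t) \<ge> 6000000185827 \<and> \<bar>Im (z t)\<bar> \<le> y0"
  shows "\<exists>t\<in>J. Im (z t) = 0 \<and> t \<le> 129 / 800 + 1 / 6 * ln (1 + 3 * y0\<^sup>2)"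
proof (rule ccontr)
  assume contra: "\<not> ?thesis"
  define t0 where "t0 = (129 / 800 :: real)"
  define T where "T = t0 + 1 / 6 * ln (1 + 3 * y0\<^sup>2)"
  have nr: "Im (z t) \<noteq> 0" if "t \<in> J" "t \<le> T" for t using contra that by (auto simp: T_def t0_def)
  have T: "t0 < T" "T \<le> 1 / 5" using ln_numeric_bounds unfolding T_def t0_def y0 by auto
  have J': "is_interval J" "t0 \<in> J" "J \<subseteq> {t0..}" "continuous_on J z" "\<And>t. t \<in> J \<Longrightarrow> H t (z t) = 0"
    using J by (auto simp: zero_branch_from_def t0_def)
  have sub: "{t0..t} \<subseteq> J" if "t \<in> J" for t
    using mem_is_interval_1_I[OF J'(1,2) that] by auto
  have gd: "simple_zero t (z t)" "max_height_zero t (z t)" "Re (z t) \<ge> 6000000185827" "\<bar>Im (z t)\<bar> \<le> y0" "Im (z t) > 0"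
    if t: "t \<in> J" "t \<le> T" for t
  proof -
    have "Im (z s) \<noteq> 0" if "s \<in> {129 / 800..t}" for s
      using nr[of s] sub[OF t(1)] that t(2) by (auto simp: t0_def)
    from good[OF t(1) this] show "simple_zero t (z t)" "max_height_zero t (z t)" "Re (z t) \<ge> 6000000185827" "\<bar>Im (z t)\<bar> \<le> y0" "Im (z t) > 0"
      by (auto simp: max_height_zero_def)
  qed
  have y2: "(Im (z t))\<^sup>2 \<le> y0\<^sup>2" if "t \<in> J" "t \<le> T" for t
    by (rule abs_le_imp_square_le[OF gd(4)[OF that]])
  have t_ge: "129 / 800 \<le> t" if "t \<in> J" for t using J'(3) that by (auto simp: t0_def)
  have dv: "deriv (H t) (z t) \<noteq> 0"
    and vel: "Im (deriv (deriv (H t)) (z t) / deriv (H t) (z t)) \<le> - 1 / Im (z t) - 3 * Im (z t)"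
    if t: "t \<in> J" "t \<le> T" for t
  proof -
    have t5: "t \<le> 1 / 5" using t T by simp
    note GL = maximal_zero_repulsion[OF gd(3)[OF t] y2[OF t, unfolded y0] t_ge[OF t(1)] t5 gd(1,2)[OF t]]
    show "deriv (H t) (z t) \<noteq> 0" by (rule GL(2))
    have "2 * Im (z t) * (3 / 2) \<le> 2 * Im (z t) * G t (z t)"
      using GL(1) gd(5)[OF t] by (intro mult_left_mono) auto
    then show "Im (deriv (deriv (H t)) (z t) / deriv (H t) (z t)) \<le> - 1 / Im (z t) - 3 * Im (z t)"
      using GL(3) by linarith
  qed
  have TJ: "T \<notin> J"
  proof
    assume TJ: "T \<in> J"
    have cT: "continuous_on {t0..T} z" by (rule continuous_on_subset[OF J'(4) sub[OF TJ]])
    have "((Im (z T))\<^sup>2 + 1 / 3) * exp (6 * T) \<le> ((Im (z t0))\<^sup>2 + 1 / 3) * exp (6 * t0)"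
    proof (rule height_decay)
      fix t assume t: "t \<in> {t0..T}"
      have tJ: "t \<in> J" "t \<le> T" using t sub[OF TJ] by auto
      show "(z has_vector_derivative deriv (deriv (H t)) (z t) / deriv (H t) (z t)) (at t within {t0..T})"
        using t cT J'(5) sub[OF TJ] dv[OF tJ] by (intro zero_branch_derivative) (auto simp: continuous_on_eq_continuous_within)
      show "Im (z t) > 0" by (rule gd(5)[OF tJ])
      show "Im (deriv (deriv (H t)) (z t) / deriv (H t) (z t)) \<le> - 1 / Im (z t) - 3 * Im (z t)" by (rule vel[OF tJ])
    qed (use T in simp)
    also have "\<dots> \<le> (y0\<^sup>2 + 1 / 3) * exp (6 * t0)"
      using y2[OF J'(2)] T by (intro mult_right_mono) auto
    also have "\<dots> = 1 / 3 * exp (6 * T)"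
    proof -
      have "1 + 3 * y0\<^sup>2 > 0" by (simp add: add_pos_nonneg)
      then have "exp (6 * T) = exp (6 * t0) * (1 + 3 * y0\<^sup>2)" by (simp add: T_def distrib_left exp_add)
      then show ?thesis by (simp add: algebra_simps)
    qed
    finally have "(Im (z T))\<^sup>2 + 1 / 3 \<le> 1 / 3" by (rule mult_right_le_imp_le) simp
    then show False using gd(5)[OF TJ] by simp
  qed
  have ltT: "t < T" if "t \<in> J" for t
  proof (rule ccontr)
    assume "\<not> t < T"
    then have "T \<in> {t0..t}" using T(1) by simp
    then show False using sub[OF that] TJ by blast
  qed
  have noext: "\<not> (\<exists>J' z'. zero_branch_from t0 J' z' \<and> J \<subset> J' \<and> (\<forall>t\<in>J. z' t = z t))"
    using followed nr ltT less_imp_le unfolding followed_while_nonreal_def t0_def by blast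
  \<comment> \<open>the domain is \<open>[t0, b]\<close> or \<open>[t0, b)\<close>\<close>
  define b where "b = Sup J"
  have bdd: "bdd_above J" using ltT less_imp_le by (intro bdd_aboveI[of _ T]) auto
  have leb: "t \<le> b" if "t \<in> J" for t unfolding b_def by (rule cSup_upper[OF that bdd])
  have bT: "b \<le> T" unfolding b_def by (rule cSup_least) (use J'(2) ltT less_imp_le in auto)
  show False
  proof (cases "b \<in> J")
    case True
    have eq: "J = {t0..b}" using sub[OF True] J'(3) leb by auto
    show False
      using extend_closed_branch[of t0 b z] J dv[OF True bT] noext unfolding eq t0_def by blast
  next
    case False
    have "t0 < b" using leb[OF J'(2)] False J'(2) by (cases "t0 = b") auto
    have eq: "J = {t0..<b}"
    proof
      have "t \<noteq> b" if "t \<in> J" for t using that False by blast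
      then show "J \<subseteq> {t0..<b}" using J'(3) leb by (fastforce simp: less_le)
      show "{t0..<b} \<subseteq> J"
      proof
        fix t assume t: "t \<in> {t0..<b}"
        then obtain s where "s \<in> J" "t < s" using less_cSupE[of t J] J'(2) unfolding b_def by auto
        then show "t \<in> J" using sub[of s] t by auto
      qed
    qed
    have y5: "y0 \<le> 1 / 5" by (rule power2_le_imp_le) (simp_all add: y0(1) power_divide)
    have bd: "Re (z t) \<ge> 0" "\<bar>Im (z t)\<bar> \<le> 1 / 5" if "t \<in> J" for t
      using gd(3,4)[OF that less_imp_le[OF ltT[OF that]]] y5 by linarith+
    have "\<exists>J' z'. zero_branch_from t0 J' z' \<and> {t0..<b} \<subset> J' \<and> (\<forall>t\<in>{t0..<b}. z' t = z t)"
      by (rule extend_open_branch) (use J bd bT T \<open>t0 < b\<close> in \<open>auto simp: t0_def eq\<close>)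
    then show False using noext unfolding eq by blast
  qed
qed

theorem theorem2p5:
  fixes X \<tau>\<^sub>0 y\<^sub>0 :: real
  assumes X: "X = 6000000185827"
    and \<tau>0: "\<tau>\<^sub>0 = 129 / 800"
    and y0: "y\<^sub>0\<^sup>2 = 87677 / 2500000" "y\<^sub>0 > 0"
  shows
    "(\<forall>\<tau> z. \<tau>\<^sub>0 \<le> \<tau> \<and> \<tau> \<le> 89 / 500 \<and> simple_zero \<tau> z \<and> max_height_zero \<tau> z
            \<and> Re z \<ge> X \<and> \<bar>Im z\<bar> \<le> y\<^sub>0
        \<longrightarrow> G \<tau> z > 1.60028669)
     \<and> (1.60028669 :: real) > 3 / 2
     \<and> (\<forall>J z. zero_branch_from \<tau>\<^sub>0 J z \<and> Im (z \<tau>\<^sub>0) \<noteq> 0 \<and> followed_while_nonreal \<tau>\<^sub>0 J z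
            \<and> (\<forall>\<tau>\<in>J. (\<forall>s\<in>{\<tau>\<^sub>0..\<tau>}. Im (z s) \<noteq> 0) \<longrightarrow>
                   simple_zero \<tau> (z \<tau>) \<and> max_height_zero \<tau> (z \<tau>)
                   \<and> Re (z \<tau>) \<ge> X \<and> \<bar>Im (z \<tau>)\<bar> \<le> y\<^sub>0)
        \<longrightarrow> (\<exists>t\<in>J. Im (z t) = 0 \<and> t \<le> \<tau>\<^sub>0 + 1 / 6 * ln (1 + 3 * y\<^sub>0\<^sup>2)))
     \<and> 0.1779229222821547 \<le> \<tau>\<^sub>0 + 1 / 6 * ln (1 + 3 * y\<^sub>0\<^sup>2)
     \<and> \<tau>\<^sub>0 + 1 / 6 * ln (1 + 3 * y\<^sub>0\<^sup>2) < 0.1779229222821548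
     \<and> \<tau>\<^sub>0 + 1 / 6 * ln (1 + 3 * y\<^sub>0\<^sup>2) < 0.178"
proof -
  have num: "0.1779229222821547 \<le> \<tau>\<^sub>0 + 1 / 6 * ln (1 + 3 * y\<^sub>0\<^sup>2)" "\<tau>\<^sub>0 + 1 / 6 * ln (1 + 3 * y\<^sub>0\<^sup>2) < 0.1779229222821548"
    using ln_numeric_bounds unfolding \<tau>0 y0 by auto
  have one: "G \<tau> z > 1.60028669"
    if "\<tau>\<^sub>0 \<le> \<tau>" "\<tau> \<le> 89 / 500" "simple_zero \<tau> z" "max_height_zero \<tau> z" "Re z \<ge> X" "\<bar>Im z\<bar> \<le> y\<^sub>0" for \<tau> z
    using that abs_le_imp_square_le[OF that(6)] unfolding X \<tau>0 y0 by (intro maximal_zero_repulsion(1)) auto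
  have two: "\<exists>t\<in>J. Im (z t) = 0 \<and> t \<le> \<tau>\<^sub>0 + 1 / 6 * ln (1 + 3 * y\<^sub>0\<^sup>2)"
    if "zero_branch_from \<tau>\<^sub>0 J z" "followed_while_nonreal \<tau>\<^sub>0 J z"
      "\<And>\<tau>. \<tau> \<in> J \<Longrightarrow> (\<And>s. s \<in> {\<tau>\<^sub>0..\<tau>} \<Longrightarrow> Im (z s) \<noteq> 0) \<Longrightarrow>
        simple_zero \<tau> (z \<tau>) \<and> max_height_zero \<tau> (z \<tau>) \<and> Re (z \<tau>) \<ge> X \<and> \<bar>Im (z \<tau>)\<bar> \<le> y\<^sub>0" for J z
    using that unfolding \<tau>0 X by (rule maximal_branch_reaches_axis[OF y0])
  show ?thesis
  proof (intro conjI allI impI)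
    show "G \<tau> z > 1.60028669"
      if "\<tau>\<^sub>0 \<le> \<tau> \<and> \<tau> \<le> 89 / 500 \<and> simple_zero \<tau> z \<and> max_height_zero \<tau> z \<and> Re z \<ge> X \<and> \<bar>Im z\<bar> \<le> y\<^sub>0" for \<tau> z
      using one that by blast
    show "\<exists>t\<in>J. Im (z t) = 0 \<and> t \<le> \<tau>\<^sub>0 + 1 / 6 * ln (1 + 3 * y\<^sub>0\<^sup>2)"
      if "zero_branch_from \<tau>\<^sub>0 J z \<and> Im (z \<tau>\<^sub>0) \<noteq> 0 \<and> followed_while_nonreal \<tau>\<^sub>0 J z
        \<and> (\<forall>\<tau>\<in>J. (\<forall>s\<in>{\<tau>\<^sub>0..\<tau>}. Im (z s) \<noteq> 0) \<longrightarrow>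
          simple_zero \<tau> (z \<tau>) \<and> max_height_zero \<tau> (z \<tau>) \<and> Re (z \<tau>) \<ge> X \<and> \<bar>Im (z \<tau>)\<bar> \<le> y\<^sub>0)" for J z
    proof (rule two)
      show "zero_branch_from \<tau>\<^sub>0 J z" "followed_while_nonreal \<tau>\<^sub>0 J z" using that by blast+
      fix \<tau> assume "\<tau> \<in> J" "\<And>s. s \<in> {\<tau>\<^sub>0..\<tau>} \<Longrightarrow> Im (z s) \<noteq> 0"
      then show "simple_zero \<tau> (z \<tau>) \<and> max_height_zero \<tau> (z \<tau>) \<and> Re (z \<tau>) \<ge> X \<and> \<bar>Im (z \<tau>)\<bar> \<le> y\<^sub>0"
        using that by blast
    qed
  qed (use num in simp_all)
qed

end
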